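(* Let $k, r$ be non-negative integers with $0 \le r \le 2k$, and let $N \ge 1$ be an integer. Then $$\frac{(\mathcal{M})_N(2k,r)}{(\mathcal{M})_N(2k,0)}\, i^r = \sum_{\mu \vdash r} \frac{r!}{h_\mu^2}\, \frac{(N \uparrow \mu)\,((-k)\uparrow \mu)}{(-2k)\uparrow \mu},$$ and, for the limits $(\mathcal{M})(2k,r) = \lim_{N\to\infty} (\mathcal{M})_N(2k,r)/N^{k^2+r}$ (which exist), $$\frac{(\mathcal{M})(2k,r)}{(\mathcal{M})(2k,0)}\, i^r = \sum_{\mu \vdash r} \frac{r!}{h_\mu^2}\, \frac{k \uparrow \mu}{(2k)\uparrow \mu},$$ where both sums run over all partitions $\mu$ of $r$. The denominators on the left-hand sides are given by $$(\mathcal{M})_N(2k,0) = \mathfrak{s}_{\langle N^k\rangle}(\underbrace{1,\dots,1}_{2k}) = \frac{G(N+2k+1)\,G(N+1)}{G(N+k+1)^2}\cdot\frac{G(k+1)^2}{G(2k+1)}$$ and $$(\mathcal{M})(2k,0) = \lim_{N\to\infty} \frac{\mathfrak{s}_{\langle N^k\rangle}(\overbrace{1,\dots,1}^{2k})}{N^{k^2}} = \frac{G(k+1)^2}{G(2k+1)}.$$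
   Context: Here $i$ denotes the imaginary unit. For an $N\times N$ unitary matrix $U$ with eigenvalues $e^{i\theta_1},\dots,e^{i\theta_N}$, set $$Z_U(\theta) := \prod_{j=1}^N \left(1 - e^{i(\theta_j - \theta)}\right),$$ with $Z_U'$ the derivative with respect to $\theta$. Define $$(\mathcal{M})_N(2k,r) := \int_{U(N)} |Z_U(0)|^{2k} \left(\frac{Z_U'(0)}{Z_U(0)}\right)^{r} dU,$$ where $dU$ is the Haar probability measure on the unitary group $U(N)$ (the integrand is defined for almost every $U$), and $$(\mathcal{M})(2k,r) := \lim_{N\to\infty} \frac{(\mathcal{M})_N(2k,r)}{N^{k^2+r}}.$$ For a partition $\mu$ (identified with its Young diagram), the content of the box $\square$ in row $i$ and column $j$ is $c(\square) = j - i$, and for a number $x$, $$x \uparrow \mu := \prod_{\square\in\mu} (x + c(\square)).$$ $h_\mu$ is the product over all boxes of $\mu$ of their hook lengths (the hook length of a box is the number of boxes weakly to its right in its row or weakly below it in its column, the box itself counted once). Empty products are $1$. The notation $\mu\vdash r$ means that $\mu$ is a partition of $r$. $\langle N^k\rangle$ is the partition with $k$ parts all equal to $N$; $\mathfrak{s}_\lambda$ is the Schur polynomial attached to $\lambda$. $G$ is the Barnes $G$-function, so for integers $n\ge 1$, $G(n) = \prod_{j=0}^{n-2} j!$. *)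

theory Defs
  imports "HOL-Probability.Probability" "Jordan_Normal_Form.Schur_Decomposition"
begin

hide_const (open) Coset.order

definition partitions_of :: "nat \<Rightarrow> nat list set" where
  "partitions_of r = {\<mu>. sorted_wrt (\<ge>) \<mu> \<and> (\<forall>p\<in>set \<mu>. p > 0) \<and> sum_list \<mu> = r}"

lemma finite_partitions_of: "finite (partitions_of r)"
proof (rule finite_subset)
  show "partitions_of r \<subseteq> {\<mu>. set \<mu> \<subseteq> {..r} \<and> length \<mu> \<le> r}"
  proof
    fix \<mu> assume "\<mu> \<in> partitions_of r"
    hence pos: "\<forall>p\<in>set \<mu>. p > 0" and s: "sum_list \<mu> = r"
      by (auto simp: partitions_of_def)
    have "length \<mu> \<le> sum_list \<mu>"
      using pos by (induction \<mu>) auto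
    moreover have "set \<mu> \<subseteq> {..r}"
      using member_le_sum_list[of _ \<mu>] s by auto
    ultimately show "\<mu> \<in> {\<mu>. set \<mu> \<subseteq> {..r} \<and> length \<mu> \<le> r}"
      using s by auto
  qed
  show "finite {\<mu>. set \<mu> \<subseteq> {..r} \<and> length \<mu> \<le> r}"
    by (rule finite_lists_length_le) simp
qed

text \<open>Boxes are pairs (row, column), both counted from 0; contents and hook lengths do not
  depend on the choice of origin.\<close>

definition young_diagram :: "nat list \<Rightarrow> (nat \<times> nat) set" where
  "young_diagram \<mu> = {(i, j). i < length \<mu> \<and> j < \<mu> ! i}"

definition content :: "nat \<times> nat \<Rightarrow> int" where
  "content b = int (snd b) - int (fst b)"

definition content_factorial :: "'a :: comm_ring_1 \<Rightarrow> nat list \<Rightarrow> 'a"  (infix "\<up>" 75) where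
  "x \<up> \<mu> = (\<Prod>b\<in>young_diagram \<mu>. x + of_int (content b))"

definition hook :: "nat list \<Rightarrow> nat \<times> nat \<Rightarrow> (nat \<times> nat) set" where
  "hook \<mu> b = {(i, j) \<in> young_diagram \<mu>.
     (i = fst b \<and> j \<ge> snd b) \<or> (j = snd b \<and> i \<ge> fst b)}"

definition hook_product :: "nat list \<Rightarrow> nat" where
  "hook_product \<mu> = (\<Prod>b\<in>young_diagram \<mu>. card (hook \<mu> b))"

text \<open>Semistandard Young tableaux with entries in \<open>{0..<n}\<close>: rows weakly and columns strictly
  increasing.\<close>

definition ssyt :: "nat \<Rightarrow> nat list \<Rightarrow> (nat \<times> nat \<Rightarrow> nat) set" where
  "ssyt n \<mu> = {T \<in> young_diagram \<mu> \<rightarrow>\<^sub>E {..<n}.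
     (\<forall>i j j'. j < j' \<and> (i, j) \<in> young_diagram \<mu> \<and> (i, j') \<in> young_diagram \<mu>
        \<longrightarrow> T (i, j) \<le> T (i, j')) \<and>
     (\<forall>i i' j. i < i' \<and> (i, j) \<in> young_diagram \<mu> \<and> (i', j) \<in> young_diagram \<mu>
        \<longrightarrow> T (i, j) < T (i', j))}"

text \<open>The value of the Schur polynomial in the \<open>n\<close> variables \<open>x 0, \<dots>, x (n - 1)\<close>.\<close>

definition schur_poly :: "nat \<Rightarrow> nat list \<Rightarrow> (nat \<Rightarrow> 'a :: comm_ring_1) \<Rightarrow> 'a" where
  "schur_poly n \<mu> x = (\<Sum>T\<in>ssyt n \<mu>. \<Prod>b\<in>young_diagram \<mu>. x (T b))"

text \<open>The Barnes G-function at the non-negative integers.\<close>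

definition barnes_G :: "nat \<Rightarrow> nat" where
  "barnes_G n = (if n = 0 then 0 else \<Prod>j<n - 1. fact j)"

definition unitary_group :: "nat \<Rightarrow> complex mat set" where
  "unitary_group N = {U \<in> carrier_mat N N. U * mat_adjoint U = 1\<^sub>m N}"

text \<open>The Borel sets of the unitary group are those
  inherited from the product of \<open>N * N\<close> copies of the complex plane through the matrix entries.\<close>

definition unitary_borel :: "nat \<Rightarrow> complex mat measure" where
  "unitary_borel N = vimage_algebra (unitary_group N)
     (\<lambda>U. \<lambda>(i, j)\<in>{..<N} \<times> {..<N}. U $$ (i, j))
     (\<Pi>\<^sub>M _\<in>{..<N} \<times> {..<N}. (borel :: complex measure))"

text \<open>Left invariance determines the probability measure uniquely and, the group being compact,
  implies right invariance.\<close>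

definition haar_prob_measure :: "nat \<Rightarrow> complex mat measure \<Rightarrow> bool" where
  "haar_prob_measure N M \<longleftrightarrow> prob_space M \<and> sets M = sets (unitary_borel N) \<and>
     (\<forall>V\<in>unitary_group N. distr M M (\<lambda>U. V * U) = M)"

text \<open>The product runs over the eigenvalues with algebraic multiplicity.\<close>

definition Z :: "complex mat \<Rightarrow> real \<Rightarrow> complex" where
  "Z U \<theta> = (\<Prod>a | eigenvalue U a. (1 - a * cis (- \<theta>)) ^ order a (char_poly U))"

definition Z' :: "complex mat \<Rightarrow> real \<Rightarrow> complex" where
  "Z' U \<theta> = vector_derivative (Z U) (at \<theta>)"

text \<open>The arguments \<open>k\<close> and \<open>r\<close> of the next two constants stand for the exponents \<open>2k\<close> and \<open>r\<close>.
  The matrices with \<open>Z U 0 = 0\<close> form a null set, so the value \<open>x / 0 = 0\<close> is immaterial.\<close>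

definition moment :: "(nat \<Rightarrow> complex mat measure) \<Rightarrow> nat \<Rightarrow> nat \<Rightarrow> nat \<Rightarrow> complex" where
  "moment H N k r =
     (\<integral>U. of_real (cmod (Z U 0) ^ (2 * k)) * (Z' U 0 / Z U 0) ^ r \<partial>H N)"

definition limit_moment :: "(nat \<Rightarrow> complex mat measure) \<Rightarrow> nat \<Rightarrow> nat \<Rightarrow> complex" where
  "limit_moment H k r = lim (\<lambda>N. moment H N k r / of_nat N ^ (k\<^sup>2 + r))"

end

theory Submission
  imports Defs
begin

text \<open>
  Left multiplication by the unitary matrices that fix a hyperplane pointwise changes
  \<open>det(z - U)\<close> by a factor affine in a quadratic form of \<open>U (z - U)\<^sup>-\<^sup>1\<close>. Comparing coefficients in the
  eigenvalue \<open>\<zeta>\<close> and averaging over a projective 2-design turns the invariance of Haar measure into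
  one first-order and one second-order identity for the generating function of the moments of
  \<open>cnj (det U) ^ q\<close> times a product of \<open>n\<close> coefficients of the characteristic polynomial. After
  multiplication with the Vandermonde product in \<open>z\<close> they fix the first two power sums of the
  exponents, which leaves a multiple of one alternant. A sum over points of a circle in the shape of
  Weyl's integral has the same generating function, so the Haar integral may be replaced by
  it; Weyl's integration formula itself is not needed.

  Now \<open>\<i> Z' / Z\<close> is the sum of \<open>y = - u / (1 - u)\<close> over the eigenvalues \<open>u\<close>, and the
  Vandermonde products in \<open>u\<close> and in \<open>y\<close> differ by powers of \<open>1 - u\<close>. Expanding the \<open>r\<close>-th power of
  the sum of the \<open>y\<close> against the Vandermonde product gives a sum over strictly increasing exponents
  \<open>l = \<mu> + \<delta>\<close>, in which the squared Vandermonde product of \<open>l\<close> yields the hook lengths and the remaining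
  factorials the contents of \<open>\<mu>\<close>. The case \<open>r = 0\<close> is the Barnes quotient; it is the
  number of tableaux of rectangular shape by the recursion over interlacing shapes, in which the
  Vandermonde product is a discrete antiderivative of itself. In the limit \<open>N \<up> \<mu>\<close> becomes \<open>N ^ r\<close>,
  and conjugation of partitions removes the signs of \<open>k\<close> and \<open>2 k\<close>.
\<close>

section \<open>Vandermonde products and alternants\<close>

text \<open>On the unitary group \<open>cnj (poly (char_poly U) 1)\<close> is, up to sign,
  \<open>poly (char_poly U) 1 * cnj (det U)\<close>. This removes the absolute value: for r \<le> 2k
  the integrand becomes \<open>cnj (det U) ^ k\<close> times a polynomial of degree 2k in the value
  and the derivative of the characteristic polynomial at 1. In terms of representations, averaging n
  characteristic polynomials against the power q of the conjugate determinant gives, up to sign, the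
  Schur polynomial of the rectangle with n - q rows of length N; times the Vandermonde product it is
  a single alternant. The obstacle is that Haar measure is known through left invariance alone. The
  first-order identity is the homogeneity of this Schur polynomial, the second-order one the
  eigenvalue of the quadratic Casimir operator. For a general partition these two data would not
  suffice, but a rectangle is extremal for them. The remaining scalar is read off at one
  coefficient: a product of q constant and n - q leading coefficients is a power of the determinant,
  so there the integrand is constant.\<close>

lemma det_mat_eq_sum:
  "det (mat n n (\<lambda>(i, j). \<phi> i j)) =
     (\<Sum>\<sigma> | \<sigma> permutes {..<n}. of_int (sign \<sigma>) * (\<Prod>i<n. \<phi> i (\<sigma> i)))"
proof -
  have "det (mat n n (\<lambda>(i, j). \<phi> i j)) =
     (\<Sum>\<sigma> | \<sigma> permutes {0..<n}. signof \<sigma> * (\<Prod>i=0..<n. mat n n (\<lambda>(i, j). \<phi> i j) $$ (i, \<sigma> i)))"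
    by (rule det_def') simp
  also have "\<dots> = (\<Sum>\<sigma> | \<sigma> permutes {..<n}. of_int (sign \<sigma>) * (\<Prod>i<n. \<phi> i (\<sigma> i)))"
    by (intro sum.cong) (auto simp: lessThan_atLeast0 permutes_in_image intro!: prod.cong)
  finally show ?thesis .
qed

lemma det_mat_eq_sum':
  "det (mat n n (\<lambda>(i, j). \<phi> i j)) =
     (\<Sum>\<sigma> | \<sigma> permutes {..<n}. of_int (sign \<sigma>) * (\<Prod>j<n. \<phi> (\<sigma> j) j))"
proof -
  have "det (mat n n (\<lambda>(i, j). \<phi> i j)) = det (transpose_mat (mat n n (\<lambda>(i, j). \<phi> i j)))"
    by (rule det_transpose[symmetric, of _ n]) simp
  also have "transpose_mat (mat n n (\<lambda>(i, j). \<phi> i j)) = mat n n (\<lambda>(j, i). \<phi> i j)"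
    by (rule eq_matI) auto
  finally show ?thesis by (simp add: det_mat_eq_sum)
qed

definition vdm :: "nat \<Rightarrow> (nat \<Rightarrow> 'a :: comm_ring_1) \<Rightarrow> 'a" where
  "vdm n x = (\<Prod>b<n. \<Prod>a<b. x b - x a)"

lemma monic_prod_linear:
  fixes x :: "nat \<Rightarrow> 'a :: idom"
  shows "degree (\<Prod>j<b. [:- x j, 1:]) = b \<and> coeff (\<Prod>j<b. [:- x j, 1:]) b = 1"
proof -
  have 1: "degree (\<Prod>j<b. [:- x j, 1:]) = b"
    by (subst degree_prod_eq_sum_degree) auto
  moreover have "lead_coeff (\<Prod>j<b. [:- x j, 1:]) = 1"
    by (subst lead_coeff_prod) auto
  ultimately show ?thesis by simp
qed

text \<open>Subtracting the leading coefficient times a monic Newton polynomial lowers the degree.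
  The value of \<open>c a\<close> is recorded because it becomes the diagonal of a triangular
  transition matrix.\<close>

lemma newton_expansion:
  fixes p :: "'a :: idom poly"
  assumes "degree p \<le> a"
  shows "\<exists>c. (\<forall>z. poly p z = (\<Sum>b\<le>a. c b * (\<Prod>j<b. z - x j))) \<and> c a = coeff p a"
  using assms
proof (induction a arbitrary: p)
  case 0
  then obtain d where "p = [:d:]" using degree_eq_zeroE by auto
  thus ?case by (intro exI[of _ "\<lambda>_. d"]) auto
next
  case (Suc a)
  define g where "g = (\<Prod>j<Suc a. [:- x j, 1:])"
  define q where "q = p - Polynomial.smult (coeff p (Suc a)) g"
  have g: "degree g = Suc a" "coeff g (Suc a) = 1" 
    using monic_prod_linear[of x "Suc a"] by (auto simp: g_def simp del: prod.lessThan_Suc)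
  have "degree q \<le> a"
  proof (rule degree_le, intro allI impI)
    fix i assume "a < i"
    thus "coeff q i = 0"
      using g Suc.prems by (cases "i = Suc a") (auto simp: q_def coeff_eq_0)
  qed
  from Suc.IH[OF this] obtain c where c: "\<And>z. poly q z = (\<Sum>b\<le>a. c b * (\<Prod>j<b. z - x j))"
    by blast
  have pg: "poly g z = (\<Prod>j<Suc a. z - x j)" for z
    unfolding g_def poly_prod by (intro prod.cong) auto
  define c' where "c' = c(Suc a := coeff p (Suc a))"
  have "poly p z = (\<Sum>b\<le>Suc a. c' b * (\<Prod>j<b. z - x j))" for z
  proof -
    have "poly p z = poly q z + coeff p (Suc a) * poly g z" by (simp add: q_def)
    also have "\<dots> = (\<Sum>b\<le>a. c' b * (\<Prod>j<b. z - x j)) + c' (Suc a) * (\<Prod>j<Suc a. z - x j)"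
      unfolding c pg by (intro arg_cong2[of _ _ _ _ "(+)"] sum.cong) (auto simp: c'_def)
    finally show ?thesis by simp
  qed
  thus ?case by (intro exI[of _ c']) (auto simp: c'_def)
qed

text \<open>In the Newton basis attached to the points the alternant is triangular; the transition from
  any other monic basis is unitriangular.\<close>

lemma det_monic_alternant:
  fixes f :: "nat \<Rightarrow> 'a :: idom poly"
  assumes f: "\<And>a. a < n \<Longrightarrow> degree (f a) = a" "\<And>a. a < n \<Longrightarrow> coeff (f a) a = 1"
  shows "det (mat n n (\<lambda>(a, i). poly (f a) (x i))) = vdm n x"
proof -
  have "\<forall>a. \<exists>c. a < n \<longrightarrow> (\<forall>z. poly (f a) z = (\<Sum>b\<le>a. c b * (\<Prod>j<b. z - x j))) \<and> c a = 1"
    using newton_expansion[of "f _" _ x] f by (metis order_refl)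
  then obtain C where C: "\<And>a z. a < n \<Longrightarrow> poly (f a) z = (\<Sum>b\<le>a. C a b * (\<Prod>j<b. z - x j))"
      "\<And>a. a < n \<Longrightarrow> C a a = 1" by metis
  define T where "T = mat n n (\<lambda>(a, b). if b \<le> a then C a b else 0)"
  define W where "W = mat n n (\<lambda>(b, i). \<Prod>j<b. x i - x j)"
  have car: "T \<in> carrier_mat n n" "W \<in> carrier_mat n n" by (auto simp: T_def W_def)
  have "mat n n (\<lambda>(a, i). poly (f a) (x i)) = T * W"
  proof (rule eq_matI)
    fix a i assume "a < dim_row (T * W)" "i < dim_col (T * W)"
    hence ai: "a < n" "i < n" by (auto simp: T_def W_def)
    have "(T * W) $$ (a, i) = (\<Sum>b=0..<n. T $$ (a, b) * W $$ (b, i))"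
      using ai by (simp add: times_mat_def scalar_prod_def T_def W_def)
    also have "\<dots> = (\<Sum>b=0..<n. if b \<le> a then C a b * (\<Prod>j<b. x i - x j) else 0)"
      using ai by (intro sum.cong) (auto simp: T_def W_def)
    also have "\<dots> = (\<Sum>b\<in>{0..<n} \<inter> {b. b \<le> a}. C a b * (\<Prod>j<b. x i - x j))"
      by (subst sum.inter_restrict) (auto intro!: sum.cong)
    also have "{0..<n} \<inter> {b. b \<le> a} = {..a}" using ai by auto
    finally show "mat n n (\<lambda>(a, i). poly (f a) (x i)) $$ (a, i) = (T * W) $$ (a, i)"
      using ai C by simp
  qed (auto simp: T_def W_def)
  hence "det (mat n n (\<lambda>(a, i). poly (f a) (x i))) = det T * det W"
    using det_mult[OF car] by simp
  also have "det T = prod_list (diag_mat T)"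
    by (rule det_lower_triangular[OF _ car(1)]) (auto simp: T_def)
  also have "\<dots> = 1"
    by (auto simp: diag_mat_def T_def C intro!: prod_list_neutral)
  also have "det W = prod_list (diag_mat W)"
  proof (rule det_upper_triangular[OF _ car(2)], rule upper_triangularI)
    fix i j assume "j < i" "i < dim_row W"
    thus "W $$ (i, j) = 0" by (auto simp: W_def)
  qed
  also have "\<dots> = vdm n x"
  proof -
    have "diag_mat W = map (\<lambda>i. \<Prod>j<i. x i - x j) [0..<n]" by (simp add: diag_mat_def W_def)
    thus ?thesis by (simp add: vdm_def prod.distinct_set_conv_list[of "[0..<n]", symmetric] atLeast0LessThan)
  qed
  finally show ?thesis by simp
qed

text \<open>An arbitrary monic family is allowed because two are used: monomials, and the falling
  factorials that appear when factorials are pulled out of a determinant.\<close>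

lemma alternant_eq_vdm:
  fixes f :: "nat \<Rightarrow> 'a :: idom poly"
  assumes f: "\<And>a. a < n \<Longrightarrow> degree (f a) = a" "\<And>a. a < n \<Longrightarrow> coeff (f a) a = 1"
  shows "(\<Sum>\<sigma> | \<sigma> permutes {..<n}. of_int (sign \<sigma>) * (\<Prod>i<n. poly (f (\<sigma> i)) (x i))) = vdm n x"
    and "(\<Sum>\<sigma> | \<sigma> permutes {..<n}. of_int (sign \<sigma>) * (\<Prod>a<n. poly (f a) (x (\<sigma> a)))) = vdm n x"
proof -
  have *: "det (mat n n (\<lambda>(a, i). poly (f a) (x i))) = vdm n x"
    by (rule det_monic_alternant) (use f in auto)
  show "(\<Sum>\<sigma> | \<sigma> permutes {..<n}. of_int (sign \<sigma>) * (\<Prod>a<n. poly (f a) (x (\<sigma> a)))) = vdm n x"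
    using * by (subst (asm) det_mat_eq_sum)
  show "(\<Sum>\<sigma> | \<sigma> permutes {..<n}. of_int (sign \<sigma>) * (\<Prod>i<n. poly (f (\<sigma> i)) (x i))) = vdm n x"
    using * by (subst (asm) det_mat_eq_sum')
qed

lemma vandermonde_sum:
  "(\<Sum>\<sigma> | \<sigma> permutes {..<n}. of_int (sign \<sigma>) * (\<Prod>i<n. x i ^ \<sigma> i)) = (vdm n x :: 'a :: idom)"
  using alternant_eq_vdm(1)[of n "\<lambda>a. monom 1 a" x] by (simp add: degree_monom_eq poly_monom)

text \<open>In the alternant form the claim is a relabelling of the summation over permutations,
  which produces the sign of \<open>\<tau>\<close>.\<close>

lemma vdm_permute:
  assumes "\<tau> permutes {..<n}"
  shows "vdm n (x \<circ> \<tau>) = of_int (sign \<tau>) * (vdm n x :: 'a :: idom)"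
proof -
  let ?P = "{\<sigma>. \<sigma> permutes {..<n}}"
  have "(\<Sum>\<sigma>\<in>?P. of_int (sign \<sigma>) * (\<Prod>a<n. x (\<tau> (\<sigma> a)) ^ a)) =
        (\<Sum>\<sigma>\<in>?P. of_int (sign \<tau>) * (of_int (sign (\<tau> \<circ> \<sigma>)) * (\<Prod>a<n. x ((\<tau> \<circ> \<sigma>) a) ^ a)))"
  proof (rule sum.cong[OF refl])
    fix \<sigma> assume "\<sigma> \<in> ?P"
    hence "sign (\<tau> \<circ> \<sigma>) = sign \<tau> * sign \<sigma>"
      using assms by (intro sign_compose) (auto intro: permutation_permutes[THEN iffD2])
    thus "of_int (sign \<sigma>) * (\<Prod>a<n. x (\<tau> (\<sigma> a)) ^ a) =
      of_int (sign \<tau>) * (of_int (sign (\<tau> \<circ> \<sigma>)) * (\<Prod>a<n. x ((\<tau> \<circ> \<sigma>) a) ^ a))"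
      by (simp add: mult.assoc[symmetric] flip: of_int_mult)
  qed
  also have "\<dots> = of_int (sign \<tau>) * (\<Sum>\<sigma>\<in>?P. of_int (sign (\<tau> \<circ> \<sigma>)) * (\<Prod>a<n. x ((\<tau> \<circ> \<sigma>) a) ^ a))"
    by (simp add: sum_distrib_left)
  also have "(\<Sum>\<sigma>\<in>?P. of_int (sign (\<tau> \<circ> \<sigma>)) * (\<Prod>a<n. x ((\<tau> \<circ> \<sigma>) a) ^ a)) =
     (\<Sum>\<sigma>\<in>?P. of_int (sign \<sigma>) * (\<Prod>a<n. x (\<sigma> a) ^ a))"
    by (rule setum_permutations_compose_left[OF assms, symmetric])
  finally show ?thesis
    using alternant_eq_vdm(2)[of n "\<lambda>a. monom 1 a" x] alternant_eq_vdm(2)[of n "\<lambda>a. monom 1 a" "x \<circ> \<tau>"]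
    by (simp add: degree_monom_eq poly_monom)
qed

lemma vdm_eq_0:
  assumes "a < n" "b < n" "a \<noteq> b" "x a = x b"
  shows "vdm n x = (0 :: 'a :: idom)"
proof -
  have *: "vdm n x = 0" if "a < b" "b < n" "x a = x b" for a b
  proof -
    have "(\<Prod>a<b. x b - x a) = 0" using that by (intro prod_zero) (auto intro!: bexI[of _ a])
    thus ?thesis unfolding vdm_def using that by (intro prod_zero) auto
  qed
  show ?thesis using *[of a b] *[of b a] assms by (metis linorder_neqE_nat)
qed

lemma vdm_neq_0:
  assumes "inj_on x {..<n}"
  shows "vdm n x \<noteq> (0 :: 'a :: idom)"
proof -
  have "x b \<noteq> x a" if "b < n" "a < b" for a b
    using assms that inj_onD[OF assms, of b a] by auto
  thus ?thesis by (auto simp: vdm_def)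
qed

section \<open>Second symmetric functions and logarithmic derivatives of the Vandermonde
  product\<close>

definition esym2 :: "nat \<Rightarrow> (nat \<Rightarrow> 'a :: comm_ring_1) \<Rightarrow> 'a" where
  "esym2 n l = (\<Sum>j<n. \<Sum>i<j. l i * l j)"

lemma two_esym2: "2 * esym2 n l = (\<Sum>i<n. l i)\<^sup>2 - (\<Sum>i<n. (l i)\<^sup>2)"
  by (induction n) (simp_all add: esym2_def power2_eq_square algebra_simps sum_distrib_left sum_distrib_right)

lemma esym2_permute:
  assumes "\<sigma> permutes {..<n}"
  shows "esym2 n (\<lambda>i. l (\<sigma> i)) = (esym2 n l :: complex)"
proof -
  have "2 * esym2 n (\<lambda>i. l (\<sigma> i)) = 2 * esym2 n l"
    unfolding two_esym2 using sum.permute[OF assms, of l] sum.permute[OF assms, of "\<lambda>i. (l i)\<^sup>2"]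
    by (simp add: o_def)
  thus ?thesis by simp
qed

lemma esym2_add:
  "esym2 n (\<lambda>i. a i + b i) = esym2 n a + esym2 n b + (\<Sum>i<n. a i * ((\<Sum>k<n. b k) - b i))"
  for a b :: "nat \<Rightarrow> complex"
proof -
  have "2 * esym2 n (\<lambda>i. a i + b i) = 2 * (esym2 n a + esym2 n b + (\<Sum>i<n. a i * ((\<Sum>k<n. b k) - b i)))"
    unfolding two_esym2 distrib_left
    by (simp add: sum.distrib power2_eq_square algebra_simps sum_distrib_left sum_distrib_right sum_subtractf)
       (rule sum.swap)
  thus ?thesis by (subst (asm) mult_left_cancel) simp_all
qed

lemma sum_off_diagonal:
  fixes h :: "nat \<Rightarrow> nat \<Rightarrow> 'a :: ab_group_add"
  shows "(\<Sum>i<n. \<Sum>k\<in>{..<n} - {i}. h i k) = (\<Sum>j<n. \<Sum>i<j. h i j + h j i)"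
proof (induction n)
  case (Suc n)
  have "(\<Sum>i<Suc n. \<Sum>k\<in>{..<Suc n} - {i}. h i k) =
        (\<Sum>i<n. \<Sum>k\<in>{..<Suc n} - {i}. h i k) + (\<Sum>k\<in>{..<n}. h n k)"
    by (simp add: lessThan_Suc)
  also have "(\<Sum>i<n. \<Sum>k\<in>{..<Suc n} - {i}. h i k) = (\<Sum>i<n. (\<Sum>k\<in>{..<n} - {i}. h i k) + h i n)"
  proof (rule sum.cong[OF refl])
    fix i assume "i \<in> {..<n}"
    hence "{..<Suc n} - {i} = insert n ({..<n} - {i})" by auto
    thus "(\<Sum>k\<in>{..<Suc n} - {i}. h i k) = (\<Sum>k\<in>{..<n} - {i}. h i k) + h i n"
      by (simp add: add.commute)
  qed
  finally show ?case by (simp add: Suc sum.distrib add.assoc)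
qed simp

text \<open>As a polynomial in its i-th argument the Vandermonde product has the other points as
  simple roots. Pairs (i, k) with k > i carry the difference with the opposite sign;
  \<open>s\<close> moves this sign into the constant.\<close>

lemma vdm_remove:
  fixes z :: "nat \<Rightarrow> 'a :: idom"
  assumes "i < n"
  shows "\<exists>c. \<forall>w. vdm n (z(i := w)) = c * (\<Prod>k\<in>{..<n} - {i}. w - z k)"
proof -
  define S where "S = {(a, b). a < b \<and> b < n}"
  have fin: "finite S" by (rule finite_subset[of _ "{..<n} \<times> {..<n}"]) (auto simp: S_def)
  have vd: "vdm n x = (\<Prod>(a, b)\<in>S. x b - x a)" for x :: "nat \<Rightarrow> 'a"
    unfolding vdm_def S_def
    by (subst prod.Sigma) (auto intro!: prod.reindex_bij_witness[of _ "\<lambda>(a,b). (b,a)" "\<lambda>(b,a). (a,b)"])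
  define S1 where "S1 = {(a, b). (a = i \<or> b = i) \<and> (a, b) \<in> S}"
  define S2 where "S2 = {(a, b). \<not> (a = i \<or> b = i) \<and> (a, b) \<in> S}"
  have S: "S = S1 \<union> S2" "S1 \<inter> S2 = {}" "finite S1" "finite S2"
    using fin by (auto simp: S1_def S2_def intro: finite_subset[OF _ fin])
  define o' where "o' = (\<lambda>(a, b). if b = i then a else b)"
  define s where "s = (\<lambda>k. if k < i then 1 else (-1 :: 'a))"
  define c where "c = (\<Prod>(a, b)\<in>S2. z b - z a) * (\<Prod>k\<in>{..<n} - {i}. s k)"
  have "vdm n (z(i := w)) = c * (\<Prod>k\<in>{..<n} - {i}. w - z k)" for w
  proof -
    have "(\<Prod>(a, b)\<in>S1. (z(i := w)) b - (z(i := w)) a) = (\<Prod>k\<in>{..<n} - {i}. s k * (w - z k))"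
      by (rule prod.reindex_bij_witness[of _ "\<lambda>k. if k < i then (k, i) else (i, k)" o'])
         (use assms in \<open>auto simp: S1_def S_def o'_def s_def\<close>)
    moreover have "(\<Prod>(a, b)\<in>S2. (z(i := w)) b - (z(i := w)) a) = (\<Prod>(a, b)\<in>S2. z b - z a)"
      by (rule prod.cong) (auto simp: S2_def)
    ultimately show ?thesis
      unfolding vd S(1) by (subst prod.union_disjoint) (use S in \<open>auto simp: c_def prod.distrib\<close>)
  qed
  thus ?thesis by blast
qed

text \<open>Weighting a monomial by its i-th exponent is the Euler operator z d/dz in the i-th
  variable. Applied to the Vandermonde product it gives the product times its logarithmic
  derivative.\<close>

lemma sum_sign_weighted_power:
  fixes z :: "nat \<Rightarrow> complex"
  assumes i: "i < n" and inj: "inj_on z {..<n}"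
  shows "(\<Sum>\<sigma> | \<sigma> permutes {..<n}. of_int (sign \<sigma>) * of_nat (\<sigma> i) * (\<Prod>k<n. z k ^ \<sigma> k)) =
           vdm n z * (\<Sum>k\<in>{..<n} - {i}. z i / (z i - z k))"
proof -
  obtain c where c: "\<And>w. vdm n (z(i := w)) = c * (\<Prod>k\<in>{..<n} - {i}. w - z k)"
    using vdm_remove[OF i, of z] by blast
  define A where "A = (\<lambda>\<sigma>. of_int (sign \<sigma>) * (\<Prod>k\<in>{..<n} - {i}. z k ^ \<sigma> k))"
  have A: "of_int (sign \<sigma>) * (\<Prod>k<n. (z(i := w)) k ^ \<sigma> k) = A \<sigma> * w ^ \<sigma> i" for \<sigma> w
    using i by (subst prod.remove[of _ i]) (auto simp: A_def intro!: prod.cong)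
  have eq: "(\<Sum>\<sigma> | \<sigma> permutes {..<n}. A \<sigma> * w ^ \<sigma> i) = c * (\<Prod>k\<in>{..<n} - {i}. w - z k)" for w
    using vandermonde_sum[where n = n and x = "z(i := w)"] unfolding c A by simp
  have neq: "z i \<noteq> z k" if "k \<in> {..<n} - {i}" for k
    using that i inj by (auto dest: inj_onD)
  have "((\<lambda>w. \<Sum>\<sigma> | \<sigma> permutes {..<n}. A \<sigma> * w ^ \<sigma> i) has_field_derivative
          (\<Sum>\<sigma> | \<sigma> permutes {..<n}. A \<sigma> * (of_nat (\<sigma> i) * z i ^ (\<sigma> i - 1)))) (at (z i))"
    by (auto intro!: derivative_eq_intros simp: mult_ac)
  moreover have "((\<lambda>w. c * (\<Prod>k\<in>{..<n} - {i}. w - z k)) has_field_derivative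
          c * ((\<Prod>k\<in>{..<n} - {i}. z i - z k) * (\<Sum>k\<in>{..<n} - {i}. 1 / (z i - z k)))) (at (z i))"
    by (intro DERIV_cmult has_field_derivative_prod'[THEN DERIV_cong]) 
       (use neq in \<open>auto intro!: derivative_eq_intros\<close>)
  ultimately have "(\<Sum>\<sigma> | \<sigma> permutes {..<n}. A \<sigma> * (of_nat (\<sigma> i) * z i ^ (\<sigma> i - 1))) =
      c * ((\<Prod>k\<in>{..<n} - {i}. z i - z k) * (\<Sum>k\<in>{..<n} - {i}. 1 / (z i - z k)))"
    unfolding eq by (rule DERIV_unique)
  also have "\<dots> = vdm n z * (\<Sum>k\<in>{..<n} - {i}. 1 / (z i - z k))"
    using c[of "z i"] by simp
  finally have "z i * (\<Sum>\<sigma> | \<sigma> permutes {..<n}. A \<sigma> * (of_nat (\<sigma> i) * z i ^ (\<sigma> i - 1))) =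
      vdm n z * (\<Sum>k\<in>{..<n} - {i}. z i / (z i - z k))"
    by (simp add: sum_distrib_left mult_ac)
  moreover have "z i * (A \<sigma> * (of_nat (\<sigma> i) * z i ^ (\<sigma> i - 1))) =
      of_int (sign \<sigma>) * of_nat (\<sigma> i) * (\<Prod>k<n. z k ^ \<sigma> k)" for \<sigma>
    using A[of \<sigma> "z i"] by (cases "\<sigma> i") (simp_all add: mult_ac)
  ultimately show ?thesis by (simp only: sum_distrib_left[of "z i"])
qed

lemma sum_permutes_id:
  assumes "\<sigma> permutes {..<n}"
  shows "(\<Sum>i<n. of_nat (\<sigma> i)) = (\<Sum>i<n. of_nat i :: 'a :: semiring_1)"
  using sum.permute[OF assms, of "of_nat :: nat \<Rightarrow> 'a"] by (simp add: o_def)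

section \<open>Antisymmetrised coefficient arrays\<close>

lemma prod_sum_power_PiE:
  fixes c :: "nat \<Rightarrow> nat \<Rightarrow> complex"
  shows "(\<Sum>m\<in>{..<n} \<rightarrow>\<^sub>E {..K}. \<Prod>i<n. c i (m i)) = (\<Prod>i<n. \<Sum>m\<le>K. c i m)"
  by (subst prod_sum_PiE) auto

text \<open>Induction on the number of variables: with the others fixed, the polynomial in the last
  variable has infinitely many roots. Every coordinate has its own infinite set, so that the sets
  can be chosen disjoint and all test points have distinct coordinates.\<close>

lemma multivariate_poly_zero:
  fixes c :: "(nat \<Rightarrow> nat) \<Rightarrow> complex"
  assumes "\<And>i. i < n \<Longrightarrow> infinite (A i)"
    and "\<And>z. (\<And>i. i < n \<Longrightarrow> z i \<in> A i) \<Longrightarrow> (\<Sum>l\<in>{..<n} \<rightarrow>\<^sub>E {..K}. c l * (\<Prod>i<n. z i ^ l i)) = 0"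
    and "l \<in> {..<n} \<rightarrow>\<^sub>E {..K}"
  shows "c l = 0"
  using assms
proof (induction n arbitrary: c l)
  case 0
  thus ?case by auto
next
  case (Suc n)
  let ?S = "{..<n} \<rightarrow>\<^sub>E {..K}"
  have split: "(\<Sum>l\<in>{..<Suc n} \<rightarrow>\<^sub>E {..K}. h l) = (\<Sum>b\<le>K. \<Sum>l\<in>?S. h (l(n := b)))" for h :: "(nat \<Rightarrow> nat) \<Rightarrow> complex"
  proof -
    have "(\<Sum>l\<in>{..<Suc n} \<rightarrow>\<^sub>E {..K}. h l) = (\<Sum>(b, l)\<in>{..K} \<times> ?S. h (l(n := b)))"
      unfolding lessThan_Suc PiE_insert_eq
      by (subst sum.reindex[OF inj_combinator]) (auto intro!: sum.cong simp: case_prod_unfold)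
    thus ?thesis by (simp add: sum.cartesian_product)
  qed
  have "(\<Sum>l\<in>?S. c (l(n := b)) * (\<Prod>i<n. z i ^ l i)) = 0"
    if z: "\<And>i. i < n \<Longrightarrow> z i \<in> A i" and b: "b \<le> K" for z b
  proof -
    define d where "d = (\<lambda>b. \<Sum>l\<in>?S. c (l(n := b)) * (\<Prod>i<n. z i ^ l i))"
    define p where "p = (\<Sum>b\<le>K. monom (d b) b)"
    have "poly p w = 0" if w: "w \<in> A n" for w
    proof -
      have "poly p w = (\<Sum>b\<le>K. \<Sum>l\<in>?S. c (l(n := b)) * ((\<Prod>i<n. z i ^ l i) * w ^ b))"
        unfolding p_def poly_sum poly_monom d_def by (simp add: sum_distrib_right mult.assoc)
      also have "\<dots> = (\<Sum>b\<le>K. \<Sum>l\<in>?S. c (l(n := b)) * (\<Prod>i<Suc n. (z(n := w)) i ^ (l(n := b)) i))"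
        by (intro sum.cong refl arg_cong2[of _ _ _ _ "(*)"]) (simp add: mult.commute)
      also have "\<dots> = (\<Sum>l\<in>{..<Suc n} \<rightarrow>\<^sub>E {..K}. c l * (\<Prod>i<Suc n. (z(n := w)) i ^ l i))"
        by (rule split[of "\<lambda>l. c l * (\<Prod>i<Suc n. (z(n := w)) i ^ l i)", symmetric])
      also have "\<dots> = 0" using z w by (intro Suc.prems(2)) (auto simp: less_Suc_eq)
      finally show ?thesis .
    qed
    hence "A n \<subseteq> {w. poly p w = 0}" by auto
    with Suc.prems(1)[of n] have "p = 0"
      using poly_roots_finite[of p] finite_subset by auto
    hence "coeff p b = 0" by simp
    thus ?thesis using b by (simp add: p_def coeff_sum d_def)
  qed
  hence *: "c (l'(n := b)) = 0" if "l' \<in> ?S" "b \<le> K" for l' b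
    using Suc.IH[of "\<lambda>l. c (l(n := b))" l'] Suc.prems(1) that by auto
  from Suc.prems(3) obtain l' b where "l = l'(n := b)" "l' \<in> ?S" "b \<le> K"
    unfolding lessThan_Suc PiE_insert_eq by auto
  thus ?case using * by (simp only:)
qed

definition shift_sum :: "nat \<Rightarrow> (nat \<Rightarrow> nat) \<Rightarrow> (nat \<Rightarrow> nat) \<Rightarrow> (nat \<Rightarrow> nat)" where
  "shift_sum n \<sigma> m = (\<lambda>i\<in>{..<n}. \<sigma> i + m i)"

text \<open>The coefficients of the product of the Vandermonde product and the polynomial with
  coefficients \<open>f\<close>.\<close>

definition alt_coeff :: "nat \<Rightarrow> nat \<Rightarrow> ((nat \<Rightarrow> nat) \<Rightarrow> complex) \<Rightarrow> (nat \<Rightarrow> nat) \<Rightarrow> complex" where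
  "alt_coeff n N f l = (\<Sum>(\<sigma>, m) | \<sigma> permutes {..<n} \<and> m \<in> {..<n} \<rightarrow>\<^sub>E {..N} \<and> shift_sum n \<sigma> m = l.
     of_int (sign \<sigma>) * f m)"

lemma finite_permutes_lessThan [simp]: "finite {\<sigma>. \<sigma> permutes {..<n::nat}}"
  by (simp add: finite_permutations)

text \<open>Collects the terms along the fibres of \<open>shift_sum\<close>. The weight
  \<open>W\<close> is free: a monomial gives the product polynomial, a monomial times a symmetric
  function of its exponents gives Euler operators applied to that polynomial.\<close>

lemma alt_coeff_sum:
  "(\<Sum>\<sigma> | \<sigma> permutes {..<n}. \<Sum>m\<in>{..<n} \<rightarrow>\<^sub>E {..N}.
      of_int (sign \<sigma>) * f m * W (shift_sum n \<sigma> m)) =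
   (\<Sum>l\<in>{..<n} \<rightarrow>\<^sub>E {..N+n}. alt_coeff n N f l * W l)"
proof -
  let ?P = "{\<sigma>. \<sigma> permutes {..<n}}" and ?M = "{..<n} \<rightarrow>\<^sub>E {..N}"
  have fin: "finite (?P \<times> ?M)" by (intro finite_cartesian_product finite_PiE) auto
  have img: "(\<lambda>x. shift_sum n (fst x) (snd x)) ` (?P \<times> ?M) \<subseteq> {..<n} \<rightarrow>\<^sub>E {..N + n}"
  proof (rule image_subsetI)
    fix x assume "x \<in> ?P \<times> ?M"
    then obtain \<sigma> m where x: "x = (\<sigma>, m)" "\<sigma> permutes {..<n}" "m \<in> ?M" by auto
    have "\<sigma> i + m i \<le> N + n" if "i < n" for i
    proof -
      have "\<sigma> i < n" using permutes_in_image[OF x(2), of i] that by simp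
      moreover have "m i \<le> N" using PiE_mem[OF x(3), of i] that by simp
      ultimately show ?thesis by linarith
    qed
    thus "shift_sum n (fst x) (snd x) \<in> {..<n} \<rightarrow>\<^sub>E {..N + n}"
      by (auto simp: x shift_sum_def)
  qed
  have "alt_coeff n N f l * W l = (\<Sum>x\<in>{x \<in> ?P \<times> ?M. shift_sum n (fst x) (snd x) = l}.
        of_int (sign (fst x)) * f (snd x) * W (shift_sum n (fst x) (snd x)))" for l
  proof -
    have "{(\<sigma>, m). \<sigma> permutes {..<n} \<and> m \<in> ?M \<and> shift_sum n \<sigma> m = l} =
        {x \<in> ?P \<times> ?M. shift_sum n (fst x) (snd x) = l}"
      by (rule Set.set_eqI) (simp add: case_prod_unfold mem_Times_iff)
    hence "alt_coeff n N f l * W l = (\<Sum>x\<in>{x \<in> ?P \<times> ?M. shift_sum n (fst x) (snd x) = l}.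
        of_int (sign (fst x)) * f (snd x) * W l)"
      by (simp add: alt_coeff_def sum_distrib_right case_prod_unfold)
    also have "\<dots> = (\<Sum>x\<in>{x \<in> ?P \<times> ?M. shift_sum n (fst x) (snd x) = l}.
        of_int (sign (fst x)) * f (snd x) * W (shift_sum n (fst x) (snd x)))"
      by (rule sum.cong[OF refl]) (simp only: mem_Collect_eq)
    finally show ?thesis .
  qed
  hence "(\<Sum>l\<in>{..<n} \<rightarrow>\<^sub>E {..N+n}. alt_coeff n N f l * W l) =
     (\<Sum>l\<in>{..<n} \<rightarrow>\<^sub>E {..N+n}. \<Sum>x\<in>{x \<in> ?P \<times> ?M. shift_sum n (fst x) (snd x) = l}.
        of_int (sign (fst x)) * f (snd x) * W (shift_sum n (fst x) (snd x)))"
    by (simp only:)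
  also have "\<dots> = (\<Sum>x\<in>?P \<times> ?M. of_int (sign (fst x)) * f (snd x) * W (shift_sum n (fst x) (snd x)))"
    by (rule sum.group[OF fin _ img]) (intro finite_PiE finite_lessThan finite_atMost)
  finally show ?thesis by (simp add: sum.cartesian_product case_prod_unfold)
qed

lemma alt_coeff_permute:
  assumes \<tau>: "\<tau> permutes {..<n}"
    and f: "\<And>m. m \<in> {..<n} \<rightarrow>\<^sub>E {..N} \<Longrightarrow> f (\<lambda>i\<in>{..<n}. m (\<tau> i)) = f m"
    and l: "l \<in> extensional {..<n}"
  shows "alt_coeff n N f (\<lambda>i\<in>{..<n}. l (\<tau> i)) = of_int (sign \<tau>) * alt_coeff n N f l"
proof -
  define \<rho> where "\<rho> = inv_into UNIV \<tau>"
  have \<rho>: "\<rho> permutes {..<n}" unfolding \<rho>_def by (rule permutes_inv[OF \<tau>])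
  have mem: "\<tau> i < n \<longleftrightarrow> i < n" "\<rho> i < n \<longleftrightarrow> i < n" for i
    using permutes_in_image[OF \<tau>, of i] permutes_in_image[OF \<rho>, of i] by auto
  have inv: "\<tau> (\<rho> i) = i" "\<rho> (\<tau> i) = i" for i
    using permutes_inverses[OF \<tau>] by (auto simp: \<rho>_def)
  have PE: "(\<lambda>i\<in>{..<n}. m (\<pi> i)) \<in> {..<n} \<rightarrow>\<^sub>E {..N}"
    if "m \<in> {..<n} \<rightarrow>\<^sub>E {..N}" "\<And>i. i < n \<Longrightarrow> \<pi> i < n" for m \<pi>
    using that by (auto simp: PiE_def Pi_def)
  have E: "(\<lambda>i\<in>{..<n}. (\<lambda>i\<in>{..<n}. m (\<pi> i)) (\<pi>' i)) = m"
    if "m \<in> extensional {..<n}" "\<And>i. i < n \<Longrightarrow> \<pi>' i < n" "\<And>i. i < n \<Longrightarrow> \<pi> (\<pi>' i) = i" 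
    for m :: "nat \<Rightarrow> nat" and \<pi> \<pi>'
    by (rule extensionalityI[of _ "{..<n}"]) (use that in auto)
  have "of_int (sign \<tau>) * alt_coeff n N f l =
    (\<Sum>(\<sigma>, m) | \<sigma> permutes {..<n} \<and> m \<in> {..<n} \<rightarrow>\<^sub>E {..N} \<and> shift_sum n \<sigma> m = l.
      of_int (sign (\<sigma> \<circ> \<tau>)) * f (\<lambda>i\<in>{..<n}. m (\<tau> i)))"
    unfolding alt_coeff_def sum_distrib_left
  proof (intro sum.cong refl, clarify)
    fix \<sigma> m assume *: "\<sigma> permutes {..<n}" "m \<in> {..<n} \<rightarrow>\<^sub>E {..N}"
    have "sign (\<sigma> \<circ> \<tau>) = sign \<sigma> * sign \<tau>"
      using * \<tau> by (intro sign_compose) (auto simp: permutation_permutes)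
    thus "of_int (sign \<tau>) * (of_int (sign \<sigma>) * f m) = of_int (sign (\<sigma> \<circ> \<tau>)) * f (\<lambda>i\<in>{..<n}. m (\<tau> i))"
      using f[OF *(2)] by simp
  qed
  also have "\<dots> = alt_coeff n N f (\<lambda>i\<in>{..<n}. l (\<tau> i))"
    unfolding alt_coeff_def
  proof (rule sum.reindex_bij_witness[of _ "\<lambda>(\<sigma>, m). (\<sigma> \<circ> \<rho>, \<lambda>i\<in>{..<n}. m (\<rho> i))"
        "\<lambda>(\<sigma>, m). (\<sigma> \<circ> \<tau>, \<lambda>i\<in>{..<n}. m (\<tau> i))"], goal_cases)
    case (1 x)
    obtain \<sigma> m where x: "x = (\<sigma>, m)" by (cases x)
    have "(\<lambda>i\<in>{..<n}. (\<lambda>i\<in>{..<n}. m (\<tau> i)) (\<rho> i)) = m"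
      by (rule E[where m = m and \<pi> = \<tau> and \<pi>' = \<rho>]) (use 1 x mem inv in \<open>auto simp: PiE_def\<close>)
    thus ?case by (simp add: x comp_def inv)
  next
    case (2 x)
    obtain \<sigma> m where x: "x = (\<sigma>, m)" by (cases x)
    hence *: "\<sigma> permutes {..<n}" "m \<in> {..<n} \<rightarrow>\<^sub>E {..N}" "shift_sum n \<sigma> m = l" using 2 by auto
    have "shift_sum n (\<sigma> \<circ> \<tau>) (\<lambda>i\<in>{..<n}. m (\<tau> i)) = (\<lambda>i\<in>{..<n}. l (\<tau> i))"
      unfolding *(3)[symmetric] by (rule extensionalityI[of _ "{..<n}"]) (auto simp: shift_sum_def mem)
    thus ?case using permutes_compose[OF \<tau> *(1)] PE[OF *(2), of \<tau>] by (simp add: x mem)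
  next
    case (3 x)
    obtain \<sigma> m where x: "x = (\<sigma>, m)" by (cases x)
    have "(\<lambda>i\<in>{..<n}. (\<lambda>i\<in>{..<n}. m (\<rho> i)) (\<tau> i)) = m"
      by (rule E[where m = m and \<pi> = \<rho> and \<pi>' = \<tau>]) (use 3 x mem inv in \<open>auto simp: PiE_def\<close>)
    thus ?case by (simp add: x comp_def inv)
  next
    case (4 x)
    obtain \<sigma> m where x: "x = (\<sigma>, m)" by (cases x)
    hence *: "\<sigma> permutes {..<n}" "m \<in> {..<n} \<rightarrow>\<^sub>E {..N}"
      "shift_sum n \<sigma> m = (\<lambda>i\<in>{..<n}. l (\<tau> i))" using 4 by auto
    have "shift_sum n (\<sigma> \<circ> \<rho>) (\<lambda>i\<in>{..<n}. m (\<rho> i)) = l"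
    proof (rule extensionalityI[of _ "{..<n}"])
      fix i assume "i \<in> {..<n}"
      thus "shift_sum n (\<sigma> \<circ> \<rho>) (\<lambda>i\<in>{..<n}. m (\<rho> i)) i = l i"
        using fun_cong[OF *(3), of "\<rho> i"] by (simp add: shift_sum_def mem inv)
    qed (use l in \<open>auto simp: shift_sum_def\<close>)
    thus ?case using permutes_compose[OF \<rho> *(1)] PE[OF *(2), of \<rho>] by (simp add: x mem)
  next
    case (5 x)
    thus ?case by (cases x) simp
  qed
  finally show ?thesis ..
qed

section \<open>Euler operators on products of polynomials\<close>

lemma poly_eq_sum_coeff:
  assumes "degree p \<le> N"
  shows "poly p z = (\<Sum>m\<le>N. coeff p m * (z :: complex) ^ m)"
  unfolding poly_altdef using assms
  by (intro sum.mono_neutral_left) (auto simp: coeff_eq_0)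

lemma mult_poly_pderiv_eq_sum:
  assumes "degree p \<le> N"
  shows "z * poly (pderiv p) z = (\<Sum>m\<le>N. of_nat m * coeff p m * (z :: complex) ^ m)"
proof (cases N)
  case 0
  thus ?thesis using assms by (auto elim!: degree_eq_zeroE simp: pderiv_pCons)
next
  case (Suc N')
  have "degree (pderiv p) \<le> N'" using degree_pderiv_le[of p] assms Suc by linarith
  hence "z * poly (pderiv p) z = (\<Sum>m\<le>N'. of_nat (Suc m) * coeff p (Suc m) * z ^ Suc m)"
    by (subst poly_eq_sum_coeff[of _ N']) (auto simp: coeff_pderiv sum_distrib_left algebra_simps)
  also have "\<dots> = (\<Sum>m\<le>N. of_nat m * coeff p m * z ^ m)"
    unfolding Suc sum.atMost_Suc_shift by simp
  finally show ?thesis .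
qed

text \<open>For a monic polynomial of degree N with roots u this is the sum of u / (z - u); for a
  characteristic polynomial it is the trace of U (z - U)^-1.\<close>

definition log_deriv_excess :: "nat \<Rightarrow> complex poly \<Rightarrow> complex \<Rightarrow> complex" where
  "log_deriv_excess N p z = z * poly (pderiv p) z / poly p z - of_nat N"

text \<open>\<open>J\<close> lists the variables to which an Euler operator is applied. Each
  variable occurs in one factor only, so the sum splits into a product over the variables; the
  exponent contributed by the Vandermonde term and the logarithmic derivative of p simply
  add.\<close>

lemma sum_shifted_coeff:
  assumes p: "degree p \<le> N" "\<And>i. i < n \<Longrightarrow> poly p (z i) \<noteq> 0" and J: "J \<subseteq> {..<n}"
  shows "(\<Sum>m\<in>{..<n} \<rightarrow>\<^sub>E {..N}. (\<Prod>i<n. coeff p (m i)) *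
      ((\<Prod>j\<in>J. of_nat (shift_sum n \<sigma> m j)) * (\<Prod>i<n. z i ^ shift_sum n \<sigma> m i))) =
    (\<Prod>i<n. poly p (z i)) * ((\<Prod>j\<in>J. of_nat (\<sigma> j) + (of_nat N + log_deriv_excess N p (z j))) * (\<Prod>i<n. z i ^ \<sigma> i))"
proof -
  have J': "(\<Prod>j\<in>J. h j) = (\<Prod>i<n. if i \<in> J then h i else 1)" for h :: "nat \<Rightarrow> complex"
    using J by (simp add: prod.If_cases Int_absorb1)
  define c where "c = (\<lambda>i m. coeff p m * ((if i \<in> J then of_nat (\<sigma> i + m) else 1) * z i ^ (\<sigma> i + m)))"
  have "(\<Sum>m\<in>{..<n} \<rightarrow>\<^sub>E {..N}. (\<Prod>i<n. coeff p (m i)) *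
      ((\<Prod>j\<in>J. of_nat (shift_sum n \<sigma> m j)) * (\<Prod>i<n. z i ^ shift_sum n \<sigma> m i))) =
     (\<Sum>m\<in>{..<n} \<rightarrow>\<^sub>E {..N}. \<Prod>i<n. c i (m i))"
    unfolding J' prod.distrib[symmetric]
    by (intro sum.cong refl prod.cong) (auto simp: c_def shift_sum_def)
  also have "\<dots> = (\<Prod>i<n. \<Sum>m\<le>N. c i m)" by (rule prod_sum_power_PiE)
  also have "\<dots> = (\<Prod>i<n. poly p (z i) * ((if i \<in> J then of_nat (\<sigma> i) + (of_nat N + log_deriv_excess N p (z i)) else 1) * z i ^ \<sigma> i))"
  proof (rule prod.cong[OF refl])
    fix i assume i: "i \<in> {..<n}"
    have P: "poly p (z i) * z i ^ \<sigma> i = (\<Sum>m\<le>N. coeff p m * z i ^ (\<sigma> i + m))"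
      by (simp add: poly_eq_sum_coeff[OF p(1)] sum_distrib_left power_add mult_ac)
    show "(\<Sum>m\<le>N. c i m) = poly p (z i) * ((if i \<in> J then of_nat (\<sigma> i) + (of_nat N + log_deriv_excess N p (z i)) else 1) * z i ^ \<sigma> i)"
    proof (cases "i \<in> J")
      case False
      thus ?thesis using P by (simp add: c_def)
    next
      case True
      have "(\<Sum>m\<le>N. c i m) = of_nat (\<sigma> i) * (\<Sum>m\<le>N. coeff p m * z i ^ (\<sigma> i + m)) +
          z i ^ \<sigma> i * (\<Sum>m\<le>N. of_nat m * coeff p m * z i ^ m)"
        using True by (simp add: c_def sum_distrib_left sum.distrib algebra_simps power_add)
      also have "\<dots> = of_nat (\<sigma> i) * (poly p (z i) * z i ^ \<sigma> i) + z i ^ \<sigma> i * (z i * poly (pderiv p) (z i))"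
        by (simp only: P mult_poly_pderiv_eq_sum[OF p(1)])
      also have "\<dots> = poly p (z i) * ((of_nat (\<sigma> i) + (of_nat N + log_deriv_excess N p (z i))) * z i ^ \<sigma> i)"
        using p(2)[of i] i by (simp add: log_deriv_excess_def field_simps)
      finally show ?thesis using True by simp
    qed
  qed
  finally show ?thesis by (simp add: J' prod.distrib)
qed

text \<open>For \<open>\<rho> i = \<Sum> u / (z i - u)\<close>, summed over the roots \<open>u\<close> of a monic polynomial of
  degree \<open>N\<close>, this is \<open>\<Sum> u\<^sup>2 / ((z i - u) * (z j - u))\<close>.\<close>

definition pair_trace :: "(nat \<Rightarrow> complex) \<Rightarrow> (nat \<Rightarrow> complex) \<Rightarrow> nat \<Rightarrow> nat \<Rightarrow> complex" where
  "pair_trace z \<rho> i j = (z j * \<rho> j - z i * \<rho> i) / (z i - z j)"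

lemma sum_pair_swap:
  fixes c :: "'b \<Rightarrow> complex"
  shows "(\<Sum>l\<in>S. c l * ((\<Sum>j<n. \<Sum>i<j. h l i j) * w l)) =
    (\<Sum>j<n::nat. \<Sum>i<j. \<Sum>l\<in>S. c l * (h l i j * w l))"
proof -
  have "(\<Sum>j<n. \<Sum>i<j. \<Sum>l\<in>S. c l * (h l i j * w l)) = (\<Sum>j<n. \<Sum>l\<in>S. \<Sum>i<j. c l * (h l i j * w l))"
    by (intro sum.cong refl sum.swap)
  also have "\<dots> = (\<Sum>l\<in>S. \<Sum>j<n. \<Sum>i<j. c l * (h l i j * w l))"
    by (rule sum.swap)
  finally show ?thesis by (simp add: sum_distrib_left sum_distrib_right)
qed

text \<open>Euler operators of order zero, one and two on the Vandermonde product times the product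
  of the values of p. The cross terms between the logarithmic derivatives of both factors are what
  creates \<open>pair_trace\<close>.\<close>

lemma alt_coeff_poly_sums:
  fixes p :: "complex poly" and z :: "nat \<Rightarrow> complex" and n N :: nat
  defines "f \<equiv> (\<lambda>m. \<Prod>i<n. coeff p (m i))"
    and "\<rho> \<equiv> (\<lambda>i. log_deriv_excess N p (z i))"
    and "c \<equiv> (\<Sum>i<n. of_nat i :: complex)"
    and "P \<equiv> (\<Prod>i<n. poly p (z i))"
  assumes p: "degree p \<le> N" "\<And>i. i < n \<Longrightarrow> poly p (z i) \<noteq> 0" and inj: "inj_on z {..<n}"
  shows "(\<Sum>l\<in>{..<n} \<rightarrow>\<^sub>E {..N+n}. alt_coeff n N f l * (\<Prod>i<n. z i ^ l i)) = vdm n z * P"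
    and "(\<Sum>l\<in>{..<n} \<rightarrow>\<^sub>E {..N+n}. alt_coeff n N f l * ((\<Sum>i<n. of_nat (l i)) * (\<Prod>i<n. z i ^ l i))) =
           vdm n z * (P * (c + of_nat n * of_nat N + (\<Sum>i<n. \<rho> i)))"
    and "(\<Sum>l\<in>{..<n} \<rightarrow>\<^sub>E {..N+n}. alt_coeff n N f l * (esym2 n (\<lambda>i. of_nat (l i)) * (\<Prod>i<n. z i ^ l i))) =
           vdm n z * (P * (esym2 n \<rho> + (\<Sum>j<n. \<Sum>i<j. pair_trace z \<rho> i j) +
             (of_nat N * (of_nat n - 1) + c) * (\<Sum>i<n. \<rho> i) +
             (esym2 n of_nat + of_nat N ^ 2 * c + of_nat n * of_nat N * c - of_nat N * c)))"
proof -
  let ?P = "{\<sigma>. \<sigma> permutes {..<n}}" and ?M = "{..<n} \<rightarrow>\<^sub>E {..N}"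
  define A where "A = (\<lambda>i. of_nat N + \<rho> i)"
  have main: "(\<Sum>l\<in>{..<n} \<rightarrow>\<^sub>E {..N+n}. alt_coeff n N f l * ((\<Prod>j\<in>J. of_nat (l j)) * (\<Prod>i<n. z i ^ l i))) =
     P * (\<Sum>\<sigma>\<in>?P. of_int (sign \<sigma>) * ((\<Prod>j\<in>J. of_nat (\<sigma> j) + A j) * (\<Prod>i<n. z i ^ \<sigma> i)))"
    if J: "J \<subseteq> {..<n}" for J
  proof -
    have "(\<Sum>l\<in>{..<n} \<rightarrow>\<^sub>E {..N+n}. alt_coeff n N f l * ((\<Prod>j\<in>J. of_nat (l j)) * (\<Prod>i<n. z i ^ l i))) =
      (\<Sum>\<sigma>\<in>?P. \<Sum>m\<in>?M. of_int (sign \<sigma>) * f m * ((\<Prod>j\<in>J. of_nat (shift_sum n \<sigma> m j)) * (\<Prod>i<n. z i ^ shift_sum n \<sigma> m i)))"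
      by (rule alt_coeff_sum[symmetric, where W = "\<lambda>l. (\<Prod>j\<in>J. of_nat (l j)) * (\<Prod>i<n. z i ^ l i)"])
    also have "\<dots> = (\<Sum>\<sigma>\<in>?P. of_int (sign \<sigma>) * (P * ((\<Prod>j\<in>J. of_nat (\<sigma> j) + A j) * (\<Prod>i<n. z i ^ \<sigma> i))))"
      using sum_shifted_coeff[OF p J] unfolding f_def P_def A_def \<rho>_def
      by (simp add: mult.assoc flip: sum_distrib_left)
    finally show ?thesis by (simp add: sum_distrib_left mult_ac)
  qed
  have S0: "(\<Sum>\<sigma>\<in>?P. of_int (sign \<sigma>) * (\<Prod>i<n. z i ^ \<sigma> i)) = vdm n z" 
    by (rule vandermonde_sum)
  \<comment> \<open>The logarithmic derivative of the Vandermonde product under the Euler operator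
    in the i-th variable.\<close>
  define \<beta> where "\<beta> = (\<lambda>i. \<Sum>k\<in>{..<n} - {i}. z i / (z i - z k))"
  have S1: "(\<Sum>\<sigma>\<in>?P. of_int (sign \<sigma>) * (of_nat (\<sigma> i) * (\<Prod>k<n. z k ^ \<sigma> k))) = vdm n z * \<beta> i" if "i < n" for i
    using sum_sign_weighted_power[OF that inj] by (simp add: \<beta>_def mult.assoc)
  show "(\<Sum>l\<in>{..<n} \<rightarrow>\<^sub>E {..N+n}. alt_coeff n N f l * (\<Prod>i<n. z i ^ l i)) = vdm n z * P"
    using main[of "{}"] S0 by simp
  have S1': "(\<Sum>\<sigma>\<in>?P. of_int (sign \<sigma>) * ((\<Sum>i<n. of_nat (\<sigma> i)) * (\<Prod>k<n. z k ^ \<sigma> k))) = vdm n z * c"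
  proof -
    have "(\<Sum>\<sigma>\<in>?P. of_int (sign \<sigma>) * ((\<Sum>i<n. of_nat (\<sigma> i)) * (\<Prod>k<n. z k ^ \<sigma> k))) =
          (\<Sum>\<sigma>\<in>?P. c * (of_int (sign \<sigma>) * (\<Prod>k<n. z k ^ \<sigma> k)))"
      by (intro sum.cong refl) (simp add: sum_permutes_id c_def)
    thus ?thesis by (simp flip: sum_distrib_left add: S0)
  qed
  \<comment> \<open>Homogeneity: summed over i, the Euler operators multiply the Vandermonde product
    by its degree \<open>c\<close>.\<close>
  have beta: "vdm n z * (\<Sum>i<n. \<beta> i) = vdm n z * c"
  proof -
    have "vdm n z * (\<Sum>i<n. \<beta> i) = (\<Sum>i<n. \<Sum>\<sigma>\<in>?P. of_int (sign \<sigma>) * (of_nat (\<sigma> i) * (\<Prod>k<n. z k ^ \<sigma> k)))"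
      by (simp add: sum_distrib_left S1)
    also have "\<dots> = (\<Sum>\<sigma>\<in>?P. of_int (sign \<sigma>) * ((\<Sum>i<n. of_nat (\<sigma> i)) * (\<Prod>k<n. z k ^ \<sigma> k)))"
      by (subst sum.swap) (simp add: sum_distrib_left sum_distrib_right)
    finally show ?thesis by (simp add: S1')
  qed
  have "(\<Sum>l\<in>{..<n} \<rightarrow>\<^sub>E {..N+n}. alt_coeff n N f l * ((\<Sum>i<n. of_nat (l i)) * (\<Prod>i<n. z i ^ l i))) =
     (\<Sum>i<n. \<Sum>l\<in>{..<n} \<rightarrow>\<^sub>E {..N+n}. alt_coeff n N f l * (of_nat (l i) * (\<Prod>i<n. z i ^ l i)))"
    by (subst sum.swap) (simp add: sum_distrib_left sum_distrib_right)
  also have "\<dots> = (\<Sum>i<n. P * (\<Sum>\<sigma>\<in>?P. of_int (sign \<sigma>) * ((of_nat (\<sigma> i) + A i) * (\<Prod>i<n. z i ^ \<sigma> i))))"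
    by (intro sum.cong refl) (use main[of "{_}"] in auto)
  also have "\<dots> = P * (\<Sum>\<sigma>\<in>?P. of_int (sign \<sigma>) * ((\<Sum>i<n. of_nat (\<sigma> i)) * (\<Prod>k<n. z k ^ \<sigma> k)) + 
      (\<Sum>i<n. A i) * (of_int (sign \<sigma>) * (\<Prod>k<n. z k ^ \<sigma> k)))"
    unfolding sum_distrib_left[symmetric]
    by (subst sum.swap) (simp add: sum_distrib_left sum_distrib_right algebra_simps sum.distrib)
  also have "\<dots> = vdm n z * (P * (c + (\<Sum>i<n. A i)))"
    unfolding sum.distrib S1' sum_distrib_left[symmetric] S0 by (simp add: algebra_simps)
  finally show "(\<Sum>l\<in>{..<n} \<rightarrow>\<^sub>E {..N+n}. alt_coeff n N f l * ((\<Sum>i<n. of_nat (l i)) * (\<Prod>i<n. z i ^ l i))) =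
           vdm n z * (P * (c + of_nat n * of_nat N + (\<Sum>i<n. \<rho> i)))"
    by (simp add: A_def sum.distrib algebra_simps)
  have "(\<Sum>l\<in>{..<n} \<rightarrow>\<^sub>E {..N+n}. alt_coeff n N f l * (esym2 n (\<lambda>i. of_nat (l i)) * (\<Prod>i<n. z i ^ l i))) =
     (\<Sum>j<n. \<Sum>i<j. \<Sum>l\<in>{..<n} \<rightarrow>\<^sub>E {..N+n}. alt_coeff n N f l * ((of_nat (l i) * of_nat (l j)) * (\<Prod>i<n. z i ^ l i)))"
    unfolding esym2_def by (rule sum_pair_swap)
  also have "\<dots> = (\<Sum>j<n. \<Sum>i<j. P * (\<Sum>\<sigma>\<in>?P. of_int (sign \<sigma>) *
       (((of_nat (\<sigma> i) + A i) * (of_nat (\<sigma> j) + A j)) * (\<Prod>i<n. z i ^ \<sigma> i))))"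
  proof (intro sum.cong refl)
    fix i j assume "j \<in> {..<n}" "i \<in> {..<j}"
    thus "(\<Sum>l\<in>{..<n} \<rightarrow>\<^sub>E {..N+n}. alt_coeff n N f l * ((of_nat (l i) * of_nat (l j)) * (\<Prod>i<n. z i ^ l i))) =
      P * (\<Sum>\<sigma>\<in>?P. of_int (sign \<sigma>) *
       (((of_nat (\<sigma> i) + A i) * (of_nat (\<sigma> j) + A j)) * (\<Prod>i<n. z i ^ \<sigma> i)))"
      using main[of "{i, j}"] by auto
  qed
  also have "\<dots> = P * (\<Sum>\<sigma>\<in>?P. of_int (sign \<sigma>) * (esym2 n (\<lambda>i. of_nat (\<sigma> i) + A i) * (\<Prod>i<n. z i ^ \<sigma> i)))"
    unfolding esym2_def sum_pair_swap by (simp only: sum_distrib_left)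
  also have "(\<Sum>\<sigma>\<in>?P. of_int (sign \<sigma>) * (esym2 n (\<lambda>i. of_nat (\<sigma> i) + A i) * (\<Prod>i<n. z i ^ \<sigma> i))) =
     (\<Sum>\<sigma>\<in>?P. (esym2 n A + esym2 n of_nat + c * (\<Sum>i<n. A i)) * (of_int (sign \<sigma>) * (\<Prod>i<n. z i ^ \<sigma> i)) -
        (\<Sum>i<n. A i * (of_int (sign \<sigma>) * (of_nat (\<sigma> i) * (\<Prod>i<n. z i ^ \<sigma> i)))))"
  proof (intro sum.cong refl)
    fix \<sigma> assume "\<sigma> \<in> ?P"
    hence \<sigma>: "\<sigma> permutes {..<n}" by simp
    \<comment> \<open>Symmetric functions of the values of \<open>\<sigma>\<close> do not depend on
      \<open>\<sigma>\<close>. After polarisation the linear cross term is the only dependence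
      left.\<close>
    have "esym2 n (\<lambda>i. of_nat (\<sigma> i) + A i) = esym2 n (\<lambda>i. A i + of_nat (\<sigma> i))" by (simp add: add.commute)
    also have "\<dots> = esym2 n A + esym2 n of_nat + (\<Sum>i<n. A i * (c - of_nat (\<sigma> i)))"
      unfolding esym2_add esym2_permute[OF \<sigma>, of of_nat] c_def sum_permutes_id[OF \<sigma>] ..
    also have "\<dots> = esym2 n A + esym2 n of_nat + c * (\<Sum>i<n. A i) - (\<Sum>i<n. A i * of_nat (\<sigma> i))"
      by (simp add: right_diff_distrib sum_subtractf sum_distrib_left mult.commute)
    finally have E2: "esym2 n (\<lambda>i. of_nat (\<sigma> i) + A i) =
      esym2 n A + esym2 n of_nat + c * (\<Sum>i<n. A i) - (\<Sum>i<n. A i * of_nat (\<sigma> i))" .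
    show "of_int (sign \<sigma>) * (esym2 n (\<lambda>i. of_nat (\<sigma> i) + A i) * (\<Prod>i<n. z i ^ \<sigma> i)) =
      (esym2 n A + esym2 n of_nat + c * (\<Sum>i<n. A i)) * (of_int (sign \<sigma>) * (\<Prod>i<n. z i ^ \<sigma> i)) -
        (\<Sum>i<n. A i * (of_int (sign \<sigma>) * (of_nat (\<sigma> i) * (\<Prod>i<n. z i ^ \<sigma> i))))"
      unfolding E2 by (simp add: left_diff_distrib right_diff_distrib sum_distrib_left sum_distrib_right mult_ac)
  qed
  also have "\<dots> = (esym2 n A + esym2 n of_nat + c * (\<Sum>i<n. A i)) * vdm n z - vdm n z * (\<Sum>i<n. A i * \<beta> i)"
  proof -
    have "(\<Sum>\<sigma>\<in>?P. \<Sum>i<n. A i * (of_int (sign \<sigma>) * (of_nat (\<sigma> i) * (\<Prod>i<n. z i ^ \<sigma> i)))) = 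
       (\<Sum>i<n. A i * (\<Sum>\<sigma>\<in>?P. of_int (sign \<sigma>) * (of_nat (\<sigma> i) * (\<Prod>i<n. z i ^ \<sigma> i))))"
      by (subst sum.swap) (simp add: sum_distrib_left)
    also have "\<dots> = vdm n z * (\<Sum>i<n. A i * \<beta> i)"
      by (simp add: S1 sum_distrib_left mult_ac)
    finally show ?thesis by (simp add: sum_subtractf S0 flip: sum_distrib_left)
  qed
  also have "vdm n z * (\<Sum>i<n. A i * \<beta> i) = vdm n z * (of_nat N * c + (\<Sum>i<n. \<rho> i * \<beta> i))"
    using beta by (simp add: A_def sum.distrib algebra_simps flip: sum_distrib_left)
  \<comment> \<open>The terms for (i, k) and (k, i) have opposite denominators and combine to one
    difference quotient.\<close>
  also have "(\<Sum>i<n. \<rho> i * \<beta> i) = - (\<Sum>j<n. \<Sum>i<j. pair_trace z \<rho> i j)"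
  proof -
    have "(\<Sum>i<n. \<rho> i * \<beta> i) = (\<Sum>i<n. \<Sum>k\<in>{..<n} - {i}. \<rho> i * (z i / (z i - z k)))"
      by (simp add: \<beta>_def sum_distrib_left)
    also have "\<dots> = (\<Sum>j<n. \<Sum>i<j. \<rho> i * (z i / (z i - z j)) + \<rho> j * (z j / (z j - z i)))"
      by (rule sum_off_diagonal)
    also have "\<dots> = (\<Sum>j<n. \<Sum>i<j. - pair_trace z \<rho> i j)"
    proof (intro sum.cong refl)
      fix i j assume "j \<in> {..<n}" "i \<in> {..<j}"
      hence "z i \<noteq> z j" using inj by (auto dest: inj_onD)
      thus "\<rho> i * (z i / (z i - z j)) + \<rho> j * (z j / (z j - z i)) = - pair_trace z \<rho> i j"
        by (simp add: pair_trace_def divide_simps) (simp add: algebra_simps)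
    qed
    finally show ?thesis by (simp add: sum_negf)
  qed
  also have "esym2 n A = esym2 n \<rho> + of_nat N * (of_nat n - 1) * (\<Sum>i<n. \<rho> i) + of_nat N ^ 2 * c"
  proof -
    have "esym2 n (\<lambda>_. of_nat N) = of_nat N ^ 2 * c"
      by (simp add: esym2_def c_def sum_distrib_left power2_eq_square mult_ac)
    moreover have "(\<Sum>i<n. \<rho> i * ((\<Sum>k<n. of_nat N) - of_nat N)) = of_nat N * (of_nat n - 1) * (\<Sum>i<n. \<rho> i)"
    proof -
      have "(\<Sum>k<n. of_nat N) - of_nat N = (of_nat N * (of_nat n - 1) :: complex)"
        by (simp add: algebra_simps)
      thus ?thesis by (simp only: sum_distrib_left mult.commute[of "\<rho> _"])
    qed
    ultimately show ?thesis
      using esym2_add[of n \<rho> "\<lambda>_. of_nat N"] by (simp add: A_def add.commute)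
  qed
  also have "(\<Sum>i<n. A i) = of_nat n * of_nat N + (\<Sum>i<n. \<rho> i)"
    by (simp add: A_def sum.distrib)
  finally have *: "(\<Sum>l\<in>{..<n} \<rightarrow>\<^sub>E {..N+n}. alt_coeff n N f l * (esym2 n (\<lambda>i. of_nat (l i)) * (\<Prod>i<n. z i ^ l i))) =
     P * ((esym2 n \<rho> + of_nat N * (of_nat n - 1) * (\<Sum>i<n. \<rho> i) + of_nat N ^ 2 * c + esym2 n of_nat + c * (of_nat n * of_nat N + (\<Sum>i<n. \<rho> i))) * vdm n z -
      vdm n z * (of_nat N * c + - (\<Sum>j<n. \<Sum>i<j. pair_trace z \<rho> i j)))" .
  show "(\<Sum>l\<in>{..<n} \<rightarrow>\<^sub>E {..N+n}. alt_coeff n N f l * (esym2 n (\<lambda>i. of_nat (l i)) * (\<Prod>i<n. z i ^ l i))) =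
           vdm n z * (P * (esym2 n \<rho> + (\<Sum>j<n. \<Sum>i<j. pair_trace z \<rho> i j) +
             (of_nat N * (of_nat n - 1) + c) * (\<Sum>i<n. \<rho> i) +
             (esym2 n of_nat + of_nat N ^ 2 * c + of_nat n * of_nat N * c - of_nat N * c)))"
    unfolding * by (simp only: distrib_left distrib_right mult_ac add_ac right_diff_distrib left_diff_distrib) simp
qed

text \<open>The staircase plus a rectangle of n - q rows of length N, written increasingly: the
  exponents of the one alternant that survives the average. As a set it is {..<N + n} without the
  block {q..<q + N}.\<close>

definition rect_exps :: "nat \<Rightarrow> nat \<Rightarrow> nat \<Rightarrow> nat" where
  "rect_exps N q i = (if i < q then i else i + N)"

lemma inj_rect_exps: "inj_on (rect_exps N q) A"
  by (auto simp: inj_on_def rect_exps_def split: if_splits)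

lemma sum_of_nat_lessThan: "(\<Sum>i<n. of_nat i) = (of_nat n * (of_nat n - 1) / 2 :: complex)"
  by (induction n) (auto simp: field_simps)

text \<open>The right sides have the shape in which the constants come out of
  \<open>alt_coeff_poly_sums\<close> once the averages are inserted: - N q for the sum of the traces
  and N (N + 1) q (q - 1) / 2 for the second-order expression.\<close>

lemma rect_exps_sums:
  assumes "q \<le> n"
  defines "c \<equiv> (\<Sum>i<n. of_nat i :: complex)"
  shows "(\<Sum>i<n. of_nat (rect_exps N q i)) = c + of_nat n * of_nat N - of_nat N * of_nat q"
    and "esym2 n (\<lambda>i. of_nat (rect_exps N q i)) =
      of_nat N * (of_nat N + 1) * (of_nat q * (of_nat q - 1) / 2) - (of_nat N * (of_nat n - 1) + c) * (of_nat N * of_nat q) +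
        (esym2 n of_nat + of_nat N ^ 2 * c + of_nat n * of_nat N * c - of_nat N * c)"
proof -
  obtain d where d: "n = q + d" using assms by (auto simp: le_iff_add)
  define b where "b = (\<lambda>i. if i < q then 0 else of_nat N :: complex)"
  have L: "of_nat (rect_exps N q i) = of_nat i + b i" for i
    by (simp add: rect_exps_def b_def)
  have sum_b: "(\<Sum>i<q+e. b i * h i) = of_nat N * ((\<Sum>i<q+e. h i) - (\<Sum>i<q. h i))" for h e
    by (induction e) (simp_all add: b_def algebra_simps)
  have e2_b: "esym2 (q + e) b = of_nat N ^ 2 * (of_nat e * (of_nat e - 1) / 2)" for e
  proof (induction e)
    case 0
    show ?case by (simp add: esym2_def b_def)
  next
    case (Suc e)
    have "esym2 (q + Suc e) b = esym2 (q + e) b + (\<Sum>i<q+e. b i * 1) * of_nat N"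
      by (simp add: esym2_def b_def sum_distrib_right)
    also have "(\<Sum>i<q+e. b i * 1) = of_nat N * of_nat e"
      using sum_b[where e = e and h = "\<lambda>_. 1"] by simp
    finally show ?case unfolding Suc of_nat_Suc by (simp add: power2_eq_square field_simps)
  qed
  have sb: "(\<Sum>i<q+d. b i) = of_nat N * of_nat d"
    using sum_b[where e = d and h = "\<lambda>_. 1"] by simp
  show "(\<Sum>i<n. of_nat (rect_exps N q i)) = c + of_nat n * of_nat N - of_nat N * of_nat q"
    unfolding L sum.distrib c_def d sb by (simp add: algebra_simps)
  have "(\<Sum>i<n. b i * ((\<Sum>k<n. of_nat k) - of_nat i)) =
     of_nat N * (of_nat d * c - (c - of_nat q * (of_nat q - 1) / 2))"
  proof -
    have E1: "(\<Sum>i<q+d. c - of_nat i) = of_nat (q + d) * c - c"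
      by (simp add: sum_subtractf c_def d)
    have E2: "(\<Sum>i<q. c - of_nat i) = of_nat q * c - of_nat q * (of_nat q - 1) / 2"
      by (simp only: sum_subtractf sum_of_nat_lessThan) simp
    show ?thesis
      unfolding c_def[symmetric] unfolding d sum_b E1 E2 by (simp add: field_simps)
  qed
  hence eq: "esym2 n (\<lambda>i. of_nat (rect_exps N q i)) = of_nat N ^ 2 * (of_nat d * (of_nat d - 1) / 2) + esym2 n of_nat +
     of_nat N * (of_nat d * c - (c - of_nat q * (of_nat q - 1) / 2))"
    unfolding L using esym2_add[of n b of_nat] e2_b by (simp add: d add.commute)
  show "esym2 n (\<lambda>i. of_nat (rect_exps N q i)) =
      of_nat N * (of_nat N + 1) * (of_nat q * (of_nat q - 1) / 2) - (of_nat N * (of_nat n - 1) + c) * (of_nat N * of_nat q) +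
        (esym2 n of_nat + of_nat N ^ 2 * c + of_nat n * of_nat N * c - of_nat N * c)"
    unfolding eq c_def sum_of_nat_lessThan unfolding d by (simp add: field_simps power2_eq_square)
qed

text \<open>The quadratic \<open>(m - q) * (m - q - N + 1)\<close> is nonpositive on the block \<open>{q..<q + N}\<close>
  and positive off it, so the complement of the block is determined by its first two power sums
  among the sets of the same size.\<close>

lemma rect_exps_extremal:
  fixes l :: "nat \<Rightarrow> nat"
  assumes q: "q \<le> n" and N: "N \<ge> 1" and inj: "inj_on l {..<n}" and bound: "\<And>i. i < n \<Longrightarrow> l i < N + n"
    and s1: "(\<Sum>i<n. int (l i)) = (\<Sum>i<n. int (rect_exps N q i))"
    and s2: "(\<Sum>i<n. (int (l i))\<^sup>2) = (\<Sum>i<n. (int (rect_exps N q i))\<^sup>2)"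
  shows "l ` {..<n} = rect_exps N q ` {..<n}"
proof -
  define h where "h = (\<lambda>m. (int m - int q) * (int m - int q - int N + 1))"
  have h: "h m = (int m)\<^sup>2 - (2 * int q + int N - 1) * int m + int q * (int q + int N - 1)" for m
    by (simp add: h_def algebra_simps power2_eq_square)
  define A B where "A = l ` {..<n}" and "B = rect_exps N q ` {..<n}"
  have fin: "finite A" "finite B" by (auto simp: A_def B_def)
  have "(\<Sum>i<n. h (l i)) = (\<Sum>i<n. h (rect_exps N q i))"
    unfolding h sum.distrib sum_subtractf sum_distrib_left[symmetric] s1 s2 ..
  hence "(\<Sum>m\<in>A. h m) = (\<Sum>m\<in>B. h m)"
    by (simp add: A_def B_def sum.reindex[OF inj] sum.reindex[OF inj_rect_exps])
  moreover have "(\<Sum>m\<in>A. h m) = (\<Sum>m\<in>A \<inter> B. h m) + (\<Sum>m\<in>A - B. h m)"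
    using fin by (subst sum.union_disjoint[symmetric]) (auto intro!: sum.cong)
  moreover have "(\<Sum>m\<in>B. h m) = (\<Sum>m\<in>A \<inter> B. h m) + (\<Sum>m\<in>B - A. h m)"
    using fin by (subst sum.union_disjoint[symmetric]) (auto intro!: sum.cong)
  ultimately have eq: "(\<Sum>m\<in>A - B. h m) = (\<Sum>m\<in>B - A. h m)" by linarith
  have pos: "h m > 0" if "m \<in> B" for m
  proof -
    from that obtain i where i: "i < n" "m = rect_exps N q i" by (auto simp: B_def)
    show ?thesis
    proof (cases "i < q")
      case True
      thus ?thesis using i N unfolding h_def rect_exps_def by (intro mult_neg_neg) auto
    next
      case False
      thus ?thesis using i N unfolding h_def rect_exps_def by (intro mult_pos_pos) auto
    qed
  qed
  \<comment> \<open>The set \<open>B\<close> fills {..<N + n} except for the block, so a number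
    below N + n outside \<open>B\<close> lies in the block. This is where the bound on
    \<open>l\<close> enters.\<close>
  have neg: "h m \<le> 0" if "m \<in> A - B" for m
  proof -
    have m: "m < N + n" "m \<notin> B" using that bound by (auto simp: A_def)
    have "q \<le> m"
    proof (rule ccontr)
      assume "\<not> q \<le> m"
      hence "m = rect_exps N q m" "m < n" using q by (auto simp: rect_exps_def)
      thus False using m(2) by (auto simp: B_def)
    qed
    moreover have "m < q + N"
    proof (rule ccontr)
      assume "\<not> m < q + N"
      hence "m = rect_exps N q (m - N)" "m - N < n" using m(1) q by (auto simp: rect_exps_def)
      thus False using m(2) by (auto simp: B_def)
    qed
    ultimately show ?thesis unfolding h_def by (intro mult_nonneg_nonpos) auto
  qed
  have "(\<Sum>m\<in>B - A. h m) \<le> 0" unfolding eq[symmetric] by (rule sum_nonpos) (rule neg)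
  moreover have "(\<Sum>m\<in>B - A. h m) > 0" if "B - A \<noteq> {}"
    by (rule sum_pos) (use fin that pos in auto)
  ultimately have "B \<subseteq> A" by force
  moreover have "card A = card B"
    by (simp add: A_def B_def card_image[OF inj] card_image[OF inj_rect_exps])
  ultimately show ?thesis
    using card_subset_eq[OF fin(1), of B] by (simp add: A_def B_def)
qed

text \<open>The index sets reach up to N + n, but a permutation contributes at most n - 1 and
  \<open>m\<close> at most N. The extremality argument depends on this strict bound.\<close>

lemma alt_coeff_eq_0_large:
  assumes "i < n" "l i \<ge> N + n"
  shows "alt_coeff n N f l = 0"
proof -
  have "shift_sum n \<sigma> m \<noteq> l" if "\<sigma> permutes {..<n}" "m \<in> {..<n} \<rightarrow>\<^sub>E {..N}" for \<sigma> m
  proof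
    assume "shift_sum n \<sigma> m = l"
    hence "l i = \<sigma> i + m i" using assms(1) by (auto simp: shift_sum_def)
    moreover have "\<sigma> i < n" using permutes_in_image[OF that(1), of i] assms(1) by simp
    moreover have "m i \<le> N" using PiE_mem[OF that(2), of i] assms(1) by simp
    ultimately show False using assms(2) by linarith
  qed
  hence "{(\<sigma>, m). \<sigma> permutes {..<n} \<and> m \<in> {..<n} \<rightarrow>\<^sub>E {..N} \<and> shift_sum n \<sigma> m = l} = {}"
    by blast
  thus ?thesis unfolding alt_coeff_def by (simp only: sum.empty)
qed

text \<open>If the two Euler operators act by the scalars belonging to \<open>rect_exps\<close>,
  comparison of coefficients shows that every exponent vector in the support has the same first two
  power sums. Its entries are distinct, because a transposition of two equal entries would fix the
  vector and change the sign of its coefficient.\<close>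

lemma alt_coeff_support_of_sums:
  fixes f :: "(nat \<Rightarrow> nat) \<Rightarrow> complex" and A :: "nat \<Rightarrow> complex set" and n N q :: nat
  defines "c \<equiv> (\<Sum>i<n. of_nat i :: complex)"
  assumes q: "q \<le> n" and N: "N \<ge> 1"
    and sym: "\<And>\<tau> m. \<tau> permutes {..<n} \<Longrightarrow> m \<in> {..<n} \<rightarrow>\<^sub>E {..N} \<Longrightarrow> f (\<lambda>i\<in>{..<n}. m (\<tau> i)) = f m"
    and inf: "\<And>i. i < n \<Longrightarrow> infinite (A i)"
    and e1: "\<And>z. (\<And>i. i < n \<Longrightarrow> z i \<in> A i) \<Longrightarrow>
      (\<Sum>l\<in>{..<n} \<rightarrow>\<^sub>E {..N+n}. alt_coeff n N f l * ((\<Sum>i<n. of_nat (l i)) * (\<Prod>i<n. z i ^ l i))) =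
      (c + of_nat n * of_nat N - of_nat N * of_nat q) *
      (\<Sum>l\<in>{..<n} \<rightarrow>\<^sub>E {..N+n}. alt_coeff n N f l * (\<Prod>i<n. z i ^ l i))"
    and e2: "\<And>z. (\<And>i. i < n \<Longrightarrow> z i \<in> A i) \<Longrightarrow>
      (\<Sum>l\<in>{..<n} \<rightarrow>\<^sub>E {..N+n}. alt_coeff n N f l * (esym2 n (\<lambda>i. of_nat (l i)) * (\<Prod>i<n. z i ^ l i))) =
      (of_nat N * (of_nat N + 1) * (of_nat q * (of_nat q - 1) / 2) - (of_nat N * (of_nat n - 1) + c) * (of_nat N * of_nat q) +
        (esym2 n of_nat + of_nat N ^ 2 * c + of_nat n * of_nat N * c - of_nat N * c)) *
      (\<Sum>l\<in>{..<n} \<rightarrow>\<^sub>E {..N+n}. alt_coeff n N f l * (\<Prod>i<n. z i ^ l i))"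
    and l: "l \<in> {..<n} \<rightarrow>\<^sub>E {..N+n}" "alt_coeff n N f l \<noteq> 0"
  shows "inj_on l {..<n} \<and> l ` {..<n} = rect_exps N q ` {..<n}"
proof -
  define g where "g = alt_coeff n N f"
  define L where "L = rect_exps N q"
  let ?S = "{..<n} \<rightarrow>\<^sub>E {..N+n}"
  have fin: "finite ?S" by (intro finite_PiE) auto
  have s1: "(\<Sum>i<n. of_nat (l i)) = (\<Sum>i<n. of_nat (L i) :: complex)" if l: "l \<in> ?S" "g l \<noteq> 0" for l
  proof -
    have "g l * ((\<Sum>i<n. of_nat (l i)) - (\<Sum>i<n. of_nat (L i))) = 0"
    proof (rule multivariate_poly_zero[OF inf _ l(1), where c = "\<lambda>l. g l * ((\<Sum>i<n. of_nat (l i)) - (\<Sum>i<n. of_nat (L i)))"])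
      fix z :: "nat \<Rightarrow> complex" assume z: "\<And>i. i < n \<Longrightarrow> z i \<in> A i"
      define K where "K = (\<Sum>i<n. of_nat (L i) :: complex)"
      have "(\<Sum>l\<in>?S. g l * ((\<Sum>i<n. of_nat (l i)) * (\<Prod>i<n. z i ^ l i))) = K * (\<Sum>l\<in>?S. g l * (\<Prod>i<n. z i ^ l i))"
        using e1[OF z] unfolding K_def L_def rect_exps_sums(1)[OF q] c_def[symmetric] g_def .
      thus "(\<Sum>l\<in>?S. g l * ((\<Sum>i<n. of_nat (l i)) - (\<Sum>i<n. of_nat (L i))) * (\<Prod>i<n. z i ^ l i)) = 0"
        unfolding K_def[symmetric]
        by (simp only: left_diff_distrib right_diff_distrib sum_subtractf mult.assoc mult.left_commute[of _ K] sum_distrib_left[of K] diff_self)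
    qed
    thus ?thesis using l(2) by simp
  qed
  have s2: "esym2 n (\<lambda>i. of_nat (l i)) = esym2 n (\<lambda>i. of_nat (L i) :: complex)" if l: "l \<in> ?S" "g l \<noteq> 0" for l
  proof -
    have "g l * (esym2 n (\<lambda>i. of_nat (l i)) - esym2 n (\<lambda>i. of_nat (L i))) = 0"
    proof (rule multivariate_poly_zero[OF inf _ l(1), where c = "\<lambda>l. g l * (esym2 n (\<lambda>i. of_nat (l i)) - esym2 n (\<lambda>i. of_nat (L i)))"])
      fix z :: "nat \<Rightarrow> complex" assume z: "\<And>i. i < n \<Longrightarrow> z i \<in> A i"
      define K where "K = esym2 n (\<lambda>i. of_nat (L i) :: complex)"
      have "(\<Sum>l\<in>?S. g l * (esym2 n (\<lambda>i. of_nat (l i)) * (\<Prod>i<n. z i ^ l i))) = K * (\<Sum>l\<in>?S. g l * (\<Prod>i<n. z i ^ l i))"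
        using e2[OF z] unfolding K_def L_def rect_exps_sums(2)[OF q] c_def[symmetric] g_def .
      thus "(\<Sum>l\<in>?S. g l * (esym2 n (\<lambda>i. of_nat (l i)) - esym2 n (\<lambda>i. of_nat (L i))) * (\<Prod>i<n. z i ^ l i)) = 0"
        unfolding K_def[symmetric]
        by (simp only: left_diff_distrib right_diff_distrib sum_subtractf mult.assoc mult.left_commute[of _ K] sum_distrib_left[of K] diff_self)
    qed
    thus ?thesis using l(2) by simp
  qed
  have l: "l \<in> ?S" "g l \<noteq> 0" using l by (auto simp: g_def)
  have ext: "l \<in> extensional {..<n}" using l by (auto simp: PiE_def)
  have inj: "inj_on l {..<n}"
  proof (rule inj_onI, rule ccontr)
    fix a b assume ab: "a \<in> {..<n}" "b \<in> {..<n}" "l a = l b" "a \<noteq> b"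
    define \<tau> where "\<tau> = Transposition.transpose a b"
    have \<tau>: "\<tau> permutes {..<n}" unfolding \<tau>_def using ab by (intro permutes_swap_id) auto
    have "(\<lambda>i\<in>{..<n}. l (\<tau> i)) = l"
      by (rule extensionalityI[of _ "{..<n}"]) (use ext ab in \<open>auto simp: \<tau>_def Transposition.transpose_def\<close>)
    moreover have "sign \<tau> = -1" using ab by (simp add: \<tau>_def sign_swap_id)
    ultimately have "g l = - g l"
      using alt_coeff_permute[where f = f and N = N, OF \<tau> sym[OF \<tau>] ext] by (simp add: g_def)
    thus False using l(2) by simp
  qed
  have lt: "l i < N + n" if "i < n" for i
    using alt_coeff_eq_0_large[of i n N l f] l(2) that unfolding g_def by (meson not_le)
  have "of_int (\<Sum>i<n. int (l i)) = (of_int (\<Sum>i<n. int (L i)) :: complex)"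
    using s1[OF l] by simp
  hence S1: "(\<Sum>i<n. int (l i)) = (\<Sum>i<n. int (L i))" by (simp only: of_int_eq_iff)
  have sq: "(\<Sum>i<n. (h i)\<^sup>2) = (\<Sum>i<n. h i)\<^sup>2 - 2 * esym2 n h" for h :: "nat \<Rightarrow> complex"
    by (simp add: two_esym2)
  have "(\<Sum>i<n. (of_nat (l i))\<^sup>2) = (\<Sum>i<n. (of_nat (L i))\<^sup>2 :: complex)"
    unfolding sq s1[OF l] s2[OF l] ..
  hence "of_int (\<Sum>i<n. (int (l i))\<^sup>2) = (of_int (\<Sum>i<n. (int (L i))\<^sup>2) :: complex)" by simp
  hence S2: "(\<Sum>i<n. (int (l i))\<^sup>2) = (\<Sum>i<n. (int (L i))\<^sup>2)" by (simp only: of_int_eq_iff)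
  have im: "l ` {..<n} = L ` {..<n}"
    unfolding L_def by (rule rect_exps_extremal[OF q N inj lt]) (use S1 S2 in \<open>auto simp: L_def\<close>)
  show ?thesis using inj im by (simp add: L_def)
qed

text \<open>All exponent vectors in the support are rearrangements of one vector, and by
  antisymmetry their coefficients agree up to the sign of the rearrangement.\<close>

lemma alternating_eq_rect_alternant:
  fixes f :: "(nat \<Rightarrow> nat) \<Rightarrow> complex" and n N q :: nat
  assumes sym: "\<And>\<tau> m. \<tau> permutes {..<n} \<Longrightarrow> m \<in> {..<n} \<rightarrow>\<^sub>E {..N} \<Longrightarrow> f (\<lambda>i\<in>{..<n}. m (\<tau> i)) = f m"
    and supp: "\<And>l. l \<in> {..<n} \<rightarrow>\<^sub>E {..N+n} \<Longrightarrow> alt_coeff n N f l \<noteq> 0 \<Longrightarrow>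
      inj_on l {..<n} \<and> l ` {..<n} = rect_exps N q ` {..<n}"
  shows "(\<Sum>l\<in>{..<n} \<rightarrow>\<^sub>E {..N+n}. alt_coeff n N f l * (\<Prod>i<n. z i ^ l i)) =
     alt_coeff n N f (\<lambda>i\<in>{..<n}. rect_exps N q i) *
     (\<Sum>\<tau> | \<tau> permutes {..<n}. of_int (sign \<tau>) * (\<Prod>i<n. z i ^ rect_exps N q (\<tau> i)))"
proof -
  define g where "g = alt_coeff n N f"
  define L where "L = rect_exps N q"
  let ?S = "{..<n} \<rightarrow>\<^sub>E {..N+n}"
  have fin: "finite ?S" by (intro finite_PiE) auto
  have ex: "\<exists>\<tau>. \<tau> permutes {..<n} \<and> l = (\<lambda>i\<in>{..<n}. L (\<tau> i))" if l: "l \<in> ?S" "g l \<noteq> 0" for l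
  proof -
    have ext: "l \<in> extensional {..<n}" using l by (auto simp: PiE_def)
    have inj: "inj_on l {..<n}" and im: "l ` {..<n} = L ` {..<n}"
      using supp[of l] l by (auto simp: g_def L_def)
    define \<tau> where "\<tau> = (\<lambda>i. if i < n then inv_into {..<n} L (l i) else i)"
    have bl: "bij_betw l {..<n} (L ` {..<n})" using inj im by (simp add: bij_betw_def)
    have bL: "bij_betw (inv_into {..<n} L) (L ` {..<n}) {..<n}"
      by (rule bij_betw_inv_into) (simp add: bij_betw_def L_def inj_rect_exps)
    have "bij_betw \<tau> {..<n} {..<n}"
      using bij_betw_trans[OF bl bL] by (rule bij_betw_cong[THEN iffD1, rotated]) (simp add: \<tau>_def)
    hence \<tau>: "\<tau> permutes {..<n}" by (rule bij_imp_permutes) (simp add: \<tau>_def)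
    have "L (\<tau> i) = l i" if "i < n" for i
    proof -
      have "l i \<in> L ` {..<n}" using im that by auto
      thus ?thesis using that by (simp add: \<tau>_def f_inv_into_f)
    qed
    hence "l = (\<lambda>i\<in>{..<n}. L (\<tau> i))"
      by (intro extensionalityI[of _ "{..<n}"]) (use ext in auto)
    thus ?thesis using \<tau> by blast
  qed
  define \<Phi> where "\<Phi> = (\<lambda>\<tau>. \<lambda>i\<in>{..<n}. L (\<tau> i))"
  let ?P = "{\<tau>. \<tau> permutes {..<n}}"
  have injP: "inj_on \<Phi> ?P"
  proof (rule inj_onI)
    fix \<tau> \<tau>' assume *: "\<tau> \<in> ?P" "\<tau>' \<in> ?P" "\<Phi> \<tau> = \<Phi> \<tau>'"
    show "\<tau> = \<tau>'"
    proof
      fix i show "\<tau> i = \<tau>' i"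
      proof (cases "i < n")
        case True
        hence "L (\<tau> i) = L (\<tau>' i)" using fun_cong[OF *(3), of i] by (simp add: \<Phi>_def)
        thus ?thesis using inj_rect_exps[of N q UNIV] by (auto simp: L_def dest: injD)
      next
        case False
        thus ?thesis using *(1,2) by (simp add: permutes_not_in)
      qed
    qed
  qed
  have im: "\<Phi> ` ?P \<subseteq> ?S"
  proof (rule image_subsetI)
    fix \<tau> assume "\<tau> \<in> ?P"
    hence "\<tau> i < n" if "i < n" for i using permutes_in_image[of \<tau> "{..<n}" i] that by auto
    thus "\<Phi> \<tau> \<in> ?S" by (force simp: \<Phi>_def L_def rect_exps_def)
  qed
  have "(\<Sum>l\<in>?S. g l * (\<Prod>i<n. z i ^ l i)) = (\<Sum>l\<in>\<Phi> ` ?P. g l * (\<Prod>i<n. z i ^ l i))"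
  proof (rule sum.mono_neutral_right[OF fin im], rule ballI)
    fix l assume "l \<in> ?S - \<Phi> ` ?P"
    hence "g l = 0" using ex[of l] by (auto simp: \<Phi>_def)
    thus "g l * (\<Prod>i<n. z i ^ l i) = 0" by simp
  qed
  also have "\<dots> = (\<Sum>\<tau>\<in>?P. g (\<Phi> \<tau>) * (\<Prod>i<n. z i ^ L (\<tau> i)))"
    by (subst sum.reindex[OF injP]) (simp add: \<Phi>_def)
  also have "\<dots> = (\<Sum>\<tau>\<in>?P. g (\<lambda>i\<in>{..<n}. L i) * (of_int (sign \<tau>) * (\<Prod>i<n. z i ^ L (\<tau> i))))"
  proof (rule sum.cong[OF refl])
    fix \<tau> assume "\<tau> \<in> ?P"
    hence \<tau>: "\<tau> permutes {..<n}" by simp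
    have "\<Phi> \<tau> = (\<lambda>i\<in>{..<n}. (\<lambda>i\<in>{..<n}. L i) (\<tau> i))"
      using permutes_in_image[OF \<tau>] by (auto simp: \<Phi>_def fun_eq_iff restrict_def)
    hence "g (\<Phi> \<tau>) = of_int (sign \<tau>) * g (\<lambda>i\<in>{..<n}. L i)"
      unfolding g_def using alt_coeff_permute[where f = f and N = N, OF \<tau> sym[OF \<tau>], of "\<lambda>i\<in>{..<n}. L i"] by simp
    thus "g (\<Phi> \<tau>) * (\<Prod>i<n. z i ^ L (\<tau> i)) = g (\<lambda>i\<in>{..<n}. L i) * (of_int (sign \<tau>) * (\<Prod>i<n. z i ^ L (\<tau> i)))"
      by simp
  qed
  finally show ?thesis by (simp add: g_def L_def sum_distrib_left)
qed

lemma alt_coeff_generating_function: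
  "(\<Sum>l\<in>{..<n} \<rightarrow>\<^sub>E {..N+n}. alt_coeff n N f l * (\<Prod>i<n. z i ^ l i)) =
     vdm n z * (\<Sum>m\<in>{..<n} \<rightarrow>\<^sub>E {..N}. f m * (\<Prod>i<n. z i ^ m i))"
proof -
  have "(\<Sum>l\<in>{..<n} \<rightarrow>\<^sub>E {..N+n}. alt_coeff n N f l * (\<Prod>i<n. z i ^ l i)) =
     (\<Sum>\<sigma> | \<sigma> permutes {..<n}. \<Sum>m\<in>{..<n} \<rightarrow>\<^sub>E {..N}.
        (of_int (sign \<sigma>) * (\<Prod>i<n. z i ^ \<sigma> i)) * (f m * (\<Prod>i<n. z i ^ m i)))"
    unfolding alt_coeff_sum[where W = "\<lambda>l. \<Prod>i<n. z i ^ l i", symmetric]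
    by (simp add: shift_sum_def power_add prod.distrib mult_ac)
  also have "\<dots> = vdm n z * (\<Sum>m\<in>{..<n} \<rightarrow>\<^sub>E {..N}. f m * (\<Prod>i<n. z i ^ m i))"
    unfolding sum_product[symmetric] vandermonde_sum ..
  finally show ?thesis .
qed

text \<open>Test points. The residue modulo n keeps the coordinates distinct, so that the
  Vandermonde product does not vanish; the offset 2 keeps the points away from the unit circle,
  where the characteristic polynomials have their roots.\<close>

definition grid :: "nat \<Rightarrow> nat \<Rightarrow> complex set" where
  "grid n i = range (\<lambda>j. of_nat (2 + i + n * j))"

lemma infinite_grid: "i < n \<Longrightarrow> infinite (grid n i)"
  unfolding grid_def by (intro range_inj_infinite injI) auto

lemma norm_grid: "z \<in> grid n i \<Longrightarrow> norm z \<ge> 2"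
proof -
  assume "z \<in> grid n i"
  then obtain j where "z = of_nat (2 + i + n * j)" by (auto simp: grid_def)
  hence "norm z = real (2 + i + n * j)" by (simp only: norm_of_nat)
  thus ?thesis by simp
qed

lemma inj_on_grid:
  assumes "\<And>i. i < n \<Longrightarrow> z i \<in> grid n i"
  shows "inj_on z {..<n}"
proof (rule inj_onI)
  fix a b assume ab: "a \<in> {..<n}" "b \<in> {..<n}" "z a = z b"
  obtain j j' where "z a = of_nat (2 + a + n * j)" "z b = of_nat (2 + b + n * j')"
    using assms[of a] assms[of b] ab by (auto simp: grid_def)
  hence "a + n * j = b + n * j'" using ab(3) by (simp only: of_nat_eq_iff)
  hence "(a + n * j) mod n = (b + n * j') mod n" by simp
  thus "a = b" using ab by simp
qed

text \<open>Both generating functions, times the Vandermonde product, are multiples c and c' of the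
  same alternant, hence c' f = c f'. The factor c is not zero, as otherwise f would vanish at
  \<open>m0\<close>; comparison at \<open>m0\<close> then gives c' = c.\<close>

theorem coefficients_unique_of_support:
  fixes f f' :: "(nat \<Rightarrow> nat) \<Rightarrow> complex" and n N q :: nat
  assumes sym: "\<And>\<tau> m. \<tau> permutes {..<n} \<Longrightarrow> m \<in> {..<n} \<rightarrow>\<^sub>E {..N} \<Longrightarrow> f (\<lambda>i\<in>{..<n}. m (\<tau> i)) = f m"
    and supp: "\<And>l. l \<in> {..<n} \<rightarrow>\<^sub>E {..N+n} \<Longrightarrow> alt_coeff n N f l \<noteq> 0 \<Longrightarrow>
      inj_on l {..<n} \<and> l ` {..<n} = rect_exps N q ` {..<n}"
    and sym': "\<And>\<tau> m. \<tau> permutes {..<n} \<Longrightarrow> m \<in> {..<n} \<rightarrow>\<^sub>E {..N} \<Longrightarrow> f' (\<lambda>i\<in>{..<n}. m (\<tau> i)) = f' m"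
    and supp': "\<And>l. l \<in> {..<n} \<rightarrow>\<^sub>E {..N+n} \<Longrightarrow> alt_coeff n N f' l \<noteq> 0 \<Longrightarrow>
      inj_on l {..<n} \<and> l ` {..<n} = rect_exps N q ` {..<n}"
    and m0: "m0 \<in> {..<n} \<rightarrow>\<^sub>E {..N}" "f m0 = f' m0" "f m0 \<noteq> 0"
    and m: "m \<in> {..<n} \<rightarrow>\<^sub>E {..N}"
  shows "f m = f' m"
proof -
  define c where "c = alt_coeff n N f (\<lambda>i\<in>{..<n}. rect_exps N q i)"
  define c' where "c' = alt_coeff n N f' (\<lambda>i\<in>{..<n}. rect_exps N q i)"
  define a where "a = (\<lambda>z::nat \<Rightarrow> complex. \<Sum>\<tau> | \<tau> permutes {..<n}. of_int (sign \<tau>) * (\<Prod>i<n. z i ^ rect_exps N q (\<tau> i)))"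
  have F: "vdm n z * (\<Sum>m\<in>{..<n} \<rightarrow>\<^sub>E {..N}. f m * (\<Prod>i<n. z i ^ m i)) = c * a z" for z
    unfolding alt_coeff_generating_function[symmetric] c_def a_def
    by (rule alternating_eq_rect_alternant[OF sym supp])
  have F': "vdm n z * (\<Sum>m\<in>{..<n} \<rightarrow>\<^sub>E {..N}. f' m * (\<Prod>i<n. z i ^ m i)) = c' * a z" for z
    unfolding alt_coeff_generating_function[symmetric] c'_def a_def
    by (rule alternating_eq_rect_alternant[OF sym' supp'])
  have proportional: "c' * f m = c * f' m" if m: "m \<in> {..<n} \<rightarrow>\<^sub>E {..N}" for m
  proof -
    have "c' * f m - c * f' m = 0"
    proof (rule multivariate_poly_zero[OF infinite_grid _ m, where c = "\<lambda>m. c' * f m - c * f' m"])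
      fix z assume z: "\<And>i. i < n \<Longrightarrow> z i \<in> grid n i"
      have "vdm n z \<noteq> 0" by (rule vdm_neq_0[OF inj_on_grid]) (rule z)
      moreover have "vdm n z * (\<Sum>m\<in>{..<n} \<rightarrow>\<^sub>E {..N}. (c' * f m - c * f' m) * (\<Prod>i<n. z i ^ m i)) =
          c' * (vdm n z * (\<Sum>m\<in>{..<n} \<rightarrow>\<^sub>E {..N}. f m * (\<Prod>i<n. z i ^ m i))) -
          c * (vdm n z * (\<Sum>m\<in>{..<n} \<rightarrow>\<^sub>E {..N}. f' m * (\<Prod>i<n. z i ^ m i)))"
        by (simp add: left_diff_distrib right_diff_distrib sum_subtractf sum_distrib_left mult_ac)
      ultimately show "(\<Sum>m\<in>{..<n} \<rightarrow>\<^sub>E {..N}. (c' * f m - c * f' m) * (\<Prod>i<n. z i ^ m i)) = 0"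
        by (simp add: F F')
    qed auto
    thus ?thesis by simp
  qed
  have "c \<noteq> 0"
  proof
    assume c: "c = 0"
    have "f m0 = 0"
    proof (rule multivariate_poly_zero[OF infinite_grid _ m0(1), where c = f])
      fix z assume z: "\<And>i. i < n \<Longrightarrow> z i \<in> grid n i"
      have "vdm n z \<noteq> 0" by (rule vdm_neq_0[OF inj_on_grid]) (rule z)
      thus "(\<Sum>m\<in>{..<n} \<rightarrow>\<^sub>E {..N}. f m * (\<Prod>i<n. z i ^ m i)) = 0" using F[of z] c by simp
    qed auto
    thus False using m0 by simp
  qed
  moreover have "c' = c" using proportional[OF m0(1)] m0 by simp
  ultimately show ?thesis using proportional[OF m] by simp
qed

section \<open>The discrete Weyl integral\<close>

definition circle_pts :: "nat \<Rightarrow> complex set" where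
  "circle_pts M = {u. u ^ M = 2 ^ M}"

lemma finite_circle_pts [simp]: "M > 0 \<Longrightarrow> finite (circle_pts M)"
  unfolding circle_pts_def by (rule finite_nth_roots)

lemma card_circle_pts: "M > 0 \<Longrightarrow> card (circle_pts M) = M"
  unfolding circle_pts_def by (rule card_nth_roots) auto

lemma norm_circle_pts: "M > 0 \<Longrightarrow> u \<in> circle_pts M \<Longrightarrow> norm u = 2"
proof -
  assume M: "M > 0" and "u \<in> circle_pts M"
  hence "norm (u ^ M) = norm (2 ^ M :: complex)" by (simp only: circle_pts_def mem_Collect_eq)
  hence "norm u ^ M = 2 ^ M" by (simp add: norm_power)
  thus ?thesis using M power_eq_imp_eq_base[of "norm u" M 2] by simp
qed

lemma circle_pts_neq: "M > 0 \<Longrightarrow> u \<in> circle_pts M \<Longrightarrow> u \<noteq> 0 \<and> u \<noteq> 1"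
  using norm_circle_pts[of M u] by auto

lemma circle_sum_power:
  assumes "m < M" "s < M"
  shows "(\<Sum>u\<in>circle_pts M. u ^ m / u ^ s) / of_nat M = (if m = s then 1 else 0)"
proof -
  have M: "M > 0" using assms by simp
  show ?thesis
  proof (cases "m = s")
    case True
    have "(\<Sum>u\<in>circle_pts M. u ^ m / u ^ s) = (\<Sum>u\<in>circle_pts M. 1)"
      by (intro sum.cong refl) (use True circle_pts_neq[OF M] in auto)
    thus ?thesis using True M by (simp add: card_circle_pts)
  next
    case False
    define w where "w = cis (2 * pi / real M)"
    have wM: "w ^ M = 1" unfolding w_def Complex.DeMoivre using M by simp
    have w0: "w \<noteq> 0" by (simp add: w_def)
    have inj: "inj_on (\<lambda>k. w ^ k) {..<M}"
    proof -
      have "w ^ k = cis (2 * pi * real k / real M)" for k by (simp add: w_def Complex.DeMoivre mult_ac)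
      thus ?thesis using Complex.bij_betw_roots_unity[OF M] by (simp add: bij_betw_def)
    qed
    hence "w ^ m \<noteq> w ^ s" using assms False by (auto dest: inj_onD)
    \<comment> \<open>Multiplication by the primitive root \<open>w\<close> permutes the points and
      multiplies the sum by \<open>w ^ m / w ^ s\<close>, which differs from 1.\<close>
    have "(\<Sum>u\<in>circle_pts M. u ^ m / u ^ s) = (\<Sum>u\<in>circle_pts M. (w * u) ^ m / (w * u) ^ s)"
      by (rule sum.reindex_bij_witness[of _ "\<lambda>u. w * u" "\<lambda>u. u / w"])
         (use wM w0 in \<open>auto simp: circle_pts_def power_mult_distrib power_divide\<close>)
    also have "\<dots> = w ^ m / w ^ s * (\<Sum>u\<in>circle_pts M. u ^ m / u ^ s)"
      by (simp add: sum_distrib_left power_mult_distrib)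
    finally have "(\<Sum>u\<in>circle_pts M. u ^ m / u ^ s) * (1 - w ^ m / w ^ s) = 0"
      by (simp add: algebra_simps)
    moreover have "1 - w ^ m / w ^ s \<noteq> 0"
      using \<open>w ^ m \<noteq> w ^ s\<close> w0 by (simp add: field_simps)
    ultimately have "(\<Sum>u\<in>circle_pts M. u ^ m / u ^ s) = 0" by (simp only: mult_eq_0_iff) blast
    thus ?thesis using False by simp
  qed
qed

lemma circle_sum_poly:
  assumes "degree p < M" "s < M"
  shows "(\<Sum>u\<in>circle_pts M. poly p u / u ^ s) / of_nat M = coeff p s"
proof -
  have "(\<Sum>u\<in>circle_pts M. poly p u / u ^ s) = (\<Sum>u\<in>circle_pts M. \<Sum>m\<le>degree p. coeff p m * (u ^ m / u ^ s))"
    by (simp add: poly_altdef sum_divide_distrib)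
  also have "\<dots> = (\<Sum>m\<le>degree p. coeff p m * (\<Sum>u\<in>circle_pts M. u ^ m / u ^ s))"
    by (subst sum.swap) (simp add: sum_distrib_left)
  finally have eq: "(\<Sum>u\<in>circle_pts M. poly p u / u ^ s) = (\<Sum>m\<le>degree p. coeff p m * (\<Sum>u\<in>circle_pts M. u ^ m / u ^ s))" .
  have "(\<Sum>u\<in>circle_pts M. poly p u / u ^ s) / of_nat M =
     (\<Sum>m\<le>degree p. coeff p m * ((\<Sum>u\<in>circle_pts M. u ^ m / u ^ s) / of_nat M))"
    unfolding eq by (simp only: sum_divide_distrib[where A = "{..degree p}"] times_divide_eq_right)
  also have "\<dots> = (\<Sum>m\<le>degree p. coeff p m * (if m = s then 1 else 0))"
    by (intro sum.cong refl, subst circle_sum_power) (use assms in auto)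
  also have "\<dots> = (if s \<le> degree p then coeff p s else 0)"
    by (simp add: mult_delta_right)
  finally show ?thesis by (auto simp: coeff_eq_0)
qed

text \<open>A discrete form of the Weyl integral of \<open>det(U)\<^sup>-\<^sup>q f(U)\<close>: the coefficient of
  \<open>u\<^sub>0\<^sup>q u\<^sub>1\<^sup>q\<^sup>+\<^sup>1 \<cdots>\<close> in \<open>f\<close> times the Vandermonde product. The points of
  modulus 2 avoid the pole of \<open>u / (1 - u)\<close>.\<close>

definition weyl_sum :: "nat \<Rightarrow> nat \<Rightarrow> nat \<Rightarrow> ((nat \<Rightarrow> complex) \<Rightarrow> complex) \<Rightarrow> complex" where
  "weyl_sum M N q f = (\<Sum>u\<in>{..<N} \<rightarrow>\<^sub>E circle_pts M. f u * vdm N u / (\<Prod>a<N. u a ^ (q + a))) / of_nat M ^ N"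

lemma weyl_sum_product:
  "(\<Sum>u\<in>{..<N} \<rightarrow>\<^sub>E circle_pts M. \<Prod>a<N. h a (u a)) / of_nat M ^ N =
     (\<Prod>a<N::nat. (\<Sum>u\<in>circle_pts M. h a u) / of_nat M :: complex)" if "M > 0"
  using that by (simp add: prod_dividef prod_sum_PiE)

text \<open>Orthogonality on the circle points is exact while no exponent reaches M, so the sum
  extracts one coefficient. The exponents q + a represent one term of the conjugate Vandermonde
  product in Weyl's density; for symmetric f all N! such terms contribute equally by
  antisymmetry.\<close>

lemma weyl_sum_monomials:
  assumes "M > 0" "finite S" "\<And>x a. x \<in> S \<Longrightarrow> a < N \<Longrightarrow> e x a < M" "q + N \<le> M"
    and "\<And>u. f u * vdm N u = (\<Sum>x\<in>S. c x * (\<Prod>a<N. u a ^ e x a))"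
  shows "weyl_sum M N q f = (\<Sum>x\<in>S. c x * (if \<forall>a<N. e x a = q + a then 1 else 0))"
proof -
  have "weyl_sum M N q f = (\<Sum>u\<in>{..<N} \<rightarrow>\<^sub>E circle_pts M. \<Sum>x\<in>S. c x * (\<Prod>a<N. u a ^ e x a / u a ^ (q + a))) / of_nat M ^ N"
    unfolding weyl_sum_def assms(5) by (simp add: sum_divide_distrib prod_dividef)
  also have "\<dots> = (\<Sum>x\<in>S. c x * ((\<Sum>u\<in>{..<N} \<rightarrow>\<^sub>E circle_pts M. \<Prod>a<N. u a ^ e x a / u a ^ (q + a)) / of_nat M ^ N))"
    by (subst sum.swap) (simp add: sum_distrib_left sum_divide_distrib)
  also have "\<dots> = (\<Sum>x\<in>S. c x * (\<Prod>a<N. if e x a = q + a then 1 else 0))"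
    by (intro sum.cong refl arg_cong2[of _ _ _ _ "(*)"])
       (subst weyl_sum_product[OF assms(1), where h = "\<lambda>a u. u ^ e _ a / u ^ (q + a)"],
        intro prod.cong refl circle_sum_power, use assms in auto)
  also have "\<dots> = (\<Sum>x\<in>S. c x * (if \<forall>a<N. e x a = q + a then 1 else 0))"
    by (intro sum.cong refl arg_cong2[of _ _ _ _ "(*)"]) (auto intro!: prod_zero)
  finally show ?thesis .
qed

section \<open>Coefficients of the polynomial with prescribed roots under the discrete
  integral\<close>

definition root_poly :: "nat \<Rightarrow> (nat \<Rightarrow> complex) \<Rightarrow> complex poly" where
  "root_poly N u = (\<Prod>a<N. [:- u a, 1:])"

lemma poly_root_poly: "poly (root_poly N u) z = (\<Prod>a<N. z - u a)"
  unfolding root_poly_def poly_prod by (intro prod.cong) auto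

lemma degree_root_poly: "degree (root_poly N u) = N" and lead_coeff_root_poly: "coeff (root_poly N u) N = 1"
  using monic_prod_linear[of u N] by (auto simp: root_poly_def)

lemma vdm_append:
  "vdm N u * vdm n z * (\<Prod>i<n. \<Prod>a<N. z i - u a) =
     vdm (N + n) (\<lambda>k. if k < N then u k else (z (k - N) :: 'a :: comm_ring_1))"
proof -
  define w where "w = (\<lambda>k. if k < N then u k else z (k - N))"
  have "vdm (N + n) w = (\<Prod>b<N. \<Prod>a<b. w b - w a) * (\<Prod>i<n. \<Prod>a<N+i. w (N + i) - w a)"
    unfolding vdm_def by (induction n) (simp_all add: mult.assoc)
  also have "(\<Prod>b<N. \<Prod>a<b. w b - w a) = vdm N u"
    unfolding vdm_def by (intro prod.cong refl) (auto simp: w_def)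
  also have "(\<Prod>i<n. \<Prod>a<N+i. w (N + i) - w a) = (\<Prod>i<n. (\<Prod>a<N. z i - u a) * (\<Prod>j<i. z i - z j))"
  proof (intro prod.cong refl)
    fix i
    have "(\<Prod>a<N+e. w (N + i) - w a) = (\<Prod>a<N. w (N + i) - w a) * (\<Prod>j<e. w (N + i) - w (N + j))" for e
      by (induction e) (simp_all add: mult.assoc)
    from this[of i] show "(\<Prod>a<N+i. w (N + i) - w a) = (\<Prod>a<N. z i - u a) * (\<Prod>j<i. z i - z j)"
      by (simp add: w_def)
  qed
  finally show ?thesis by (simp add: w_def prod.distrib vdm_def mult_ac)
qed

definition weyl_coeff :: "nat \<Rightarrow> nat \<Rightarrow> nat \<Rightarrow> nat \<Rightarrow> (nat \<Rightarrow> nat) \<Rightarrow> complex" where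
  "weyl_coeff M N q n m = weyl_sum M N q (\<lambda>u. \<Prod>i<n. coeff (root_poly N u) (m i))"

lemma weyl_sum_sum: "finite S \<Longrightarrow> (\<Sum>x\<in>S. c x * weyl_sum M N q (f x)) = weyl_sum M N q (\<lambda>u. \<Sum>x\<in>S. c x * f x u)"
proof -
  assume "finite S"
  have "(\<Sum>x\<in>S. c x * weyl_sum M N q (f x)) =
    (\<Sum>x\<in>S. \<Sum>u\<in>{..<N} \<rightarrow>\<^sub>E circle_pts M. c x * f x u * vdm N u / (\<Prod>a<N. u a ^ (q + a))) / of_nat M ^ N"
    unfolding weyl_sum_def by (simp add: sum_divide_distrib sum_distrib_left mult.assoc)
  also have "\<dots> = weyl_sum M N q (\<lambda>u. \<Sum>x\<in>S. c x * f x u)"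
    unfolding weyl_sum_def by (subst sum.swap) (simp add: sum_divide_distrib sum_distrib_right)
  finally show ?thesis .
qed

lemma weyl_coeff_sym:
  assumes \<tau>: "\<tau> permutes {..<n}"
  shows "weyl_coeff M N q n (\<lambda>i\<in>{..<n}. m (\<tau> i)) = weyl_coeff M N q n m"
proof -
  have "(\<Prod>i<n. coeff p ((\<lambda>i\<in>{..<n}. m (\<tau> i)) i)) = (\<Prod>i<n. coeff p (m i))" for p :: "complex poly"
    using prod.permute[OF \<tau>, of "\<lambda>i. coeff p (m i)"] by (simp add: o_def)
  thus ?thesis by (simp add: weyl_coeff_def)
qed

text \<open>The Vandermonde products in u and in z together with the factors z i - u a form one
  Vandermonde product in N + n variables. Extracting the coefficient in u prescribes the permutation
  on the first N positions.\<close>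

lemma weyl_coeff_generating_function:
  assumes M: "N + n \<le> M" "M > 0" and q: "q \<le> n"
  shows "vdm n z * (\<Sum>m\<in>{..<n} \<rightarrow>\<^sub>E {..N}. weyl_coeff M N q n m * (\<Prod>i<n. z i ^ m i)) =
    (\<Sum>\<pi> | \<pi> permutes {..<N + n} \<and> (\<forall>a<N. \<pi> a = q + a). of_int (sign \<pi>) * (\<Prod>i<n. z i ^ \<pi> (N + i)))"
proof -
  let ?M = "{..<n} \<rightarrow>\<^sub>E {..N}" and ?P = "{\<pi>. \<pi> permutes {..<N + n}}"
  have finM: "finite ?M" by (intro finite_PiE) auto
  have "vdm n z * (\<Sum>m\<in>?M. weyl_coeff M N q n m * (\<Prod>i<n. z i ^ m i)) =
     weyl_sum M N q (\<lambda>u. \<Sum>m\<in>?M. (vdm n z * (\<Prod>i<n. z i ^ m i)) * (\<Prod>i<n. coeff (root_poly N u) (m i)))"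
    unfolding weyl_sum_sum[OF finM, symmetric] weyl_coeff_def by (simp add: sum_distrib_left mult_ac)
  also have "(\<lambda>u. \<Sum>m\<in>?M. (vdm n z * (\<Prod>i<n. z i ^ m i)) * (\<Prod>i<n. coeff (root_poly N u) (m i))) =
     (\<lambda>u. vdm n z * (\<Prod>i<n. \<Prod>a<N. z i - u a))"
  proof
    fix u
    have "(\<Sum>m\<in>?M. (vdm n z * (\<Prod>i<n. z i ^ m i)) * (\<Prod>i<n. coeff (root_poly N u) (m i))) =
       vdm n z * (\<Sum>m\<in>?M. \<Prod>i<n. coeff (root_poly N u) (m i) * z i ^ m i)"
      by (simp add: sum_distrib_left prod.distrib mult_ac)
    also have "(\<Sum>m\<in>?M. \<Prod>i<n. coeff (root_poly N u) (m i) * z i ^ m i) =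
       (\<Prod>i<n. \<Sum>m\<le>N. coeff (root_poly N u) m * z i ^ m)"
      by (rule prod_sum_power_PiE)
    also have "\<dots> = (\<Prod>i<n. poly (root_poly N u) (z i))"
      by (simp add: poly_eq_sum_coeff[of _ N] degree_root_poly)
    finally show "(\<Sum>m\<in>?M. (vdm n z * (\<Prod>i<n. z i ^ m i)) * (\<Prod>i<n. coeff (root_poly N u) (m i))) =
       vdm n z * (\<Prod>i<n. \<Prod>a<N. z i - u a)" by (simp add: poly_root_poly)
  qed
  also have "weyl_sum M N q (\<lambda>u. vdm n z * (\<Prod>i<n. \<Prod>a<N. z i - u a)) =
     (\<Sum>\<pi>\<in>?P. (of_int (sign \<pi>) * (\<Prod>i<n. z i ^ \<pi> (N + i))) * (if \<forall>a<N. \<pi> a = q + a then 1 else 0))"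
  proof (rule weyl_sum_monomials[OF M(2) finite_permutes_lessThan])
    fix \<pi> a assume "\<pi> \<in> ?P" "a < N"
    thus "\<pi> a < M" using permutes_in_image[of \<pi> "{..<N+n}" a] M by auto
  next
    fix u
    have "vdm n z * (\<Prod>i<n. \<Prod>a<N. z i - u a) * vdm N u = vdm (N + n) (\<lambda>k. if k < N then u k else z (k - N))"
      unfolding vdm_append[symmetric] by (simp add: mult_ac)
    also have "\<dots> = (\<Sum>\<pi>\<in>?P. of_int (sign \<pi>) * (\<Prod>k<N+n. (if k < N then u k else z (k - N)) ^ \<pi> k))"
      by (rule vandermonde_sum[symmetric])
    also have "\<dots> = (\<Sum>\<pi>\<in>?P. (of_int (sign \<pi>) * (\<Prod>i<n. z i ^ \<pi> (N + i))) * (\<Prod>a<N. u a ^ \<pi> a))"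
    proof (intro sum.cong refl)
      fix \<pi>
      have "(\<Prod>k<N+n. (if k < N then u k else z (k - N)) ^ \<pi> k) = (\<Prod>a<N. u a ^ \<pi> a) * (\<Prod>i<n. z i ^ \<pi> (N + i))"
        by (induction n) (simp_all add: mult.assoc)
      thus "of_int (sign \<pi>) * (\<Prod>k<N+n. (if k < N then u k else z (k - N)) ^ \<pi> k) =
         (of_int (sign \<pi>) * (\<Prod>i<n. z i ^ \<pi> (N + i))) * (\<Prod>a<N. u a ^ \<pi> a)" by (simp add: mult_ac)
    qed
    finally show "vdm n z * (\<Prod>i<n. \<Prod>a<N. z i - u a) * vdm N u =
      (\<Sum>\<pi>\<in>?P. (of_int (sign \<pi>) * (\<Prod>i<n. z i ^ \<pi> (N + i))) * (\<Prod>a<N. u a ^ \<pi> a))" .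
  qed (use M q in auto)
  also have "\<dots> = (\<Sum>\<pi> | \<pi> permutes {..<N + n} \<and> (\<forall>a<N. \<pi> a = q + a). of_int (sign \<pi>) * (\<Prod>i<n. z i ^ \<pi> (N + i)))"
    by (rule sum.mono_neutral_cong_right) auto
  finally show ?thesis .
qed

text \<open>A permutation that maps the first N positions onto the block {q..<q + N} maps the last n
  positions onto its complement, and these values are the exponents of z.\<close>

lemma weyl_coeff_support:
  assumes M: "N + n \<le> M" "M > 0" and q: "q \<le> n"
    and l: "l \<in> {..<n} \<rightarrow>\<^sub>E {..N+n}" "alt_coeff n N (weyl_coeff M N q n) l \<noteq> 0"
  shows "inj_on l {..<n} \<and> l ` {..<n} = rect_exps N q ` {..<n}"
proof -
  let ?S = "{..<n} \<rightarrow>\<^sub>E {..N+n}"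
  define Q where "Q = {\<pi>. \<pi> permutes {..<N + n} \<and> (\<forall>a<N. \<pi> a = q + a)}"
  have fin: "finite Q" unfolding Q_def by (rule finite_subset[of _ "{\<pi>. \<pi> permutes {..<N + n}}"]) auto
  define e where "e = (\<lambda>\<pi>::nat \<Rightarrow> nat. \<lambda>i\<in>{..<n}. \<pi> (N + i))"
  define h where "h = (\<lambda>l. \<Sum>\<pi>\<in>{\<pi> \<in> Q. e \<pi> = l}. of_int (sign \<pi>) :: complex)"
  have img: "e ` Q \<subseteq> ?S"
  proof (rule image_subsetI)
    fix \<pi> assume "\<pi> \<in> Q"
    hence "\<pi> (N + i) < N + n" if "i < n" for i
      using permutes_in_image[of \<pi> "{..<N+n}" "N + i"] that by (auto simp: Q_def)
    thus "e \<pi> \<in> ?S" by (force simp: e_def)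
  qed
  have "alt_coeff n N (weyl_coeff M N q n) l - h l = 0"
  proof (rule multivariate_poly_zero[OF infinite_grid _ l(1), where c = "\<lambda>l. alt_coeff n N (weyl_coeff M N q n) l - h l"])
    fix z
    have "(\<Sum>l\<in>?S. h l * (\<Prod>i<n. z i ^ l i)) =
       (\<Sum>l\<in>?S. \<Sum>\<pi>\<in>{\<pi> \<in> Q. e \<pi> = l}. of_int (sign \<pi>) * (\<Prod>i<n. z i ^ \<pi> (N + i)))"
      unfolding h_def sum_distrib_right by (intro sum.cong refl) (auto simp: e_def)
    also have "\<dots> = (\<Sum>\<pi>\<in>Q. of_int (sign \<pi>) * (\<Prod>i<n. z i ^ \<pi> (N + i)))"
      by (rule sum.group[OF fin _ img]) (intro finite_PiE finite_lessThan finite_atMost)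
    finally show "(\<Sum>l\<in>?S. (alt_coeff n N (weyl_coeff M N q n) l - h l) * (\<Prod>i<n. z i ^ l i)) = 0"
      unfolding left_diff_distrib sum_subtractf alt_coeff_generating_function weyl_coeff_generating_function[OF M q] Q_def[symmetric]
      by simp
  qed auto
  hence "h l \<noteq> 0" using l by simp
  hence "{\<pi> \<in> Q. e \<pi> = l} \<noteq> {}" unfolding h_def by (metis sum.empty)
  then obtain \<pi> where \<pi>: "\<pi> permutes {..<N + n}" "\<And>a. a < N \<Longrightarrow> \<pi> a = q + a" "e \<pi> = l"
    by (auto simp: Q_def)
  have li: "l i = \<pi> (N + i)" if "i < n" for i using \<pi>(3) that by (auto simp: e_def)
  have inj\<pi>: "inj \<pi>" by (rule permutes_inj[OF \<pi>(1)])
  have inj: "inj_on l {..<n}"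
  proof (rule inj_onI)
    fix i j assume *: "i \<in> {..<n}" "j \<in> {..<n}" "l i = l j"
    hence "\<pi> (N + i) = \<pi> (N + j)" by (simp add: li)
    hence "N + i = N + j" by (rule injD[OF inj\<pi>])
    thus "i = j" by simp
  qed
  have "l ` {..<n} \<subseteq> rect_exps N q ` {..<n}"
  proof (rule image_subsetI)
    fix i assume i: "i \<in> {..<n}"
    have lt: "l i < N + n" using permutes_in_image[OF \<pi>(1), of "N + i"] i by (simp add: li)
    have out: "\<not> (q \<le> l i \<and> l i < q + N)"
    proof
      assume *: "q \<le> l i \<and> l i < q + N"
      hence "\<pi> (l i - q) = \<pi> (N + i)" using \<pi>(2)[of "l i - q"] i * by (auto simp: li)
      hence "l i - q = N + i" by (rule injD[OF inj\<pi>])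
      thus False using * by arith
    qed
    have "l i = rect_exps N q (if l i < q then l i else l i - N)" "(if l i < q then l i else l i - N) < n"
      using out lt q by (auto simp: rect_exps_def)
    thus "l i \<in> rect_exps N q ` {..<n}" by blast
  qed
  moreover have "card (l ` {..<n}) = card (rect_exps N q ` {..<n})"
    by (simp add: card_image[OF inj] card_image[OF inj_rect_exps])
  ultimately show ?thesis using inj by (simp add: card_subset_eq)
qed

text \<open>Selects q constant and n - q leading coefficients of a monic polynomial. For a
  characteristic polynomial their product is plus or minus the power q of the determinant, so the
  weighted integrand is constant; this fixes the normalisation.\<close>

definition corner_exps :: "nat \<Rightarrow> nat \<Rightarrow> nat \<Rightarrow> nat \<Rightarrow> nat" where
  "corner_exps N q n = (\<lambda>i\<in>{..<n}. if i < q then 0 else N)"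

lemma prod_corner:
  assumes "q \<le> n"
  shows "(\<Prod>i<n. h (corner_exps N q n i)) = h 0 ^ q * (h N ^ (n - q) :: 'a :: comm_monoid_mult)"
proof -
  have "{..<n} = {..<q} \<union> {q..<n}" using assms by auto
  hence "(\<Prod>i<n. h (corner_exps N q n i)) = (\<Prod>i<q. h (corner_exps N q n i)) * (\<Prod>i\<in>{q..<n}. h (corner_exps N q n i))"
    by (simp add: prod.union_disjoint ivl_disj_int)
  also have "(\<Prod>i<q. h (corner_exps N q n i)) = h 0 ^ q"
    using assms by (simp add: corner_exps_def)
  also have "(\<Prod>i\<in>{q..<n}. h (corner_exps N q n i)) = h N ^ (n - q)"
    by (simp add: corner_exps_def)
  finally show ?thesis .
qed

text \<open>The constant coefficients supply every u a to the power q, so the Vandermonde product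
  has to supply the exponents a themselves, which only its identity term does.\<close>

lemma weyl_coeff_corner:
  assumes M: "N + n \<le> M" "M > 0" and q: "q \<le> n"
  shows "weyl_coeff M N q n (corner_exps N q n) = (-1) ^ (N * q)"
proof -
  let ?P = "{\<sigma>. \<sigma> permutes {..<N}}"
  have "weyl_coeff M N q n (corner_exps N q n) =
     (\<Sum>\<sigma>\<in>?P. ((-1) ^ (N * q) * of_int (sign \<sigma>)) * (if \<forall>a<N. q + \<sigma> a = q + a then 1 else 0))"
    unfolding weyl_coeff_def
  proof (rule weyl_sum_monomials[OF M(2) finite_permutes_lessThan])
    fix \<sigma> a assume "\<sigma> \<in> ?P" "a < N"
    thus "q + \<sigma> a < M" using permutes_in_image[of \<sigma> "{..<N}" a] M q by auto
  next
    fix u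
    have "coeff (root_poly N u) 0 = (\<Prod>a<N. - u a)"
      using poly_root_poly[of N u 0] by (simp add: poly_0_coeff_0)
    also have "\<dots> = (-1) ^ N * (\<Prod>a<N. u a)" by (simp add: prod_uminus)
    finally have "(\<Prod>i<n. coeff (root_poly N u) (corner_exps N q n i)) = (-1) ^ (N * q) * (\<Prod>a<N. u a ^ q)"
      by (simp add: prod_corner[OF q] lead_coeff_root_poly power_mult_distrib power_mult prod_power_distrib)
    hence "(\<Prod>i<n. coeff (root_poly N u) (corner_exps N q n i)) * vdm N u =
      (-1) ^ (N * q) * (\<Prod>a<N. u a ^ q) * (\<Sum>\<sigma>\<in>?P. of_int (sign \<sigma>) * (\<Prod>a<N. u a ^ \<sigma> a))"
      unfolding vandermonde_sum by simp
    thus "(\<Prod>i<n. coeff (root_poly N u) (corner_exps N q n i)) * vdm N u =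
      (\<Sum>\<sigma>\<in>?P. ((-1) ^ (N * q) * of_int (sign \<sigma>)) * (\<Prod>a<N. u a ^ (q + \<sigma> a)))"
      by (simp add: sum_distrib_left power_add prod.distrib mult_ac)
  qed (use M q in auto)
  also have "\<dots> = (\<Sum>\<sigma>\<in>?P. if \<sigma> = id then (-1) ^ (N * q) * of_int (sign \<sigma>) else 0)"
  proof (intro sum.cong refl)
    fix \<sigma> assume \<sigma>: "\<sigma> \<in> ?P"
    have "(\<forall>a<N. q + \<sigma> a = q + a) \<longleftrightarrow> \<sigma> = id"
    proof
      assume *: "\<forall>a<N. q + \<sigma> a = q + a"
      show "\<sigma> = id"
      proof
        fix a show "\<sigma> a = id a" using * \<sigma> by (cases "a < N") (auto simp: permutes_not_in)
      qed
    qed simp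
    thus "(-1) ^ (N * q) * of_int (sign \<sigma>) * (if \<forall>a<N. q + \<sigma> a = q + a then 1 else 0) =
      (if \<sigma> = id then (-1) ^ (N * q) * of_int (sign \<sigma>) else (0::complex))"
      by simp
  qed
  also have "\<dots> = (-1) ^ (N * q)"
    by (simp add: permutes_id sign_id)
  finally show ?thesis .
qed

section \<open>Unitary matrices and resolvents\<close>

lemma mat_adjoint_index:
  assumes "U \<in> carrier_mat N N" "i < N" "j < N"
  shows "mat_adjoint U $$ (i, j) = cnj (U $$ (j, i))"
  using assms by (simp add: mat_adjoint_def mat_of_rows_def)

lemma mat_adjoint_carrier: "U \<in> carrier_mat N N \<Longrightarrow> mat_adjoint U \<in> carrier_mat N N"
  by (auto simp: mat_adjoint_def mat_of_rows_def)

lemma unitary_iff: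
  assumes "U \<in> carrier_mat N N"
  shows "U \<in> unitary_group N \<longleftrightarrow>
     (\<forall>i<N. \<forall>j<N. (\<Sum>k<N. U $$ (i, k) * cnj (U $$ (j, k))) = (if i = j then 1 else 0))"
proof -
  have adj: "mat_adjoint U \<in> carrier_mat N N" by (rule mat_adjoint_carrier[OF assms])
  have e: "(U * mat_adjoint U) $$ (i, j) = (\<Sum>k<N. U $$ (i, k) * cnj (U $$ (j, k)))" if "i < N" "j < N" for i j
    using that assms adj mat_adjoint_index[OF assms]
    by (simp add: times_mat_def scalar_prod_def lessThan_atLeast0)
  show ?thesis
  proof
    assume "U \<in> unitary_group N"
    hence "U * mat_adjoint U = 1\<^sub>m N" by (simp add: unitary_group_def)
    thus "\<forall>i<N. \<forall>j<N. (\<Sum>k<N. U $$ (i, k) * cnj (U $$ (j, k))) = (if i = j then 1 else 0)"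
      using e by (metis index_one_mat(1))
  next
    assume *: "\<forall>i<N. \<forall>j<N. (\<Sum>k<N. U $$ (i, k) * cnj (U $$ (j, k))) = (if i = j then 1 else 0)"
    have "U * mat_adjoint U = 1\<^sub>m N"
      by (rule eq_matI) (use * e assms adj in auto)
    thus "U \<in> unitary_group N" using assms by (simp add: unitary_group_def)
  qed
qed

lemma unitary_adjoint_left:
  assumes "U \<in> unitary_group N"
  shows "mat_adjoint U * U = 1\<^sub>m N"
  using assms mat_mult_left_right_inverse[of U N "mat_adjoint U"] mat_adjoint_carrier[of U N]
  by (auto simp: unitary_group_def)

lemma mat_adjoint_mult:
  fixes A B :: "complex mat"
  assumes A: "A \<in> carrier_mat N N" and B: "B \<in> carrier_mat N N"
  shows "mat_adjoint (A * B) = mat_adjoint B * mat_adjoint A"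
proof (rule eq_matI)
  have c: "mat_adjoint A \<in> carrier_mat N N" "mat_adjoint B \<in> carrier_mat N N" "A * B \<in> carrier_mat N N"
    using A B by (auto intro: mat_adjoint_carrier)
  fix i j assume "i < dim_row (mat_adjoint B * mat_adjoint A)" "j < dim_col (mat_adjoint B * mat_adjoint A)"
  hence ij: "i < N" "j < N" using c by auto
  have e: "(A * B) $$ (j, i) = (\<Sum>k<N. A $$ (j, k) * B $$ (k, i))"
    using ij A B by (simp add: times_mat_def scalar_prod_def lessThan_atLeast0)
  have "mat_adjoint (A * B) $$ (i, j) = cnj (\<Sum>k<N. A $$ (j, k) * B $$ (k, i))"
    by (simp only: mat_adjoint_index[OF c(3) ij] e)
  also have "\<dots> = (\<Sum>k<N. mat_adjoint B $$ (i, k) * mat_adjoint A $$ (k, j))"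
    using ij by (simp add: mat_adjoint_index[OF A] mat_adjoint_index[OF B] mult.commute)
  also have "\<dots> = (mat_adjoint B * mat_adjoint A) $$ (i, j)"
    using ij c by (simp add: times_mat_def scalar_prod_def lessThan_atLeast0)
  finally show "mat_adjoint (A * B) $$ (i, j) = (mat_adjoint B * mat_adjoint A) $$ (i, j)" .
qed (use assms mat_adjoint_carrier in \<open>auto simp: mat_adjoint_def\<close>)

lemma unitary_mult:
  assumes "V \<in> unitary_group N" "U \<in> unitary_group N"
  shows "V * U \<in> unitary_group N"
proof -
  have c: "V \<in> carrier_mat N N" "U \<in> carrier_mat N N" "mat_adjoint V \<in> carrier_mat N N" "mat_adjoint U \<in> carrier_mat N N"
    using assms by (auto simp: unitary_group_def mat_adjoint_carrier)
  have "(V * U) * mat_adjoint (V * U) = V * (U * (mat_adjoint U * mat_adjoint V))"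
    using c by (simp add: mat_adjoint_mult[of _ N] assoc_mult_mat[of _ N N _ N _ N])
  also have "U * (mat_adjoint U * mat_adjoint V) = (U * mat_adjoint U) * mat_adjoint V"
    using c by (simp add: assoc_mult_mat[of _ N N _ N _ N])
  also have "\<dots> = mat_adjoint V" using assms c by (simp add: unitary_group_def)
  also have "V * mat_adjoint V = 1\<^sub>m N" using assms by (simp add: unitary_group_def)
  finally show ?thesis using c by (simp add: unitary_group_def)
qed

lemma unitary_eigenvalue_norm:
  assumes U: "U \<in> unitary_group N" and a: "eigenvalue U a"
  shows "norm a = 1"
proof -
  have c: "U \<in> carrier_mat N N" using U by (simp add: unitary_group_def)
  obtain v where v: "v \<in> carrier_vec N" "v \<noteq> 0\<^sub>v N" "U *\<^sub>v v = a \<cdot>\<^sub>v v"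
    using a c by (auto simp: eigenvalue_def eigenvector_def)
  have comp: "(\<Sum>k<N. U $$ (i, k) * v $ k) = a * v $ i" if "i < N" for i
  proof -
    have "(U *\<^sub>v v) $ i = (\<Sum>k<N. U $$ (i, k) * v $ k)"
      using that c v(1) by (simp add: scalar_prod_def lessThan_atLeast0)
    thus ?thesis using v that by simp
  qed
  have ortho: "(\<Sum>i<N. cnj (U $$ (i, j)) * U $$ (i, k)) = (if j = k then 1 else 0)" if "j < N" "k < N" for j k
  proof -
    have ac: "mat_adjoint U \<in> carrier_mat N N" by (rule mat_adjoint_carrier[OF c])
    have "(mat_adjoint U * U) $$ (j, k) = (\<Sum>i<N. mat_adjoint U $$ (j, i) * U $$ (i, k))"
      using that c ac by (simp add: times_mat_def scalar_prod_def lessThan_atLeast0)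
    also have "\<dots> = (\<Sum>i<N. cnj (U $$ (i, j)) * U $$ (i, k))"
      by (rule sum.cong) (use that in \<open>auto simp: mat_adjoint_index[OF c]\<close>)
    finally show ?thesis using that by (simp add: unitary_adjoint_left[OF U])
  qed
  define S where "S = (\<Sum>i<N. cnj (v $ i) * v $ i)"
  have "(\<Sum>i<N. cnj (\<Sum>j<N. U $$ (i, j) * v $ j) * (\<Sum>k<N. U $$ (i, k) * v $ k)) = 
      (\<Sum>i<N. \<Sum>j<N. \<Sum>k<N. cnj (v $ j) * v $ k * (cnj (U $$ (i, j)) * U $$ (i, k)))"
    by (simp add: sum_distrib_left sum_distrib_right mult_ac)
  also have "\<dots> = (\<Sum>j<N. \<Sum>i<N. \<Sum>k<N. cnj (v $ j) * v $ k * (cnj (U $$ (i, j)) * U $$ (i, k)))"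
    by (rule sum.swap)
  also have "\<dots> = (\<Sum>j<N. \<Sum>k<N. \<Sum>i<N. cnj (v $ j) * v $ k * (cnj (U $$ (i, j)) * U $$ (i, k)))"
    by (intro sum.cong refl sum.swap)
  also have "\<dots> = (\<Sum>j<N. \<Sum>k<N. cnj (v $ j) * v $ k * (if j = k then 1 else 0))"
    by (intro sum.cong refl) (simp add: ortho flip: sum_distrib_left)
  also have "\<dots> = S" by (simp add: S_def mult_delta_right)
  also have "(\<Sum>i<N. cnj (\<Sum>j<N. U $$ (i, j) * v $ j) * (\<Sum>k<N. U $$ (i, k) * v $ k)) = (\<Sum>i<N. (cnj a * a) * (cnj (v $ i) * v $ i))"
  proof (rule sum.cong[OF refl])
    fix i assume "i \<in> {..<N}"
    hence e: "(\<Sum>k<N. U $$ (i, k) * v $ k) = a * v $ i" using comp by simp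
    show "cnj (\<Sum>j<N. U $$ (i, j) * v $ j) * (\<Sum>k<N. U $$ (i, k) * v $ k) = (cnj a * a) * (cnj (v $ i) * v $ i)"
      unfolding e by simp
  qed
  also have "\<dots> = (cnj a * a) * S" by (simp add: S_def sum_distrib_left)
  finally have "(cnj a * a - 1) * S = 0" by (simp add: algebra_simps)
  moreover have "S \<noteq> 0"
  proof
    assume "S = 0"
    hence "of_real (\<Sum>i<N. (norm (v $ i))\<^sup>2) = (0 :: complex)"
      unfolding S_def by (simp only: of_real_sum complex_norm_square mult.commute[of "cnj _"])
    hence "(\<Sum>i<N. (norm (v $ i))\<^sup>2) = 0" by (simp only: of_real_eq_0_iff)
    hence "\<forall>i<N. v $ i = 0" by (subst (asm) sum_nonneg_eq_0_iff) auto
    hence "v = 0\<^sub>v N" using v(1) by (intro eq_vecI) auto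
    thus False using v(2) by simp
  qed
  ultimately have "cnj a * a = 1" by simp
  hence "of_real ((norm a)\<^sup>2) = (1 :: complex)" using complex_norm_square[of a] by (simp add: mult.commute)
  hence "(norm a)\<^sup>2 = 1" by (simp only: of_real_eq_1_iff)
  thus ?thesis using norm_ge_zero[of a] by (auto simp: power2_eq_1_iff)
qed

section \<open>Roots, bounds and constant term of the characteristic polynomial\<close>

lemma char_poly_unitary_roots:
  assumes U: "U \<in> unitary_group N"
  shows "\<exists>as. char_poly U = (\<Prod>a\<leftarrow>as. [:- a, 1:]) \<and> length as = N \<and> (\<forall>a\<in>set as. norm a = 1)"
proof -
  have c: "U \<in> carrier_mat N N" using U by (simp add: unitary_group_def)
  obtain as where as: "char_poly U = (\<Prod>a\<leftarrow>as. [:- a, 1:])" "length as = N"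
    using char_poly_factorized[OF c] by blast
  have "norm a = 1" if "a \<in> set as" for a
  proof -
    have "poly (char_poly U) a = 0" unfolding as(1) using that by (induction as) auto
    thus ?thesis using eigenvalue_root_char_poly[OF c] unitary_eigenvalue_norm[OF U] by blast
  qed
  thus ?thesis using as by blast
qed

lemma norm_coeff_linear_factors:
  assumes "\<forall>a\<in>set as. norm (a :: complex) = 1"
  shows "norm (coeff (\<Prod>a\<leftarrow>as. [:- a, 1:]) m) \<le> 2 ^ length as"
  using assms
proof (induction as arbitrary: m)
  case Nil
  thus ?case by (cases m) auto
next
  case (Cons a as)
  define p where "p = (\<Prod>a\<leftarrow>as. [:- a, 1:])"
  have "coeff ([:- a, 1:] * p) m = - a * coeff p m + (case m of 0 \<Rightarrow> 0 | Suc m \<Rightarrow> coeff p m)"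
    by (cases m) (auto simp: coeff_pCons)
  also have "norm \<dots> \<le> norm (- a * coeff p m) + norm (case m of 0 \<Rightarrow> 0 | Suc m \<Rightarrow> coeff p m)"
    by (rule norm_triangle_ineq)
  also have "\<dots> \<le> 2 ^ length as + 2 ^ length as"
    using Cons by (intro add_mono) (auto simp: norm_mult p_def split: nat.splits)
  finally show ?case by (simp add: p_def)
qed

lemma norm_coeff_char_poly_unitary:
  "U \<in> unitary_group N \<Longrightarrow> norm (coeff (char_poly U) m) \<le> 2 ^ N"
  using char_poly_unitary_roots[of U N] norm_coeff_linear_factors by metis

lemma char_poly_unitary_neq_0:
  assumes U: "U \<in> unitary_group N" and z: "norm z > 1"
  shows "poly (char_poly U) z \<noteq> 0"
proof
  assume "poly (char_poly U) z = 0"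
  hence "norm z = 1"
    using eigenvalue_root_char_poly[of U N z] unitary_eigenvalue_norm[OF U] U by (auto simp: unitary_group_def)
  thus False using z by simp
qed

lemma norm_char_poly_unitary_lower:
  assumes U: "U \<in> unitary_group N" and z: "norm z \<ge> 2"
  shows "norm (poly (char_poly U) z) \<ge> 1"
proof -
  obtain as where as: "char_poly U = (\<Prod>a\<leftarrow>as. [:- a, 1:])" "\<forall>a\<in>set as. norm a = 1"
    using char_poly_unitary_roots[OF U] by blast
  have "norm (poly (\<Prod>a\<leftarrow>as. [:- a, 1:]) z) \<ge> 1" using as(2)
  proof (induction as)
    case (Cons a as)
    have "norm (z - a) \<ge> 1" using norm_triangle_ineq2[of z a] z Cons by simp
    hence "1 * 1 \<le> norm (z - a) * norm (poly (\<Prod>a\<leftarrow>as. [:- a, 1:]) z)"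
      using Cons by (intro mult_mono) auto
    moreover have "poly (\<Prod>a\<leftarrow>a # as. [:- a, 1:]) z = (z - a) * poly (\<Prod>a\<leftarrow>as. [:- a, 1:]) z"
      by (simp add: algebra_simps)
    ultimately show ?case by (simp only: norm_mult length_Cons power_Suc mult_1)
  qed simp
  thus ?thesis using as by simp
qed

lemma norm_char_poly_unitary_upper:
  assumes U: "U \<in> unitary_group N"
  shows "norm (poly (char_poly U) z) \<le> (norm z + 1) ^ N"
proof -
  obtain as where as: "char_poly U = (\<Prod>a\<leftarrow>as. [:- a, 1:])" "length as = N" "\<forall>a\<in>set as. norm a = 1"
    using char_poly_unitary_roots[OF U] by blast
  have "norm (poly (\<Prod>a\<leftarrow>as. [:- a, 1:]) z) \<le> (norm z + 1) ^ length as" using as(3)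
  proof (induction as)
    case (Cons a as)
    have "norm (z - a) \<le> norm z + 1" using norm_triangle_ineq4[of z a] Cons by simp
    hence "norm (z - a) * norm (poly (\<Prod>a\<leftarrow>as. [:- a, 1:]) z) \<le> (norm z + 1) * (norm z + 1) ^ length as"
      using Cons by (intro mult_mono) auto
    moreover have "poly (\<Prod>a\<leftarrow>a # as. [:- a, 1:]) z = (z - a) * poly (\<Prod>a\<leftarrow>as. [:- a, 1:]) z"
      by (simp add: algebra_simps)
    ultimately show ?case by (simp only: norm_mult length_Cons power_Suc mult_1)
  qed simp
  thus ?thesis using as by simp
qed

lemma det_unitary:
  assumes "U \<in> unitary_group N"
  shows "det U * cnj (det U) = 1" and "norm (det U) = 1"
proof -
  have c: "U \<in> carrier_mat N N" using assms by (simp add: unitary_group_def)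
  obtain as where as: "char_poly U = (\<Prod>a\<leftarrow>as. [:- a, 1:])" "length as = N" "\<forall>a\<in>set as. norm a = 1"
    using char_poly_unitary_roots[OF assms] by blast
  have "det (- U) = poly (char_poly U) 0"
    unfolding char_poly_matrix[OF c] by (rule arg_cong[of _ _ det]) (use c in \<open>auto simp: char_matrix_def\<close>)
  also have "\<dots> = (\<Prod>a\<leftarrow>as. - a)" unfolding as(1) by (induction as) auto
  finally have "norm (det (- U)) = norm (\<Prod>a\<leftarrow>as. - a)" by simp
  also have "\<dots> = 1" using as(3) by (induction as) (auto simp: norm_mult)
  also have "- U = (-1) \<cdot>\<^sub>m U" by (rule eq_matI) auto
  finally show 1: "norm (det U) = 1" by (simp add: norm_mult norm_power)
  show "det U * cnj (det U) = 1" using complex_norm_square[of "det U"] 1 by simp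
qed

text \<open>The matrix determinant lemma for \<open>1 + x y\<^sup>T\<close>: both triangular completions of the
  bordered matrix have the same determinant.\<close>

lemma det_one_plus_outer:
  fixes x y :: "nat \<Rightarrow> complex"
  shows "det (mat N N (\<lambda>(i, j). (if i = j then 1 else 0) + x i * y j)) = 1 + (\<Sum>i<N. x i * y i)"
proof -
  define X Y where "X = mat N 1 (\<lambda>(i, j). x i)" and "Y = mat 1 N (\<lambda>(i, j). y j)"
  have c: "X \<in> carrier_mat N 1" "Y \<in> carrier_mat 1 N" by (auto simp: X_def Y_def)
  define P where "P = four_block_mat (1\<^sub>m 1) Y (- X) (1\<^sub>m N)"
  define T where "T = four_block_mat (1\<^sub>m 1) (0\<^sub>m 1 N) X (1\<^sub>m N)"
  have cP: "P \<in> carrier_mat (1 + N) (1 + N)" "T \<in> carrier_mat (1 + N) (1 + N)"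
    using c unfolding P_def T_def by (auto intro!: four_block_carrier_mat)
  have YX: "Y * X = mat 1 1 (\<lambda>_. \<Sum>i<N. x i * y i)"
    by (rule eq_matI) (auto simp: X_def Y_def scalar_prod_def lessThan_atLeast0 mult.commute)
  have detT: "det T = 1"
    unfolding T_def by (subst det_four_block_mat_upper_right_zero[of _ 1 _ N]) (use c in auto)
  have "P * T = four_block_mat (1\<^sub>m 1 * 1\<^sub>m 1 + Y * X) (1\<^sub>m 1 * 0\<^sub>m 1 N + Y * 1\<^sub>m N) (- X * 1\<^sub>m 1 + 1\<^sub>m N * X) (- X * 0\<^sub>m 1 N + 1\<^sub>m N * 1\<^sub>m N)"
    unfolding P_def T_def by (rule mult_four_block_mat) (use c in auto)
  also have "- X * 1\<^sub>m 1 + 1\<^sub>m N * X = 0\<^sub>m N 1" using c by auto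
  finally have "det (P * T) = det (1\<^sub>m 1 * 1\<^sub>m 1 + Y * X) * det (- X * 0\<^sub>m 1 N + 1\<^sub>m N * 1\<^sub>m N)"
    by (simp only:) (rule det_four_block_mat_lower_left_zero[of _ 1 _ N], use c in auto)
  also have "det (1\<^sub>m 1 * 1\<^sub>m 1 + Y * X) = 1 + (\<Sum>i<N. x i * y i)"
    unfolding YX by (subst det_single) auto
  also have "- X * 0\<^sub>m 1 N + 1\<^sub>m N * 1\<^sub>m N = 1\<^sub>m N" using c by auto
  finally have 1: "det (P * T) = 1 + (\<Sum>i<N. x i * y i)" by simp
  have "T * P = four_block_mat (1\<^sub>m 1 * 1\<^sub>m 1 + 0\<^sub>m 1 N * - X) (1\<^sub>m 1 * Y + 0\<^sub>m 1 N * 1\<^sub>m N) (X * 1\<^sub>m 1 + 1\<^sub>m N * - X) (X * Y + 1\<^sub>m N * 1\<^sub>m N)"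
    unfolding P_def T_def by (rule mult_four_block_mat) (use c in auto)
  also have "X * 1\<^sub>m 1 + 1\<^sub>m N * - X = 0\<^sub>m N 1" using c by auto
  finally have "det (T * P) = det (1\<^sub>m 1 * 1\<^sub>m 1 + 0\<^sub>m 1 N * - X) * det (X * Y + 1\<^sub>m N * 1\<^sub>m N)"
    by (simp only:) (rule det_four_block_mat_lower_left_zero[of _ 1 _ N], use c in auto)
  also have "1\<^sub>m 1 * 1\<^sub>m 1 + 0\<^sub>m 1 N * - X = 1\<^sub>m 1" using c by auto
  also have "X * Y + 1\<^sub>m N * 1\<^sub>m N = mat N N (\<lambda>(i, j). (if i = j then 1 else 0) + x i * y j)"
    by (rule eq_matI) (auto simp: X_def Y_def scalar_prod_def add.commute)
  finally have 2: "det (T * P) = det (mat N N (\<lambda>(i, j). (if i = j then 1 else 0) + x i * y j))" by simp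
  have "det (P * T) = det (T * P)" by (simp add: det_mult[OF cP(1) cP(2)] det_mult[OF cP(2) cP(1)])
  thus ?thesis using 1 2 by simp
qed

section \<open>Resolvents and traces\<close>

definition spec_mat :: "nat \<Rightarrow> complex mat \<Rightarrow> complex \<Rightarrow> complex mat" where
  "spec_mat N U z = mat N N (\<lambda>(i, j). (if i = j then z else 0) - U $$ (i, j))"

lemma spec_mat_carrier [simp]: "spec_mat N U z \<in> carrier_mat N N"
  by (simp add: spec_mat_def)

lemma poly_char_poly_eq_det:
  assumes "U \<in> carrier_mat N N"
  shows "poly (char_poly U) z = det (spec_mat N U z)"
  unfolding char_poly_matrix[OF assms]
  by (rule arg_cong[of _ _ det], rule eq_matI) (use assms in \<open>auto simp: char_matrix_def spec_mat_def\<close>)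

definition resolvent :: "nat \<Rightarrow> complex mat \<Rightarrow> complex \<Rightarrow> complex mat" where
  "resolvent N U z = inverse (poly (char_poly U) z) \<cdot>\<^sub>m adj_mat (spec_mat N U z)"

lemma resolvent_carrier [simp]: "resolvent N U z \<in> carrier_mat N N"
  using adj_mat(1)[OF spec_mat_carrier[of N U z]] by (simp add: resolvent_def)

lemma resolvent_inverse:
  assumes "U \<in> carrier_mat N N" "poly (char_poly U) z \<noteq> 0"
  shows "spec_mat N U z * resolvent N U z = 1\<^sub>m N" "resolvent N U z * spec_mat N U z = 1\<^sub>m N"
proof -
  note a = adj_mat[OF spec_mat_carrier[of N U z]]
  show "spec_mat N U z * resolvent N U z = 1\<^sub>m N"
    unfolding resolvent_def using a assms
    by (subst mult_smult_distrib[of _ N N _ N]) (auto simp: poly_char_poly_eq_det[OF assms(1)])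
  show "resolvent N U z * spec_mat N U z = 1\<^sub>m N"
    unfolding resolvent_def using a assms
    by (subst mult_smult_assoc_mat[of _ N N _ N]) (auto simp: poly_char_poly_eq_det[OF assms(1)])
qed

text \<open>The matrix \<open>U (z - U)\<^sup>-\<^sup>1\<close>.\<close>

definition res_entry :: "nat \<Rightarrow> complex mat \<Rightarrow> complex \<Rightarrow> nat \<Rightarrow> nat \<Rightarrow> complex" where
  "res_entry N U z i j = z * resolvent N U z $$ (i, j) - (if i = j then 1 else 0)"

lemma mult_index_sum:
  assumes "A \<in> carrier_mat N N" "B \<in> carrier_mat N N" "i < N" "j < N"
  shows "(A * B) $$ (i, j) = (\<Sum>k<N. A $$ (i, k) * (B $$ (k, j) :: complex))"
  using assms by (simp add: times_mat_def scalar_prod_def lessThan_atLeast0)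

lemma res_entry_eq:
  assumes U: "U \<in> carrier_mat N N" "poly (char_poly U) z \<noteq> 0" and ij: "i < N" "j < N"
  shows "res_entry N U z i j = (\<Sum>k<N. U $$ (i, k) * resolvent N U z $$ (k, j))"
proof -
  have "(if i = j then 1 else 0) = (spec_mat N U z * resolvent N U z) $$ (i, j)"
    using ij by (simp add: resolvent_inverse[OF U])
  also have "\<dots> = (\<Sum>k<N. spec_mat N U z $$ (i, k) * resolvent N U z $$ (k, j))"
    by (rule mult_index_sum) (use ij in auto)
  also have "\<dots> = (\<Sum>k<N. (if i = k then z else 0) * resolvent N U z $$ (k, j) - U $$ (i, k) * resolvent N U z $$ (k, j))"
    by (intro sum.cong refl) (use ij in \<open>auto simp: spec_mat_def left_diff_distrib\<close>)
  also have "\<dots> = z * resolvent N U z $$ (i, j) - (\<Sum>k<N. U $$ (i, k) * resolvent N U z $$ (k, j))"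
    using ij by (simp add: sum_subtractf mult_delta_left)
  finally show ?thesis by (simp add: res_entry_def)
qed

text \<open>The derivative of the characteristic polynomial is the sum of the characteristic
  polynomials of the principal submatrices, and these are the diagonal entries of the adjugate that
  enters \<open>resolvent\<close>.\<close>

lemma trace_res_entry:
  assumes U: "U \<in> carrier_mat N N" "poly (char_poly U) z \<noteq> 0"
  shows "(\<Sum>a<N. res_entry N U z a a) = z * poly (pderiv (char_poly U)) z / poly (char_poly U) z - of_nat N"
proof -
  have "poly (pderiv (char_poly U)) z = (\<Sum>i<N. poly (char_poly (mat_delete U i i)) z)"
    by (simp add: pderiv_char_poly[OF U(1)] poly_sum)
  also have "\<dots> = (\<Sum>i<N. adj_mat (spec_mat N U z) $$ (i, i))"
  proof (rule sum.cong[OF refl])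
    fix i assume i: "i \<in> {..<N}"
    have md: "mat_delete U i i \<in> carrier_mat (N - 1) (N - 1)" using mat_delete_carrier[OF U(1)] .
    have "spec_mat (N - 1) (mat_delete U i i) z = mat_delete (spec_mat N U z) i i"
      by (rule eq_matI) (use U(1) i in \<open>auto simp: spec_mat_def mat_delete_def\<close>)
    thus "poly (char_poly (mat_delete U i i)) z = adj_mat (spec_mat N U z) $$ (i, i)"
      using i by (simp add: poly_char_poly_eq_det[OF md] adj_mat_def cofactor_def spec_mat_def)
  qed
  finally have t: "poly (pderiv (char_poly U)) z = (\<Sum>i<N. adj_mat (spec_mat N U z) $$ (i, i))" .
  have "(\<Sum>a<N. res_entry N U z a a) = z * (inverse (poly (char_poly U) z) * (\<Sum>i<N. adj_mat (spec_mat N U z) $$ (i, i))) - of_nat N"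
    using adj_mat(1)[OF spec_mat_carrier[of N U z]]
    by (simp add: res_entry_def resolvent_def sum_subtractf sum_distrib_left)
  thus ?thesis by (simp add: t[symmetric] divide_inverse mult_ac)
qed

text \<open>The resolvent identity: for B = (z - U)^-1 and C = (w - U)^-1 one has (z - w) B C = C -
  B. Taking traces expresses the trace of a product through single traces, in the form of
  \<open>pair_trace\<close>.\<close>

lemma trace_product_res_entry:
  assumes U: "U \<in> carrier_mat N N" "poly (char_poly U) z \<noteq> 0" "poly (char_poly U) w \<noteq> 0" and zw: "z \<noteq> w"
  shows "(\<Sum>a<N. \<Sum>b<N. res_entry N U z a b * res_entry N U w b a) =
     (w * (\<Sum>a<N. res_entry N U w a a) - z * (\<Sum>a<N. res_entry N U z a a)) / (z - w)"
proof -
  define B C where "B = resolvent N U z" and "C = resolvent N U w"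
  have c: "B \<in> carrier_mat N N" "C \<in> carrier_mat N N" by (auto simp: B_def C_def)
  have ent: "(z - w) * (\<Sum>k<N. B $$ (a, k) * C $$ (k, b)) = C $$ (a, b) - B $$ (a, b)" if ab: "a < N" "b < N" for a b
  proof -
    have sp: "spec_mat N U z = spec_mat N U w + (z - w) \<cdot>\<^sub>m 1\<^sub>m N"
      by (rule eq_matI) (auto simp: spec_mat_def)
    have "C = (B * spec_mat N U z) * C" using c by (simp add: B_def resolvent_inverse[OF U(1,2)])
    also have "\<dots> = B * (spec_mat N U z * C)" by (rule assoc_mult_mat[OF c(1) spec_mat_carrier c(2)])
    also have "spec_mat N U z * C = 1\<^sub>m N + (z - w) \<cdot>\<^sub>m C"
    proof -
      have "(spec_mat N U w + (z - w) \<cdot>\<^sub>m 1\<^sub>m N) * C = spec_mat N U w * C + ((z - w) \<cdot>\<^sub>m 1\<^sub>m N) * C"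
        by (rule add_mult_distrib_mat[OF spec_mat_carrier _ c(2)]) auto
      also have "((z - w) \<cdot>\<^sub>m 1\<^sub>m N) * C = (z - w) \<cdot>\<^sub>m C"
        using mult_smult_assoc_mat[of "1\<^sub>m N" N N C N "z - w"] c by simp
      finally show ?thesis unfolding sp by (simp add: C_def resolvent_inverse(1)[OF U(1,3)])
    qed
    also have "B * (1\<^sub>m N + (z - w) \<cdot>\<^sub>m C) = B + (z - w) \<cdot>\<^sub>m (B * C)"
      using c by (subst mult_add_distrib_mat[of _ N N]) (auto simp: mult_smult_distrib[of _ N N _ N])
    finally have e: "C $$ (a, b) = (B + (z - w) \<cdot>\<^sub>m (B * C)) $$ (a, b)" by simp
    have "(B + (z - w) \<cdot>\<^sub>m (B * C)) $$ (a, b) = B $$ (a, b) + (z - w) * (B * C) $$ (a, b)"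
      using c ab by simp
    also have "(B * C) $$ (a, b) = (\<Sum>k<N. B $$ (a, k) * C $$ (k, b))"
      by (rule mult_index_sum[OF c ab])
    finally show ?thesis unfolding e by simp
  qed
  define S where "S = (\<Sum>a<N. \<Sum>b<N. B $$ (a, b) * C $$ (b, a))"
  define tB tC where "tB = (\<Sum>a<N. B $$ (a, a))" and "tC = (\<Sum>a<N. C $$ (a, a))"
  have S: "(z - w) * S = tC - tB"
  proof -
    have "(z - w) * S = (\<Sum>a<N. (z - w) * (\<Sum>b<N. B $$ (a, b) * C $$ (b, a)))"
      by (simp add: S_def sum_distrib_left)
    also have "\<dots> = (\<Sum>a<N. C $$ (a, a) - B $$ (a, a))" by (intro sum.cong refl ent) auto
    finally show ?thesis by (simp add: sum_subtractf tB_def tC_def)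
  qed
  have r: "(\<Sum>a<N. res_entry N U z a a) = z * tB - of_nat N" "(\<Sum>a<N. res_entry N U w a a) = w * tC - of_nat N"
    by (simp_all add: res_entry_def sum_subtractf sum_distrib_left tB_def tC_def B_def C_def)
  have "(\<Sum>a<N. \<Sum>b<N. res_entry N U z a b * res_entry N U w b a) =
     (\<Sum>a<N. \<Sum>b<N. z * w * (B $$ (a, b) * C $$ (b, a)) - (if a = b then z * B $$ (a, b) else 0)
        - (if a = b then w * C $$ (b, a) else 0) + (if a = b then 1 else 0))"
    by (intro sum.cong refl) (auto simp: res_entry_def B_def C_def algebra_simps)
  also have "\<dots> = z * w * S - z * tB - w * tC + of_nat N"
    by (simp add: sum.distrib sum_subtractf S_def tB_def tC_def sum_distrib_left)
  finally have t: "(\<Sum>a<N. \<Sum>b<N. res_entry N U z a b * res_entry N U w b a) = z * w * S - z * tB - w * tC + of_nat N" .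
  have "(z - w) * (\<Sum>a<N. \<Sum>b<N. res_entry N U z a b * res_entry N U w b a) =
     z * w * ((z - w) * S) + (z - w) * (of_nat N - z * tB - w * tC)"
    unfolding t by (simp add: algebra_simps)
  also have "\<dots> = w * (w * tC - of_nat N) - z * (z * tB - of_nat N)"
    unfolding S by (simp add: algebra_simps)
  finally show ?thesis unfolding r using zw by (simp add: field_simps)
qed

text \<open>The complex reflection that multiplies \<open>v\<close> by \<open>\<zeta>\<close> and
  fixes its orthogonal complement. The vector is not normalised, whence the division by its squared
  length.\<close>

definition rank_one_unitary :: "nat \<Rightarrow> (nat \<Rightarrow> complex) \<Rightarrow> complex \<Rightarrow> complex mat" where
  "rank_one_unitary N v \<zeta> = mat N N (\<lambda>(i, j). (if i = j then 1 else 0) +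
     (\<zeta> - 1) / (\<Sum>k<N. v k * cnj (v k)) * v i * cnj (v j))"

lemma rank_one_unitary:
  assumes \<zeta>: "norm \<zeta> = 1" and v: "(\<Sum>k<N. v k * cnj (v k)) \<noteq> 0"
  shows "rank_one_unitary N v \<zeta> \<in> unitary_group N"
proof -
  define s where "s = (\<Sum>k<N. v k * cnj (v k))"
  define c where "c = (\<zeta> - 1) / s"
  have cs: "cnj s = s" by (simp add: s_def mult.commute)
  have zz: "\<zeta> * cnj \<zeta> = 1" using complex_norm_square[of \<zeta>] \<zeta> by simp
  \<comment> \<open>Unitarity reduces to this scalar relation, which says that 1 + c s = \<zeta> has
    modulus 1.\<close>
  have "c + cnj c + c * cnj c * s = 0"
    using v zz unfolding s_def[symmetric] c_def by (simp add: cs field_simps)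
  have "(\<Sum>k<N. ((if i = k then 1 else 0) + c * v i * cnj (v k)) * cnj ((if j = k then 1 else 0) + c * v j * cnj (v k)))
        = (if i = j then 1 else 0)" if ij: "i < N" "j < N" for i j
  proof -
    have "(\<Sum>k<N. ((if i = k then 1 else 0) + c * v i * cnj (v k)) * cnj ((if j = k then 1 else 0) + c * v j * cnj (v k))) =
      (\<Sum>k<N. (if k = i then (if i = j then 1 else 0) else 0) + (if k = i then cnj c * cnj (v j) * v k else 0)
         + (if k = j then c * v i * cnj (v k) else 0) + c * cnj c * v i * cnj (v j) * (v k * cnj (v k)))"
      by (intro sum.cong refl) (auto simp: algebra_simps)
    also have "\<dots> = (if i = j then 1 else 0) + (c + cnj c + c * cnj c * s) * (v i * cnj (v j))"
      using ij by (simp add: sum.distrib s_def flip: sum_distrib_left) (simp add: algebra_simps)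
    finally show ?thesis using \<open>c + cnj c + c * cnj c * s = 0\<close> by simp
  qed
  thus ?thesis
    by (subst unitary_iff) (auto simp: rank_one_unitary_def c_def s_def mult.assoc)
qed

lemma det_rank_one_unitary:
  assumes v: "(\<Sum>k<N. v k * cnj (v k)) \<noteq> 0"
  shows "det (rank_one_unitary N v \<zeta>) = \<zeta>"
proof -
  define s where "s = (\<Sum>k<N. v k * cnj (v k))"
  have "det (rank_one_unitary N v \<zeta>) = 1 + (\<Sum>i<N. ((\<zeta> - 1) / s * v i) * cnj (v i))"
    unfolding rank_one_unitary_def s_def by (rule det_one_plus_outer)
  also have "\<dots> = 1 + (\<zeta> - 1) / s * s" by (simp add: s_def sum_distrib_left mult.assoc)
  finally show ?thesis using v by (simp add: s_def)
qed

text \<open>The Rayleigh quotient of U (z - U)^-1 at \<open>v\<close>.\<close>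

definition res_form :: "nat \<Rightarrow> (nat \<Rightarrow> complex) \<Rightarrow> complex mat \<Rightarrow> complex \<Rightarrow> complex" where
  "res_form N v U z = (\<Sum>a<N. \<Sum>b<N. cnj (v a) * res_entry N U z a b * v b) / (\<Sum>k<N. v k * cnj (v k))"

text \<open>With V the reflection, z - V U factors as W (z - U), where W is the identity plus the
  outer product of - c v and the row vector y obtained by applying the adjoint of v to U (z - U)^-1.
  The matrix determinant lemma evaluates det W.\<close>

lemma char_poly_rank_one_mult:
  assumes U: "U \<in> carrier_mat N N" "poly (char_poly U) z \<noteq> 0"
  shows "poly (char_poly (rank_one_unitary N v \<zeta> * U)) z =
     poly (char_poly U) z * (1 - (\<zeta> - 1) * res_form N v U z)"
proof -
  define s where "s = (\<Sum>k<N. v k * cnj (v k))"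
  define c where "c = (\<zeta> - 1) / s"
  define V where "V = rank_one_unitary N v \<zeta>"
  define y where "y = (\<lambda>j. \<Sum>b<N. cnj (v b) * res_entry N U z b j)"
  define W where "W = mat N N (\<lambda>(i, j). (if i = j then 1 else 0) + (- c * v i) * y j)"
  have V: "V \<in> carrier_mat N N" and W: "W \<in> carrier_mat N N" by (auto simp: V_def rank_one_unitary_def W_def)
  have VU: "V * U \<in> carrier_mat N N" using V U by auto
  have yA: "(\<Sum>k<N. y k * spec_mat N U z $$ (k, j)) = (\<Sum>b<N. cnj (v b) * U $$ (b, j))" if j: "j < N" for j
  proof -
    have "(\<Sum>k<N. res_entry N U z b k * spec_mat N U z $$ (k, j)) = U $$ (b, j)" if b: "b < N" for b
    proof -
      have "(\<Sum>k<N. res_entry N U z b k * spec_mat N U z $$ (k, j)) =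
          (\<Sum>k<N. (U * resolvent N U z) $$ (b, k) * spec_mat N U z $$ (k, j))"
        by (intro sum.cong refl) (use U b in \<open>auto simp: res_entry_eq[OF U] mult_index_sum[OF U(1) resolvent_carrier]\<close>)
      also have "\<dots> = ((U * resolvent N U z) * spec_mat N U z) $$ (b, j)"
        by (rule mult_index_sum[symmetric]) (use U b j in auto)
      also have "(U * resolvent N U z) * spec_mat N U z = U"
        using U by (simp add: assoc_mult_mat[OF U(1) resolvent_carrier spec_mat_carrier] resolvent_inverse[OF U])
      finally show ?thesis .
    qed
    hence "(\<Sum>b<N. cnj (v b) * (\<Sum>k<N. res_entry N U z b k * spec_mat N U z $$ (k, j))) = (\<Sum>b<N. cnj (v b) * U $$ (b, j))"
      by simp
    moreover have "(\<Sum>k<N. y k * spec_mat N U z $$ (k, j)) = (\<Sum>b<N. cnj (v b) * (\<Sum>k<N. res_entry N U z b k * spec_mat N U z $$ (k, j)))"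
      unfolding y_def sum_distrib_right sum_distrib_left by (subst sum.swap) (simp add: mult.assoc)
    ultimately show ?thesis by simp
  qed
  have "spec_mat N (V * U) z = W * spec_mat N U z"
  proof (rule eq_matI)
    fix i j assume "i < dim_row (W * spec_mat N U z)" "j < dim_col (W * spec_mat N U z)"
    hence ij: "i < N" "j < N" using W by (auto simp: spec_mat_def)
    have "(W * spec_mat N U z) $$ (i, j) = (\<Sum>k<N. ((if i = k then 1 else 0) + (- c * v i) * y k) * spec_mat N U z $$ (k, j))"
      using ij by (subst mult_index_sum[OF W spec_mat_carrier ij]) (auto simp: W_def intro!: sum.cong)
    also have "\<dots> = spec_mat N U z $$ (i, j) - c * v i * (\<Sum>k<N. y k * spec_mat N U z $$ (k, j))"
      using ij by (simp add: left_diff_distrib distrib_right sum.distrib mult_delta_left sum_distrib_left sum_subtractf sum_negf mult.assoc)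
    also have "\<dots> = (if i = j then z else 0) - (U $$ (i, j) + c * v i * (\<Sum>b<N. cnj (v b) * U $$ (b, j)))"
      unfolding yA[OF ij(2)] using ij by (simp add: spec_mat_def)
    also have "U $$ (i, j) + c * v i * (\<Sum>b<N. cnj (v b) * U $$ (b, j)) = (V * U) $$ (i, j)"
    proof -
      have "(V * U) $$ (i, j) = (\<Sum>k<N. ((if i = k then 1 else 0) + c * v i * cnj (v k)) * U $$ (k, j))"
        by (subst mult_index_sum[OF V U(1) ij]) (use ij in \<open>auto simp: V_def rank_one_unitary_def c_def s_def intro!: sum.cong\<close>)
      thus ?thesis using ij by (simp add: distrib_right sum.distrib mult_delta_left sum_distrib_left mult.assoc)
    qed
    finally show "spec_mat N (V * U) z $$ (i, j) = (W * spec_mat N U z) $$ (i, j)"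
      using ij by (simp add: spec_mat_def)
  qed (use W in \<open>auto simp: spec_mat_def\<close>)
  hence "poly (char_poly (V * U)) z = det W * poly (char_poly U) z"
    by (simp add: poly_char_poly_eq_det[OF VU] poly_char_poly_eq_det[OF U(1)] det_mult[OF W spec_mat_carrier])
  also have "det W = 1 + (\<Sum>i<N. (- c * v i) * y i)"
    unfolding W_def by (rule det_one_plus_outer)
  also have "(\<Sum>i<N. (- c * v i) * y i) = - ((\<zeta> - 1) * res_form N v U z)"
  proof -
    have "(\<Sum>i<N. v i * y i) = (\<Sum>a<N. \<Sum>b<N. cnj (v a) * res_entry N U z a b * v b)"
      unfolding y_def sum_distrib_left by (subst sum.swap) (simp add: mult_ac)
    moreover have "(\<Sum>i<N. (- c * v i) * y i) = - c * (\<Sum>i<N. v i * y i)"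
      by (simp add: sum_distrib_left mult.assoc)
    ultimately show ?thesis by (simp add: res_form_def c_def s_def)
  qed
  finally show ?thesis by (simp add: V_def algebra_simps)
qed

section \<open>Haar integrals over the unitary group\<close>

locale haar_unitary = prob_space M for M :: "complex mat measure" and N :: nat +
  assumes sets_haar: "sets M = sets (unitary_borel N)"
    and left_invariant: "V \<in> unitary_group N \<Longrightarrow> distr M M (\<lambda>U. V * U) = M"

lemma haar_unitaryI: "haar_prob_measure N M \<Longrightarrow> haar_unitary M N"
  by (auto simp: haar_prob_measure_def haar_unitary_def haar_unitary_axioms_def)

context haar_unitary
begin

lemma space_haar: "space M = unitary_group N"
  using sets_eq_imp_space_eq[OF sets_haar] by (simp add: unitary_borel_def)

lemma entry_map_measurable:
  "(\<lambda>U. \<lambda>(i, j)\<in>{..<N} \<times> {..<N}. U $$ (i, j)) \<in> M \<rightarrow>\<^sub>M (\<Pi>\<^sub>M _\<in>{..<N} \<times> {..<N}. (borel :: complex measure))"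
  unfolding measurable_cong_sets[OF sets_haar refl] unitary_borel_def
  by (rule measurable_vimage_algebra1) (auto simp: space_PiM)

lemma entry_measurable:
  assumes "i < N" "j < N"
  shows "(\<lambda>U. U $$ (i, j)) \<in> borel_measurable M"
proof -
  have "(\<lambda>U. (\<lambda>(i, j)\<in>{..<N} \<times> {..<N}. U $$ (i, j)) (i, j)) \<in> borel_measurable M"
    by (rule measurable_compose[OF entry_map_measurable measurable_component_singleton]) (use assms in auto)
  thus ?thesis using assms by simp
qed

lemma mult_measurable:
  assumes V: "V \<in> unitary_group N"
  shows "(\<lambda>U. V * U) \<in> M \<rightarrow>\<^sub>M M"
proof -
  have Vc: "V \<in> carrier_mat N N" using V by (simp add: unitary_group_def)
  have "(\<lambda>U. V * U) \<in> M \<rightarrow>\<^sub>M unitary_borel N"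
    unfolding unitary_borel_def
  proof (rule measurable_vimage_algebra2)
    show "(\<lambda>U. V * U) \<in> space M \<rightarrow> unitary_group N"
      using unitary_mult[OF V] by (auto simp: space_haar)
    have "(\<lambda>U. \<lambda>x\<in>{..<N} \<times> {..<N}. \<Sum>k<N. V $$ (fst x, k) * U $$ (k, snd x)) \<in>
        M \<rightarrow>\<^sub>M (\<Pi>\<^sub>M _\<in>{..<N} \<times> {..<N}. (borel :: complex measure))"
      by (rule measurable_restrict) (intro borel_measurable_sum borel_measurable_times borel_measurable_const entry_measurable, auto)
    moreover have "(\<lambda>U. \<lambda>x\<in>{..<N} \<times> {..<N}. \<Sum>k<N. V $$ (fst x, k) * U $$ (k, snd x)) \<in>
        M \<rightarrow>\<^sub>M (\<Pi>\<^sub>M _\<in>{..<N} \<times> {..<N}. (borel :: complex measure)) \<longleftrightarrow>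
      (\<lambda>U. \<lambda>(i, j)\<in>{..<N} \<times> {..<N}. (V * U) $$ (i, j)) \<in>
        M \<rightarrow>\<^sub>M (\<Pi>\<^sub>M _\<in>{..<N} \<times> {..<N}. (borel :: complex measure))"
    proof (rule measurable_cong, rule restrict_ext)
      fix U x assume U: "U \<in> space M" and x: "x \<in> {..<N} \<times> {..<N}"
      have Uc: "U \<in> carrier_mat N N" using U by (simp add: space_haar unitary_group_def)
      obtain i j where [simp]: "x = (i, j)" by (cases x)
      show "(\<Sum>k<N. V $$ (fst x, k) * U $$ (k, snd x)) = (case x of (i, j) \<Rightarrow> (V * U) $$ (i, j))"
        using mult_index_sum[OF Vc Uc, of i j] x by simp
    qed
    ultimately show "(\<lambda>U. \<lambda>(i, j)\<in>{..<N} \<times> {..<N}. (V * U) $$ (i, j)) \<in>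
        M \<rightarrow>\<^sub>M (\<Pi>\<^sub>M _\<in>{..<N} \<times> {..<N}. (borel :: complex measure))"
      by simp
  qed
  thus ?thesis by (simp add: measurable_cong_sets[OF refl sets_haar])
qed

lemma integral_left_mult:
  fixes f :: "complex mat \<Rightarrow> complex"
  assumes "V \<in> unitary_group N" "f \<in> borel_measurable M"
  shows "(\<integral>U. f (V * U) \<partial>M) = (\<integral>U. f U \<partial>M)"
  using integral_distr[OF mult_measurable[OF assms(1)] assms(2)] left_invariant[OF assms(1)] by simp

text \<open>On a probability space a bounded measurable function is integrable. Eigenvalues of
  modulus 1 and test points of modulus at least 2 make all integrands bounded, so this one
  predicate, closed under algebraic operations, carries all integrability arguments.\<close>

definition bdd :: "(complex mat \<Rightarrow> complex) \<Rightarrow> bool" where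
  "bdd f \<longleftrightarrow> f \<in> borel_measurable M \<and> (\<exists>B. \<forall>U\<in>space M. norm (f U) \<le> B)"

lemma bdd_integrable: "bdd f \<Longrightarrow> integrable M f"
  unfolding bdd_def by (elim conjE exE, rule integrable_const_bound) auto

lemma bdd_measurable: "bdd f \<Longrightarrow> f \<in> borel_measurable M"
  by (simp add: bdd_def)

lemma bdd_const: "bdd (\<lambda>_. c)"
  unfolding bdd_def by (intro conjI borel_measurable_const exI[of _ "norm c"]) simp

lemma bdd_add: "bdd f \<Longrightarrow> bdd g \<Longrightarrow> bdd (\<lambda>U. f U + g U)"
proof -
  assume f: "bdd f" and g: "bdd g"
  then obtain A B where "\<forall>U\<in>space M. norm (f U) \<le> A" "\<forall>U\<in>space M. norm (g U) \<le> B" by (auto simp: bdd_def)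
  hence "\<forall>U\<in>space M. norm (f U + g U) \<le> A + B" by (auto intro!: norm_triangle_le add_mono)
  thus ?thesis using f g unfolding bdd_def by (auto intro: borel_measurable_add)
qed

lemma bdd_mult: "bdd f \<Longrightarrow> bdd g \<Longrightarrow> bdd (\<lambda>U. f U * g U)"
proof -
  assume f: "bdd f" and g: "bdd g"
  then obtain A B where *: "\<And>U. U \<in> space M \<Longrightarrow> norm (f U) \<le> A" "\<And>U. U \<in> space M \<Longrightarrow> norm (g U) \<le> B" by (auto simp: bdd_def)
  have "norm (f U * g U) \<le> A * B" if "U \<in> space M" for U
    unfolding norm_mult using * that order_trans[OF norm_ge_zero *(1)[OF that]] by (intro mult_mono) auto
  thus ?thesis using f g unfolding bdd_def by (auto intro: borel_measurable_times)
qed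

lemma bdd_sum: "(\<And>x. x \<in> S \<Longrightarrow> bdd (f x)) \<Longrightarrow> bdd (\<lambda>U. \<Sum>x\<in>S. f x U)"
  by (induction S rule: infinite_finite_induct) (simp_all add: bdd_const bdd_add)

lemma bdd_prod: "(\<And>x. x \<in> S \<Longrightarrow> bdd (f x)) \<Longrightarrow> bdd (\<lambda>U. \<Prod>x\<in>S. f x U)"
  by (induction S rule: infinite_finite_induct) (simp_all add: bdd_const bdd_mult)

lemma bdd_uminus: "bdd f \<Longrightarrow> bdd (\<lambda>U. - f U)"
  using bdd_mult[OF bdd_const[of "-1"], of f] by simp

lemma bdd_diff: "bdd f \<Longrightarrow> bdd g \<Longrightarrow> bdd (\<lambda>U. f U - g U)"
  unfolding diff_conv_add_uminus by (intro bdd_add bdd_uminus)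

lemma bdd_power: "bdd f \<Longrightarrow> bdd (\<lambda>U. f U ^ n)"
  by (induction n) (simp_all add: bdd_const bdd_mult)

lemma integral_bdd_sum:
  "(\<And>x. x \<in> S \<Longrightarrow> bdd (f x)) \<Longrightarrow> (\<integral>U. (\<Sum>x\<in>S. f x U) \<partial>M) = (\<Sum>x\<in>S. \<integral>U. f x U \<partial>M)"
  by (rule Bochner_Integration.integral_sum) (rule bdd_integrable)

text \<open>Measurability of a polynomial-valued map, taken coefficientwise. It is stable under sums
  and products, so the Leibniz expansion of the determinant yields it for
  \<open>char_poly\<close>.\<close>

definition coeffs_measurable :: "(complex mat \<Rightarrow> complex poly) \<Rightarrow> bool" where
  "coeffs_measurable f \<longleftrightarrow> (\<forall>m. (\<lambda>U. coeff (f U) m) \<in> borel_measurable M)"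

lemma coeffs_measurable_mult:
  "coeffs_measurable f \<Longrightarrow> coeffs_measurable g \<Longrightarrow> coeffs_measurable (\<lambda>U. f U * g U)"
  by (auto simp: coeffs_measurable_def coeff_mult intro!: borel_measurable_sum borel_measurable_times)

lemma coeffs_measurable_prod:
  "(\<And>x. x \<in> S \<Longrightarrow> coeffs_measurable (f x)) \<Longrightarrow> coeffs_measurable (\<lambda>U. \<Prod>x\<in>S. f x U)"
proof (induction S rule: infinite_finite_induct)
  case (insert x F)
  thus ?case by (simp add: coeffs_measurable_mult)
qed (auto simp: coeffs_measurable_def)

lemma coeffs_measurable_sum:
  "(\<And>x. x \<in> S \<Longrightarrow> coeffs_measurable (f x)) \<Longrightarrow> coeffs_measurable (\<lambda>U. \<Sum>x\<in>S. f x U)"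
  by (auto simp: coeffs_measurable_def coeff_sum intro!: borel_measurable_sum)

lemma coeffs_measurable_char_poly: "coeffs_measurable char_poly"
proof -
  define e where "e = (\<lambda>i j (U :: complex mat). if i = j then [:- U $$ (i, j), 1:] else [:- U $$ (i, j):])"
  have e: "coeffs_measurable (e i j)" if "i < N" "j < N" for i j
  proof -
    have "(\<lambda>U. coeff (e i j U) m) \<in> borel_measurable M" for m
      using entry_measurable[OF that] by (cases m; cases "i = j"; cases "m - 1") (auto simp: e_def coeff_pCons split: nat.splits)
    thus ?thesis by (simp add: coeffs_measurable_def)
  qed
  have meas: "coeffs_measurable (\<lambda>U. \<Sum>\<sigma> | \<sigma> permutes {0..<N}. of_int (sign \<sigma>) * (\<Prod>i=0..<N. e i (\<sigma> i) U))"
  proof (intro coeffs_measurable_sum coeffs_measurable_mult coeffs_measurable_prod)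
    fix \<sigma> i assume "\<sigma> \<in> {\<sigma>. \<sigma> permutes {0..<N}}" "i \<in> {0..<N}"
    thus "coeffs_measurable (e i (\<sigma> i))" using permutes_in_image[of \<sigma> "{0..<N}" i] by (intro e) auto
  qed (auto simp: coeffs_measurable_def)
  have eq: "char_poly U = (\<Sum>\<sigma> | \<sigma> permutes {0..<N}. of_int (sign \<sigma>) * (\<Prod>i=0..<N. e i (\<sigma> i) U))"
    if U: "U \<in> space M" for U
  proof -
    have Uc: "U \<in> carrier_mat N N" using U by (simp add: space_haar unitary_group_def)
    have "char_poly U = (\<Sum>\<sigma> | \<sigma> permutes {0..<N}. of_int (sign \<sigma>) * (\<Prod>i=0..<N. char_poly_matrix U $$ (i, \<sigma> i)))"
      unfolding char_poly_def by (rule det_def') (use Uc in auto)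
    also have "\<dots> = (\<Sum>\<sigma> | \<sigma> permutes {0..<N}. of_int (sign \<sigma>) * (\<Prod>i=0..<N. e i (\<sigma> i) U))"
    proof (intro sum.cong refl arg_cong2[of _ _ _ _ "(*)"] prod.cong)
      fix \<sigma> i assume "\<sigma> \<in> {\<sigma>. \<sigma> permutes {0..<N}}" "i \<in> {0..<N}"
      hence "i < N" "\<sigma> i < N" using permutes_in_image[of \<sigma> "{0..<N}" i] by auto
      thus "char_poly_matrix U $$ (i, \<sigma> i) = e i (\<sigma> i) U"
        using Uc by (auto simp: char_poly_matrix_def e_def)
    qed
    finally show ?thesis .
  qed
  show ?thesis
    unfolding coeffs_measurable_def
  proof
    fix m
    have "(\<lambda>U. coeff (char_poly U) m) \<in> borel_measurable M \<longleftrightarrow>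
      (\<lambda>U. coeff (\<Sum>\<sigma> | \<sigma> permutes {0..<N}. of_int (sign \<sigma>) * (\<Prod>i=0..<N. e i (\<sigma> i) U)) m) \<in> borel_measurable M"
      by (rule measurable_cong) (simp only: eq)
    thus "(\<lambda>U. coeff (char_poly U) m) \<in> borel_measurable M"
      using meas by (simp add: coeffs_measurable_def)
  qed
qed

lemma bdd_coeff_char_poly: "bdd (\<lambda>U. coeff (char_poly U) m)"
  using coeffs_measurable_char_poly norm_coeff_char_poly_unitary
  unfolding bdd_def coeffs_measurable_def space_haar by blast

lemma bdd_cong: "(\<And>U. U \<in> unitary_group N \<Longrightarrow> f U = g U) \<Longrightarrow> bdd f \<longleftrightarrow> bdd g"
proof -
  assume *: "\<And>U. U \<in> unitary_group N \<Longrightarrow> f U = g U"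
  have "f \<in> borel_measurable M \<longleftrightarrow> g \<in> borel_measurable M"
    by (rule measurable_cong) (simp add: * space_haar)
  thus ?thesis using * by (auto simp: bdd_def space_haar)
qed

lemma degree_char_poly_unitary: "U \<in> unitary_group N \<Longrightarrow> degree (char_poly U) = N"
  using degree_monic_char_poly[of U N] by (simp add: unitary_group_def)

lemma bdd_poly_char_poly: "bdd (\<lambda>U. poly (char_poly U) z)"
proof (subst bdd_cong)
  fix U assume "U \<in> unitary_group N"
  thus "poly (char_poly U) z = (\<Sum>m\<le>N. coeff (char_poly U) m * z ^ m)"
    by (simp add: poly_altdef degree_char_poly_unitary)
qed (intro bdd_sum bdd_mult bdd_const bdd_coeff_char_poly)

lemma det_unitary_coeff:
  assumes "U \<in> unitary_group N"
  shows "det U = (-1) ^ N * coeff (char_poly U) 0"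
proof -
  have c: "U \<in> carrier_mat N N" using assms by (simp add: unitary_group_def)
  have "coeff (char_poly U) 0 = det (spec_mat N U 0)"
    using poly_char_poly_eq_det[OF c, of 0] by (simp add: poly_0_coeff_0)
  also have "spec_mat N U 0 = (-1) \<cdot>\<^sub>m U"
    by (rule eq_matI) (use c in \<open>auto simp: spec_mat_def\<close>)
  also have "det ((-1) \<cdot>\<^sub>m U) = (-1) ^ N * det U" using c by simp
  finally show ?thesis by (simp flip: power_add mult.assoc add: mult_2[symmetric])
qed

lemma bdd_cnj: "bdd f \<Longrightarrow> bdd (\<lambda>U. cnj (f U))"
  unfolding bdd_def complex_mod_cnj
  by (elim conjE, intro conjI, rule measurable_compose[OF _ borel_measurable_continuous_onI])
     (auto intro!: continuous_intros)

lemma bdd_cnj_det: "bdd (\<lambda>U. cnj (det U))"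
proof (subst bdd_cong)
  fix U assume "U \<in> unitary_group N"
  thus "cnj (det U) = cnj ((-1) ^ N * coeff (char_poly U) 0)" by (simp only: det_unitary_coeff)
qed (intro bdd_cnj bdd_mult bdd_const bdd_coeff_char_poly)

text \<open>The reflection with \<zeta> = -1 expresses the Rayleigh quotient through a quotient of
  two values of characteristic polynomials. These are bounded above, and the denominator is bounded
  away from 0 since \<open>norm z \<ge> 2\<close>.\<close>

lemma bdd_res_form:
  assumes z: "norm z \<ge> 2" and v: "(\<Sum>k<N. v k * cnj (v k)) \<noteq> 0"
  shows "bdd (\<lambda>U. res_form N v U z)"
proof -
  define V where "V = rank_one_unitary N v (-1)"
  have V: "V \<in> unitary_group N" unfolding V_def by (rule rank_one_unitary) (use v in auto)
  have neq: "poly (char_poly U) z \<noteq> 0" if "U \<in> unitary_group N" for U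
    using char_poly_unitary_neq_0[OF that] z by auto
  have VU: "bdd (\<lambda>U. poly (char_poly (V * U)) z)"
  proof -
    have m: "(\<lambda>U. poly (char_poly U) z) \<in> borel_measurable M" by (rule bdd_measurable[OF bdd_poly_char_poly])
    have "(\<lambda>U. poly (char_poly (V * U)) z) \<in> borel_measurable M"
      by (rule measurable_compose[OF mult_measurable[OF V] m])
    thus ?thesis using norm_char_poly_unitary_upper[OF unitary_mult[OF V]] unfolding bdd_def space_haar by blast
  qed
  have inv: "bdd (\<lambda>U. inverse (poly (char_poly U) z))"
  proof -
    have m: "(\<lambda>U. poly (char_poly U) z) \<in> borel_measurable M" by (rule bdd_measurable[OF bdd_poly_char_poly])
    have "(\<lambda>U. inverse (poly (char_poly U) z)) \<in> borel_measurable M"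
      using m by measurable
    moreover have "norm (inverse (poly (char_poly U) z)) \<le> 1" if "U \<in> space M" for U
      using norm_char_poly_unitary_lower[of U N z] that z
      by (simp add: space_haar norm_inverse inverse_le_1_iff)
    ultimately show ?thesis unfolding bdd_def by blast
  qed
  have "bdd (\<lambda>U. (poly (char_poly (V * U)) z * inverse (poly (char_poly U) z) - 1) * (1 / 2))"
    by (intro bdd_mult bdd_diff VU inv bdd_const)
  moreover have E: "res_form N v U z = (poly (char_poly (V * U)) z * inverse (poly (char_poly U) z) - 1) * (1 / 2)"
    if "U \<in> unitary_group N" for U
    using char_poly_rank_one_mult[of U N z v "-1"] neq[OF that] that
    by (simp add: V_def unitary_group_def field_simps)
  ultimately show ?thesis
    using bdd_cong[of "\<lambda>U. res_form N v U z" "\<lambda>U. (poly (char_poly (V * U)) z * inverse (poly (char_poly U) z) - 1) * (1 / 2)", OF E]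
    by blast
qed

end

section \<open>Moment identities from complex reflections\<close>

lemma coeff_prod_linear:
  fixes t :: "nat \<Rightarrow> complex"
  shows "coeff (\<Prod>i<n. [:1, - t i:]) 0 = 1"
    and "coeff (\<Prod>i<n. [:1, - t i:]) 1 = - (\<Sum>i<n. t i)"
    and "coeff (\<Prod>i<n. [:1, - t i:]) 2 = esym2 n t"
proof -
  define p where "p = (\<lambda>n. \<Prod>i<n. [:1, - t i:])"
  have s: "p (Suc n) = p n + pCons 0 (Polynomial.smult (- t n) (p n))" for n
    by (simp add: p_def mult.commute[of _ "[:1, - t n:]"])
  have 0: "coeff (p n) 0 = 1" for n by (induction n) (simp_all add: s, simp add: p_def)
  have 1: "coeff (p n) 1 = - (\<Sum>i<n. t i)" for n
    by (induction n) (simp_all add: s 0, simp add: p_def)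
  have 2: "coeff (p n) 2 = esym2 n t" for n
  proof (induction n)
    case 0
    show ?case by (simp add: p_def esym2_def)
  next
    case (Suc n)
    have "coeff (p (Suc n)) 2 = coeff (p n) 2 - t n * coeff (p n) 1"
      by (simp add: s numeral_2_eq_2)
    thus ?case by (simp add: Suc 1[unfolded One_nat_def] esym2_def sum_distrib_right sum_distrib_left mult.commute)
  qed
  show "coeff (\<Prod>i<n. [:1, - t i:]) 0 = 1" "coeff (\<Prod>i<n. [:1, - t i:]) 1 = - (\<Sum>i<n. t i)"
    "coeff (\<Prod>i<n. [:1, - t i:]) 2 = esym2 n t"
    using 0 1 2 by (auto simp: p_def)
qed

text \<open>Supplies enough values of \<zeta> - 1 to compare coefficients of polynomials in it. The
  angles 1 / (n + 1) lie in [0, pi], where the cosine is injective.\<close>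

lemma infinite_unit_circle_shift: "infinite {\<zeta> - 1 |\<zeta>::complex. norm \<zeta> = 1}"
proof -
  have "infinite (range (\<lambda>n::nat. cis (1 / real (Suc n)) - 1))"
  proof (rule range_inj_infinite, rule injI)
    fix m n :: nat assume "cis (1 / real (Suc m)) - 1 = cis (1 / real (Suc n)) - 1"
    hence "cos (1 / real (Suc m)) = cos (1 / real (Suc n))" by (auto simp: complex_eq_iff)
    moreover have "1 / real (Suc n) \<le> pi" for n 
    proof -
      have "1 / real (Suc n) \<le> 1" by simp
      thus ?thesis using pi_gt3 by linarith
    qed
    ultimately have "1 / real (Suc m) = 1 / real (Suc n)" by (intro cos_inj_pi[of "1 / real (Suc m)" "1 / real (Suc n)"]) simp_all
    thus "m = n" by simp
  qed
  moreover have "range (\<lambda>n::nat. cis (1 / real (Suc n)) - 1) \<subseteq> {\<zeta> - 1 |\<zeta>::complex. norm \<zeta> = 1}"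
    using norm_cis by blast
  ultimately show ?thesis using infinite_super by blast
qed

context haar_unitary
begin

lemma bdd_coeff_prod:
  assumes "\<And>x k. x \<in> S \<Longrightarrow> bdd (\<lambda>U. coeff (f x U) k)"
  shows "bdd (\<lambda>U. coeff (\<Prod>x\<in>S. f x U) k)"
  using assms
proof (induction S arbitrary: k rule: infinite_finite_induct)
  case (insert x F)
  have "bdd (\<lambda>U. coeff (f x U * (\<Prod>x\<in>F. f x U)) k)"
    unfolding coeff_mult using insert by (intro bdd_sum bdd_mult) auto
  thus ?case using insert by simp
qed (simp_all add: bdd_const)

definition det_weight :: "nat \<Rightarrow> complex mat \<Rightarrow> complex" where
  "det_weight q U = cnj (det U) ^ q"

lemma bdd_det_weight: "bdd (det_weight q)"
  unfolding det_weight_def[abs_def] by (intro bdd_power bdd_cnj_det)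

definition char_prod :: "nat \<Rightarrow> (nat \<Rightarrow> complex) \<Rightarrow> complex mat \<Rightarrow> complex" where
  "char_prod n z U = (\<Prod>i<n. poly (char_poly U) (z i))"

lemma bdd_char_prod: "bdd (char_prod n z)"
  unfolding char_prod_def[abs_def] by (intro bdd_prod bdd_poly_char_poly)

definition char_moment :: "nat \<Rightarrow> nat \<Rightarrow> (nat \<Rightarrow> complex) \<Rightarrow> complex" where
  "char_moment n q z = (\<integral>U. det_weight q U * char_prod n z U \<partial>M)"

context
  fixes n q :: nat and z v :: "nat \<Rightarrow> complex"
  assumes z: "\<And>i. i < n \<Longrightarrow> norm (z i) \<ge> 2" and v: "(\<Sum>k<N. v k * cnj (v k)) \<noteq> 0"
begin

text \<open>Under left multiplication by the reflection the weight contributes the conjugate of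
  \<zeta> to the power q. Since \<open>norm \<zeta> = 1\<close>, it moves to the other side as
  \<open>\<zeta> ^ q\<close>, after which both sides are polynomials in \<zeta> - 1.\<close>

lemma integral_rank_one:
  assumes \<zeta>: "norm \<zeta> = 1"
  shows "(\<integral>U. det_weight q U * char_prod n z U * (\<Prod>i<n. 1 - (\<zeta> - 1) * res_form N v U (z i)) \<partial>M) =
     \<zeta> ^ q * char_moment n q z"
proof -
  define V where "V = rank_one_unitary N v \<zeta>"
  have V: "V \<in> unitary_group N" unfolding V_def by (rule rank_one_unitary[OF \<zeta> v])
  have zz: "\<zeta> * cnj \<zeta> = 1" using complex_norm_square[of \<zeta>] \<zeta> by simp
  have "char_moment n q z = (\<integral>U. det_weight q (V * U) * char_prod n z (V * U) \<partial>M)"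
    unfolding char_moment_def
    by (rule integral_left_mult[OF V, symmetric]) (rule bdd_measurable[OF bdd_mult[OF bdd_det_weight bdd_char_prod]])
  also have "\<dots> = (\<integral>U. cnj \<zeta> ^ q * (det_weight q U * char_prod n z U * (\<Prod>i<n. 1 - (\<zeta> - 1) * res_form N v U (z i))) \<partial>M)"
  proof (rule Bochner_Integration.integral_cong[OF refl])
    fix U assume "U \<in> space M"
    hence U: "U \<in> unitary_group N" by (simp add: space_haar)
    have Uc: "U \<in> carrier_mat N N" "V \<in> carrier_mat N N" using U V by (auto simp: unitary_group_def)
    have "det (V * U) = \<zeta> * det U"
      unfolding det_mult[OF Uc(2,1)] using det_rank_one_unitary[OF v, of \<zeta>] by (simp add: V_def)
    moreover have "poly (char_poly (V * U)) (z i) = poly (char_poly U) (z i) * (1 - (\<zeta> - 1) * res_form N v U (z i))"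
      if "i < n" for i
      unfolding V_def using z[OF that] by (intro char_poly_rank_one_mult[OF Uc(1)] char_poly_unitary_neq_0[OF U]) auto
    ultimately show "det_weight q (V * U) * char_prod n z (V * U) =
       cnj \<zeta> ^ q * (det_weight q U * char_prod n z U * (\<Prod>i<n. 1 - (\<zeta> - 1) * res_form N v U (z i)))"
      by (simp add: det_weight_def char_prod_def power_mult_distrib prod.distrib)
  qed
  also have "\<dots> = cnj \<zeta> ^ q * (\<integral>U. det_weight q U * char_prod n z U * (\<Prod>i<n. 1 - (\<zeta> - 1) * res_form N v U (z i)) \<partial>M)"
    by (rule integral_mult_right_zero)
  finally have "\<zeta> ^ q * char_moment n q z = (\<zeta> * cnj \<zeta>) ^ q * (\<integral>U. det_weight q U * char_prod n z U * (\<Prod>i<n. 1 - (\<zeta> - 1) * res_form N v U (z i)) \<partial>M)"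
    by (simp add: power_mult_distrib mult.assoc)
  thus ?thesis by (simp add: zz)
qed

lemma bdd_res_coeff: "bdd (\<lambda>U. det_weight q U * char_prod n z U * coeff (\<Prod>i<n. [:1, - res_form N v U (z i):]) k)"
proof (intro bdd_mult bdd_det_weight bdd_char_prod bdd_coeff_prod)
  fix i k assume "i \<in> {..<n}"
  hence b: "bdd (\<lambda>U. - res_form N v U (z i))" using z v by (intro bdd_uminus bdd_res_form) auto
  show "bdd (\<lambda>U. coeff [:1, - res_form N v U (z i):] k)"
  proof (cases k)
    case (Suc k')
    thus ?thesis using b by (cases k') (simp_all add: bdd_const)
  qed (simp add: bdd_const)
qed

text \<open>With w = \<zeta> - 1 both sides of \<open>integral_rank_one\<close> are polynomials in w
  that agree at infinitely many points; (1 + w)^q supplies the binomial coefficient.\<close>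

lemma integral_res_coeff:
  "(\<integral>U. det_weight q U * char_prod n z U * coeff (\<Prod>i<n. [:1, - res_form N v U (z i):]) k \<partial>M) =
     of_nat (q choose k) * char_moment n q z"
proof -
  define I where "I = (\<lambda>k. \<integral>U. det_weight q U * char_prod n z U * coeff (\<Prod>i<n. [:1, - res_form N v U (z i):]) k \<partial>M)"
  define p1 where "p1 = (\<Sum>k\<le>n. monom (I k) k)"
  define p2 where "p2 = (\<Sum>k\<le>q. monom (of_nat (q choose k) * char_moment n q z) k)"
  have deg: "degree (\<Prod>i<n. [:1, - res_form N v U (z i):]) \<le> n" for U
  proof -
    have "degree (\<Prod>i<n. [:1, - res_form N v U (z i):]) \<le> (\<Sum>i<n. degree [:1, - res_form N v U (z i):])"
      by (rule degree_prod_sum_le[OF finite_lessThan, unfolded o_def])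
    also have "\<dots> \<le> (\<Sum>i<n. 1)" by (intro sum_mono) simp
    finally show ?thesis by simp
  qed
  have "poly (p1 - p2) w = 0" if "w \<in> {\<zeta> - 1 |\<zeta>::complex. norm \<zeta> = 1}" for w
  proof -
    from that obtain \<zeta> where \<zeta>: "w = \<zeta> - 1" "norm \<zeta> = 1" by blast
    have "\<zeta> ^ q * char_moment n q z = (\<integral>U. (\<Sum>k\<le>n. w ^ k * (det_weight q U * char_prod n z U * coeff (\<Prod>i<n. [:1, - res_form N v U (z i):]) k)) \<partial>M)"
      unfolding integral_rank_one[OF \<zeta>(2), symmetric]
    proof (rule Bochner_Integration.integral_cong[OF refl])
      fix U
      have "(\<Prod>i<n. 1 - (\<zeta> - 1) * res_form N v U (z i)) = poly (\<Prod>i<n. [:1, - res_form N v U (z i):]) w"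
        unfolding poly_prod \<zeta>(1) by (intro prod.cong) auto
      also have "\<dots> = (\<Sum>k\<le>n. coeff (\<Prod>i<n. [:1, - res_form N v U (z i):]) k * w ^ k)"
        by (rule poly_eq_sum_coeff[OF deg])
      finally show "det_weight q U * char_prod n z U * (\<Prod>i<n. 1 - (\<zeta> - 1) * res_form N v U (z i)) =
        (\<Sum>k\<le>n. w ^ k * (det_weight q U * char_prod n z U * coeff (\<Prod>i<n. [:1, - res_form N v U (z i):]) k))"
        by (simp add: sum_distrib_left mult_ac)
    qed
    also have "\<dots> = (\<Sum>k\<le>n. \<integral>U. w ^ k * (det_weight q U * char_prod n z U * coeff (\<Prod>i<n. [:1, - res_form N v U (z i):]) k) \<partial>M)"
      by (rule integral_bdd_sum) (intro bdd_mult[OF bdd_const bdd_res_coeff])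
    also have "\<dots> = poly p1 w"
      by (simp add: p1_def I_def poly_sum poly_monom mult.commute)
    finally have 1: "poly p1 w = \<zeta> ^ q * char_moment n q z" by simp
    have "\<zeta> ^ q = (w + 1) ^ q" by (simp add: \<zeta>)
    also have "\<dots> = (\<Sum>k\<le>q. of_nat (q choose k) * w ^ k)" by (subst binomial_ring) simp
    finally have "poly p2 w = \<zeta> ^ q * char_moment n q z"
      by (simp add: p2_def poly_sum poly_monom sum_distrib_left sum_distrib_right mult_ac)
    thus ?thesis using 1 by simp
  qed
  hence sub: "{\<zeta> - 1 |\<zeta>::complex. norm \<zeta> = 1} \<subseteq> {w. poly (p1 - p2) w = 0}" by auto
  have "p1 - p2 = 0"
  proof (rule ccontr)
    assume "p1 - p2 \<noteq> 0"
    from finite_subset[OF sub poly_roots_finite[OF this]] infinite_unit_circle_shift show False by contradiction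
  qed
  hence eq: "coeff p1 k = coeff p2 k" by simp
  have "coeff p2 k = of_nat (q choose k) * char_moment n q z"
    by (auto simp: p2_def coeff_sum binomial_eq_0)
  moreover have "coeff p1 k = I k"
  proof (cases "k \<le> n")
    case False
    hence "coeff (\<Prod>i<n. [:1, - res_form N v U (z i):]) k = 0" for U using deg[of U] by (intro coeff_eq_0) auto
    thus ?thesis using False by (simp add: p1_def coeff_sum I_def)
  qed (simp add: p1_def coeff_sum)
  ultimately show ?thesis using eq by (simp add: I_def)
qed

lemma integral_res_sum:
  "(\<integral>U. det_weight q U * char_prod n z U * (\<Sum>i<n. res_form N v U (z i)) \<partial>M) = - of_nat q * char_moment n q z"
proof -
  define I where "I = (\<integral>U. det_weight q U * char_prod n z U * (\<Sum>i<n. res_form N v U (z i)) \<partial>M)"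
  have "- I = of_nat q * char_moment n q z"
    using integral_res_coeff[of 1] unfolding coeff_prod_linear I_def by simp
  hence "I = - (of_nat q * char_moment n q z)" by (metis add.inverse_inverse)
  thus ?thesis by (simp add: I_def)
qed

lemma integral_res_esym2:
  "(\<integral>U. det_weight q U * char_prod n z U * esym2 n (\<lambda>i. res_form N v U (z i)) \<partial>M) = of_nat (q choose 2) * char_moment n q z"
  using integral_res_coeff[of 2] unfolding coeff_prod_linear .

lemma bdd_res_sum: "bdd (\<lambda>U. det_weight q U * char_prod n z U * (\<Sum>i<n. res_form N v U (z i)))"
  using bdd_uminus[OF bdd_res_coeff[of 1]] unfolding coeff_prod_linear by simp

lemma bdd_res_esym2: "bdd (\<lambda>U. det_weight q U * char_prod n z U * esym2 n (\<lambda>i. res_form N v U (z i)))"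
  using bdd_res_coeff[of 2] unfolding coeff_prod_linear .

end

text \<open>The vectors \<open>e\<^sub>a\<close> and \<open>e\<^sub>a + \<omega> e\<^sub>b\<close> with \<open>\<omega>\<^sup>4 = 1\<close> form a complex projective 2-design up to
  weights, so summing over them symmetrises a product of two quadratic forms into traces.\<close>

definition unit_vec_fun :: "nat \<Rightarrow> nat \<Rightarrow> complex" where
  "unit_vec_fun a k = (if k = a then 1 else 0)"

definition pair_vec_fun :: "nat \<Rightarrow> nat \<Rightarrow> complex \<Rightarrow> nat \<Rightarrow> complex" where
  "pair_vec_fun a b \<omega> k = (if k = a then 1 else if k = b then \<omega> else 0)"

lemma norm_unit_vec_fun: "a < N \<Longrightarrow> (\<Sum>k<N. unit_vec_fun a k * cnj (unit_vec_fun a k)) = 1"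
proof -
  assume "a < N"
  have "(\<Sum>k<N. unit_vec_fun a k * cnj (unit_vec_fun a k)) = (\<Sum>k<N. if k = a then 1 else 0)"
    by (intro sum.cong) (auto simp: unit_vec_fun_def)
  thus ?thesis using \<open>a < N\<close> by simp
qed

lemma res_form_unit: "a < N \<Longrightarrow> res_form N (unit_vec_fun a) U z = res_entry N U z a a"
proof -
  assume a: "a < N"
  have "(\<Sum>x<N. \<Sum>y<N. cnj (unit_vec_fun a x) * res_entry N U z x y * unit_vec_fun a y) =
        (\<Sum>x<N. if x = a then res_entry N U z a a else 0)"
    using a by (intro sum.cong refl) (auto simp: unit_vec_fun_def mult_delta_right)
  thus ?thesis using a by (simp add: res_form_def norm_unit_vec_fun)
qed

lemma norm_pair_vec_fun:
  "a < N \<Longrightarrow> b < N \<Longrightarrow> a \<noteq> b \<Longrightarrow> \<omega> * cnj \<omega> = 1 \<Longrightarrow>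
     (\<Sum>k<N. pair_vec_fun a b \<omega> k * cnj (pair_vec_fun a b \<omega> k)) = 2"
proof -
  assume *: "a < N" "b < N" "a \<noteq> b" "\<omega> * cnj \<omega> = 1"
  have "(\<Sum>k<N. pair_vec_fun a b \<omega> k * cnj (pair_vec_fun a b \<omega> k)) = (\<Sum>k<N. (if k = a then 1 else 0) + (if k = b then 1 else 0))"
    by (intro sum.cong) (use * in \<open>auto simp: pair_vec_fun_def\<close>)
  thus ?thesis using * by (simp add: sum.distrib)
qed

lemma res_form_pair:
  assumes "a < N" "b < N" "a \<noteq> b" "\<omega> * cnj \<omega> = 1"
  shows "res_form N (pair_vec_fun a b \<omega>) U z = (res_entry N U z a a + res_entry N U z b b +
     \<omega> * res_entry N U z a b + cnj \<omega> * res_entry N U z b a) / 2"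
proof -
  let ?R = "res_entry N U z"
  have inner: "(\<Sum>y<N. ?R x y * pair_vec_fun a b \<omega> y) = ?R x a + \<omega> * ?R x b" for x
  proof -
    have "(\<Sum>y<N. ?R x y * pair_vec_fun a b \<omega> y) = (\<Sum>y<N. (if y = a then ?R x a else 0) + (if y = b then \<omega> * ?R x b else 0))"
      by (intro sum.cong) (use assms in \<open>auto simp: pair_vec_fun_def\<close>)
    thus ?thesis using assms by (simp add: sum.distrib)
  qed
  have "(\<Sum>x<N. \<Sum>y<N. cnj (pair_vec_fun a b \<omega> x) * ?R x y * pair_vec_fun a b \<omega> y) =
     (\<Sum>x<N. cnj (pair_vec_fun a b \<omega> x) * (?R x a + \<omega> * ?R x b))"
    by (simp add: mult.assoc inner flip: sum_distrib_left)
  also have "\<dots> = (\<Sum>x<N. (if x = a then ?R a a + \<omega> * ?R a b else 0) + (if x = b then cnj \<omega> * (?R b a + \<omega> * ?R b b) else 0))"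
    by (intro sum.cong) (use assms in \<open>auto simp: pair_vec_fun_def\<close>)
  also have "\<dots> = ?R a a + \<omega> * ?R a b + cnj \<omega> * ?R b a + (\<omega> * cnj \<omega>) * ?R b b"
    using assms by (simp add: sum.distrib algebra_simps)
  finally show ?thesis using assms by (simp add: res_form_def norm_pair_vec_fun algebra_simps)
qed

lemma
  assumes z: "\<And>i. i < n \<Longrightarrow> norm (z i) \<ge> 2"
  shows integral_trace_sum: "(\<integral>U. det_weight q U * char_prod n z U * (\<Sum>i<n. \<Sum>a<N. res_entry N U (z i) a a) \<partial>M) =
      - of_nat N * of_nat q * char_moment n q z"
    and bdd_trace_sum: "bdd (\<lambda>U. det_weight q U * char_prod n z U * (\<Sum>i<n. \<Sum>a<N. res_entry N U (z i) a a))"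
proof -
  have v: "(\<Sum>k<N. unit_vec_fun a k * cnj (unit_vec_fun a k)) \<noteq> 0" if "a < N" for a
    using norm_unit_vec_fun[OF that] by simp
  have e: "det_weight q U * char_prod n z U * (\<Sum>i<n. \<Sum>a<N. res_entry N U (z i) a a) =
     (\<Sum>a<N. det_weight q U * char_prod n z U * (\<Sum>i<n. res_form N (unit_vec_fun a) U (z i)))" for U
    by (subst sum.swap) (simp add: res_form_unit sum_distrib_left)
  show "bdd (\<lambda>U. det_weight q U * char_prod n z U * (\<Sum>i<n. \<Sum>a<N. res_entry N U (z i) a a))"
    unfolding e by (rule bdd_sum, rule bdd_res_sum[OF z v]) auto
  have "(\<integral>U. det_weight q U * char_prod n z U * (\<Sum>i<n. \<Sum>a<N. res_entry N U (z i) a a) \<partial>M) =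
     (\<Sum>a<N. \<integral>U. det_weight q U * char_prod n z U * (\<Sum>i<n. res_form N (unit_vec_fun a) U (z i)) \<partial>M)"
    unfolding e by (rule integral_bdd_sum, rule bdd_res_sum[OF z v]) auto
  also have "\<dots> = (\<Sum>a<N. - of_nat q * char_moment n q z)"
    by (intro sum.cong refl integral_res_sum z v) auto
  finally show "(\<integral>U. det_weight q U * char_prod n z U * (\<Sum>i<n. \<Sum>a<N. res_entry N U (z i) a a) \<partial>M) =
      - of_nat N * of_nat q * char_moment n q z" by (simp add: mult.assoc)
qed

definition quartic_roots :: "complex set" where "quartic_roots = {1, \<i>, -1, -\<i>}"

text \<open>Both \<omega> and its square sum to 0 over the fourth roots of unity. Hence only the
  products A A and the mixed products B C remain, each four times, which cancels the two
  halves.\<close>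

lemma sum_quartic_pair:
  fixes A :: "nat \<Rightarrow> complex"
  shows "(\<Sum>\<omega>\<in>quartic_roots. esym2 n (\<lambda>i. (A i + \<omega> * B i + cnj \<omega> * C i) / 2)) =
    (\<Sum>j<n. \<Sum>i<j. A i * A j + B i * C j + C i * B j)"
proof -
  have e: "(\<Sum>\<omega>\<in>quartic_roots. h \<omega>) = h 1 + h \<i> + h (-1) + h (-\<i>)" for h :: "complex \<Rightarrow> complex"
    unfolding quartic_roots_def by (simp add: complex_eq_iff)
  show ?thesis
    unfolding e esym2_def sum.distrib[symmetric]
    by (intro sum.cong refl) (simp add: field_simps)
qed

text \<open>Origin of the weight 6 - 2N: the sum over ordered pairs a \<noteq> b lacks the diagonal
  terms \<open>Q a a = 6 * E a\<close>, which 6 restores; in the full double sum the products of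
  equal diagonal entries occur 2N times, which - 2N removes. Twice the desired expression is
  left.\<close>

lemma esym2_trace_decomposition:
  fixes U :: "complex mat" and z :: "nat \<Rightarrow> complex"
  defines "R \<equiv> (\<lambda>i a b. res_entry N U (z i) a b)"
  shows "2 * (esym2 n (\<lambda>i. \<Sum>a<N. R i a a) + (\<Sum>j<n. \<Sum>i<j. \<Sum>a<N. \<Sum>b<N. R i a b * R j b a)) =
    (\<Sum>a<N. \<Sum>b\<in>{..<N} - {a}. \<Sum>\<omega>\<in>quartic_roots. esym2 n (\<lambda>i. res_form N (pair_vec_fun a b \<omega>) U (z i))) +
    (\<Sum>a<N. (6 - 2 * of_nat N) * esym2 n (\<lambda>i. res_form N (unit_vec_fun a) U (z i)))"
proof -
  define Q where "Q = (\<lambda>a b. \<Sum>j<n. \<Sum>i<j. (R i a a + R i b b) * (R j a a + R j b b) + R i a b * R j b a + R i b a * R j a b)"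
  define E where "E = (\<lambda>a. \<Sum>j<n. \<Sum>i<j. R i a a * R j a a)"
  have unit: "esym2 n (\<lambda>i. res_form N (unit_vec_fun a) U (z i)) = E a" if "a < N" for a
    using that by (simp add: res_form_unit esym2_def E_def R_def)
  have pair: "(\<Sum>\<omega>\<in>quartic_roots. esym2 n (\<lambda>i. res_form N (pair_vec_fun a b \<omega>) U (z i))) = Q a b"
    if "a < N" "b < N" "a \<noteq> b" for a b
  proof -
    have "(\<Sum>\<omega>\<in>quartic_roots. esym2 n (\<lambda>i. res_form N (pair_vec_fun a b \<omega>) U (z i))) =
      (\<Sum>\<omega>\<in>quartic_roots. esym2 n (\<lambda>i. ((R i a a + R i b b) + \<omega> * R i a b + cnj \<omega> * R i b a) / 2))"
      by (intro sum.cong refl) (use that in \<open>auto simp: res_form_pair quartic_roots_def R_def\<close>)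
    thus ?thesis unfolding sum_quartic_pair by (simp add: Q_def)
  qed
  have diag: "Q a a = 6 * E a" for a
    unfolding Q_def E_def sum_distrib_left by (intro sum.cong refl) (simp add: algebra_simps)
  have "(\<Sum>a<N. \<Sum>b\<in>{..<N} - {a}. Q a b) = (\<Sum>a<N. (\<Sum>b<N. Q a b) - 6 * E a)"
    by (intro sum.cong refl) (simp add: sum_diff1 diag)
  hence 1: "(\<Sum>a<N. \<Sum>b\<in>{..<N} - {a}. Q a b) + (\<Sum>a<N. (6 - 2 * of_nat N) * E a) = (\<Sum>a<N. \<Sum>b<N. Q a b) - 2 * of_nat N * (\<Sum>a<N. E a)"
    by (simp add: sum_subtractf left_diff_distrib sum_distrib_left)
  have sw: "(\<Sum>a<N. \<Sum>b<N. \<Sum>j<n. \<Sum>i<j. h a b i j) = (\<Sum>j<n. \<Sum>i<j. \<Sum>a<N. \<Sum>b<N. h a b i j)" for h :: "nat \<Rightarrow> nat \<Rightarrow> nat \<Rightarrow> nat \<Rightarrow> complex"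
  proof -
    have cp: "(\<Sum>a<N. \<Sum>b<N. g a b) = (\<Sum>p\<in>{..<N} \<times> {..<N}. g (fst p) (snd p))" for g :: "nat \<Rightarrow> nat \<Rightarrow> complex"
      by (simp only: sum.cartesian_product case_prod_unfold)
    have "(\<Sum>a<N. \<Sum>b<N. \<Sum>j<n. \<Sum>i<j. h a b i j) = (\<Sum>p\<in>{..<N} \<times> {..<N}. \<Sum>j<n. \<Sum>i<j. h (fst p) (snd p) i j)"
      by (rule cp)
    also have "\<dots> = (\<Sum>j<n. \<Sum>p\<in>{..<N} \<times> {..<N}. \<Sum>i<j. h (fst p) (snd p) i j)" by (rule sum.swap)
    also have "\<dots> = (\<Sum>j<n. \<Sum>i<j. \<Sum>p\<in>{..<N} \<times> {..<N}. h (fst p) (snd p) i j)" by (intro sum.cong refl sum.swap)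
    finally show ?thesis by (simp only: cp)
  qed
  have sw1: "(\<Sum>a<N. E a) = (\<Sum>j<n. \<Sum>i<j. \<Sum>a<N. R i a a * R j a a)"
  proof -
    have "(\<Sum>a<N. E a) = (\<Sum>j<n. \<Sum>a<N. \<Sum>i<j. R i a a * R j a a)" unfolding E_def by (rule sum.swap)
    also have "\<dots> = (\<Sum>j<n. \<Sum>i<j. \<Sum>a<N. R i a a * R j a a)" by (intro sum.cong refl sum.swap)
    finally show ?thesis .
  qed
  have "(\<Sum>a<N. \<Sum>b<N. (R i a a + R i b b) * (R j a a + R j b b) + R i a b * R j b a + R i b a * R j a b) =
     2 * of_nat N * (\<Sum>a<N. R i a a * R j a a) + 2 * ((\<Sum>a<N. R i a a) * (\<Sum>a<N. R j a a)) + 2 * (\<Sum>a<N. \<Sum>b<N. R i a b * R j b a)" for i j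
  proof -
    have s1: "(\<Sum>a<N. \<Sum>b<N. R i b a * R j a b) = (\<Sum>a<N. \<Sum>b<N. R i a b * R j b a)" by (rule sum.swap)
    have s2: "(\<Sum>a<N. \<Sum>b<N. R i a a * R j b b) = (\<Sum>a<N. R i a a) * (\<Sum>a<N. R j a a)" by (simp add: sum_product)
    have s3: "(\<Sum>a<N. \<Sum>b<N. R i b b * R j a a) = (\<Sum>a<N. R i a a) * (\<Sum>a<N. R j a a)"
      by (subst sum.swap) (simp only: sum_product)
    have s4: "(\<Sum>a<N. \<Sum>b<N. R i a a * R j a a) = of_nat N * (\<Sum>a<N. R i a a * R j a a)"
      by (simp add: sum_distrib_left)
    have s5: "(\<Sum>a<N. \<Sum>b<N. R i b b * R j b b) = of_nat N * (\<Sum>a<N. R i a a * R j a a)"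
      by simp
    show ?thesis
      unfolding distrib_left distrib_right sum.distrib s1 s2 s3 s4 s5 by simp
  qed
  hence 2: "(\<Sum>a<N. \<Sum>b<N. Q a b) = (\<Sum>j<n. \<Sum>i<j. 2 * of_nat N * (\<Sum>a<N. R i a a * R j a a) +
      2 * ((\<Sum>a<N. R i a a) * (\<Sum>a<N. R j a a)) + 2 * (\<Sum>a<N. \<Sum>b<N. R i a b * R j b a))"
    unfolding Q_def sw by (simp only:)
  have 3: "\<dots> = 2 * of_nat N * (\<Sum>a<N. E a) + 2 * (esym2 n (\<lambda>i. \<Sum>a<N. R i a a) + (\<Sum>j<n. \<Sum>i<j. \<Sum>a<N. \<Sum>b<N. R i a b * R j b a))"
    unfolding sw1 esym2_def by (simp add: sum.distrib sum_distrib_left distrib_left)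
  have "(\<Sum>a<N. \<Sum>b\<in>{..<N} - {a}. \<Sum>\<omega>\<in>quartic_roots. esym2 n (\<lambda>i. res_form N (pair_vec_fun a b \<omega>) U (z i))) =
      (\<Sum>a<N. \<Sum>b\<in>{..<N} - {a}. Q a b)"
    by (intro sum.cong refl pair) auto
  moreover have "(\<Sum>a<N. (6 - 2 * of_nat N) * esym2 n (\<lambda>i. res_form N (unit_vec_fun a) U (z i))) = (\<Sum>a<N. (6 - 2 * of_nat N) * E a)"
    by (intro sum.cong refl) (simp add: unit)
  ultimately show ?thesis using 1 2 3 by simp
qed

text \<open>Every vector contributes (q choose 2) by \<open>integral_res_esym2\<close>. There are 4
  N (N - 1) pair vectors and N unit vectors of weight 6 - 2N, and half of the total weight is N (N +
  1).\<close>

lemma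
  assumes z: "\<And>i. i < n \<Longrightarrow> norm (z i) \<ge> 2"
  shows integral_trace_esym2: "(\<integral>U. det_weight q U * char_prod n z U * (esym2 n (\<lambda>i. \<Sum>a<N. res_entry N U (z i) a a) +
      (\<Sum>j<n. \<Sum>i<j. \<Sum>a<N. \<Sum>b<N. res_entry N U (z i) a b * res_entry N U (z j) b a)) \<partial>M) =
      of_nat N * (of_nat N + 1) * of_nat (q choose 2) * char_moment n q z"
    and bdd_trace_esym2: "bdd (\<lambda>U. det_weight q U * char_prod n z U * (esym2 n (\<lambda>i. \<Sum>a<N. res_entry N U (z i) a a) +
      (\<Sum>j<n. \<Sum>i<j. \<Sum>a<N. \<Sum>b<N. res_entry N U (z i) a b * res_entry N U (z j) b a)))"
proof -
  let ?W = "\<lambda>U. det_weight q U * char_prod n z U"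
  let ?T = "\<lambda>U. esym2 n (\<lambda>i. \<Sum>a<N. res_entry N U (z i) a a) +
      (\<Sum>j<n. \<Sum>i<j. \<Sum>a<N. \<Sum>b<N. res_entry N U (z i) a b * res_entry N U (z j) b a)"
  let ?F = "char_moment n q z"
  have vu: "(\<Sum>k<N. unit_vec_fun a k * cnj (unit_vec_fun a k)) \<noteq> 0" if "a < N" for a
    using norm_unit_vec_fun[OF that] by simp
  have vp: "(\<Sum>k<N. pair_vec_fun a b \<omega> k * cnj (pair_vec_fun a b \<omega> k)) \<noteq> 0"
    if "a < N" "b \<in> {..<N} - {a}" "\<omega> \<in> quartic_roots" for a b \<omega>
    using norm_pair_vec_fun[of a b \<omega>] that by (auto simp: quartic_roots_def)
  let ?S1 = "\<lambda>U. \<Sum>a<N. \<Sum>b\<in>{..<N} - {a}. \<Sum>\<omega>\<in>quartic_roots. ?W U * esym2 n (\<lambda>i. res_form N (pair_vec_fun a b \<omega>) U (z i))"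
  let ?S2 = "\<lambda>U. \<Sum>a<N. (6 - 2 * of_nat N) * (?W U * esym2 n (\<lambda>i. res_form N (unit_vec_fun a) U (z i)))"
  have dec: "?W U * ?T U = (1 / 2) * (?S1 U + ?S2 U)" for U
  proof -
    have "?W U * ?T U = (1 / 2) * (?W U * (2 * ?T U))" by simp
    also have "?W U * (2 * ?T U) = ?S1 U + ?S2 U"
      unfolding esym2_trace_decomposition by (simp add: distrib_left sum_distrib_left mult_ac)
    finally show ?thesis .
  qed
  have b1: "bdd (\<lambda>U. ?W U * esym2 n (\<lambda>i. res_form N (pair_vec_fun a b \<omega>) U (z i)))"
    if "a < N" "b \<in> {..<N} - {a}" "\<omega> \<in> quartic_roots" for a b \<omega>
    by (rule bdd_res_esym2[OF z vp[OF that]])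
  have b2: "bdd (\<lambda>U. ?W U * esym2 n (\<lambda>i. res_form N (unit_vec_fun a) U (z i)))" if "a < N" for a
    by (rule bdd_res_esym2[OF z vu[OF that]])
  have bS1: "bdd ?S1" by (intro bdd_sum b1) auto
  have bS2: "bdd ?S2" by (intro bdd_sum bdd_mult[OF bdd_const] b2) auto
  show "bdd (\<lambda>U. ?W U * ?T U)"
    unfolding dec by (intro bdd_mult[OF bdd_const] bdd_add bS1 bS2)
  have i1: "(\<integral>U. ?S1 U \<partial>M) = (\<Sum>a<N. \<Sum>b\<in>{..<N} - {a}. \<Sum>\<omega>\<in>quartic_roots. of_nat (q choose 2) * ?F)"
  proof -
    have "(\<integral>U. ?S1 U \<partial>M) = (\<Sum>a<N. \<integral>U. (\<Sum>b\<in>{..<N} - {a}. \<Sum>\<omega>\<in>quartic_roots. ?W U * esym2 n (\<lambda>i. res_form N (pair_vec_fun a b \<omega>) U (z i))) \<partial>M)"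
      by (rule integral_bdd_sum, intro bdd_sum b1) auto
    also have "\<dots> = (\<Sum>a<N. \<Sum>b\<in>{..<N} - {a}. \<integral>U. (\<Sum>\<omega>\<in>quartic_roots. ?W U * esym2 n (\<lambda>i. res_form N (pair_vec_fun a b \<omega>) U (z i))) \<partial>M)"
      by (intro sum.cong refl, rule integral_bdd_sum, intro bdd_sum b1) auto
    also have "\<dots> = (\<Sum>a<N. \<Sum>b\<in>{..<N} - {a}. \<Sum>\<omega>\<in>quartic_roots. \<integral>U. ?W U * esym2 n (\<lambda>i. res_form N (pair_vec_fun a b \<omega>) U (z i)) \<partial>M)"
      by (intro sum.cong refl, rule integral_bdd_sum, intro b1) auto
    also have "\<dots> = (\<Sum>a<N. \<Sum>b\<in>{..<N} - {a}. \<Sum>\<omega>\<in>quartic_roots. of_nat (q choose 2) * ?F)"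
      by (intro sum.cong refl integral_res_esym2 z vp) auto
    finally show ?thesis .
  qed
  have cq: "card quartic_roots = 4" unfolding quartic_roots_def by (simp add: complex_eq_iff)
  have i1': "(\<integral>U. ?S1 U \<partial>M) = of_nat N * (of_nat N - 1) * 4 * (of_nat (q choose 2) * ?F)"
  proof -
    have "(\<Sum>a<N. \<Sum>b\<in>{..<N} - {a}. \<Sum>\<omega>\<in>quartic_roots. of_nat (q choose 2) * ?F) =
      (\<Sum>a<N. (of_nat N - 1) * (4 * (of_nat (q choose 2) * ?F)))"
    proof (rule sum.cong[OF refl])
      fix a assume a: "a \<in> {..<N}"
      hence "card ({..<N} - {a}) = N - 1" by simp
      moreover have "(of_nat (N - 1) :: complex) = of_nat N - 1" using a by (simp add: of_nat_diff)
      ultimately show "(\<Sum>b\<in>{..<N} - {a}. \<Sum>\<omega>\<in>quartic_roots. of_nat (q choose 2) * ?F) = (of_nat N - 1) * (4 * (of_nat (q choose 2) * ?F))"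
        by (simp add: cq)
    qed
    thus ?thesis unfolding i1 by (simp only: sum_constant card_lessThan mult.assoc)
  qed
  have i2: "(\<integral>U. ?S2 U \<partial>M) = of_nat N * (6 - 2 * of_nat N) * (of_nat (q choose 2) * ?F)"
  proof -
    have "(\<integral>U. ?S2 U \<partial>M) = (\<Sum>a<N. \<integral>U. (6 - 2 * of_nat N) * (?W U * esym2 n (\<lambda>i. res_form N (unit_vec_fun a) U (z i))) \<partial>M)"
      by (rule integral_bdd_sum, intro bdd_mult[OF bdd_const] b2) auto
    also have "\<dots> = (\<Sum>a<N. (6 - 2 * of_nat N) * (of_nat (q choose 2) * ?F))"
    proof (rule sum.cong[OF refl])
      fix a assume "a \<in> {..<N}"
      hence "(\<integral>U. ?W U * esym2 n (\<lambda>i. res_form N (unit_vec_fun a) U (z i)) \<partial>M) = of_nat (q choose 2) * ?F"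
        by (intro integral_res_esym2 z vu) auto
      thus "(\<integral>U. (6 - 2 * of_nat N) * (?W U * esym2 n (\<lambda>i. res_form N (unit_vec_fun a) U (z i))) \<partial>M) = (6 - 2 * of_nat N) * (of_nat (q choose 2) * ?F)"
        by (subst integral_mult_right_zero) simp
    qed
    finally show ?thesis by (simp add: mult.assoc)
  qed
  have "(\<integral>U. ?W U * ?T U \<partial>M) = (1 / 2) * ((\<integral>U. ?S1 U \<partial>M) + (\<integral>U. ?S2 U \<partial>M))"
    unfolding dec by (subst integral_mult_right_zero, subst Bochner_Integration.integral_add[OF bdd_integrable[OF bS1] bdd_integrable[OF bS2]]) (rule refl)
  also have "\<dots> = of_nat N * (of_nat N + 1) * of_nat (q choose 2) * ?F"
    unfolding i1' i2 by (simp add: algebra_simps)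
  finally show "(\<integral>U. ?W U * ?T U \<partial>M) = of_nat N * (of_nat N + 1) * of_nat (q choose 2) * ?F" .
qed

end

section \<open>Moments of coefficients of the characteristic polynomial\<close>

context haar_unitary
begin

definition coeff_moment :: "nat \<Rightarrow> nat \<Rightarrow> (nat \<Rightarrow> nat) \<Rightarrow> complex" where
  "coeff_moment n q m = (\<integral>U. det_weight q U * (\<Prod>i<n. coeff (char_poly U) (m i)) \<partial>M)"

lemma bdd_coeff_product: "bdd (\<lambda>U. det_weight q U * (\<Prod>i<n. coeff (char_poly U) (m i)))"
  by (intro bdd_mult bdd_det_weight bdd_prod bdd_coeff_char_poly)

lemma alt_coeff_coeff_moment:
  shows "alt_coeff n N (coeff_moment n q) l =
      (\<integral>U. det_weight q U * alt_coeff n N (\<lambda>m. \<Prod>i<n. coeff (char_poly U) (m i)) l \<partial>M)"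
    and "bdd (\<lambda>U. det_weight q U * alt_coeff n N (\<lambda>m. \<Prod>i<n. coeff (char_poly U) (m i)) l)"
proof -
  let ?X = "{(\<sigma>, m). \<sigma> permutes {..<n} \<and> m \<in> {..<n} \<rightarrow>\<^sub>E {..N} \<and> shift_sum n \<sigma> m = l}"
  have e: "det_weight q U * alt_coeff n N (\<lambda>m. \<Prod>i<n. coeff (char_poly U) (m i)) l =
     (\<Sum>x\<in>?X. of_int (sign (fst x)) * (det_weight q U * (\<Prod>i<n. coeff (char_poly U) (snd x i))))" for U
    unfolding alt_coeff_def sum_distrib_left case_prod_unfold by (simp add: mult_ac)
  have b: "bdd (\<lambda>U. of_int (sign (fst x)) * (det_weight q U * (\<Prod>i<n. coeff (char_poly U) (snd x i))))"
    for x :: "(nat \<Rightarrow> nat) \<times> (nat \<Rightarrow> nat)"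
    by (rule bdd_mult[OF bdd_const bdd_coeff_product])
  show "bdd (\<lambda>U. det_weight q U * alt_coeff n N (\<lambda>m. \<Prod>i<n. coeff (char_poly U) (m i)) l)"
    unfolding e by (rule bdd_sum) (rule b)
  have "(\<integral>U. det_weight q U * alt_coeff n N (\<lambda>m. \<Prod>i<n. coeff (char_poly U) (m i)) l \<partial>M) =
     (\<Sum>x\<in>?X. of_int (sign (fst x)) * coeff_moment n q (snd x))"
    unfolding e coeff_moment_def integral_mult_right_zero[symmetric] by (rule integral_bdd_sum) (rule b)
  thus "alt_coeff n N (coeff_moment n q) l =
      (\<integral>U. det_weight q U * alt_coeff n N (\<lambda>m. \<Prod>i<n. coeff (char_poly U) (m i)) l \<partial>M)"
    by (simp add: alt_coeff_def case_prod_unfold)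
qed

lemma coeff_moment_weighted_sum:
  "(\<Sum>l\<in>{..<n} \<rightarrow>\<^sub>E {..N+n}. alt_coeff n N (coeff_moment n q) l * W l) =
     (\<integral>U. det_weight q U * (\<Sum>l\<in>{..<n} \<rightarrow>\<^sub>E {..N+n}. alt_coeff n N (\<lambda>m. \<Prod>i<n. coeff (char_poly U) (m i)) l * W l) \<partial>M)"
proof -
  let ?S = "{..<n} \<rightarrow>\<^sub>E {..N+n}"
  have "(\<integral>U. det_weight q U * (\<Sum>l\<in>?S. alt_coeff n N (\<lambda>m. \<Prod>i<n. coeff (char_poly U) (m i)) l * W l) \<partial>M) =
     (\<integral>U. (\<Sum>l\<in>?S. W l * (det_weight q U * alt_coeff n N (\<lambda>m. \<Prod>i<n. coeff (char_poly U) (m i)) l)) \<partial>M)"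
    by (simp add: sum_distrib_left mult_ac)
  also have "\<dots> = (\<Sum>l\<in>?S. \<integral>U. W l * (det_weight q U * alt_coeff n N (\<lambda>m. \<Prod>i<n. coeff (char_poly U) (m i)) l) \<partial>M)"
    by (rule integral_bdd_sum) (rule bdd_mult[OF bdd_const alt_coeff_coeff_moment(2)])
  also have "\<dots> = (\<Sum>l\<in>?S. W l * alt_coeff n N (coeff_moment n q) l)"
    by (simp only: integral_mult_right_zero alt_coeff_coeff_moment(1))
  finally show ?thesis by (simp add: mult.commute)
qed

lemma coeff_moment_permute:
  assumes \<tau>: "\<tau> permutes {..<n}"
  shows "coeff_moment n q (\<lambda>i\<in>{..<n}. m (\<tau> i)) = coeff_moment n q m"
proof -
  have "(\<Prod>i<n. coeff p ((\<lambda>i\<in>{..<n}. m (\<tau> i)) i)) = (\<Prod>i<n. coeff p (m i))" for p :: "complex poly"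
    using prod.permute[OF \<tau>, of "\<lambda>i. coeff p (m i)"] by (simp add: o_def)
  thus ?thesis by (simp add: coeff_moment_def)
qed

text \<open>Integrates \<open>alt_coeff_poly_sums\<close> for the characteristic polynomial. The
  logarithmic derivatives are traces and \<open>pair_trace\<close> is the trace of a product; e2 of
  the traces plus the traces of pairwise products is the very combination whose average the 2-design
  yields.\<close>

lemma coeff_moment_sums:
  fixes z :: "nat \<Rightarrow> complex" and n q :: nat
  defines "c \<equiv> (\<Sum>i<n. of_nat i :: complex)"
    and "G \<equiv> (\<Sum>l\<in>{..<n} \<rightarrow>\<^sub>E {..N+n}. alt_coeff n N (coeff_moment n q) l * (\<Prod>i<n. z i ^ l i))"
  assumes z: "\<And>i. i < n \<Longrightarrow> norm (z i) \<ge> 2" and inj: "inj_on z {..<n}"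
  shows "(\<Sum>l\<in>{..<n} \<rightarrow>\<^sub>E {..N+n}. alt_coeff n N (coeff_moment n q) l * ((\<Sum>i<n. of_nat (l i)) * (\<Prod>i<n. z i ^ l i))) =
      (c + of_nat n * of_nat N - of_nat N * of_nat q) * G" (is ?T1)
    and "(\<Sum>l\<in>{..<n} \<rightarrow>\<^sub>E {..N+n}. alt_coeff n N (coeff_moment n q) l * (esym2 n (\<lambda>i. of_nat (l i)) * (\<Prod>i<n. z i ^ l i))) =
      (of_nat N * (of_nat N + 1) * (of_nat q * (of_nat q - 1) / 2) - (of_nat N * (of_nat n - 1) + c) * (of_nat N * of_nat q) +
        (esym2 n of_nat + of_nat N ^ 2 * c + of_nat n * of_nat N * c - of_nat N * c)) * G" (is ?T2)
proof -
  define \<rho> where "\<rho> = (\<lambda>U i. \<Sum>a<N. res_entry N U (z i) a a)"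
  define T where "T = (\<lambda>U. \<Sum>j<n. \<Sum>i<j. \<Sum>a<N. \<Sum>b<N. res_entry N U (z i) a b * res_entry N U (z j) b a)"
  let ?W = "\<lambda>U. det_weight q U * char_prod n z U"
  let ?F = "char_moment n q z"
  define K where "K = esym2 n of_nat + of_nat N ^ 2 * c + of_nat n * of_nat N * c - of_nat N * c"
  have U: "U \<in> carrier_mat N N" "degree (char_poly U) \<le> N" "\<And>i. i < n \<Longrightarrow> poly (char_poly U) (z i) \<noteq> 0"
    if "U \<in> space M" for U
  proof -
    have U: "U \<in> unitary_group N" using that by (simp add: space_haar)
    show "U \<in> carrier_mat N N" using U by (simp add: unitary_group_def)
    show "degree (char_poly U) \<le> N" using degree_char_poly_unitary[OF U] by simp
    show "poly (char_poly U) (z i) \<noteq> 0" if "i < n" for i using z[OF that] by (intro char_poly_unitary_neq_0[OF U]) simp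
  qed
  have \<rho>: "log_deriv_excess N (char_poly U) (z i) = \<rho> U i" if "U \<in> space M" "i < n" for U i
    using trace_res_entry[OF U(1)[OF that(1)] U(3)[OF that]] by (simp add: \<rho>_def log_deriv_excess_def)
  have T: "(\<Sum>j<n. \<Sum>i<j. pair_trace z (\<lambda>i. log_deriv_excess N (char_poly U) (z i)) i j) = T U" if "U \<in> space M" for U
    unfolding T_def
  proof (intro sum.cong refl)
    fix i j assume ij: "j \<in> {..<n}" "i \<in> {..<j}"
    hence "z i \<noteq> z j" using inj by (auto dest: inj_onD)
    hence "(\<Sum>a<N. \<Sum>b<N. res_entry N U (z i) a b * res_entry N U (z j) b a) = (z j * \<rho> U j - z i * \<rho> U i) / (z i - z j)"
      unfolding \<rho>_def using ij that by (intro trace_product_res_entry U) auto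
    thus "pair_trace z (\<lambda>i. log_deriv_excess N (char_poly U) (z i)) i j =
      (\<Sum>a<N. \<Sum>b<N. res_entry N U (z i) a b * res_entry N U (z j) b a)"
      using ij that by (simp add: pair_trace_def \<rho>)
  qed
  have G: "G = vdm n z * ?F"
  proof -
    have "G = (\<integral>U. vdm n z * ?W U \<partial>M)"
      unfolding G_def coeff_moment_weighted_sum
      by (intro Bochner_Integration.integral_cong refl, subst alt_coeff_poly_sums(1)[OF U(2,3) inj])
         (auto simp: char_prod_def)
    thus ?thesis by (simp add: char_moment_def)
  qed
  have bW: "bdd ?W" by (rule bdd_mult[OF bdd_det_weight bdd_char_prod])
  have i1: "(\<integral>U. ?W U * (\<Sum>i<n. \<rho> U i) \<partial>M) = - of_nat N * of_nat q * ?F" and b1: "bdd (\<lambda>U. ?W U * (\<Sum>i<n. \<rho> U i))"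
    unfolding \<rho>_def using integral_trace_sum[OF z] bdd_trace_sum[OF z] by auto
  have i2: "(\<integral>U. ?W U * (esym2 n (\<rho> U) + T U) \<partial>M) = of_nat N * (of_nat N + 1) * of_nat (q choose 2) * ?F"
    and b2: "bdd (\<lambda>U. ?W U * (esym2 n (\<rho> U) + T U))"
    unfolding \<rho>_def T_def using integral_trace_esym2[OF z] bdd_trace_esym2[OF z] by auto
  have "(\<Sum>l\<in>{..<n} \<rightarrow>\<^sub>E {..N+n}. alt_coeff n N (coeff_moment n q) l * ((\<Sum>i<n. of_nat (l i)) * (\<Prod>i<n. z i ^ l i))) =
     (\<integral>U. vdm n z * (c + of_nat n * of_nat N) * ?W U + vdm n z * (?W U * (\<Sum>i<n. \<rho> U i)) \<partial>M)"
    unfolding coeff_moment_weighted_sum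
  proof (intro Bochner_Integration.integral_cong refl)
    fix U assume US: "U \<in> space M"
    have "(\<Sum>i<n. log_deriv_excess N (char_poly U) (z i)) = (\<Sum>i<n. \<rho> U i)"
      by (intro sum.cong refl) (use \<rho>[OF US] in auto)
    thus "det_weight q U * (\<Sum>l\<in>{..<n} \<rightarrow>\<^sub>E {..N+n}. alt_coeff n N (\<lambda>m. \<Prod>i<n. coeff (char_poly U) (m i)) l *
        ((\<Sum>i<n. of_nat (l i)) * (\<Prod>i<n. z i ^ l i))) =
      vdm n z * (c + of_nat n * of_nat N) * ?W U + vdm n z * (?W U * (\<Sum>i<n. \<rho> U i))"
      by (subst alt_coeff_poly_sums(2)[OF U(2)[OF US] U(3)[OF US] inj]) (auto simp: char_prod_def c_def algebra_simps)
  qed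
  also have "\<dots> = vdm n z * (c + of_nat n * of_nat N) * ?F + vdm n z * (- of_nat N * of_nat q * ?F)"
    by (subst Bochner_Integration.integral_add[OF bdd_integrable[OF bdd_mult[OF bdd_const bW]] bdd_integrable[OF bdd_mult[OF bdd_const b1]]])
       (simp only: integral_mult_right_zero i1 char_moment_def)
  finally show ?T1 unfolding G by (simp add: algebra_simps)
  have "(\<Sum>l\<in>{..<n} \<rightarrow>\<^sub>E {..N+n}. alt_coeff n N (coeff_moment n q) l * (esym2 n (\<lambda>i. of_nat (l i)) * (\<Prod>i<n. z i ^ l i))) =
     (\<integral>U. (vdm n z * (?W U * (esym2 n (\<rho> U) + T U)) + vdm n z * (of_nat N * (of_nat n - 1) + c) * (?W U * (\<Sum>i<n. \<rho> U i))) + vdm n z * K * ?W U \<partial>M)"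
    unfolding coeff_moment_weighted_sum
  proof (intro Bochner_Integration.integral_cong refl)
    fix U assume US: "U \<in> space M"
    have s: "(\<Sum>i<n. log_deriv_excess N (char_poly U) (z i)) = (\<Sum>i<n. \<rho> U i)"
      by (intro sum.cong refl) (use \<rho>[OF US] in auto)
    have e: "esym2 n (\<lambda>i. log_deriv_excess N (char_poly U) (z i)) = esym2 n (\<rho> U)"
      unfolding esym2_def by (intro sum.cong refl) (use \<rho>[OF US] in auto)
    show "det_weight q U * (\<Sum>l\<in>{..<n} \<rightarrow>\<^sub>E {..N+n}. alt_coeff n N (\<lambda>m. \<Prod>i<n. coeff (char_poly U) (m i)) l *
        (esym2 n (\<lambda>i. of_nat (l i)) * (\<Prod>i<n. z i ^ l i))) =
      (vdm n z * (?W U * (esym2 n (\<rho> U) + T U)) + vdm n z * (of_nat N * (of_nat n - 1) + c) * (?W U * (\<Sum>i<n. \<rho> U i))) + vdm n z * K * ?W U"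
      apply (subst alt_coeff_poly_sums(3)[OF U(2)[OF US] U(3)[OF US] inj], assumption)
      unfolding s e T[OF US] c_def[symmetric]
      unfolding K_def[symmetric] char_prod_def by (simp add: algebra_simps)
  qed
  also have "\<dots> = (vdm n z * (of_nat N * (of_nat N + 1) * of_nat (q choose 2) * ?F) +
      vdm n z * (of_nat N * (of_nat n - 1) + c) * (- of_nat N * of_nat q * ?F)) + vdm n z * K * ?F"
    by (subst Bochner_Integration.integral_add[OF bdd_integrable[OF bdd_add[OF bdd_mult[OF bdd_const b2] bdd_mult[OF bdd_const b1]]] bdd_integrable[OF bdd_mult[OF bdd_const bW]]],
        subst Bochner_Integration.integral_add[OF bdd_integrable[OF bdd_mult[OF bdd_const b2]] bdd_integrable[OF bdd_mult[OF bdd_const b1]]])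
       (simp only: integral_mult_right_zero i1 i2 char_moment_def)
  also have "(of_nat (q choose 2) :: complex) = of_nat q * (of_nat q - 1) / 2"
    by (induction q) (simp_all add: numeral_2_eq_2 field_simps)
  finally show ?T2 unfolding G K_def by (simp add: algebra_simps)
qed

lemma coeff_moment_corner:
  assumes "q \<le> n"
  shows "coeff_moment n q (corner_exps N q n) = (-1) ^ (N * q)"
proof -
  have "det_weight q U * (\<Prod>i<n. coeff (char_poly U) (corner_exps N q n i)) = (-1) ^ (N * q)" if "U \<in> space M" for U
  proof -
    have U: "U \<in> unitary_group N" using that by (simp add: space_haar)
    have "coeff (char_poly U) N = 1" using degree_monic_char_poly[of U N] U by (simp add: unitary_group_def)
    moreover have "coeff (char_poly U) 0 = (-1) ^ N * det U"
      unfolding det_unitary_coeff[OF U] by (simp flip: power_add mult.assoc add: mult_2[symmetric])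
    ultimately have "det_weight q U * (\<Prod>i<n. coeff (char_poly U) (corner_exps N q n i)) = (-1) ^ (N * q) * (det U * cnj (det U)) ^ q"
      by (simp add: prod_corner[OF assms] det_weight_def power_mult_distrib power_mult)
    thus ?thesis using det_unitary(1)[OF U] by simp
  qed
  hence "coeff_moment n q (corner_exps N q n) = (\<integral>U. (-1) ^ (N * q) \<partial>M)"
    unfolding coeff_moment_def by (intro Bochner_Integration.integral_cong refl)
  thus ?thesis by (simp add: prob_space)
qed

text \<open>Both arrays are symmetric, have antisymmetrisations supported on the rearrangements of
  \<open>rect_exps\<close>, and take the value (-1)^(N q) at the corner;
  \<open>coefficients_unique_of_support\<close> applies.\<close>

theorem coeff_moment_eq_weyl_coeff:
  assumes q: "q \<le> n" and N: "N \<ge> 1" and L: "N + n \<le> L" and m: "m \<in> {..<n} \<rightarrow>\<^sub>E {..N}"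
  shows "coeff_moment n q m = weyl_coeff L N q n m"
proof (rule coefficients_unique_of_support[where q = q, OF _ _ _ _ _ _ _ m])
  have L0: "L > 0" using N L by simp
  show "corner_exps N q n \<in> {..<n} \<rightarrow>\<^sub>E {..N}" by (auto simp: corner_exps_def)
  show "coeff_moment n q (corner_exps N q n) = weyl_coeff L N q n (corner_exps N q n)"
    by (simp add: coeff_moment_corner[OF q] weyl_coeff_corner[OF L L0 q])
  show "coeff_moment n q (corner_exps N q n) \<noteq> 0" by (simp add: coeff_moment_corner[OF q])
  fix \<tau> m assume \<tau>: "\<tau> permutes {..<n}"
  show "coeff_moment n q (\<lambda>i\<in>{..<n}. m (\<tau> i)) = coeff_moment n q m" by (rule coeff_moment_permute[OF \<tau>])
  show "weyl_coeff L N q n (\<lambda>i\<in>{..<n}. m (\<tau> i)) = weyl_coeff L N q n m" by (rule weyl_coeff_sym[OF \<tau>])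
next
  fix l assume l: "l \<in> {..<n} \<rightarrow>\<^sub>E {..N+n}" "alt_coeff n N (coeff_moment n q) l \<noteq> 0"
  show "inj_on l {..<n} \<and> l ` {..<n} = rect_exps N q ` {..<n}"
  proof (rule alt_coeff_support_of_sums[OF q N _ infinite_grid _ _ l])
    fix z assume "\<And>i. i < n \<Longrightarrow> z i \<in> grid n i"
    hence *: "\<And>i. i < n \<Longrightarrow> norm (z i) \<ge> 2" "inj_on z {..<n}" using norm_grid inj_on_grid by blast+
    show "(\<Sum>l\<in>{..<n} \<rightarrow>\<^sub>E {..N+n}. alt_coeff n N (coeff_moment n q) l * ((\<Sum>i<n. of_nat (l i)) * (\<Prod>i<n. z i ^ l i))) =
      ((\<Sum>i<n. of_nat i) + of_nat n * of_nat N - of_nat N * of_nat q) *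
      (\<Sum>l\<in>{..<n} \<rightarrow>\<^sub>E {..N+n}. alt_coeff n N (coeff_moment n q) l * (\<Prod>i<n. z i ^ l i))"
      by (rule coeff_moment_sums(1)[OF *])
    show "(\<Sum>l\<in>{..<n} \<rightarrow>\<^sub>E {..N+n}. alt_coeff n N (coeff_moment n q) l * (esym2 n (\<lambda>i. of_nat (l i)) * (\<Prod>i<n. z i ^ l i))) =
      (of_nat N * (of_nat N + 1) * (of_nat q * (of_nat q - 1) / 2) - (of_nat N * (of_nat n - 1) + (\<Sum>i<n. of_nat i)) * (of_nat N * of_nat q) +
        (esym2 n of_nat + of_nat N ^ 2 * (\<Sum>i<n. of_nat i) + of_nat n * of_nat N * (\<Sum>i<n. of_nat i) - of_nat N * (\<Sum>i<n. of_nat i))) *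
      (\<Sum>l\<in>{..<n} \<rightarrow>\<^sub>E {..N+n}. alt_coeff n N (coeff_moment n q) l * (\<Prod>i<n. z i ^ l i))"
      by (rule coeff_moment_sums(2)[OF *])
  qed (auto intro: coeff_moment_permute)
next
  fix l assume l: "l \<in> {..<n} \<rightarrow>\<^sub>E {..N+n}" "alt_coeff n N (weyl_coeff L N q n) l \<noteq> 0"
  have L0: "L > 0" using N L by simp
  show "inj_on l {..<n} \<and> l ` {..<n} = rect_exps N q ` {..<n}"
    by (rule weyl_coeff_support[OF L L0 q l])
qed

end

section \<open>Evaluation of the discrete Weyl integral\<close>

lemma sum_PiE_Suc:
  "(\<Sum>l\<in>{..<Suc n} \<rightarrow>\<^sub>E {..K}. h l) = (\<Sum>b\<le>K. \<Sum>l\<in>{..<n} \<rightarrow>\<^sub>E {..K}. h (l(n := b)))"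
  for h :: "(nat \<Rightarrow> nat) \<Rightarrow> 'a :: comm_monoid_add"
proof -
  have "(\<Sum>l\<in>{..<Suc n} \<rightarrow>\<^sub>E {..K}. h l) = (\<Sum>(b, l)\<in>{..K} \<times> ({..<n} \<rightarrow>\<^sub>E {..K}). h (l(n := b)))"
    unfolding lessThan_Suc PiE_insert_eq
    by (subst sum.reindex[OF inj_combinator]) (auto intro!: sum.cong simp: case_prod_unfold)
  thus ?thesis by (simp add: sum.cartesian_product)
qed

text \<open>After division by r! the multinomial coefficient is a product over the variables, the
  form in which the power can be combined with the Vandermonde product.\<close>

lemma multinomial_exponential_form:
  fixes y :: "nat \<Rightarrow> complex"
  assumes "r \<le> K"
  shows "(\<Sum>m\<in>{..<N} \<rightarrow>\<^sub>E {..K}. if (\<Sum>a<N. m a) = r then \<Prod>a<N. y a ^ m a / fact (m a) else 0) =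
     (\<Sum>a<N. y a) ^ r / fact r"
  using assms
proof (induction N arbitrary: r)
  case 0
  thus ?case by (cases r) auto
next
  case (Suc N)
  define S where "S = (\<Sum>a<N. y a)"
  have "(\<Sum>m\<in>{..<Suc N} \<rightarrow>\<^sub>E {..K}. if (\<Sum>a<Suc N. m a) = r then \<Prod>a<Suc N. y a ^ m a / fact (m a) else 0) =
    (\<Sum>b\<le>K. \<Sum>m\<in>{..<N} \<rightarrow>\<^sub>E {..K}. if (\<Sum>a<N. m a) + b = r then (\<Prod>a<N. y a ^ m a / fact (m a)) * (y N ^ b / fact b) else 0)"
    unfolding sum_PiE_Suc by (intro sum.cong refl if_cong) simp_all
  also have "\<dots> = (\<Sum>b\<le>K. if b \<le> r then (y N ^ b / fact b) * (S ^ (r - b) / fact (r - b)) else 0)"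
  proof (rule sum.cong[OF refl])
    fix b
    show "(\<Sum>m\<in>{..<N} \<rightarrow>\<^sub>E {..K}. if (\<Sum>a<N. m a) + b = r then (\<Prod>a<N. y a ^ m a / fact (m a)) * (y N ^ b / fact b) else 0) =
       (if b \<le> r then (y N ^ b / fact b) * (S ^ (r - b) / fact (r - b)) else 0)"
    proof (cases "b \<le> r")
      case True
      have "(\<Sum>m\<in>{..<N} \<rightarrow>\<^sub>E {..K}. if (\<Sum>a<N. m a) + b = r then (\<Prod>a<N. y a ^ m a / fact (m a)) * (y N ^ b / fact b) else 0) =
         (y N ^ b / fact b) * (\<Sum>m\<in>{..<N} \<rightarrow>\<^sub>E {..K}. if (\<Sum>a<N. m a) = r - b then (\<Prod>a<N. y a ^ m a / fact (m a)) else 0)"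
        unfolding sum_distrib_left
      proof (rule sum.cong[OF refl])
        fix m
        have e: "((\<Sum>a<N. m a) + b = r) = ((\<Sum>a<N. m a) = r - b)" using True by linarith
        show "(if (\<Sum>a<N. m a) + b = r then (\<Prod>a<N. y a ^ m a / fact (m a)) * (y N ^ b / fact b) else 0) =
          (y N ^ b / fact b) * (if (\<Sum>a<N. m a) = r - b then (\<Prod>a<N. y a ^ m a / fact (m a)) else 0)"
          unfolding e by (cases "(\<Sum>a<N. m a) = r - b") (simp_all only: refl if_True if_False mult_zero_right mult_zero_left mult.commute simp_thms)
      qed
      thus ?thesis using True Suc.IH[of "r - b"] Suc.prems by (simp add: S_def)
    qed (auto intro!: sum.neutral)
  qed
  also have "\<dots> = (\<Sum>b\<le>r. (y N ^ b / fact b) * (S ^ (r - b) / fact (r - b)))"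
    by (rule sum.mono_neutral_cong_right) (use Suc.prems in auto)
  also have "\<dots> = (\<Sum>b\<le>r. of_nat (r choose b) * y N ^ b * S ^ (r - b)) / fact r"
    unfolding sum_divide_distrib
    by (intro sum.cong refl) (simp add: binomial_fact field_simps)
  also have "\<dots> = (y N + S) ^ r / fact r" by (simp add: binomial_ring)
  finally show ?case by (simp add: S_def add.commute)
qed

section \<open>Falling factorials and the expansion of a power sum against the Vandermonde
  product\<close>

definition ffact :: "nat \<Rightarrow> complex poly" where
  "ffact s = (\<Prod>j<s. [:- of_nat j, 1:])"

lemma degree_ffact: "degree (ffact s) = s" and lead_coeff_ffact: "coeff (ffact s) s = 1"
  using monic_prod_linear[of "of_nat :: nat \<Rightarrow> complex" s] by (auto simp: ffact_def)

lemma poly_ffact_eq_prod: "poly (ffact s) x = (\<Prod>j<s. x - of_nat j)"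
  unfolding ffact_def poly_prod by (intro prod.cong) auto

text \<open>The value 0 for l < s allows sums over all permutations later on: a term whose exponent
  would be negative vanishes by itself.\<close>

lemma poly_ffact: "poly (ffact s) (of_nat l) = (if s \<le> l then fact l / fact (l - s) else 0)"
proof -
  note p = poly_ffact_eq_prod
  show ?thesis
  proof (cases "s \<le> l")
    case True
    have "(\<Prod>j<s. of_nat l - of_nat j :: complex) * fact (l - s) = fact l" using True
    proof (induction s)
      case (Suc s)
      have "fact (l - s) = (of_nat l - of_nat s) * (fact (l - Suc s) :: complex)"
        using Suc.prems by (subst fact_reduce) (auto simp: of_nat_diff)
      thus ?case using Suc by (simp add: mult.assoc)
    qed simp
    thus ?thesis using True by (simp add: p field_simps)
  next
    case False
    thus ?thesis by (auto simp: p intro!: prod_zero bexI[of _ l])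
  qed
qed

text \<open>The size of the staircase, which is the degree of the Vandermonde product and the number
  of its factors.\<close>

definition content_shift :: "nat \<Rightarrow> nat" where "content_shift N = (\<Sum>a<N. a)"

text \<open>The coefficient is the alternating sum of the products of 1 / (l a - \<sigma> a)!.
  Pulling out all 1 / (l a)! leaves an alternant of falling factorials, that is the Vandermonde
  product of the l a: Frobenius's formula for the number of standard tableaux, divided by
  r!.\<close>

lemma alt_coeff_multinomial:
  assumes l: "l \<in> {..<N} \<rightarrow>\<^sub>E {..r+N}"
  shows "alt_coeff N r (\<lambda>m. if (\<Sum>a<N. m a) = r then \<Prod>a<N. 1 / fact (m a) else 0) l =
     (if (\<Sum>a<N. l a) = r + content_shift N then vdm N (\<lambda>a. of_nat (l a)) / (\<Prod>a<N. fact (l a)) else 0)"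
proof -
  let ?P = "{\<sigma>. \<sigma> permutes {..<N}}" and ?M = "{..<N} \<rightarrow>\<^sub>E {..r}"
  define f where "f = (\<lambda>m. if (\<Sum>a<N. m a) = r then \<Prod>a<N. 1 / fact (m a) else (0 :: complex))"
  have s\<sigma>: "(\<Sum>a<N. \<sigma> a) = content_shift N" if "\<sigma> permutes {..<N}" for \<sigma>
    using sum.permute[OF that, of "\<lambda>a. a"] by (simp add: content_shift_def o_def)
  have fin: "finite (?P \<times> ?M)" by (intro finite_cartesian_product finite_PiE) auto
  have "alt_coeff N r f l = (\<Sum>x\<in>{x \<in> ?P \<times> ?M. shift_sum N (fst x) (snd x) = l}. of_int (sign (fst x)) * f (snd x))"
  proof -
    have "{(\<sigma>, m). \<sigma> permutes {..<N} \<and> m \<in> ?M \<and> shift_sum N \<sigma> m = l} = {x \<in> ?P \<times> ?M. shift_sum N (fst x) (snd x) = l}"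
      by (rule Set.set_eqI) (simp add: case_prod_unfold mem_Times_iff)
    thus ?thesis by (simp add: alt_coeff_def case_prod_unfold)
  qed
  also have "\<dots> = (\<Sum>x\<in>?P \<times> ?M. if shift_sum N (fst x) (snd x) = l then of_int (sign (fst x)) * f (snd x) else 0)"
    by (rule sum.inter_filter[OF fin])
  also have "\<dots> = (\<Sum>\<sigma>\<in>?P. \<Sum>m\<in>?M. if shift_sum N \<sigma> m = l then of_int (sign \<sigma>) * f m else 0)"
    by (simp add: sum.cartesian_product case_prod_unfold)
  also have "\<dots> = (\<Sum>\<sigma>\<in>?P. if (\<Sum>a<N. l a) = r + content_shift N then of_int (sign \<sigma>) * (\<Prod>a<N. poly (ffact (\<sigma> a)) (of_nat (l a))) / (\<Prod>a<N. fact (l a)) else 0)"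
  proof (rule sum.cong[OF refl])
    fix \<sigma> assume "\<sigma> \<in> ?P"
    hence \<sigma>: "\<sigma> permutes {..<N}" by simp
    \<comment> \<open>For given \<open>l\<close> and \<open>\<sigma>\<close> this is the only
      candidate for \<open>m\<close>; when a difference would be negative, the corresponding falling
      factorial is 0.\<close>
    define m0 where "m0 = (\<lambda>a\<in>{..<N}. l a - \<sigma> a)"
    have m0: "m = m0" "\<forall>a<N. \<sigma> a \<le> l a" if "m \<in> ?M" "shift_sum N \<sigma> m = l" for m
    proof -
      have la: "l a = \<sigma> a + m a" if "a < N" for a using \<open>shift_sum N \<sigma> m = l\<close> that by (auto simp: shift_sum_def)
      show "\<forall>a<N. \<sigma> a \<le> l a" using la by simp
      show "m = m0" by (rule extensionalityI[of _ "{..<N}"]) (use that la in \<open>auto simp: m0_def PiE_def\<close>)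
    qed
    show "(\<Sum>m\<in>?M. if shift_sum N \<sigma> m = l then of_int (sign \<sigma>) * f m else 0) =
      (if (\<Sum>a<N. l a) = r + content_shift N then of_int (sign \<sigma>) * (\<Prod>a<N. poly (ffact (\<sigma> a)) (of_nat (l a))) / (\<Prod>a<N. fact (l a)) else 0)"
    proof (cases "\<forall>a<N. \<sigma> a \<le> l a")
      case False
      hence "(\<Sum>m\<in>?M. if shift_sum N \<sigma> m = l then of_int (sign \<sigma>) * f m else 0) = 0"
        using m0(2) by (intro sum.neutral) auto
      moreover from False obtain a where "a < N" "\<not> \<sigma> a \<le> l a" by auto
      hence "(\<Prod>a<N. poly (ffact (\<sigma> a)) (of_nat (l a))) = 0"
        by (intro prod_zero) (auto simp: poly_ffact)
      ultimately show ?thesis by simp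
    next
      case True
      have sum0: "(\<Sum>a<N. m0 a) + content_shift N = (\<Sum>a<N. l a)"
        unfolding s\<sigma>[OF \<sigma>, symmetric] sum.distrib[symmetric]
        by (rule sum.cong) (use True in \<open>auto simp: m0_def\<close>)
      have sh: "shift_sum N \<sigma> m0 = l"
        by (rule extensionalityI[of _ "{..<N}"]) (use True l in \<open>auto simp: shift_sum_def m0_def PiE_def\<close>)
      have fm0: "f m0 = (if (\<Sum>a<N. l a) = r + content_shift N then (\<Prod>a<N. poly (ffact (\<sigma> a)) (of_nat (l a))) / (\<Prod>a<N. fact (l a)) else 0)"
      proof -
        have "(\<Prod>a<N. 1 / fact (m0 a) :: complex) = (\<Prod>a<N. poly (ffact (\<sigma> a)) (of_nat (l a))) / (\<Prod>a<N. fact (l a))"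
          unfolding prod_dividef[symmetric] by (rule prod.cong) (use True in \<open>auto simp: poly_ffact m0_def\<close>)
        thus ?thesis using sum0 by (auto simp: f_def)
      qed
      show ?thesis
      proof (cases "(\<Sum>a<N. l a) = r + content_shift N")
        case False
        have "(\<Sum>m\<in>?M. if shift_sum N \<sigma> m = l then of_int (sign \<sigma>) * f m else 0) = 0"
        proof (rule sum.neutral, rule ballI)
          fix m assume m: "m \<in> ?M"
          have "shift_sum N \<sigma> m = l \<longrightarrow> m = m0" using m0(1)[OF m] by blast
          moreover have "f m0 = 0" using fm0 False by simp
          ultimately show "(if shift_sum N \<sigma> m = l then of_int (sign \<sigma>) * f m else 0) = 0"
            by (cases "shift_sum N \<sigma> m = l") simp_all
        qed
        thus ?thesis using False by simp
      next
        case T: True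
        have m0M: "m0 \<in> ?M"
        proof (rule PiE_I)
          fix a assume a: "a \<in> {..<N}"
          have "m0 a \<le> (\<Sum>a<N. m0 a)" using a by (intro member_le_sum) auto
          thus "m0 a \<in> {..r}" using sum0 T by simp
        qed (simp add: m0_def)
        have "(\<Sum>m\<in>?M. if shift_sum N \<sigma> m = l then of_int (sign \<sigma>) * f m else 0) =
           (\<Sum>m\<in>?M. if m = m0 then of_int (sign \<sigma>) * f m0 else 0)"
        proof (rule sum.cong[OF refl])
          fix m assume m: "m \<in> ?M"
          have "shift_sum N \<sigma> m = l \<longleftrightarrow> m = m0" using m0(1)[OF m] sh by blast
          thus "(if shift_sum N \<sigma> m = l then of_int (sign \<sigma>) * f m else 0) = (if m = m0 then of_int (sign \<sigma>) * f m0 else 0)"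
            by simp
        qed
        also have "\<dots> = of_int (sign \<sigma>) * f m0" using m0M by (simp add: finite_PiE)
        finally show ?thesis using T by (simp add: fm0)
      qed
    qed
  qed
  also have "\<dots> = (if (\<Sum>a<N. l a) = r + content_shift N then
      (\<Sum>\<sigma>\<in>?P. of_int (sign \<sigma>) * (\<Prod>a<N. poly (ffact (\<sigma> a)) (of_nat (l a)))) / (\<Prod>a<N. fact (l a)) else 0)"
    by (simp add: sum_divide_distrib)
  also have "(\<Sum>\<sigma>\<in>?P. of_int (sign \<sigma>) * (\<Prod>a<N. poly (ffact (\<sigma> a)) (of_nat (l a)))) = vdm N (\<lambda>a. of_nat (l a))"
    by (rule alternant_eq_vdm(1)) (auto simp: degree_ffact lead_coeff_ffact)
  finally show ?thesis by (simp only: f_def)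
qed

lemma vdm_times_power_sum:
  fixes y :: "nat \<Rightarrow> complex"
  shows "vdm N y * (\<Sum>a<N. y a) ^ r = fact r * (\<Sum>l\<in>{..<N} \<rightarrow>\<^sub>E {..r+N}.
     (if (\<Sum>a<N. l a) = r + content_shift N then vdm N (\<lambda>a. of_nat (l a)) / (\<Prod>a<N. fact (l a)) else 0) * (\<Prod>a<N. y a ^ l a))"
proof -
  define f where "f = (\<lambda>m. if (\<Sum>a<N. m a) = r then \<Prod>a<N. 1 / fact (m a) else (0 :: complex))"
  have "(\<Sum>a<N. y a) ^ r = fact r * (\<Sum>m\<in>{..<N} \<rightarrow>\<^sub>E {..r}. f m * (\<Prod>a<N. y a ^ m a))"
  proof -
    have "(\<Sum>m\<in>{..<N} \<rightarrow>\<^sub>E {..r}. f m * (\<Prod>a<N. y a ^ m a)) = (\<Sum>a<N. y a) ^ r / fact r"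
      unfolding multinomial_exponential_form[OF order_refl, symmetric] f_def
      by (intro sum.cong refl) (auto simp: prod_dividef)
    thus ?thesis by simp
  qed
  hence "vdm N y * (\<Sum>a<N. y a) ^ r = fact r * (vdm N y * (\<Sum>m\<in>{..<N} \<rightarrow>\<^sub>E {..r}. f m * (\<Prod>a<N. y a ^ m a)))"
    by simp
  also have "vdm N y * (\<Sum>m\<in>{..<N} \<rightarrow>\<^sub>E {..r}. f m * (\<Prod>a<N. y a ^ m a)) =
     (\<Sum>l\<in>{..<N} \<rightarrow>\<^sub>E {..r+N}. alt_coeff N r f l * (\<Prod>a<N. y a ^ l a))"
    by (rule alt_coeff_generating_function[symmetric])
  also have "\<dots> = (\<Sum>l\<in>{..<N} \<rightarrow>\<^sub>E {..r+N}. (if (\<Sum>a<N. l a) = r + content_shift N then vdm N (\<lambda>a. of_nat (l a)) / (\<Prod>a<N. fact (l a)) else 0) * (\<Prod>a<N. y a ^ l a))"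
    by (intro sum.cong refl arg_cong2[of _ _ _ _ "(*)"]) (simp only: f_def alt_coeff_multinomial)
  finally show ?thesis .
qed

text \<open>Injectivity makes the coefficient nonzero, and a nonzero coefficient has exponents
  strictly below r + N. With r \<le> n this gives the bound n + N under which the circle sums are
  evaluated.\<close>

lemma multinomial_support:
  assumes l: "l \<in> {..<N} \<rightarrow>\<^sub>E {..r+N}" and s: "(\<Sum>a<N. l a) = r + content_shift N"
    and inj: "inj_on l {..<N}" and a: "a < N"
  shows "l a < r + N"
proof (rule ccontr)
  assume "\<not> l a < r + N"
  hence "alt_coeff N r (\<lambda>m. if (\<Sum>a<N. m a) = r then \<Prod>a<N. 1 / fact (m a) else 0) l = 0"
    by (intro alt_coeff_eq_0_large[OF a]) simp
  hence "vdm N (\<lambda>a. of_nat (l a) :: complex) = 0"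
    unfolding alt_coeff_multinomial[OF l] using s by simp
  moreover have "vdm N (\<lambda>a. of_nat (l a) :: complex) \<noteq> 0"
    by (rule vdm_neq_0) (use inj in \<open>auto simp: inj_on_def\<close>)
  ultimately show False by simp
qed

lemma coeff_one_minus_power:
  "coeff ([:1, -1 :: complex:] ^ m) s = (-1) ^ s * of_nat (m choose s)"
proof (induction m arbitrary: s)
  case 0
  thus ?case by (cases s) auto
next
  case (Suc m)
  have "[:1, -1 :: complex:] ^ Suc m = [:1, -1:] ^ m - pCons 0 ([:1, -1:] ^ m)" by simp
  thus ?case using Suc by (cases s) (simp_all add: algebra_simps del: power_Suc)
qed

text \<open>The variable \<open>y = - u / (1 - u)\<close> linearises the logarithmic derivative.\<close>

definition cayley_var :: "complex \<Rightarrow> complex" where "cayley_var u = - u / (1 - u)"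

text \<open>The factor (1 - u)^(n + N - 1) clears the pole of y^l for every l < n + N, and a
  coefficient of (-u)^l (1 - u)^(n + N - 1 - l) is extracted. Its sign (-1)^s does not depend on l,
  so it can leave the sum over exponents.\<close>

lemma circle_sum_cayley:
  assumes L: "n + N \<le> L" "N > 0" and sa: "s < q + N" and q: "q \<le> n" and l: "l < n + N"
  shows "(\<Sum>u\<in>circle_pts L. (1 - u) ^ (n + N - 1) * cayley_var u ^ l / u ^ s) / of_nat L =
    (if l \<le> s then (-1) ^ s * of_nat ((n + N - 1 - l) choose (s - l)) else 0)"
proof -
  have L0: "L > 0" using L by simp
  define p where "p = monom ((-1) ^ l) l * [:1, -1 :: complex:] ^ (n + N - 1 - l)"
  have e: "(1 - u) ^ (n + N - 1) * cayley_var u ^ l = poly p u" if "u \<in> circle_pts L" for u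
  proof -
    have u: "1 - u \<noteq> 0" using circle_pts_neq[OF L0 that] by auto
    have "(1 - u) ^ (n + N - 1) = (1 - u) ^ (n + N - 1 - l) * (1 - u) ^ l" using l by (simp flip: power_add)
    moreover have "(1 - u) ^ l * cayley_var u ^ l = (-u) ^ l"
      unfolding power_mult_distrib[symmetric] using u by (simp add: cayley_var_def)
    ultimately have "(1 - u) ^ (n + N - 1) * cayley_var u ^ l = (1 - u) ^ (n + N - 1 - l) * (-u) ^ l"
      by (simp only: mult.assoc)
    also have "\<dots> = poly p u" by (simp add: p_def poly_monom poly_power power_minus[of u] mult_ac)
    finally show ?thesis .
  qed
  have "(\<Sum>u\<in>circle_pts L. (1 - u) ^ (n + N - 1) * cayley_var u ^ l / u ^ s) / of_nat L = (\<Sum>u\<in>circle_pts L. poly p u / u ^ s) / of_nat L"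
    by (intro arg_cong2[of _ _ _ _ "(/)"] sum.cong refl e)
  also have "\<dots> = coeff p s"
  proof (rule circle_sum_poly)
    have "degree ([:1, -1 :: complex:] ^ (n + N - 1 - l)) \<le> n + N - 1 - l"
      using degree_power_le[of "[:1, -1 :: complex:]" "n + N - 1 - l"] by simp
    hence "degree p \<le> l + (n + N - 1 - l)"
      unfolding p_def by (intro order_trans[OF degree_mult_le] add_mono degree_monom_le)
    thus "degree p < L" using L l by linarith
    show "s < L" using sa q L by linarith
  qed
  also have "\<dots> = (if l \<le> s then (-1) ^ s * of_nat ((n + N - 1 - l) choose (s - l)) else 0)"
  proof (cases "l \<le> s")
    case True
    have "coeff p s = (-1) ^ l * coeff ([:1, -1 :: complex:] ^ (n + N - 1 - l)) (s - l)"
      using True unfolding p_def coeff_monom_mult by simp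
    also have "\<dots> = (-1) ^ l * (-1) ^ (s - l) * of_nat ((n + N - 1 - l) choose (s - l))"
      unfolding coeff_one_minus_power by (rule mult.assoc[symmetric])
    also have "(-1) ^ l * (-1) ^ (s - l) = ((-1) ^ s :: complex)"
      unfolding power_add[symmetric] using True by simp
    finally show ?thesis using True by simp
  next
    case False
    thus ?thesis unfolding p_def coeff_monom_mult by simp
  qed
  finally show ?thesis .
qed

text \<open>Since y = 1 - 1 / (1 - u), a difference of two u is minus the difference of their y
  times both factors 1 - u. Every variable takes part in N - 1 of the differences.\<close>

lemma vdm_cayley:
  assumes "\<And>a. a < N \<Longrightarrow> u a \<noteq> 1"
  shows "vdm N u = (-1) ^ content_shift N * (\<Prod>a<N. (1 - u a) ^ (N - 1)) * vdm N (\<lambda>a. cayley_var (u a))"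
  using assms
proof (induction N)
  case 0
  thus ?case by (simp add: vdm_def content_shift_def)
next
  case (Suc N)
  have nz: "1 - u a \<noteq> 0" if "a < Suc N" for a using Suc.prems[OF that] by simp
  have d: "u N - u a = - ((cayley_var (u N) - cayley_var (u a)) * (1 - u N) * (1 - u a))" if "a < N" for a
  proof -
    have n: "1 - u N \<noteq> 0" "1 - u a \<noteq> 0" using nz[of N] nz[of a] that by auto
    have "cayley_var (u N) - cayley_var (u a) = (u a - u N) / ((1 - u N) * (1 - u a))"
      unfolding cayley_var_def diff_frac_eq[OF n] by (simp add: algebra_simps)
    thus ?thesis using n by simp
  qed
  have v: "vdm (Suc N) x = vdm N x * (\<Prod>a<N. x N - x a)" for x :: "nat \<Rightarrow> complex" by (simp add: vdm_def)
  have "(\<Prod>a<N. u N - u a) = (\<Prod>a<N. (-1) * ((cayley_var (u N) - cayley_var (u a)) * ((1 - u N) * (1 - u a))))"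
    by (rule prod.cong[OF refl]) (use d in \<open>simp add: mult.assoc\<close>)
  also have "\<dots> = (-1) ^ N * ((\<Prod>a<N. cayley_var (u N) - cayley_var (u a)) * ((1 - u N) ^ N * (\<Prod>a<N. 1 - u a)))"
    by (simp only: prod.distrib prod_constant card_lessThan)
  finally have e: "(\<Prod>a<N. u N - u a) = (-1) ^ N * ((\<Prod>a<N. cayley_var (u N) - cayley_var (u a)) * ((1 - u N) ^ N * (\<Prod>a<N. 1 - u a)))" .
  have p: "(\<Prod>a<N. (1 - u a) ^ (N - 1)) * (\<Prod>a<N. 1 - u a) = (\<Prod>a<N. (1 - u a) ^ N)"
    by (cases N) (simp_all add: prod.distrib mult.commute)
  have "vdm (Suc N) u = (-1) ^ (content_shift N + N) * ((\<Prod>a<N. (1 - u a) ^ (N - 1)) * (\<Prod>a<N. 1 - u a)) * (1 - u N) ^ N *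
     (vdm N (\<lambda>a. cayley_var (u a)) * (\<Prod>a<N. cayley_var (u N) - cayley_var (u a)))"
    using Suc.IH Suc.prems unfolding v e by (simp add: power_add mult_ac)
  thus ?case unfolding p v[of "\<lambda>a. cayley_var (u a)"] by (simp add: content_shift_def mult_ac)
qed

text \<open>Reflection of the points and reversal of their order each change the sign of every
  difference.\<close>

lemma vdm_reverse:
  "vdm N (\<lambda>a. c - x (N - Suc a)) = (vdm N x :: 'a :: comm_ring_1)"
proof -
  have "vdm N (\<lambda>a. c - x (N - Suc a)) = (\<Prod>(b, a)\<in>(SIGMA b:{..<N}. {..<b}). x (N - Suc a) - x (N - Suc b))"
    unfolding vdm_def by (subst prod.Sigma) (auto intro!: prod.cong)
  also have "\<dots> = (\<Prod>(b, a)\<in>(SIGMA b:{..<N}. {..<b}). x b - x a)"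
    by (rule prod.reindex_bij_witness[of _ "\<lambda>(b, a). (N - Suc a, N - Suc b)" "\<lambda>(b, a). (N - Suc a, N - Suc b)"]) auto
  also have "\<dots> = vdm N x"
    unfolding vdm_def by (subst prod.Sigma) auto
  finally show ?thesis .
qed

text \<open>Reversing rows and points simultaneously conjugates \<open>\<sigma>\<close> by the
  reversal, which preserves its sign; \<open>vdm_reverse\<close> then absorbs the reflection c -
  x.\<close>

lemma alternant_reverse_eq_vdm:
  fixes x :: "nat \<Rightarrow> complex"
  shows "(\<Sum>\<sigma> | \<sigma> permutes {..<N}. of_int (sign \<sigma>) * (\<Prod>a<N. poly (ffact (N - Suc a)) (c - x (\<sigma> a)))) = vdm N x"
proof -
  define \<rho> where "\<rho> = (\<lambda>a. if a < N then N - Suc a else a)"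
  have rr: "\<rho> (\<rho> a) = a" for a by (auto simp: \<rho>_def)
  have \<rho>: "\<rho> permutes {..<N}"
    by (rule bij_imp_permutes) (auto simp: \<rho>_def intro!: bij_betw_byWitness[of _ \<rho>])
  let ?P = "{\<sigma>. \<sigma> permutes {..<N}}"
  have inv: "\<rho> \<circ> (\<rho> \<circ> \<sigma> \<circ> \<rho>) \<circ> \<rho> = \<sigma>" for \<sigma> by (auto simp: rr)
  have perm: "\<rho> \<circ> \<sigma> \<circ> \<rho> \<in> ?P" if "\<sigma> \<in> ?P" for \<sigma>
    using that \<rho> by (auto intro: permutes_compose)
  have "(\<Sum>\<sigma>\<in>?P. of_int (sign \<sigma>) * (\<Prod>a<N. poly (ffact (N - Suc a)) (c - x (\<sigma> a)))) =
     (\<Sum>\<sigma>\<in>?P. of_int (sign \<sigma>) * (\<Prod>a<N. poly (ffact a) (c - x (\<rho> (\<sigma> a)))))"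
  proof (rule sum.reindex_bij_witness[of _ "\<lambda>\<sigma>. \<rho> \<circ> \<sigma> \<circ> \<rho>" "\<lambda>\<sigma>. \<rho> \<circ> \<sigma> \<circ> \<rho>"])
    fix \<sigma> assume s: "\<sigma> \<in> ?P"
    have "sign (\<rho> \<circ> \<sigma> \<circ> \<rho>) = sign \<rho> * sign \<sigma> * sign \<rho>"
      using s \<rho> by (simp add: sign_compose permutation_compose permutation_permutes) (metis finite_lessThan permutation_permutes permutation_compose sign_compose)
    hence sg: "sign (\<rho> \<circ> \<sigma> \<circ> \<rho>) = sign \<sigma>" by (simp add: sign_def)
    have "(\<Prod>a<N. poly (ffact a) (c - x (\<rho> ((\<rho> \<circ> \<sigma> \<circ> \<rho>) a)))) = (\<Prod>a<N. poly (ffact (\<rho> (\<rho> a))) (c - x (\<sigma> (\<rho> a))))"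
      by (simp add: rr)
    also have "\<dots> = (\<Prod>a<N. poly (ffact (\<rho> a)) (c - x (\<sigma> a)))"
      using prod.permute[OF \<rho>, of "\<lambda>a. poly (ffact (\<rho> a)) (c - x (\<sigma> a))"] by (simp add: o_def)
    also have "\<dots> = (\<Prod>a<N. poly (ffact (N - Suc a)) (c - x (\<sigma> a)))" by (simp add: \<rho>_def)
    finally show "of_int (sign (\<rho> \<circ> \<sigma> \<circ> \<rho>)) * (\<Prod>a<N. poly (ffact a) (c - x (\<rho> ((\<rho> \<circ> \<sigma> \<circ> \<rho>) a)))) =
      of_int (sign \<sigma>) * (\<Prod>a<N. poly (ffact (N - Suc a)) (c - x (\<sigma> a)))" by (simp only: sg)
  qed (use inv perm in auto)
  also have "\<dots> = vdm N (\<lambda>a. c - x (\<rho> a))"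
    using alternant_eq_vdm(2)[of N ffact "\<lambda>a. c - x (\<rho> a)"] by (simp add: degree_ffact lead_coeff_ffact)
  also have "\<dots> = vdm N (\<lambda>a. c - x (N - Suc a))"
    unfolding vdm_def by (intro prod.cong refl) (auto simp: \<rho>_def)
  finally show ?thesis by (simp add: vdm_reverse)
qed

section \<open>Strictly increasing exponents and row sums\<close>

definition increasing_seqs :: "nat \<Rightarrow> nat \<Rightarrow> (nat \<Rightarrow> nat) set" where
  "increasing_seqs N K = {l \<in> {..<N} \<rightarrow>\<^sub>E {..K}. \<forall>a b. a < b \<and> b < N \<longrightarrow> l a < l b}"

lemma increasing_seq_nth:
  assumes "\<forall>a b. a < b \<and> b < N \<longrightarrow> l a < (l b :: nat)" "a < N"
  shows "l a = sorted_list_of_set (l ` {..<N}) ! a"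
proof -
  have "sorted (map l [0..<N])" "distinct (map l [0..<N])"
    using assms(1) by (auto simp: sorted_iff_nth_mono distinct_conv_nth)
      (metis le_eq_less_or_eq order_refl, metis less_irrefl linorder_neqE_nat)
  hence "sorted_list_of_set (set (map l [0..<N])) = map l [0..<N]"
    by (rule sorted_list_of_set.idem_if_sorted_distinct)
  hence "sorted_list_of_set (l ` {..<N}) = map l [0..<N]" by (simp only: set_map set_upt lessThan_atLeast0)
  thus ?thesis using assms(2) by simp
qed

text \<open>An injective sequence is, in exactly one way, the increasing enumeration of its image
  composed with a permutation.\<close>

lemma sum_injective_seqs:
  fixes g :: "(nat \<Rightarrow> nat) \<Rightarrow> 'a :: comm_monoid_add"
  shows "(\<Sum>l\<in>{l \<in> {..<N} \<rightarrow>\<^sub>E {..K}. inj_on l {..<N}}. g l) =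
     (\<Sum>l\<in>increasing_seqs N K. \<Sum>\<sigma> | \<sigma> permutes {..<N}. g (l \<circ> \<sigma>))"
proof -
  let ?P = "{\<sigma>. \<sigma> permutes {..<N}}" and ?I = "increasing_seqs N K"
  have img: "(l \<circ> \<sigma>) ` {..<N} = l ` {..<N}" if "\<sigma> \<in> ?P" for l :: "nat \<Rightarrow> nat" and \<sigma>
    using that permutes_image[of \<sigma> "{..<N}"] by (metis image_comp mem_Collect_eq)
  have li: "inj_on l {..<N}" if "l \<in> ?I" for l
    using that unfolding increasing_seqs_def inj_on_def by (auto) (metis less_irrefl linorder_neqE_nat)
  have inj: "inj_on (\<lambda>(l, \<sigma>). l \<circ> \<sigma>) (?I \<times> ?P)"
  proof (rule inj_onI, clarify)
    fix l \<sigma> l' \<sigma>' assume l: "l \<in> ?I" and l': "l' \<in> ?I" and p: "\<sigma> permutes {..<N}" "\<sigma>' permutes {..<N}" and e: "l \<circ> \<sigma> = l' \<circ> \<sigma>'"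
    have i: "l ` {..<N} = l' ` {..<N}" using img[of \<sigma> l] img[of \<sigma>' l'] p e by simp
    have ll: "l = l'"
    proof (rule extensionalityI[of _ "{..<N}"])
      fix a assume "a \<in> {..<N}"
      thus "l a = l' a" using increasing_seq_nth[of N l a] increasing_seq_nth[of N l' a] l l' i by (simp add: increasing_seqs_def)
    qed (use l l' in \<open>auto simp: increasing_seqs_def PiE_def\<close>)
    moreover have "\<sigma> = \<sigma>'"
    proof
      fix a show "\<sigma> a = \<sigma>' a"
      proof (cases "a < N")
        case True
        have "l (\<sigma> a) = l (\<sigma>' a)" using e ll by (metis comp_apply)
        thus ?thesis using li[OF l] permutes_in_image[OF p(1)] permutes_in_image[OF p(2)] True by (auto dest: inj_onD)
      qed (use p in \<open>auto simp: permutes_not_in\<close>)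
    qed
    ultimately show "l = l' \<and> \<sigma> = \<sigma>'" by simp
  qed
  have "(\<lambda>(l, \<sigma>). l \<circ> \<sigma>) ` (?I \<times> ?P) = {l \<in> {..<N} \<rightarrow>\<^sub>E {..K}. inj_on l {..<N}}"
  proof (intro equalityI subsetI)
    fix m assume "m \<in> (\<lambda>(l, \<sigma>). l \<circ> \<sigma>) ` (?I \<times> ?P)"
    then obtain l \<sigma> where l: "l \<in> ?I" and p: "\<sigma> permutes {..<N}" and m: "m = l \<circ> \<sigma>" by auto
    have "inj_on m {..<N}" unfolding m
      by (rule comp_inj_on) (use p li[OF l] permutes_image[OF p] in \<open>auto intro: permutes_inj_on\<close>)
    moreover have "m \<in> {..<N} \<rightarrow>\<^sub>E {..K}"
      unfolding m using l permutes_in_image[OF p] p by (auto simp: increasing_seqs_def PiE_def Pi_def extensional_def permutes_not_in)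
    ultimately show "m \<in> {l \<in> {..<N} \<rightarrow>\<^sub>E {..K}. inj_on l {..<N}}" by simp
  next
    fix m assume m: "m \<in> {l \<in> {..<N} \<rightarrow>\<^sub>E {..K}. inj_on l {..<N}}"
    define A where "A = m ` {..<N}"
    define l where "l = (\<lambda>a\<in>{..<N}. sorted_list_of_set A ! a)"
    have A: "finite A" "card A = N" using m by (auto simp: A_def card_image)
    have len: "length (sorted_list_of_set A) = N" using A by simp
    have lA: "l ` {..<N} = A"
    proof -
      have "l ` {..<N} = (\<lambda>a. sorted_list_of_set A ! a) ` {..<N}" by (simp add: l_def)
      also have "\<dots> = set (sorted_list_of_set A)" using len by (auto simp: set_conv_nth)
      finally show ?thesis using A by simp
    qed
    have lI: "l \<in> ?I"
      unfolding increasing_seqs_def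
    proof (intro CollectI conjI allI impI)
      show "l \<in> {..<N} \<rightarrow>\<^sub>E {..K}"
      proof (rule PiE_I)
        fix a assume "a \<in> {..<N}"
        hence "l a \<in> l ` {..<N}" by (rule imageI)
        moreover have "m ` {..<N} \<subseteq> {..K}" using m by auto
        ultimately show "l a \<in> {..K}" unfolding lA A_def by (rule rev_subsetD)
      qed (simp add: l_def)
      fix a b assume "a < b \<and> b < N"
      moreover have "sorted_wrt (<) (sorted_list_of_set A)" by (rule strict_sorted_list_of_set)
      ultimately show "l a < l b" using len by (simp add: l_def sorted_wrt_nth_less)
    qed
    have bl: "bij_betw l {..<N} A" using li[OF lI] lA by (simp add: bij_betw_def)
    have bm: "bij_betw m {..<N} A" using m by (simp add: bij_betw_def A_def)
    define \<sigma> where "\<sigma> = (\<lambda>a. if a < N then inv_into {..<N} l (m a) else a)"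
    have "bij_betw (inv_into {..<N} l \<circ> m) {..<N} {..<N}"
      by (rule bij_betw_trans[OF bm bij_betw_inv_into[OF bl]])
    moreover have "bij_betw \<sigma> {..<N} {..<N} = bij_betw (inv_into {..<N} l \<circ> m) {..<N} {..<N}"
      by (rule bij_betw_cong) (simp add: \<sigma>_def)
    ultimately have "bij_betw \<sigma> {..<N} {..<N}" by simp
    hence p: "\<sigma> permutes {..<N}" by (rule bij_imp_permutes) (simp add: \<sigma>_def)
    have "m = l \<circ> \<sigma>"
    proof
      fix a show "m a = (l \<circ> \<sigma>) a"
      proof (cases "a < N")
        case True
        hence "m a \<in> A" by (simp add: A_def)
        hence "l (inv_into {..<N} l (m a)) = m a" by (rule bij_betw_inv_into_right[OF bl])
        thus ?thesis using True by (simp add: \<sigma>_def)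
      qed (use m in \<open>auto simp: \<sigma>_def l_def PiE_def extensional_def\<close>)
    qed
    thus "m \<in> (\<lambda>(l, \<sigma>). l \<circ> \<sigma>) ` (?I \<times> ?P)" using lI p by auto
  qed
  hence "(\<Sum>l\<in>{l \<in> {..<N} \<rightarrow>\<^sub>E {..K}. inj_on l {..<N}}. g l) = (\<Sum>(l, \<sigma>)\<in>?I \<times> ?P. g (l \<circ> \<sigma>))"
    using sum.reindex[OF inj, of g] by (simp only: case_prod_unfold comp_def)
  thus ?thesis unfolding sum.cartesian_product .
qed

text \<open>Up to factors that do not depend on \<open>l\<close>, the part of
  \<open>(n + N - 1 - l) choose (q + a - l)\<close> that does not depend on the row \<open>a\<close>.\<close>

definition row_weight :: "nat \<Rightarrow> nat \<Rightarrow> nat \<Rightarrow> nat \<Rightarrow> complex" where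
  "row_weight N q n l = (if l < q + N then fact (n + N - 1 - l) / (fact (q + N - 1 - l) * fact l) else 0)"

text \<open>In the binomial coefficient, 1 / (q + a - l)! is the falling factorial of degree N - 1 -
  a at q + N - 1 - l, divided by (q + N - 1 - l)!. All dependence on both the row and l thus sits in
  a monic family of polynomials, and the sum over permutations becomes an alternant.\<close>

lemma circle_sum_row_weight:
  assumes L: "n + N \<le> L" and a: "a < N" and q: "q \<le> n" and l: "l < n + N"
  shows "(\<Sum>u\<in>circle_pts L. (1 - u) ^ (n + N - 1) * cayley_var u ^ l / u ^ (q + a)) / of_nat L / fact l =
    (-1) ^ (q + a) * row_weight N q n l * poly (ffact (N - Suc a)) (of_nat (q + N - 1) - of_nat l) / fact (n - q + (N - Suc a))"
proof -
  have c: "(\<Sum>u\<in>circle_pts L. (1 - u) ^ (n + N - 1) * cayley_var u ^ l / u ^ (q + a)) / of_nat L =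
     (if l \<le> q + a then (-1) ^ (q + a) * of_nat ((n + N - 1 - l) choose (q + a - l)) else 0)"
    by (rule circle_sum_cayley) (use assms in auto)
  show ?thesis
  proof (cases "l < q + N")
    case False
    thus ?thesis unfolding c row_weight_def using a by simp
  next
    case True
    have d: "of_nat (q + N - 1) - of_nat l = (of_nat (q + N - 1 - l) :: complex)" using True by (simp add: of_nat_diff)
    show ?thesis
    proof (cases "l \<le> q + a")
      case False
      thus ?thesis unfolding c d poly_ffact using True by simp
    next
      case la: True
      have e1: "n + N - 1 - l - (q + a - l) = n - q + (N - Suc a)" "q + N - 1 - l - (N - Suc a) = q + a - l"
        "N - Suc a \<le> q + N - 1 - l" "q + a - l \<le> n + N - 1 - l" using la a q by auto
      have "of_nat ((n + N - 1 - l) choose (q + a - l)) = (fact (n + N - 1 - l) / (fact (q + a - l) * fact (n - q + (N - Suc a))) :: complex)"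
        using binomial_fact[OF e1(4)] unfolding e1(1) by simp
      thus ?thesis unfolding c d poly_ffact e1(2) row_weight_def using la True e1(3) by simp
    qed
  qed
qed

text \<open>Origin of the square: one Vandermonde product of \<open>l\<close> is the coefficient of
  the expanded power, the other is the alternant of the circle sums over the rearrangements of
  \<open>l\<close>.\<close>

lemma weyl_sum_log_deriv:
  assumes L: "n + N \<le> L" and N: "N > 0" and q: "q \<le> n" and r: "r \<le> n"
  shows "weyl_sum L N q (\<lambda>u. (\<Prod>a<N. (1 - u a) ^ n) * (\<Sum>a<N. cayley_var (u a)) ^ r) =
    (-1) ^ (N * q) * fact r / (\<Prod>a<N. fact (n - q + a)) *
    (\<Sum>l\<in>{l \<in> increasing_seqs N (r + N). (\<Sum>a<N. l a) = r + content_shift N}.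
        vdm N (\<lambda>a. of_nat (l a)) ^ 2 * (\<Prod>a<N. row_weight N q n (l a)))"
proof -
  let ?P = "{\<sigma>. \<sigma> permutes {..<N}}" and ?B = "{..<N} \<rightarrow>\<^sub>E {..r+N}" and ?s = "content_shift N"
  let ?V = "\<lambda>l. vdm N (\<lambda>a. of_nat (l a)) :: complex"
  define cs where "cs = (\<lambda>a l. (\<Sum>u\<in>circle_pts L. (1 - u) ^ (n + N - 1) * cayley_var u ^ l / u ^ (q + a)) / of_nat L)"
  define g where "g = (\<lambda>l. if (\<Sum>a<N. l a) = r + ?s then ?V l * (\<Prod>a<N. cs a (l a) / fact (l a)) else 0)"
  define w where "w = (\<lambda>l. (if (\<Sum>a<N. l a) = r + ?s then ?V l / (\<Prod>a<N. fact (l a)) else 0))"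
  have L0: "L > 0" using L N by simp
  have "weyl_sum L N q (\<lambda>u. (\<Prod>a<N. (1 - u a) ^ n) * (\<Sum>a<N. cayley_var (u a)) ^ r) =
    (\<Sum>u\<in>{..<N} \<rightarrow>\<^sub>E circle_pts L. \<Sum>l\<in>?B. (-1) ^ ?s * fact r * w l * (\<Prod>a<N. (1 - u a) ^ (n + N - 1) * cayley_var (u a) ^ l a / u a ^ (q + a))) / of_nat L ^ N"
    unfolding weyl_sum_def
  proof (rule arg_cong2[of _ _ _ _ "(/)"], rule sum.cong[OF refl])
    fix u assume u: "u \<in> {..<N} \<rightarrow>\<^sub>E circle_pts L"
    have u1: "u a \<noteq> 1" if "a < N" for a using circle_pts_neq[OF L0, of "u a"] u that by auto
    have pw: "(\<Prod>a<N. (1 - u a) ^ n) * (\<Prod>a<N. (1 - u a) ^ (N - 1)) = (\<Prod>a<N. (1 - u a) ^ (n + N - 1))"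
      unfolding prod.distrib[symmetric] power_add[symmetric] using N by simp
    have "(\<Prod>a<N. (1 - u a) ^ n) * (\<Sum>a<N. cayley_var (u a)) ^ r * vdm N u =
      (-1) ^ ?s * ((\<Prod>a<N. (1 - u a) ^ n) * (\<Prod>a<N. (1 - u a) ^ (N - 1))) * (vdm N (\<lambda>a. cayley_var (u a)) * (\<Sum>a<N. cayley_var (u a)) ^ r)"
      by (subst vdm_cayley[OF u1]) (simp_all add: mult_ac)
    also have "\<dots> = (\<Sum>l\<in>?B. (-1) ^ ?s * fact r * w l * ((\<Prod>a<N. (1 - u a) ^ (n + N - 1)) * (\<Prod>a<N. cayley_var (u a) ^ l a)))"
      unfolding pw vdm_times_power_sum w_def[symmetric]
      unfolding w_def sum_distrib_left by (intro sum.cong refl) (simp add: mult_ac)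
    finally have e: "(\<Prod>a<N. (1 - u a) ^ n) * (\<Sum>a<N. cayley_var (u a)) ^ r * vdm N u =
      (\<Sum>l\<in>?B. (-1) ^ ?s * fact r * w l * ((\<Prod>a<N. (1 - u a) ^ (n + N - 1)) * (\<Prod>a<N. cayley_var (u a) ^ l a)))" .
    show "(\<Prod>a<N. (1 - u a) ^ n) * (\<Sum>a<N. cayley_var (u a)) ^ r * vdm N u / (\<Prod>a<N. u a ^ (q + a)) =
      (\<Sum>l\<in>?B. (-1) ^ ?s * fact r * w l * (\<Prod>a<N. (1 - u a) ^ (n + N - 1) * cayley_var (u a) ^ l a / u a ^ (q + a)))"
      unfolding e sum_divide_distrib by (simp only: prod.distrib prod_dividef times_divide_eq_right)
  qed simp
  also have "\<dots> = (\<Sum>l\<in>?B. (-1) ^ ?s * fact r * w l * ((\<Sum>u\<in>{..<N} \<rightarrow>\<^sub>E circle_pts L. \<Prod>a<N. (1 - u a) ^ (n + N - 1) * cayley_var (u a) ^ l a / u a ^ (q + a)) / of_nat L ^ N))"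
    unfolding times_divide_eq_right sum_distrib_left sum_divide_distrib by (rule sum.swap)
  also have "\<dots> = (\<Sum>l\<in>?B. (-1) ^ ?s * fact r * w l * (\<Prod>a<N. cs a (l a)))"
    unfolding cs_def
    by (intro sum.cong refl arg_cong2[of _ _ _ _ "(*)"]) (rule weyl_sum_product[OF L0, where h = "\<lambda>a u. (1 - u) ^ (n + N - 1) * cayley_var u ^ _ a / u ^ (q + a)"])
  also have "\<dots> = (\<Sum>l\<in>?B. (-1) ^ ?s * fact r * g l)"
  proof (rule sum.cong[OF refl])
    fix l
    show "(-1) ^ ?s * fact r * w l * (\<Prod>a<N. cs a (l a)) = (-1) ^ ?s * fact r * g l"
      by (cases "(\<Sum>a<N. l a) = r + ?s") (simp_all add: w_def g_def prod_dividef)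
  qed
  also have "\<dots> = (-1) ^ ?s * fact r * (\<Sum>l\<in>?B. g l)" by (rule sum_distrib_left[symmetric])
  also have "(\<Sum>l\<in>?B. g l) = (\<Sum>l\<in>{l \<in> ?B. inj_on l {..<N}}. g l)"
  proof (rule sum.mono_neutral_right)
    show "\<forall>l\<in>?B - {l \<in> ?B. inj_on l {..<N}}. g l = 0"
    proof
      fix l assume "l \<in> ?B - {l \<in> ?B. inj_on l {..<N}}"
      then obtain a b where "a < N" "b < N" "a \<noteq> b" "l a = l b" by (auto simp: inj_on_def)
      hence "?V l = 0" by (intro vdm_eq_0[of a N b]) auto
      thus "g l = 0" by (simp add: g_def)
    qed
  qed (auto intro!: finite_PiE)
  also have "\<dots> = (\<Sum>l\<in>increasing_seqs N (r + N). \<Sum>\<sigma>\<in>?P. g (l \<circ> \<sigma>))" by (rule sum_injective_seqs)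
  also have "\<dots> = (\<Sum>l\<in>increasing_seqs N (r + N). if (\<Sum>a<N. l a) = r + ?s then
      (-1) ^ (N * q) * (-1) ^ ?s / (\<Prod>a<N. fact (n - q + a)) * (?V l ^ 2 * (\<Prod>a<N. row_weight N q n (l a))) else 0)"
  proof (rule sum.cong[OF refl])
    fix l assume l: "l \<in> increasing_seqs N (r + N)"
    have lB: "l \<in> ?B" and inj: "inj_on l {..<N}"
      using l by (auto simp: increasing_seqs_def inj_on_def) (metis less_irrefl linorder_neqE_nat)
    have s\<sigma>: "(\<Sum>a<N. (l \<circ> \<sigma>) a) = (\<Sum>a<N. l a)" if "\<sigma> \<in> ?P" for \<sigma>
      using that sum.permute[of \<sigma> "{..<N}" l] by simp
    show "(\<Sum>\<sigma>\<in>?P. g (l \<circ> \<sigma>)) = (if (\<Sum>a<N. l a) = r + ?s then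
      (-1) ^ (N * q) * (-1) ^ ?s / (\<Prod>a<N. fact (n - q + a)) * (?V l ^ 2 * (\<Prod>a<N. row_weight N q n (l a))) else 0)"
    proof (cases "(\<Sum>a<N. l a) = r + ?s")
      case False
      hence "g (l \<circ> \<sigma>) = 0" if "\<sigma> \<in> ?P" for \<sigma> using s\<sigma>[OF that] by (simp add: g_def)
      thus ?thesis using False by simp
    next
      case True
      have ln: "l a < n + N" if "a < N" for a using multinomial_support[OF lB True inj that] r by simp
      let ?K = "(-1) ^ (N * q) * (-1) ^ ?s / (\<Prod>a<N. fact (n - q + a)) * (\<Prod>a<N. row_weight N q n (l a)) :: complex"
      let ?f = "\<lambda>\<sigma>. (\<Prod>a<N. poly (ffact (N - Suc a)) (of_nat (q + N - 1) - of_nat (l (\<sigma> a)) :: complex))"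
      have gs: "g (l \<circ> \<sigma>) = ?K * ?V l * (of_int (sign \<sigma>) * ?f \<sigma>)" if "\<sigma> \<in> ?P" for \<sigma>
      proof -
        have p: "\<sigma> permutes {..<N}" using that by simp
        have "(\<Prod>a<N. cs a ((l \<circ> \<sigma>) a) / fact ((l \<circ> \<sigma>) a)) =
          (\<Prod>a<N. (-1) ^ (q + a) * row_weight N q n (l (\<sigma> a)) * poly (ffact (N - Suc a)) (of_nat (q + N - 1) - of_nat (l (\<sigma> a))) / fact (n - q + (N - Suc a)))"
          unfolding cs_def o_def
          by (intro prod.cong refl circle_sum_row_weight) (use L q ln permutes_in_image[OF p] in auto)
        also have "\<dots> = (\<Prod>a<N. (-1) ^ (q + a)) * (\<Prod>a<N. row_weight N q n (l (\<sigma> a))) * ?f \<sigma> / (\<Prod>a<N. fact (n - q + (N - Suc a)))"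
          by (simp only: prod.distrib prod_dividef)
        also have "(\<Prod>a<N. (-1) ^ (q + a)) = ((-1) ^ (N * q) * (-1) ^ ?s :: complex)"
          by (simp only: power_add prod.distrib prod_constant card_lessThan power_sum content_shift_def power_mult[symmetric] mult.commute)
        also have "(\<Prod>a<N. row_weight N q n (l (\<sigma> a))) = (\<Prod>a<N. row_weight N q n (l a))"
          using prod.permute[OF p, of "\<lambda>a. row_weight N q n (l a)"] by (simp add: o_def)
        also have "(\<Prod>a<N. fact (n - q + (N - Suc a))) = (\<Prod>a<N. fact (n - q + a) :: complex)"
          by (rule prod.nat_diff_reindex)
        finally have pr: "(\<Prod>a<N. cs a ((l \<circ> \<sigma>) a) / fact ((l \<circ> \<sigma>) a)) = (-1) ^ (N * q) * (-1) ^ ?s * (\<Prod>a<N. row_weight N q n (l a)) * ?f \<sigma> / (\<Prod>a<N. fact (n - q + a))" .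
        have "?V (l \<circ> \<sigma>) = of_int (sign \<sigma>) * ?V l"
          using vdm_permute[OF p, of "\<lambda>a. of_nat (l a) :: complex"] by (simp add: o_def)
        thus ?thesis using s\<sigma>[OF that] True unfolding g_def pr by simp
      qed
      have "(\<Sum>\<sigma>\<in>?P. g (l \<circ> \<sigma>)) = (\<Sum>\<sigma>\<in>?P. ?K * ?V l * (of_int (sign \<sigma>) * ?f \<sigma>))"
        by (rule sum.cong[OF refl gs])
      also have "\<dots> = ?K * ?V l * (\<Sum>\<sigma>\<in>?P. of_int (sign \<sigma>) * ?f \<sigma>)" by (rule sum_distrib_left[symmetric])
      also have "(\<Sum>\<sigma>\<in>?P. of_int (sign \<sigma>) * ?f \<sigma>) = ?V l"
        by (rule alternant_reverse_eq_vdm)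
      finally have "(\<Sum>\<sigma>\<in>?P. g (l \<circ> \<sigma>)) = ?K * ?V l * ?V l" .
      also have "\<dots> = (-1) ^ (N * q) * (-1) ^ ?s / (\<Prod>a<N. fact (n - q + a)) * (?V l ^ 2 * (\<Prod>a<N. row_weight N q n (l a)))"
        by (simp add: power2_eq_square)
      finally show ?thesis by (simp only: True if_True simp_thms)
    qed
  qed
  also have "\<dots> = (\<Sum>l\<in>{l \<in> increasing_seqs N (r + N). (\<Sum>a<N. l a) = r + ?s}.
      (-1) ^ (N * q) * (-1) ^ ?s / (\<Prod>a<N. fact (n - q + a)) * (?V l ^ 2 * (\<Prod>a<N. row_weight N q n (l a))))"
    by (rule sum.inter_filter[symmetric]) (auto simp: increasing_seqs_def intro!: finite_subset[OF _ finite_PiE[of "{..<N}" "\<lambda>_. {..r+N}"]])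
  also have "\<dots> = (-1) ^ (N * q) * (-1) ^ ?s / (\<Prod>a<N. fact (n - q + a)) *
     (\<Sum>l\<in>{l \<in> increasing_seqs N (r + N). (\<Sum>a<N. l a) = r + ?s}. ?V l ^ 2 * (\<Prod>a<N. row_weight N q n (l a)))"
    by (rule sum_distrib_left[symmetric])
  finally have e: "weyl_sum L N q (\<lambda>u. (\<Prod>a<N. (1 - u a) ^ n) * (\<Sum>a<N. cayley_var (u a)) ^ r) =
     (-1) ^ ?s * fact r * ((-1) ^ (N * q) * (-1) ^ ?s / (\<Prod>a<N. fact (n - q + a)) *
     (\<Sum>l\<in>{l \<in> increasing_seqs N (r + N). (\<Sum>a<N. l a) = r + ?s}. ?V l ^ 2 * (\<Prod>a<N. row_weight N q n (l a))))" .
  \<comment> \<open>The sign with exponent \<open>content_shift N\<close> occurs twice, in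
    \<open>vdm_cayley\<close> and in the product of the row signs (-1)^(q + a).\<close>
  have sq: "(-1) ^ ?s * (-1) ^ ?s = (1 :: complex)" by (simp flip: power_mult_distrib)
  have cm: "x * f * (w * x / p * S) = (x * x) * (w * f / p * S)" for x f w p S :: complex by simp
  show ?thesis unfolding e by (subst cm) (simp only: sq mult_1_left)
qed

section \<open>Hook lengths and contents\<close>

definition part :: "nat list \<Rightarrow> nat \<Rightarrow> nat" where
  "part \<mu> i = (if i < length \<mu> then \<mu> ! i else 0)"

lemma part_antimono: "\<mu> \<in> partitions_of r \<Longrightarrow> i \<le> j \<Longrightarrow> part \<mu> j \<le> part \<mu> i"
  using sorted_wrt_nth_less[of "(\<ge>)" \<mu> i j] by (cases "i = j") (auto simp: part_def partitions_of_def)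

lemma part_pos: "\<mu> \<in> partitions_of r \<Longrightarrow> i < length \<mu> \<Longrightarrow> part \<mu> i > 0"
  by (simp add: part_def partitions_of_def)

lemma sum_part: "\<mu> \<in> partitions_of r \<Longrightarrow> length \<mu> \<le> N \<Longrightarrow> (\<Sum>i<N. part \<mu> i) = r"
proof -
  assume m: "\<mu> \<in> partitions_of r" "length \<mu> \<le> N"
  have "(\<Sum>i<N. part \<mu> i) = (\<Sum>i<length \<mu>. \<mu> ! i)"
    by (rule sum.mono_neutral_cong_right) (use m in \<open>auto simp: part_def\<close>)
  also have "\<dots> = r" using m by (simp add: partitions_of_def sum_list_sum_nth lessThan_atLeast0)
  finally show ?thesis .
qed

lemma part_le: "\<mu> \<in> partitions_of r \<Longrightarrow> part \<mu> i \<le> r"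
  using member_le_sum_list[of "\<mu> ! i" \<mu>] by (simp add: part_def partitions_of_def)

lemma partition_eqI:
  assumes "\<mu> \<in> partitions_of r" "\<nu> \<in> partitions_of r'" "\<And>i. part \<mu> i = part \<nu> i"
  shows "\<mu> = \<nu>"
proof -
  have "\<not> length \<mu> < length \<nu>" using part_pos[OF assms(2), of "length \<mu>"] assms(3)[of "length \<mu>"] by (auto simp: part_def)
  moreover have "\<not> length \<nu> < length \<mu>" using part_pos[OF assms(1), of "length \<nu>"] assms(3)[of "length \<nu>"] by (auto simp: part_def)
  ultimately have "length \<mu> = length \<nu>" by simp
  moreover have "\<mu> ! i = \<nu> ! i" if "i < length \<mu>" for i using assms(3)[of i] that calculation by (simp add: part_def)
  ultimately show ?thesis by (rule nth_equalityI)
qed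

lemma young_diagram_eq_Sigma:
  "length \<mu> \<le> N \<Longrightarrow> young_diagram \<mu> = (SIGMA i:{..<N}. {..<part \<mu> i})"
  by (auto simp: young_diagram_def part_def split: if_splits)

lemma finite_young_diagram [simp]: "finite (young_diagram \<mu>)"
  by (simp add: young_diagram_eq_Sigma[OF order_refl])

lemma prod_young_diagram:
  "length \<mu> \<le> N \<Longrightarrow> (\<Prod>b\<in>young_diagram \<mu>. f b) = (\<Prod>i<N. \<Prod>j<part \<mu> i. f (i, j))"
  by (simp add: young_diagram_eq_Sigma prod.Sigma)

lemma card_young_diagram: "\<mu> \<in> partitions_of r \<Longrightarrow> card (young_diagram \<mu>) = r"
  by (simp add: young_diagram_eq_Sigma[OF order_refl] sum_part)

lemma down_closed_eq_lessThan:
  fixes A :: "nat set"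
  assumes "finite A" "\<And>i i'. i \<in> A \<Longrightarrow> i' \<le> i \<Longrightarrow> i' \<in> A"
  shows "A = {..<card A}"
proof (rule card_subset_eq[OF assms(1), symmetric])
  show "{..<card A} \<subseteq> A"
  proof
    fix i assume "i \<in> {..<card A}"
    show "i \<in> A"
    proof (rule ccontr)
      assume "i \<notin> A"
      hence "A \<subseteq> {..<i}" using assms(2) by (metis lessThan_iff not_less subsetI)
      hence "card A \<le> i" using card_mono[of "{..<i}" A] by simp
      thus False using \<open>i \<in> {..<card A}\<close> by simp
    qed
  qed
qed simp

definition col :: "nat list \<Rightarrow> nat \<Rightarrow> nat" where
  "col \<mu> j = card {i. j < part \<mu> i}"

text \<open>The rows that reach column j form an initial segment because the parts decrease, so
  membership of a box can be tested by row length or by column length.\<close>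

lemma less_part_iff:
  assumes "\<mu> \<in> partitions_of r"
  shows "j < part \<mu> i \<longleftrightarrow> i < col \<mu> j"
proof -
  let ?A = "{i. j < part \<mu> i}"
  have fin: "finite ?A" by (rule finite_subset[of _ "{..<length \<mu>}"]) (auto simp: part_def split: if_splits)
  have down: "i' \<in> ?A" if "i \<in> ?A" "i' \<le> i" for i i' using part_antimono[OF assms that(2)] that(1) by simp
  have "?A = {..<card ?A}" by (rule down_closed_eq_lessThan[OF fin]) (use down in blast)
  thus ?thesis unfolding col_def by blast
qed

lemma col_antimono:
  assumes m: "\<mu> \<in> partitions_of r" and "j \<le> j'"
  shows "col \<mu> j' \<le> col \<mu> j"
proof (rule ccontr)
  assume "\<not> col \<mu> j' \<le> col \<mu> j"
  hence "j' < part \<mu> (col \<mu> j)" using less_part_iff[OF m] by simp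
  hence "j < part \<mu> (col \<mu> j)" using assms(2) by simp
  thus False using less_part_iff[OF m] by simp
qed

lemma card_hook:
  assumes m: "\<mu> \<in> partitions_of r" and b: "j < part \<mu> i"
  shows "card (hook \<mu> (i, j)) = (part \<mu> i - j) + (col \<mu> j - Suc i)"
proof -
  have yd: "(i, j) \<in> young_diagram \<mu> \<longleftrightarrow> j < part \<mu> i" for i j
    by (auto simp: young_diagram_def part_def)
  have "hook \<mu> (i, j) = (\<lambda>j. (i, j)) ` {j..<part \<mu> i} \<union> (\<lambda>i. (i, j)) ` {Suc i..<col \<mu> j}"
  proof (rule Set.set_eqI, clarify)
    fix i' j'
    show "(i', j') \<in> hook \<mu> (i, j) \<longleftrightarrow> (i', j') \<in> (\<lambda>j. (i, j)) ` {j..<part \<mu> i} \<union> (\<lambda>i. (i, j)) ` {Suc i..<col \<mu> j}"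
      unfolding hook_def using b less_part_iff[OF m, of j i']
      by (cases "i' = i") (auto simp: yd image_iff Suc_le_eq)
  qed
  moreover have "card ((\<lambda>j. (i, j)) ` {j..<part \<mu> i} \<union> (\<lambda>i. (i, j)) ` {Suc i..<col \<mu> j}) =
     card ((\<lambda>j. (i, j)) ` {j..<part \<mu> i}) + card ((\<lambda>i. (i, j)) ` {Suc i..<col \<mu> j})"
    by (rule card_Un_disjoint) auto
  ultimately show ?thesis by (simp add: card_image inj_on_def)
qed

section \<open>Shifted parts and hook lengths\<close>

definition shifted_part :: "nat \<Rightarrow> nat list \<Rightarrow> nat \<Rightarrow> nat" where
  "shifted_part N \<mu> i = part \<mu> i + (N - Suc i)"

lemma shifted_part_less:
  "\<mu> \<in> partitions_of r \<Longrightarrow> i < m \<Longrightarrow> m < N \<Longrightarrow> shifted_part N \<mu> m < shifted_part N \<mu> i"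
  using part_antimono[of \<mu> r i m] by (simp add: shifted_part_def)

text \<open>The hook lengths in row \<open>i\<close> and the differences of the shifted part \<open>i\<close> with the later
  ones partition \<open>{1..shifted_part N \<mu> i}\<close>.\<close>

lemma row_hook_product:
  assumes m: "\<mu> \<in> partitions_of r" and N: "length \<mu> \<le> N" and i: "i < N"
  shows "(\<Prod>j<part \<mu> i. card (hook \<mu> (i, j))) * (\<Prod>m\<in>{i<..<N}. shifted_part N \<mu> i - shifted_part N \<mu> m) =
    fact (shifted_part N \<mu> i)"
proof -
  let ?l = "shifted_part N \<mu>"
  \<comment> \<open>Chosen so that \<open>shifted_part N \<mu> i - g j\<close> is the hook length of
    the box in row i and column j.\<close>
  define g where "g = (\<lambda>j. j + (N - col \<mu> j))"
  have colN: "col \<mu> j \<le> N" for j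
  proof (rule ccontr)
    assume "\<not> col \<mu> j \<le> N"
    hence "j < part \<mu> N" using less_part_iff[OF m] by simp
    thus False using N by (simp add: part_def)
  qed
  have coli: "i < col \<mu> j" if "j < part \<mu> i" for j using less_part_iff[OF m] that by simp
  have g_less: "g j < g j'" if "j < j'" for j j' using col_antimono[OF m, of j j'] that by (simp add: g_def)
  have inj_g: "inj_on g {..<part \<mu> i}"
    by (intro linorder_inj_onI) (use g_less in \<open>auto simp: nat_neq_iff\<close>)
  have inj_l: "inj_on ?l {i<..<N}"
    by (intro linorder_inj_onI) (use shifted_part_less[OF m] in \<open>auto simp: nat_neq_iff\<close>)
  have disj: "g ` {..<part \<mu> i} \<inter> ?l ` {i<..<N} = {}"
  proof (rule ccontr)
    assume "g ` {..<part \<mu> i} \<inter> ?l ` {i<..<N} \<noteq> {}"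
    then obtain j h where h: "i < h" "h < N" "g j = ?l h" by auto
    show False
    \<comment> \<open>If the box (h, j) belongs to the diagram, then
      \<open>shifted_part N \<mu> h\<close> exceeds \<open>g j\<close>; otherwise it is
      smaller.\<close>
    proof (cases "h < col \<mu> j")
      case True
      hence "j < part \<mu> h" using less_part_iff[OF m] by simp
      thus False using h True colN[of j] by (simp add: g_def shifted_part_def)
    next
      case False
      hence "part \<mu> h \<le> j" using less_part_iff[OF m] by (simp add: not_less[symmetric])
      thus False using h False by (simp add: g_def shifted_part_def)
    qed
  qed
  have sub: "g ` {..<part \<mu> i} \<union> ?l ` {i<..<N} \<subseteq> {..<?l i}"
  proof -
    have "g j < ?l i" if "j < part \<mu> i" for j
      using coli[OF that] colN[of j] that i by (simp add: g_def shifted_part_def)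
    thus ?thesis using shifted_part_less[OF m, of i _ N] by auto
  qed
  have U: "g ` {..<part \<mu> i} \<union> ?l ` {i<..<N} = {..<?l i}"
  proof (rule card_subset_eq[OF _ sub])
    have "card (g ` {..<part \<mu> i} \<union> ?l ` {i<..<N}) = part \<mu> i + (N - Suc i)"
      using disj by (subst card_Un_disjoint) (auto simp: card_image[OF inj_g] card_image[OF inj_l])
    thus "card (g ` {..<part \<mu> i} \<union> ?l ` {i<..<N}) = card {..<?l i}" by (simp add: shifted_part_def)
  qed simp
  have "fact (?l i) = (\<Prod>t<?l i. ?l i - t)"
    by (subst prod.nat_diff_reindex[symmetric]) (simp add: fact_prod_Suc lessThan_atLeast0)
  also have "\<dots> = (\<Prod>t\<in>g ` {..<part \<mu> i}. ?l i - t) * (\<Prod>t\<in>?l ` {i<..<N}. ?l i - t)"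
    unfolding U[symmetric] using disj by (subst prod.union_disjoint) auto
  also have "\<dots> = (\<Prod>j<part \<mu> i. ?l i - g j) * (\<Prod>m\<in>{i<..<N}. ?l i - ?l m)"
    using inj_g inj_l by (simp add: prod.reindex)
  also have "(\<Prod>j<part \<mu> i. ?l i - g j) = (\<Prod>j<part \<mu> i. card (hook \<mu> (i, j)))"
  proof (rule prod.cong[OF refl])
    fix j assume "j \<in> {..<part \<mu> i}"
    hence j: "j < part \<mu> i" by simp
    show "?l i - g j = card (hook \<mu> (i, j))"
      unfolding card_hook[OF m j] using coli[OF j] colN[of j] j i by (simp add: g_def shifted_part_def)
  qed
  finally show ?thesis by simp
qed

lemma prod_lower_pairs:
  "(\<Prod>i<N. \<Prod>m\<in>{i<..<N::nat}. f i m) = (\<Prod>b<N. \<Prod>a<b. f a b)"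
  by (subst (1 2) prod.Sigma; simp)
    (rule prod.reindex_bij_witness[of _ "\<lambda>(b, a). (a, b)" "\<lambda>(a, b). (b, a)"]; auto)

text \<open>The product of \<open>row_hook_product\<close> over all rows: the differences of shifted
  parts assemble to the Vandermonde product, with positive factors once the decreasing sequence is
  reversed.\<close>

lemma hook_product_vdm:
  assumes m: "\<mu> \<in> partitions_of r" and N: "length \<mu> \<le> N"
  shows "of_nat (hook_product \<mu>) * vdm N (\<lambda>a. of_nat (shifted_part N \<mu> (N - Suc a))) =
    (\<Prod>i<N. fact (shifted_part N \<mu> i) :: complex)"
proof -
  let ?l = "shifted_part N \<mu>"
  have "vdm N (\<lambda>a. of_nat (?l (N - Suc a))) = vdm N (\<lambda>a. - of_nat (?l a) :: complex)"
    using vdm_reverse[of N 0 "\<lambda>a. - of_nat (?l a) :: complex"] by simp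
  also have "\<dots> = (\<Prod>b<N. \<Prod>a<b. of_nat (?l a - ?l b))"
    unfolding vdm_def by (intro prod.cong refl) (use shifted_part_less[OF m] in \<open>auto simp: of_nat_diff less_imp_le\<close>)
  also have "\<dots> = of_nat (\<Prod>i<N. \<Prod>h\<in>{i<..<N}. ?l i - ?l h)"
    unfolding prod_lower_pairs by simp
  finally have "of_nat (hook_product \<mu>) * vdm N (\<lambda>a. of_nat (?l (N - Suc a))) =
      (of_nat ((\<Prod>i<N. \<Prod>j<part \<mu> i. card (hook \<mu> (i, j))) * (\<Prod>i<N. \<Prod>h\<in>{i<..<N}. ?l i - ?l h)) :: complex)"
    unfolding hook_product_def prod_young_diagram[OF N] by simp
  also have "(\<Prod>i<N. \<Prod>j<part \<mu> i. card (hook \<mu> (i, j))) * (\<Prod>i<N. \<Prod>h\<in>{i<..<N}. ?l i - ?l h) = (\<Prod>i<N. fact (?l i))"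
    unfolding prod.distrib[symmetric] by (intro prod.cong refl row_hook_product[OF m N]) simp
  finally show ?thesis by simp
qed

lemma hook_product_pos: "hook_product \<mu> > 0"
proof -
  have "card (hook \<mu> b) > 0" if "b \<in> young_diagram \<mu>" for b
  proof -
    have "finite (hook \<mu> b)" by (rule finite_subset[OF _ finite_young_diagram[of \<mu>]]) (auto simp: hook_def)
    moreover have "b \<in> hook \<mu> b" using that by (auto simp: hook_def)
    ultimately show ?thesis by (auto simp: card_gt_0_iff)
  qed
  thus ?thesis unfolding hook_product_def by (intro prod_pos) auto
qed

definition partition_seq :: "nat \<Rightarrow> nat list \<Rightarrow> nat \<Rightarrow> nat" where
  "partition_seq N \<mu> = (\<lambda>a\<in>{..<N}. shifted_part N \<mu> (N - Suc a))"

text \<open>A strictly increasing sequence dominates the staircase. Its difference with the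
  staircase, read backwards and stripped of zeros, is the partition.\<close>

lemma bij_betw_partition_seq:
  "bij_betw (partition_seq N) {\<mu> \<in> partitions_of r. length \<mu> \<le> N}
     {l \<in> increasing_seqs N (r + N). (\<Sum>a<N. l a) = r + content_shift N}"
    (is "bij_betw _ ?A ?B")
proof -
  have val: "partition_seq N \<mu> a = part \<mu> (N - Suc a) + a" if "a < N" for \<mu> a
    using that by (simp add: partition_seq_def shifted_part_def)
  have inj: "inj_on (partition_seq N) ?A"
  proof (rule inj_onI)
    fix \<mu> \<nu> assume m: "\<mu> \<in> ?A" and n: "\<nu> \<in> ?A" and e: "partition_seq N \<mu> = partition_seq N \<nu>"
    have "part \<mu> i = part \<nu> i" for i
    proof (cases "i < N")
      case True
      thus ?thesis using fun_cong[OF e, of "N - Suc i"] by (simp add: val)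
    qed (use m n in \<open>simp add: part_def\<close>)
    thus "\<mu> = \<nu>" using partition_eqI[of \<mu> r \<nu> r] m n by simp
  qed
  have "partition_seq N ` ?A = ?B"
  proof (intro equalityI subsetI)
    fix l assume "l \<in> partition_seq N ` ?A"
    then obtain \<mu> where m: "\<mu> \<in> partitions_of r" "length \<mu> \<le> N" and l: "l = partition_seq N \<mu>" by auto
    have "(\<Sum>a<N. l a) = (\<Sum>a<N. part \<mu> (N - Suc a)) + content_shift N"
      by (simp add: l val content_shift_def sum.distrib)
    also have "(\<Sum>a<N. part \<mu> (N - Suc a)) = r" using sum.nat_diff_reindex[of "part \<mu>" N] sum_part[OF m] by simp
    finally have s: "(\<Sum>a<N. l a) = r + content_shift N" .
    have "l \<in> {..<N} \<rightarrow>\<^sub>E {..r + N}"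
    proof (rule PiE_I)
      fix a assume "a \<in> {..<N}"
      thus "l a \<in> {..r + N}" using part_le[OF m(1), of "N - Suc a"] by (simp add: l val)
    qed (simp add: l partition_seq_def)
    moreover have "l a < l b" if "a < b" "b < N" for a b
    proof -
      have "part \<mu> (N - Suc a) \<le> part \<mu> (N - Suc b)" by (rule part_antimono[OF m(1)]) (use that in simp)
      thus ?thesis using that by (simp add: l val)
    qed
    ultimately show "l \<in> ?B" using s by (simp add: increasing_seqs_def)
  next
    fix l assume "l \<in> ?B"
    hence lB: "l \<in> {..<N} \<rightarrow>\<^sub>E {..r + N}" and inc: "\<And>a b. a < b \<Longrightarrow> b < N \<Longrightarrow> l a < l b" and s: "(\<Sum>a<N. l a) = r + content_shift N"
      by (auto simp: increasing_seqs_def)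
    define p where "p = (\<lambda>i. l (N - Suc i) - (N - Suc i))"
    \<comment> \<open>A strictly increasing sequence gains at least 1 at each step, so its
      difference with the staircase is weakly increasing.\<close>
    have mono: "l a + (b - a) \<le> l b" if "a \<le> b" "b < N" for a b
      using that
    proof (induction b)
      case (Suc b)
      show ?case
      proof (cases "a = Suc b")
        case False
        hence "l a + (b - a) \<le> l b" using Suc by simp
        thus ?thesis using inc[of b "Suc b"] Suc.prems False by simp
      qed simp
    qed simp
    have la: "a \<le> l a" if "a < N" for a using mono[of 0 a] that by simp
    have anti: "p j \<le> p i" if "i \<le> j" "j < N" for i j
    proof -
      have "l (N - Suc j) + (N - Suc i - (N - Suc j)) \<le> l (N - Suc i)" by (rule mono) (use that in auto)
      moreover have "N - Suc i = N - Suc j + (N - Suc i - (N - Suc j))" using that by simp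
      ultimately show ?thesis unfolding p_def by linarith
    qed
    define n where "n = card {i. i < N \<and> p i > 0}"
    have pn: "p i > 0 \<longleftrightarrow> i < n" if "i < N" for i
    proof -
      let ?A = "{i. i < N \<and> p i > 0}"
      have down: "i' \<in> ?A" if "i \<in> ?A" "i' \<le> i" for i i' using anti[OF that(2)] that by auto
      have "?A = {..<card ?A}" by (rule down_closed_eq_lessThan) (use down in \<open>simp, blast\<close>)
      hence "i \<in> ?A \<longleftrightarrow> i < n" unfolding n_def by blast
      thus ?thesis using that by simp
    qed
    have nN: "n \<le> N" unfolding n_def using card_mono[of "{..<N}" "{i. i < N \<and> p i > 0}"] by auto
    define \<mu> where "\<mu> = map p [0..<n]"
    have part: "part \<mu> i = p i" if "i < N" for i using pn[OF that] by (auto simp: part_def \<mu>_def)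
    have "(\<Sum>i<N. p i) + content_shift N = (\<Sum>a<N. l a)"
    proof -
      have "(\<Sum>i<N. p i) = (\<Sum>a<N. l a - a)" unfolding p_def by (rule sum.nat_diff_reindex)
      thus ?thesis unfolding content_shift_def using la by (simp flip: sum.distrib)
    qed
    hence sp: "(\<Sum>i<N. p i) = r" using s by simp
    have "(\<Sum>i<n. p i) = (\<Sum>i<N. p i)"
    proof (rule sum.mono_neutral_left)
      show "\<forall>i\<in>{..<N} - {..<n}. p i = 0" using pn by (metis DiffD1 DiffD2 gr0I lessThan_iff)
    qed (use nN in auto)
    hence "sum_list \<mu> = r" using sp by (simp add: \<mu>_def sum_list_distinct_conv_sum_set lessThan_atLeast0)
    moreover have "sorted_wrt (\<ge>) \<mu>" using anti nN by (auto simp: \<mu>_def sorted_wrt_iff_nth_less)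
    moreover have "\<forall>x\<in>set \<mu>. x > 0" using pn nN by (auto simp: \<mu>_def)
    ultimately have "\<mu> \<in> ?A" using nN by (simp add: partitions_of_def \<mu>_def)
    moreover have "l = partition_seq N \<mu>"
    proof (rule extensionalityI[of _ "{..<N}"])
      fix a assume "a \<in> {..<N}"
      thus "l a = partition_seq N \<mu> a" using la[of a] by (simp add: val part p_def)
    qed (use lB in \<open>auto simp: partition_seq_def PiE_def\<close>)
    ultimately show "l \<in> partition_seq N ` ?A" by blast
  qed
  thus ?thesis using inj by (simp add: bij_betw_def)
qed

lemma prod_rising: "0 < x \<Longrightarrow> (\<Prod>j<m. of_nat (x + j)) * fact (x - 1) = (fact (x + m - 1) :: complex)"
proof (induction m)
  case (Suc m)
  have "fact (x + m) = of_nat (x + m) * (fact (x + m - 1) :: complex)" using Suc.prems by (subst fact_reduce) auto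
  thus ?case using Suc by (simp add: mult_ac)
qed simp

lemma prod_falling: "(\<Prod>j<m. of_nat y - of_nat j) = (if m \<le> y then fact y / fact (y - m) else (0 :: complex))"
  unfolding poly_ffact_eq_prod[symmetric] by (rule poly_ffact)

text \<open>Rising factorials turn into contents added to N, falling factorials at q + i and n + i
  into contents subtracted from q and n. If row i is longer than q + i, it has a box of content q
  and both sides are 0; r \<le> n keeps every denominator - n + c nonzero.\<close>

lemma row_weight_shifted_part:
  assumes m: "\<mu> \<in> partitions_of r" and i: "i < N" and r: "r \<le> n"
  shows "fact (shifted_part N \<mu> i) ^ 2 * row_weight N q n (shifted_part N \<mu> i) =
    fact (n + i) * fact (N - Suc i) / fact (q + i) *
    (\<Prod>j<part \<mu> i. (of_nat N + of_int (content (i, j))) * ((- of_nat q + of_int (content (i, j))) / (- of_nat n + of_int (content (i, j)))))"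
proof -
  let ?m = "part \<mu> i" and ?l = "shifted_part N \<mu> i"
  have mr: "?m \<le> n" using part_le[OF m, of i] r by simp
  have a: "(\<Prod>j<?m. of_nat N + of_int (content (i, j))) * fact (N - Suc i) = (fact ?l :: complex)"
  proof -
    have "(\<Prod>j<?m. of_nat N + of_int (content (i, j))) = (\<Prod>j<?m. of_nat (N - i + j) :: complex)"
      using i by (intro prod.cong refl) (simp add: content_def of_nat_diff)
    thus ?thesis using prod_rising[of "N - i" ?m] i by (simp add: shifted_part_def add.commute)
  qed
  have b: "(\<Prod>j<?m. (- of_nat q + of_int (content (i, j))) / (- of_nat n + of_int (content (i, j)))) =
     (\<Prod>j<?m. of_nat (q + i) - of_nat j) / (\<Prod>j<?m. of_nat (n + i) - of_nat j :: complex)"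
    unfolding prod_dividef[symmetric]
  proof (intro prod.cong refl)
    fix j
    have "- of_nat z + of_int (content (i, j)) = - (of_nat (z + i) - of_nat j :: complex)" for z
      by (simp add: content_def)
    thus "(- of_nat q + of_int (content (i, j))) / (- of_nat n + of_int (content (i, j))) =
      (of_nat (q + i) - of_nat j) / (of_nat (n + i) - of_nat j :: complex)" by (metis minus_divide_divide)
  qed
  have e: "n + N - 1 - ?l = n + i - ?m" "q + N - 1 - ?l = q + i - ?m" "?l < q + N \<longleftrightarrow> ?m \<le> q + i"
    using i by (auto simp: shifted_part_def)
  show ?thesis
  proof (cases "?m \<le> q + i")
    case False
    thus ?thesis unfolding prod.distrib b prod_falling row_weight_def e by simp
  next
    case True
    show ?thesis unfolding prod.distrib b prod_falling row_weight_def e a[symmetric]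
      using True mr by (simp add: power2_eq_square)
  qed
qed

lemma content_factorial_eq_0: "N < length \<mu> \<Longrightarrow> \<mu> \<in> partitions_of r \<Longrightarrow> of_nat N \<up> \<mu> = (0 :: complex)"
  unfolding content_factorial_def
  by (rule prod_zero[OF finite_young_diagram]) (auto intro!: bexI[of _ "(N, 0)"] simp: content_def young_diagram_def partitions_of_def)

lemma weyl_sum_partitions:
  assumes L: "n + N \<le> L" and N: "N > 0" and q: "q \<le> n" and r: "r \<le> n"
  shows "weyl_sum L N q (\<lambda>u. (\<Prod>a<N. (1 - u a) ^ n) * (\<Sum>a<N. cayley_var (u a)) ^ r) =
    (-1) ^ (N * q) * (\<Prod>i<N. fact (n + i) * fact i / (fact (q + i) * fact (n - q + i))) *
    (\<Sum>\<mu>\<in>partitions_of r. fact r / of_nat (hook_product \<mu>) ^ 2 *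
       ((of_nat N \<up> \<mu>) * ((- of_nat q) \<up> \<mu>) / ((- of_nat n) \<up> \<mu>)))"
proof -
  let ?A = "{\<mu> \<in> partitions_of r. length \<mu> \<le> N}"
  let ?t = "\<lambda>\<mu>. ((of_nat N \<up> \<mu>) * ((- of_nat q) \<up> \<mu>) / ((- of_nat n) \<up> \<mu>)) / of_nat (hook_product \<mu>) ^ 2 :: complex"
  have "(\<Sum>l\<in>{l \<in> increasing_seqs N (r + N). (\<Sum>a<N. l a) = r + content_shift N}.
        vdm N (\<lambda>a. of_nat (l a)) ^ 2 * (\<Prod>a<N. row_weight N q n (l a))) =
     (\<Sum>\<mu>\<in>?A. vdm N (\<lambda>a. of_nat (partition_seq N \<mu> a)) ^ 2 * (\<Prod>a<N. row_weight N q n (partition_seq N \<mu> a)))"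
    by (rule sum.reindex_bij_betw[OF bij_betw_partition_seq, symmetric])
  also have "\<dots> = (\<Sum>\<mu>\<in>?A. (\<Prod>i<N. fact (n + i) * fact i / fact (q + i)) * ?t \<mu>)"
  proof (rule sum.cong[OF refl])
    fix \<mu> assume "\<mu> \<in> ?A"
    hence m: "\<mu> \<in> partitions_of r" "length \<mu> \<le> N" by auto
    let ?l = "shifted_part N \<mu>" and ?h = "of_nat (hook_product \<mu>) :: complex"
    have v: "vdm N (\<lambda>a. of_nat (partition_seq N \<mu> a)) = vdm N (\<lambda>a. of_nat (?l (N - Suc a)) :: complex)"
      unfolding vdm_def by (intro prod.cong refl) (simp add: partition_seq_def)
    have h0: "?h \<noteq> 0" using hook_product_pos[of \<mu>] by simp
    have v': "vdm N (\<lambda>a. of_nat (?l (N - Suc a)) :: complex) = (\<Prod>i<N. fact (?l i)) / ?h"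
      using hook_product_vdm[OF m] h0 by (simp add: field_simps)
    have "(\<Prod>a<N. row_weight N q n (partition_seq N \<mu> a)) = (\<Prod>a<N. row_weight N q n (?l (N - Suc a)))"
      by (intro prod.cong refl) (simp add: partition_seq_def)
    also have "\<dots> = (\<Prod>i<N. row_weight N q n (?l i))" by (rule prod.nat_diff_reindex)
    finally have rw: "(\<Prod>a<N. row_weight N q n (partition_seq N \<mu> a)) = (\<Prod>i<N. row_weight N q n (?l i))" .
    have "(\<Prod>i<N. fact (?l i) ^ 2) * (\<Prod>i<N. row_weight N q n (?l i)) =
      (\<Prod>i<N. fact (n + i) * fact (N - Suc i) / fact (q + i) *
       (\<Prod>j<part \<mu> i. (of_nat N + of_int (content (i, j))) * ((- of_nat q + of_int (content (i, j))) / (- of_nat n + of_int (content (i, j))))))"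
      unfolding prod.distrib[symmetric] by (intro prod.cong refl row_weight_shifted_part[OF m(1) _ r]) auto
    also have "\<dots> = (\<Prod>i<N. fact (n + i) * fact (N - Suc i) / fact (q + i)) *
      (\<Prod>i<N. \<Prod>j<part \<mu> i. (of_nat N + of_int (content (i, j))) * ((- of_nat q + of_int (content (i, j))) / (- of_nat n + of_int (content (i, j)))))"
      by (rule prod.distrib)
    also have "(\<Prod>i<N. \<Prod>j<part \<mu> i. (of_nat N + of_int (content (i, j))) * ((- of_nat q + of_int (content (i, j))) / (- of_nat n + of_int (content (i, j)) :: complex))) =
       (of_nat N \<up> \<mu>) * ((- of_nat q) \<up> \<mu>) / ((- of_nat n) \<up> \<mu>)"
      unfolding content_factorial_def prod_young_diagram[OF m(2)] prod.distrib prod_dividef by simp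
    also have "(\<Prod>i<N. fact (n + i) * fact (N - Suc i) / fact (q + i) :: complex) = (\<Prod>i<N. fact (n + i) * fact i / fact (q + i))"
      unfolding prod_dividef prod.distrib using prod.nat_diff_reindex[of fact N] by simp
    finally have "(\<Prod>i<N. fact (?l i) ^ 2) * (\<Prod>i<N. row_weight N q n (?l i)) =
       (\<Prod>i<N. fact (n + i) * fact i / fact (q + i)) * ((of_nat N \<up> \<mu>) * ((- of_nat q) \<up> \<mu>) / ((- of_nat n) \<up> \<mu>))" .
    thus "vdm N (\<lambda>a. of_nat (partition_seq N \<mu> a)) ^ 2 * (\<Prod>a<N. row_weight N q n (partition_seq N \<mu> a)) =
       (\<Prod>i<N. fact (n + i) * fact i / fact (q + i)) * ?t \<mu>"
      unfolding v v' rw by (simp add: power_divide prod_power_distrib)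
  qed
  also have "\<dots> = (\<Prod>i<N. fact (n + i) * fact i / fact (q + i)) * (\<Sum>\<mu>\<in>?A. ?t \<mu>)"
    by (rule sum_distrib_left[symmetric])
  \<comment> \<open>A partition with more than N rows has a box of content - N, so its term
    vanishes.\<close>
  also have "(\<Sum>\<mu>\<in>?A. ?t \<mu>) = (\<Sum>\<mu>\<in>partitions_of r. ?t \<mu>)"
  proof (rule sum.mono_neutral_left[OF finite_partitions_of])
    show "\<forall>\<mu>\<in>partitions_of r - ?A. ?t \<mu> = 0"
      using content_factorial_eq_0[of N _ r] by (simp add: not_le)
  qed auto
  finally have e: "(\<Sum>l\<in>{l \<in> increasing_seqs N (r + N). (\<Sum>a<N. l a) = r + content_shift N}.
        vdm N (\<lambda>a. of_nat (l a)) ^ 2 * (\<Prod>a<N. row_weight N q n (l a))) =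
     (\<Prod>i<N. fact (n + i) * fact i / fact (q + i)) * (\<Sum>\<mu>\<in>partitions_of r. ?t \<mu>)" .
  have f: "(\<Sum>\<mu>\<in>partitions_of r. fact r / of_nat (hook_product \<mu>) ^ 2 *
       ((of_nat N \<up> \<mu>) * ((- of_nat q) \<up> \<mu>) / ((- of_nat n) \<up> \<mu>))) = fact r * (\<Sum>\<mu>\<in>partitions_of r. ?t \<mu>)"
    unfolding sum_distrib_left by (intro sum.cong refl) simp
  have g: "(\<Prod>i<N. fact (n + i) * fact i / (fact (q + i) * fact (n - q + i))) =
     (\<Prod>i<N. fact (n + i) * fact i / fact (q + i)) / (\<Prod>a<N. fact (n - q + a) :: complex)"
    unfolding prod_dividef prod.distrib by simp
  show ?thesis unfolding weyl_sum_log_deriv[OF assms] e f g by simp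
qed

section \<open>The moments as Haar integrals\<close>

text \<open>The derivative at 1 of the reversed polynomial z^N p(1/z), which for a characteristic
  polynomial is det(1 - z U).\<close>

lemma reversed_deriv_at_one:
  fixes p :: "complex poly"
  assumes d: "degree p \<le> N"
  shows "of_nat N * poly p 1 - poly (pderiv p) 1 = (\<Sum>m\<le>N. of_nat (N - m) * coeff p m)"
proof -
  have "of_nat N * poly p 1 - poly (pderiv p) 1 = (\<Sum>m\<le>N. of_nat N * coeff p m) - (\<Sum>m\<le>N. of_nat m * coeff p m)"
    using mult_poly_pderiv_eq_sum[OF d, of 1] poly_eq_sum_coeff[OF d, of 1] by (simp add: sum_distrib_left)
  also have "\<dots> = (\<Sum>m\<le>N. of_nat (N - m) * coeff p m)"
    unfolding sum_subtractf[symmetric] by (intro sum.cong refl) (simp add: of_nat_diff left_diff_distrib)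
  finally show ?thesis .
qed

lemma Z_eq_char_poly:
  assumes U: "U \<in> unitary_group N"
  shows "Z U \<theta> = cis (- \<theta>) ^ N * poly (char_poly U) (cis \<theta>)"
proof -
  have c: "U \<in> carrier_mat N N" using U by (simp add: unitary_group_def)
  let ?p = "char_poly U"
  have p: "degree ?p = N" "lead_coeff ?p = 1" using degree_monic_char_poly[OF c] by auto
  have p0: "?p \<noteq> 0" using p(2) by auto
  let ?E = "{a. eigenvalue U a}"
  have E: "?E = {a. poly ?p a = 0}" using eigenvalue_root_char_poly[OF c] by auto
  have fin: "finite ?E" unfolding E using p0 by (rule poly_roots_finite)
  have dec: "?p = (\<Prod>a\<in>?E. [:- a, 1:] ^ Polynomial.order a ?p)"
    using complex_poly_decompose[of ?p] p(2) unfolding E by simp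
  have "degree (\<Prod>a\<in>?E. [:- a, 1:] ^ Polynomial.order a ?p) = (\<Sum>a\<in>?E. degree ([:- a, 1:] ^ Polynomial.order a ?p))"
    by (rule degree_prod_eq_sum_degree) auto
  hence sumN: "(\<Sum>a\<in>?E. Polynomial.order a ?p) = N" using dec p(1) by (simp add: degree_linear_power)
  have "Z U \<theta> = (\<Prod>a\<in>?E. cis (- \<theta>) ^ Polynomial.order a ?p * (cis \<theta> - a) ^ Polynomial.order a ?p)"
    unfolding Z_def power_mult_distrib[symmetric]
    by (intro prod.cong refl arg_cong2[of _ _ _ _ "(^)"]) (simp add: algebra_simps cis_mult)
  also have "\<dots> = cis (- \<theta>) ^ N * (\<Prod>a\<in>?E. (cis \<theta> - a) ^ Polynomial.order a ?p)"
    unfolding prod.distrib by (simp add: sumN flip: power_sum)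
  also have "(\<Prod>a\<in>?E. (cis \<theta> - a) ^ Polynomial.order a ?p) = poly (\<Prod>a\<in>?E. [:- a, 1:] ^ Polynomial.order a ?p) (cis \<theta>)"
    unfolding poly_prod by (intro prod.cong refl) (simp add: poly_power)
  finally show ?thesis using dec by simp
qed

lemma Z'_eq_char_poly:
  assumes U: "U \<in> unitary_group N"
  shows "Z' U 0 * \<i> = of_nat N * poly (char_poly U) 1 - poly (pderiv (char_poly U)) 1"
proof -
  let ?p = "char_poly U"
  have Z: "Z U = (\<lambda>\<theta>. exp (- (\<i> * of_real \<theta>)) ^ N * poly ?p (exp (\<i> * of_real \<theta>)))"
    unfolding Z_eq_char_poly[OF U] cis_conv_exp by (simp add: fun_eq_iff)
  have "((\<lambda>z. exp (- (\<i> * z)) ^ N * poly ?p (exp (\<i> * z))) has_field_derivative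
     - \<i> * (of_nat N * poly ?p 1 - poly (pderiv ?p) 1)) (at (of_real 0))"
    by (rule derivative_eq_intros refl poly_DERIV[THEN DERIV_chain2] | simp)+ (simp add: algebra_simps)
  hence "(Z U has_vector_derivative - \<i> * (of_nat N * poly ?p 1 - poly (pderiv ?p) 1)) (at 0)"
    unfolding Z by (rule has_vector_derivative_real_field)
  hence "Z' U 0 = - \<i> * (of_nat N * poly ?p 1 - poly (pderiv ?p) 1)"
    unfolding Z'_def by (rule vector_derivative_at)
  moreover have "- \<i> * X * \<i> = X" for X by (simp add: complex_eq_iff)
  ultimately show ?thesis by simp
qed

section \<open>Removing the absolute value and the zeros of Z\<close>

context haar_unitary
begin

text \<open>For a root a of modulus 1 the conjugate of 1 - a, times - a, is 1 - a; the product of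
  the - a is the determinant up to sign. This converts the squared absolute value into a square
  times \<open>cnj (det U)\<close>.\<close>

lemma cnj_char_poly_one:
  assumes U: "U \<in> unitary_group N"
  shows "cnj (poly (char_poly U) 1) = (-1) ^ N * poly (char_poly U) 1 * cnj (det U)"
proof -
  obtain as where as: "char_poly U = (\<Prod>a\<leftarrow>as. [:- a, 1:])" "\<forall>a\<in>set as. norm a = 1"
    using char_poly_unitary_roots[OF U] by blast
  have "cnj (poly (\<Prod>a\<leftarrow>as. [:- a, 1:]) 1) * poly (\<Prod>a\<leftarrow>as. [:- a, 1:]) 0 = poly (\<Prod>a\<leftarrow>as. [:- a, 1:]) 1"
    using as(2)
  proof (induction as)
    case (Cons a as)
    have "a * cnj a = 1" using Cons.prems by (simp add: complex_norm_square[symmetric])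
    hence "cnj (1 - a) * (- a) = 1 - a" by (simp add: algebra_simps)
    hence "(cnj (1 - a) * (- a)) * (cnj (poly (\<Prod>a\<leftarrow>as. [:- a, 1:]) 1) * poly (\<Prod>a\<leftarrow>as. [:- a, 1:]) 0) =
      (1 - a) * poly (\<Prod>a\<leftarrow>as. [:- a, 1:]) 1" using Cons by simp
    thus ?case by (simp add: algebra_simps)
  qed simp
  hence "cnj (poly (char_poly U) 1) * coeff (char_poly U) 0 = poly (char_poly U) 1"
    unfolding as(1)[symmetric] by (simp add: poly_0_coeff_0)
  moreover have "coeff (char_poly U) 0 = (-1) ^ N * det U"
    unfolding det_unitary_coeff[OF U] by (simp flip: mult.assoc power_mult_distrib)
  ultimately have e: "cnj (poly (char_poly U) 1) * ((-1) ^ N * det U) = poly (char_poly U) 1" by simp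
  have sq: "(-1) ^ N * (-1) ^ N = (1 :: complex)" by (simp flip: power_mult_distrib)
  have "cnj (poly (char_poly U) 1) = cnj (poly (char_poly U) 1) * (((-1) ^ N * (-1) ^ N) * (det U * cnj (det U)))"
    unfolding sq det_unitary(1)[OF U] by simp
  also have "\<dots> = cnj (poly (char_poly U) 1) * ((-1) ^ N * det U) * ((-1) ^ N * cnj (det U))"
    by (simp only: mult_ac)
  finally show ?thesis unfolding e by (simp only: mult_ac)
qed

text \<open>Invariance under the scalar matrix \<open>cnj \<zeta>\<close>, which rotates the
  spectrum and carries the eigenvalue \<open>\<zeta>\<close> to 1.\<close>

lemma integral_root_indicator:
  assumes \<zeta>: "norm \<zeta> = 1"
  shows "(\<integral>U. (if poly (char_poly U) \<zeta> = 0 then 1 else 0) \<partial>M) = (\<integral>U. (if poly (char_poly U) 1 = 0 then 1 else (0 :: complex)) \<partial>M)"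
proof -
  have z0: "\<zeta> \<noteq> 0" using \<zeta> by auto
  let ?V = "cnj \<zeta> \<cdot>\<^sub>m 1\<^sub>m N :: complex mat"
  have zz: "\<zeta> * cnj \<zeta> = 1" using \<zeta> by (simp add: complex_norm_square[symmetric])
  have V: "?V \<in> unitary_group N"
  proof -
    have c: "?V \<in> carrier_mat N N" by simp
    have "(\<Sum>k<N. ?V $$ (i, k) * cnj (?V $$ (j, k))) = (if i = j then 1 else 0)" if "i < N" "j < N" for i j
    proof -
      have "(\<Sum>k<N. ?V $$ (i, k) * cnj (?V $$ (j, k))) = (\<Sum>k<N. if k = i then (if i = j then 1 else 0) else 0)"
        by (rule sum.cong[OF refl]) (use that zz in \<open>auto simp: mult.commute\<close>)
      thus ?thesis using that by simp
    qed
    thus ?thesis unfolding unitary_iff[OF c] by simp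
  qed
  have VU: "poly (char_poly (?V * U)) 1 = cnj \<zeta> ^ N * poly (char_poly U) \<zeta>" if U: "U \<in> unitary_group N" for U
  proof -
    have c: "U \<in> carrier_mat N N" using U by (simp add: unitary_group_def)
    have VUc: "?V * U = cnj \<zeta> \<cdot>\<^sub>m U"
      using mult_smult_assoc_mat[OF one_carrier_mat c, of "cnj \<zeta>"] left_mult_one_mat[OF c] by simp
    have s: "spec_mat N (?V * U) 1 = cnj \<zeta> \<cdot>\<^sub>m spec_mat N U \<zeta>"
      unfolding VUc by (rule eq_matI) (use c zz in \<open>auto simp: spec_mat_def algebra_simps\<close>)
    have "?V * U \<in> carrier_mat N N" unfolding VUc using c by simp
    hence "poly (char_poly (?V * U)) 1 = det (cnj \<zeta> \<cdot>\<^sub>m spec_mat N U \<zeta>)"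
      unfolding s[symmetric] by (rule poly_char_poly_eq_det)
    also have "\<dots> = cnj \<zeta> ^ N * det (spec_mat N U \<zeta>)" by (simp add: spec_mat_def)
    finally show ?thesis unfolding poly_char_poly_eq_det[OF c] .
  qed
  have meas: "(\<lambda>U. if poly (char_poly U) 1 = 0 then 1 else 0 :: complex) \<in> borel_measurable M"
    using bdd_measurable[OF bdd_poly_char_poly[of 1]] by simp
  have "(\<integral>U. (if poly (char_poly U) \<zeta> = 0 then 1 else 0) \<partial>M) = (\<integral>U. (if poly (char_poly (?V * U)) 1 = 0 then 1 else (0 :: complex)) \<partial>M)"
    by (rule Bochner_Integration.integral_cong) (use z0 in \<open>auto simp: VU space_haar\<close>)
  thus ?thesis using integral_left_mult[OF V meas] by simp
qed

lemma bdd_root_indicator: "bdd (\<lambda>U. if poly (char_poly U) \<zeta> = 0 then 1 else 0)"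
proof -
  have "(\<lambda>U. if poly (char_poly U) \<zeta> = 0 then 1 else 0 :: complex) \<in> borel_measurable M"
    using bdd_measurable[OF bdd_poly_char_poly[of \<zeta>]] by simp
  thus ?thesis unfolding bdd_def by (auto intro!: exI[of _ 1])
qed

text \<open>A unitary matrix has at most \<open>N\<close> of the \<open>J\<close>-th roots of unity as eigenvalues, and by
  invariance each of them is an eigenvalue with the same probability.\<close>

lemma AE_char_poly_one_neq_0: "AE U in M. poly (char_poly U) 1 \<noteq> 0"
proof -
  define A where "A = {U \<in> space M. poly (char_poly U) 1 = 0}"
  have A: "A \<in> sets M" unfolding A_def using bdd_measurable[OF bdd_poly_char_poly[of 1]] by simp
  have int: "(\<integral>U. (if poly (char_poly U) 1 = 0 then 1 else 0 :: complex) \<partial>M) = of_real (prob A)"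
  proof -
    have "(\<integral>U. (if poly (char_poly U) 1 = 0 then 1 else 0 :: complex) \<partial>M) = (\<integral>U. of_real (indicator A U) \<partial>M)"
      by (rule Bochner_Integration.integral_cong) (auto simp: A_def indicator_def)
    thus ?thesis using A by (simp add: integral_complex_of_real)
  qed
  have J: "real J * prob A \<le> real N" if J: "J > 0" for J
  proof -
    let ?R = "{z :: complex. z ^ J = 1}"
    have R: "finite ?R" "card ?R = J" using J card_roots_unity_eq[of J] finite_roots_unity[of J] by auto
    have nR: "norm z = 1" if "z \<in> ?R" for z
    proof -
      have "norm z ^ J = 1" using that by (simp flip: norm_power)
      thus ?thesis using J power_eq_imp_eq_base[of "norm z" J 1] by simp
    qed
    have "of_nat J * of_real (prob A) = (\<Sum>\<zeta>\<in>?R. (\<integral>U. (if poly (char_poly U) \<zeta> = 0 then 1 else 0 :: complex) \<partial>M))"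
      using nR R(2) by (simp add: integral_root_indicator int)
    also have "\<dots> = (\<integral>U. (\<Sum>\<zeta>\<in>?R. if poly (char_poly U) \<zeta> = 0 then 1 else 0 :: complex) \<partial>M)"
      by (rule integral_bdd_sum[symmetric]) (rule bdd_root_indicator)
    finally have e: "of_nat J * of_real (prob A) = (\<integral>U. (\<Sum>\<zeta>\<in>?R. if poly (char_poly U) \<zeta> = 0 then 1 else 0 :: complex) \<partial>M)" .
    have "real J * prob A = norm (of_nat J * of_real (prob A) :: complex)" by (simp add: norm_mult)
    also have "\<dots> \<le> (\<integral>U. norm (\<Sum>\<zeta>\<in>?R. if poly (char_poly U) \<zeta> = 0 then 1 else 0 :: complex) \<partial>M)"
      unfolding e by (rule integral_norm_bound)
    also have "\<dots> \<le> (\<integral>U. real N \<partial>M)"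
    proof (rule integral_mono)
      show "integrable M (\<lambda>U. norm (\<Sum>\<zeta>\<in>?R. if poly (char_poly U) \<zeta> = 0 then 1 else 0 :: complex))"
        by (intro integrable_norm bdd_integrable bdd_sum bdd_root_indicator)
      fix U assume "U \<in> space M"
      hence U: "U \<in> unitary_group N" by (simp add: space_haar)
      have d: "degree (char_poly U) = N" using degree_char_poly_unitary[OF U] .
      have p0: "char_poly U \<noteq> 0" using U degree_monic_char_poly[of U N] by (auto simp: unitary_group_def)
      have "(\<Sum>\<zeta>\<in>?R. if poly (char_poly U) \<zeta> = 0 then 1 else 0 :: complex) = of_nat (card {\<zeta>\<in>?R. poly (char_poly U) \<zeta> = 0})"
        using R(1) by (simp add: sum.If_cases Int_def conj_commute)
      moreover have "card {\<zeta>\<in>?R. poly (char_poly U) \<zeta> = 0} \<le> card {\<zeta>. poly (char_poly U) \<zeta> = 0}"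
        by (rule card_mono) (use p0 in \<open>auto simp: poly_roots_finite\<close>)
      moreover have "card {\<zeta>. poly (char_poly U) \<zeta> = 0} \<le> N" using card_poly_roots_bound[OF p0] d by simp
      ultimately show "norm (\<Sum>\<zeta>\<in>?R. if poly (char_poly U) \<zeta> = 0 then 1 else 0 :: complex) \<le> real N" by simp
    qed simp
    finally show ?thesis by (simp add: prob_space)
  qed
  have "prob A = 0"
  proof (rule ccontr)
    assume "prob A \<noteq> 0"
    hence pos: "prob A > 0" using measure_nonneg[of M A] by linarith
    obtain J where "real N / prob A < real J" using reals_Archimedean2 by blast
    hence *: "real N < real J * prob A" using pos by (simp add: field_simps)
    moreover have "J > 0" using * pos by (cases J) auto
    ultimately show False using J[of J] by simp
  qed
  hence "A \<in> null_sets M" using A by (simp add: null_sets_def emeasure_eq_measure)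
  thus ?thesis by (rule AE_I') (auto simp: A_def)
qed

text \<open>Where Z is nonzero this is algebra. Where it vanishes, both integrands are 0 if r < 2k;
  for r = 2k they may differ, and \<open>AE_char_poly_one_neq_0\<close> is invoked.\<close>

lemma integral_moment:
  assumes N: "N \<ge> 1" and r: "r \<le> 2 * k"
  shows "(\<integral>U. of_real (cmod (Z U 0) ^ (2 * k)) * (Z' U 0 / Z U 0) ^ r \<partial>M) * \<i> ^ r =
    (-1) ^ (N * k) * (\<integral>U. det_weight k U * (poly (char_poly U) 1 ^ (2 * k - r) *
       (of_nat N * poly (char_poly U) 1 - poly (pderiv (char_poly U)) 1) ^ r) \<partial>M)"
    (is "_ = _ * (\<integral>U. ?g U \<partial>M)")
proof -
  let ?f = "\<lambda>U. of_real (cmod (Z U 0) ^ (2 * k)) * (Z' U 0 / Z U 0) ^ r * \<i> ^ r"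
  let ?D = "\<lambda>U. of_nat N * poly (char_poly U) 1 - poly (pderiv (char_poly U)) 1"
  have D: "?D U = (\<Sum>m\<le>N. of_nat (N - m) * coeff (char_poly U) m)" if U: "U \<in> unitary_group N" for U
    by (rule reversed_deriv_at_one) (simp add: degree_char_poly_unitary[OF U])
  have bD: "bdd ?D"
    by (subst bdd_cong[OF D]) (assumption, intro bdd_sum bdd_mult bdd_const bdd_coeff_char_poly)
  have bg: "bdd ?g"
    by (intro bdd_mult bdd_det_weight bdd_power bdd_poly_char_poly bD)
  have eq: "?f U = (-1) ^ (N * k) * ?g U" if U: "U \<in> unitary_group N" and c: "poly (char_poly U) 1 \<noteq> 0 \<or> r < 2 * k" for U
  proof -
    let ?c = "poly (char_poly U) 1"
    have Z0: "Z U 0 = ?c" using Z_eq_char_poly[OF U, of 0] by simp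
    have ab: "of_real (cmod (Z U 0) ^ (2 * k)) = (-1) ^ (N * k) * det_weight k U * ?c ^ (2 * k)"
    proof -
      have "of_real (cmod (Z U 0) ^ (2 * k)) = (?c * cnj ?c) ^ k"
        unfolding Z0 power_mult complex_norm_square[symmetric] by simp
      also have "\<dots> = ((-1) ^ N * cnj (det U) * ?c ^ 2) ^ k"
        unfolding cnj_char_poly_one[OF U] by (simp add: power2_eq_square mult_ac)
      finally show ?thesis by (simp add: power_mult_distrib power_mult det_weight_def)
    qed
    have "(Z' U 0 / Z U 0) ^ r * \<i> ^ r = (?D U / ?c) ^ r"
      unfolding power_mult_distrib[symmetric] Z0 Z'_eq_char_poly[OF U, symmetric] by simp
    hence "?f U = (-1) ^ (N * k) * det_weight k U * (?c ^ (2 * k) * (?D U / ?c) ^ r)"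
      unfolding ab by (simp only: mult.assoc)
    also have "?c ^ (2 * k) * (?D U / ?c) ^ r = ?c ^ (2 * k - r) * ?D U ^ r"
    proof (cases "?c = 0")
      case True
      hence "r < 2 * k" using c by simp
      thus ?thesis using True by (simp add: zero_power)
    next
      case False
      have "?c ^ (2 * k) = ?c ^ (2 * k - r) * ?c ^ r" using r by (simp flip: power_add)
      thus ?thesis using False by (simp add: power_divide)
    qed
    finally show ?thesis by (simp only: mult.assoc)
  qed
  have gm: "?g \<in> borel_measurable M" using bg by (rule bdd_measurable)
  have "(\<integral>U. ?f U \<partial>M) = (\<integral>U. (-1) ^ (N * k) * ?g U \<partial>M)"
  proof -
    define h where "h = (\<lambda>U. (-1) ^ (N * k) * ?g U)"
    \<comment> \<open>On the group \<open>f'\<close> equals the original integrand, and there its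
      exceptional branch is a constant. This form makes the measurability of the integrand, and
      hence the almost-everywhere comparison, available.\<close>
    define f' where "f' = (\<lambda>U. if poly (char_poly U) 1 = 0 \<and> r = 2 * k then ?f U else h U)"
    have ff: "(\<integral>U. ?f U \<partial>M) = (\<integral>U. f' U \<partial>M)"
    proof (rule Bochner_Integration.integral_cong[OF refl])
      fix U assume "U \<in> space M"
      hence "U \<in> unitary_group N" by (simp add: space_haar)
      thus "?f U = f' U" using eq[of U] r unfolding f'_def h_def by auto
    qed
    have const: "?f U = (if k = 0 then 1 else 0)" if "U \<in> unitary_group N" "poly (char_poly U) 1 = 0 \<and> r = 2 * k" for U
      using Z_eq_char_poly[OF that(1), of 0] that(2) by (cases "k = 0") auto
    have f'm: "f' \<in> borel_measurable M"
    proof -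
      have "(\<lambda>U. if poly (char_poly U) 1 = 0 \<and> r = 2 * k then (if k = 0 then 1 else 0) else h U) \<in> borel_measurable M"
        using bdd_measurable[OF bdd_poly_char_poly[of 1]] gm unfolding h_def by measurable
      moreover have "f' \<in> borel_measurable M \<longleftrightarrow> (\<lambda>U. if poly (char_poly U) 1 = 0 \<and> r = 2 * k then (if k = 0 then 1 else 0) else h U) \<in> borel_measurable M"
        by (rule measurable_cong) (use const in \<open>auto simp: f'_def space_haar\<close>)
      ultimately show ?thesis by (rule rev_iffD2)
    qed
    have hm: "h \<in> borel_measurable M" unfolding h_def by (intro borel_measurable_times borel_measurable_const gm)
    have "AE U in M. f' U = h U"
      using AE_char_poly_one_neq_0 by (rule eventually_mono) (simp only: f'_def simp_thms if_False)
    hence "(\<integral>U. f' U \<partial>M) = (\<integral>U. h U \<partial>M)"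
      by (rule integral_cong_AE[OF f'm hm])
    thus ?thesis unfolding ff h_def .
  qed
  thus ?thesis unfolding integral_mult_left_zero integral_mult_right_zero .
qed

end

section \<open>From the moments to the discrete Weyl integral\<close>

lemma prod_if_less:
  "r \<le> n \<Longrightarrow> (\<Prod>i<n::nat. if i < r then a else b) = a ^ r * (b :: 'a :: comm_monoid_mult) ^ (n - r)"
proof (induction n)
  case (Suc n)
  thus ?case by (cases "r = Suc n") (auto simp: Suc_diff_le mult_ac)
qed simp

text \<open>The first r factors carry the derivative weight N - m, the others the weight 1, and each
  factor sums separately. The weights do not involve p, so the identity serves both for
  \<open>char_poly U\<close> and for \<open>root_poly N u\<close>.\<close>

lemma sum_weighted_coeffs:
  fixes p :: "complex poly"
  assumes d: "degree p \<le> N" and r: "r \<le> n"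
  shows "(\<Sum>m\<in>{..<n} \<rightarrow>\<^sub>E {..N}. (\<Prod>i<n. if i < r then of_nat (N - m i) else 1) * (\<Prod>i<n. coeff p (m i))) =
    poly p 1 ^ (n - r) * (of_nat N * poly p 1 - poly (pderiv p) 1) ^ r"
proof -
  have "(\<Sum>m\<in>{..<n} \<rightarrow>\<^sub>E {..N}. (\<Prod>i<n. if i < r then of_nat (N - m i) else 1) * (\<Prod>i<n. coeff p (m i))) =
     (\<Sum>m\<in>{..<n} \<rightarrow>\<^sub>E {..N}. \<Prod>i<n. (if i < r then of_nat (N - m i) else 1) * coeff p (m i))"
    by (simp only: prod.distrib)
  also have "\<dots> = (\<Prod>i<n. \<Sum>m\<le>N. (if i < r then of_nat (N - m) else 1) * coeff p m)"
    by (rule prod_sum_PiE[symmetric]) auto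
  also have "\<dots> = (\<Prod>i<n. if i < r then of_nat N * poly p 1 - poly (pderiv p) 1 else poly p 1)"
  proof (intro prod.cong refl)
    fix i
    have "poly p 1 = (\<Sum>m\<le>N. coeff p m)" by (simp add: poly_eq_sum_coeff[OF d])
    thus "(\<Sum>m\<le>N. (if i < r then of_nat (N - m) else 1) * coeff p m) =
      (if i < r then of_nat N * poly p 1 - poly (pderiv p) 1 else poly p 1)"
      by (cases "i < r") (simp_all only: if_True if_False mult_1_left reversed_deriv_at_one[OF d, symmetric])
  qed
  finally show ?thesis using r by (simp add: prod_if_less mult.commute)
qed

text \<open>At 1 the quotient p'/p is the sum of 1 / (1 - u), and 1 - 1 / (1 - u) = - u / (1 -
  u).\<close>

lemma root_poly_log_deriv:
  assumes "\<And>a. a < N \<Longrightarrow> u a \<noteq> 1"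
  shows "of_nat N * poly (root_poly N u) 1 - poly (pderiv (root_poly N u)) 1 =
    (\<Prod>a<N. 1 - u a) * (\<Sum>a<N. cayley_var (u a))"
  using assms
proof (induction N)
  case 0
  thus ?case by (simp add: root_poly_def)
next
  case (Suc N)
  define P where "P = poly (root_poly N u) 1"
  define Q where "Q = poly (pderiv (root_poly N u)) 1"
  have P: "P = (\<Prod>a<N. 1 - u a)" by (simp add: P_def poly_root_poly)
  have IH: "of_nat N * P - Q = P * (\<Sum>a<N. cayley_var (u a))"
    using Suc unfolding P P_def Q_def by (simp add: poly_root_poly)
  have s: "root_poly (Suc N) u = root_poly N u * [:- u N, 1:]" by (simp add: root_poly_def)
  have 1: "poly (root_poly (Suc N) u) 1 = P * (1 - u N)" unfolding s by (simp add: P_def algebra_simps)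
  have 2: "poly (pderiv (root_poly (Suc N) u)) 1 = P + (1 - u N) * Q"
    unfolding s pderiv_mult by (simp add: P_def Q_def pderiv_pCons algebra_simps)
  have c: "(1 - u N) * cayley_var (u N) = - u N" using Suc.prems[of N] by (simp add: cayley_var_def)
  have "of_nat (Suc N) * (P * (1 - u N)) - (P + (1 - u N) * Q) = (1 - u N) * (of_nat N * P - Q) + P * (- u N)"
    by (simp add: algebra_simps)
  also have "\<dots> = P * (1 - u N) * ((\<Sum>a<N. cayley_var (u a)) + cayley_var (u N))"
    unfolding IH c[symmetric] by (simp add: algebra_simps)
  finally show ?case unfolding 1 2 by (simp add: P)
qed

text \<open>The product formula of Keating and Snaith for the moment with r = 0: with j = i + 1 the
  factors are Gamma(j) Gamma(j + 2k) / Gamma(j + k)^2.\<close>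

definition moment_constant :: "nat \<Rightarrow> nat \<Rightarrow> complex" where
  "moment_constant k N = (\<Prod>i<N. fact (2 * k + i) * fact i / (fact (k + i) * fact (k + i)))"

context haar_unitary
begin

lemma haar_moment_eq:
  assumes N: "N \<ge> 1" and r: "r \<le> 2 * k"
  shows "(\<integral>U. of_real (cmod (Z U 0) ^ (2 * k)) * (Z' U 0 / Z U 0) ^ r \<partial>M) * \<i> ^ r =
    moment_constant k N *
    (\<Sum>\<mu>\<in>partitions_of r. fact r / of_nat (hook_product \<mu>) ^ 2 *
       ((of_nat N \<up> \<mu>) * ((- of_nat k) \<up> \<mu>) / ((- of_nat (2 * k)) \<up> \<mu>)))"
proof -
  let ?n = "2 * k" and ?L = "N + 2 * k"
  let ?B = "{..<?n} \<rightarrow>\<^sub>E {..N}"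
  let ?w = "\<lambda>m. (\<Prod>i<?n. if i < r then of_nat (N - m i) else 1) :: complex"
  have fin: "finite ?B" by (intro finite_PiE) auto
  have "(\<integral>U. det_weight k U * (poly (char_poly U) 1 ^ (?n - r) *
       (of_nat N * poly (char_poly U) 1 - poly (pderiv (char_poly U)) 1) ^ r) \<partial>M) =
     (\<integral>U. (\<Sum>m\<in>?B. ?w m * (det_weight k U * (\<Prod>i<?n. coeff (char_poly U) (m i)))) \<partial>M)"
  proof (rule Bochner_Integration.integral_cong[OF refl])
    fix U assume "U \<in> space M"
    hence d: "degree (char_poly U) \<le> N" using degree_char_poly_unitary[of U] by (simp add: space_haar)
    show "det_weight k U * (poly (char_poly U) 1 ^ (?n - r) *
       (of_nat N * poly (char_poly U) 1 - poly (pderiv (char_poly U)) 1) ^ r) =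
      (\<Sum>m\<in>?B. ?w m * (det_weight k U * (\<Prod>i<?n. coeff (char_poly U) (m i))))"
      unfolding sum_weighted_coeffs[OF d r, symmetric] sum_distrib_left
      by (intro sum.cong refl) (simp only: mult_ac)
  qed
  also have "\<dots> = (\<Sum>m\<in>?B. \<integral>U. ?w m * (det_weight k U * (\<Prod>i<?n. coeff (char_poly U) (m i))) \<partial>M)"
    by (rule integral_bdd_sum) (intro bdd_mult bdd_const bdd_coeff_product)
  also have "\<dots> = (\<Sum>m\<in>?B. ?w m * weyl_sum ?L N k (\<lambda>u. \<Prod>i<?n. coeff (root_poly N u) (m i)))"
  proof (rule sum.cong[OF refl])
    fix m assume m: "m \<in> ?B"
    have "coeff_moment ?n k m = weyl_coeff ?L N k ?n m"
      by (rule coeff_moment_eq_weyl_coeff[OF _ N _ m]) auto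
    thus "(\<integral>U. ?w m * (det_weight k U * (\<Prod>i<?n. coeff (char_poly U) (m i))) \<partial>M) =
       ?w m * weyl_sum ?L N k (\<lambda>u. \<Prod>i<?n. coeff (root_poly N u) (m i))"
      unfolding integral_mult_right_zero coeff_moment_def weyl_coeff_def by (rule arg_cong)
  qed
  also have "\<dots> = weyl_sum ?L N k (\<lambda>u. \<Sum>m\<in>?B. ?w m * (\<Prod>i<?n. coeff (root_poly N u) (m i)))"
    by (rule weyl_sum_sum[OF fin])
  also have "\<dots> = weyl_sum ?L N k (\<lambda>u. (\<Prod>a<N. (1 - u a) ^ ?n) * (\<Sum>a<N. cayley_var (u a)) ^ r)"
    unfolding weyl_sum_def
  proof (intro arg_cong2[of _ _ _ _ "(/)"] refl sum.cong arg_cong2[of _ _ _ _ "(*)"])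
    fix u assume u: "u \<in> {..<N} \<rightarrow>\<^sub>E circle_pts ?L"
    have u1: "u a \<noteq> 1" if "a < N" for a using circle_pts_neq[of ?L "u a"] N u that by auto
    have "(\<Sum>m\<in>?B. ?w m * (\<Prod>i<?n. coeff (root_poly N u) (m i))) =
       (\<Prod>a<N. 1 - u a) ^ (?n - r) * ((\<Prod>a<N. 1 - u a) * (\<Sum>a<N. cayley_var (u a))) ^ r"
    proof -
      have "of_nat N * poly (root_poly N u) 1 - poly (pderiv (root_poly N u)) 1 = (\<Prod>a<N. 1 - u a) * (\<Sum>a<N. cayley_var (u a))"
        by (rule root_poly_log_deriv[OF u1])
      moreover have "poly (root_poly N u) 1 ^ (?n - r) = (\<Prod>a<N. 1 - u a) ^ (?n - r)" by (simp only: poly_root_poly)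
      ultimately show ?thesis
        unfolding sum_weighted_coeffs[OF eq_refl[OF degree_root_poly] r] by (metis (no_types))
    qed
    also have "\<dots> = ((\<Prod>a<N. 1 - u a) ^ (?n - r) * (\<Prod>a<N. 1 - u a) ^ r) * (\<Sum>a<N. cayley_var (u a)) ^ r"
      by (simp only: power_mult_distrib mult.assoc)
    also have "(\<Prod>a<N. 1 - u a) ^ (?n - r) * (\<Prod>a<N. 1 - u a) ^ r = (\<Prod>a<N. (1 - u a) ^ ?n)"
      unfolding power_add[symmetric] using r by (simp add: prod_power_distrib)
    finally show "(\<Sum>m\<in>?B. ?w m * (\<Prod>i<?n. coeff (root_poly N u) (m i))) =
      (\<Prod>a<N. (1 - u a) ^ ?n) * (\<Sum>a<N. cayley_var (u a)) ^ r" .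
  qed
  also have "\<dots> = (-1) ^ (N * k) * moment_constant k N *
    (\<Sum>\<mu>\<in>partitions_of r. fact r / of_nat (hook_product \<mu>) ^ 2 *
       ((of_nat N \<up> \<mu>) * ((- of_nat k) \<up> \<mu>) / ((- of_nat (2 * k)) \<up> \<mu>)))"
    using weyl_sum_partitions[of ?n N ?L k r] N r by (simp add: moment_constant_def)
  finally have e: "(\<integral>U. det_weight k U * (poly (char_poly U) 1 ^ (?n - r) *
       (of_nat N * poly (char_poly U) 1 - poly (pderiv (char_poly U)) 1) ^ r) \<partial>M) = (-1) ^ (N * k) * moment_constant k N *
    (\<Sum>\<mu>\<in>partitions_of r. fact r / of_nat (hook_product \<mu>) ^ 2 *
       ((of_nat N \<up> \<mu>) * ((- of_nat k) \<up> \<mu>) / ((- of_nat (2 * k)) \<up> \<mu>)))" .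
  \<comment> \<open>The sign from conjugating the characteristic polynomial cancels the sign of the
    discrete Weyl integral.\<close>
  have sq: "(-1) ^ (N * k) * ((-1) ^ (N * k) * a * b) = a * (b :: complex)" for a b
    by (simp flip: power_mult_distrib mult.assoc)
  show ?thesis unfolding integral_moment[OF N r] e by (rule sq)
qed

end

section \<open>Counting semistandard tableaux\<close>

lemma poly_ffact_diff:
  "poly (ffact (Suc b)) (y + 1) - poly (ffact (Suc b)) y = of_nat (Suc b) * poly (ffact b) (y :: complex)"
proof -
  note p = poly_ffact_eq_prod
  have 1: "poly (ffact (Suc b)) (y + 1) = (y + 1) * (\<Prod>j<b. y - of_nat j)"
    unfolding p prod.lessThan_Suc_shift by simp
  have 2: "poly (ffact (Suc b)) y = (\<Prod>j<b. y - of_nat j) * (y - of_nat b)" unfolding p by simp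
  show ?thesis unfolding 1 2 unfolding p by (simp add: algebra_simps)
qed

lemma sum_ffact_atLeastLessThan:
  assumes "l \<le> u"
  shows "of_nat (Suc b) * (\<Sum>y\<in>{l..<u::nat}. poly (ffact b) (of_nat y)) =
    poly (ffact (Suc b)) (of_nat u) - poly (ffact (Suc b)) (of_nat l :: complex)"
proof -
  have "of_nat (Suc b) * (\<Sum>y\<in>{l..<u}. poly (ffact b) (of_nat y)) =
     (\<Sum>y\<in>{l..<u}. poly (ffact (Suc b)) (of_nat (Suc y)) - poly (ffact (Suc b)) (of_nat y :: complex))"
    unfolding sum_distrib_left
  proof (rule sum.cong[OF refl])
    fix y
    have s: "of_nat (Suc y) = (of_nat y + 1 :: complex)" by simp
    show "of_nat (Suc b) * poly (ffact b) (of_nat y) = poly (ffact (Suc b)) (of_nat (Suc y)) - poly (ffact (Suc b)) (of_nat y :: complex)"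
      unfolding s poly_ffact_diff by (rule refl)
  qed
  also have "\<dots> = poly (ffact (Suc b)) (of_nat u) - poly (ffact (Suc b)) (of_nat l)"
    using assms by (rule sum_Suc_diff')
  finally show ?thesis .
qed

text \<open>Subtracting from every column of the alternant the preceding one leaves a first row with a
  single non-zero entry.\<close>

lemma det_column_differences:
  fixes f :: "nat \<Rightarrow> 'a :: idom poly"
  assumes f: "\<And>b. b \<le> n \<Longrightarrow> degree (f b) = b" "\<And>b. b \<le> n \<Longrightarrow> coeff (f b) b = 1"
  shows "det (mat n n (\<lambda>(b, i). poly (f (Suc b)) (x (Suc i)) - poly (f (Suc b)) (x i))) = vdm (Suc n) x"
proof -
  let ?m = "Suc n"
  define V where "V = mat ?m ?m (\<lambda>(b, i). poly (f b) (x i))"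
  define D where "D = mat ?m ?m (\<lambda>(j, i). if j = i then 1 else if Suc j = i then -1 else (0 :: 'a))"
  define W where "W = mat ?m ?m (\<lambda>(b, i). if i = 0 then poly (f b) (x 0) else poly (f b) (x i) - poly (f b) (x (i - 1)))"
  have c: "V \<in> carrier_mat ?m ?m" "D \<in> carrier_mat ?m ?m" "W \<in> carrier_mat ?m ?m" by (auto simp: V_def D_def W_def)
  have dV: "det V = vdm ?m x" unfolding V_def by (rule det_monic_alternant) (use f in auto)
  have dD: "det D = 1"
  proof -
    have "upper_triangular D" by (auto simp: upper_triangular_def D_def)
    hence "det D = prod_list (diag_mat D)" using c(2) by (rule det_upper_triangular)
    also have "\<dots> = (\<Prod>i = 0..<?m. D $$ (i, i))" using c(2) by (simp only: prod_list_diag_prod carrier_matD)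
    also have "\<dots> = 1" by (rule prod.neutral) (auto simp: D_def)
    finally show ?thesis .
  qed
  have VD: "V * D = W"
  proof (rule eq_matI)
    fix b i assume "b < dim_row W" "i < dim_col W"
    hence bi: "b < ?m" "i < ?m" by (auto simp: W_def)
    have "(V * D) $$ (b, i) = (\<Sum>j<?m. V $$ (b, j) * D $$ (j, i))"
      using bi c by (simp add: scalar_prod_def lessThan_atLeast0)
    also have "\<dots> = (\<Sum>j<?m. (if j = i then poly (f b) (x i) else 0) - (if Suc j = i then poly (f b) (x j) else 0))"
      by (rule sum.cong[OF refl]) (use bi in \<open>auto simp: V_def D_def\<close>)
    also have "\<dots> = poly (f b) (x i) - (\<Sum>j<?m. if Suc j = i then poly (f b) (x j) else 0)"
      using bi by (simp add: sum_subtractf)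
    also have "(\<Sum>j<?m. if Suc j = i then poly (f b) (x j) else 0) = (if i = 0 then 0 else poly (f b) (x (i - 1)))"
    proof (cases i)
      case (Suc i')
      have "(\<Sum>j<?m. if Suc j = i then poly (f b) (x j) else 0) = (\<Sum>j<?m. if j = i' then poly (f b) (x j) else 0)"
        unfolding Suc by (intro sum.cong refl if_cong) auto
      thus ?thesis using bi Suc by simp
    qed simp
    also have "poly (f b) (x i) - \<dots> = W $$ (b, i)" using bi by (simp add: W_def)
    finally show "(V * D) $$ (b, i) = W $$ (b, i)" .
  qed (auto simp: V_def D_def W_def)
  have f0: "f 0 = 1"
  proof -
    have "degree (f 0) = 0" "coeff (f 0) 0 = 1" using f by auto
    then obtain a where "f 0 = [:a:]" "a = 1" by (metis coeff_pCons_0 degree_eq_zeroE)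
    thus ?thesis by (simp add: one_pCons)
  qed
  have "det W = (\<Sum>i<?m. W $$ (0, i) * cofactor W 0 i)"
    by (rule laplace_expansion_row[OF c(3)]) simp
  also have "\<dots> = (\<Sum>i<?m. if i = 0 then cofactor W 0 0 else 0)"
    by (rule sum.cong[OF refl]) (auto simp: W_def f0)
  also have "\<dots> = det (mat_delete W 0 0)" by (simp add: cofactor_def)
  also have "mat_delete W 0 0 = mat n n (\<lambda>(b, i). poly (f (Suc b)) (x (Suc i)) - poly (f (Suc b)) (x i))"
    by (rule eq_matI) (auto simp: mat_delete_def W_def)
  finally have "det W = det (mat n n (\<lambda>(b, i). poly (f (Suc b)) (x (Suc i)) - poly (f (Suc b)) (x i)))" .
  thus ?thesis using det_mult[OF c(1) c(2)] VD dV dD by simp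
qed

text \<open>In the basis of falling factorials each variable telescopes separately: (b + 1) times
  the sum of the falling factorial of degree b is a difference in degree b + 1. The factors b + 1
  multiply to n!, and the alternant of column differences remains.\<close>

lemma sum_vdm_interlacing:
  assumes x: "\<And>a. a < n \<Longrightarrow> x a \<le> x (Suc a)"
  shows "fact n * (\<Sum>y\<in>PiE {..<n} (\<lambda>a. {x a..<x (Suc a)}). vdm n (\<lambda>a. of_nat (y a))) =
    (vdm (Suc n) (\<lambda>a. of_nat (x a)) :: complex)"
proof -
  let ?P = "{\<sigma>. \<sigma> permutes {..<n}}" and ?Y = "PiE {..<n} (\<lambda>a. {x a..<x (Suc a)})"
  let ?d = "\<lambda>b i. poly (ffact (Suc b)) (of_nat (x (Suc i))) - poly (ffact (Suc b)) (of_nat (x i)) :: complex"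
  have "(\<Sum>y\<in>?Y. vdm n (\<lambda>a. of_nat (y a))) =
     (\<Sum>y\<in>?Y. \<Sum>\<sigma>\<in>?P. of_int (sign \<sigma>) * (\<Prod>i<n. poly (ffact (\<sigma> i)) (of_nat (y i)) :: complex))"
    by (rule sum.cong[OF refl], rule alternant_eq_vdm(1)[symmetric]) (auto simp: degree_ffact lead_coeff_ffact)
  also have "\<dots> = (\<Sum>\<sigma>\<in>?P. of_int (sign \<sigma>) * (\<Sum>y\<in>?Y. \<Prod>i<n. poly (ffact (\<sigma> i)) (of_nat (y i))))"
    unfolding sum_distrib_left by (rule sum.swap)
  also have "\<dots> = (\<Sum>\<sigma>\<in>?P. of_int (sign \<sigma>) * (\<Prod>i<n. \<Sum>y\<in>{x i..<x (Suc i)}. poly (ffact (\<sigma> i)) (of_nat y)))"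
    by (intro sum.cong refl arg_cong2[of _ _ _ _ "(*)"] prod_sum_PiE[symmetric]) auto
  finally have "fact n * (\<Sum>y\<in>?Y. vdm n (\<lambda>a. of_nat (y a))) =
    (\<Sum>\<sigma>\<in>?P. of_int (sign \<sigma>) * (fact n * (\<Prod>i<n. \<Sum>y\<in>{x i..<x (Suc i)}. poly (ffact (\<sigma> i)) (of_nat y :: complex))))"
    unfolding sum_distrib_left[of "fact n", symmetric] by (simp add: sum_distrib_left mult.left_commute)
  also have "\<dots> = (\<Sum>\<sigma>\<in>?P. of_int (sign \<sigma>) * (\<Prod>i<n. ?d (\<sigma> i) i))"
  proof (intro sum.cong refl arg_cong2[of _ _ _ _ "(*)"])
    fix \<sigma> assume "\<sigma> \<in> ?P"
    hence p: "\<sigma> permutes {..<n}" by simp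
    have "(\<Prod>i<n. of_nat (Suc (\<sigma> i))) = (\<Prod>i<n. of_nat (Suc i) :: complex)"
      using prod.permute[OF p, of "\<lambda>i. of_nat (Suc i) :: complex"] by (simp add: o_def)
    also have "\<dots> = fact n" by (simp add: fact_prod_Suc lessThan_atLeast0)
    finally have f: "(\<Prod>i<n. of_nat (Suc (\<sigma> i))) = (fact n :: complex)" .
    show "fact n * (\<Prod>i<n. \<Sum>y\<in>{x i..<x (Suc i)}. poly (ffact (\<sigma> i)) (of_nat y)) = (\<Prod>i<n. ?d (\<sigma> i) i)"
      unfolding f[symmetric] prod.distrib[symmetric]
      by (intro prod.cong refl sum_ffact_atLeastLessThan x) auto
  qed
  also have "\<dots> = det (mat n n (\<lambda>(b, i). ?d b i))"
    by (rule det_mat_eq_sum'[symmetric])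
  also have "\<dots> = vdm (Suc n) (\<lambda>a. of_nat (x a))"
    by (rule det_column_differences) (auto simp: degree_ffact lead_coeff_ffact)
  finally show ?thesis .
qed

text \<open>Shapes are functions padded with zeros, so that an interlacing shape is obtained without
  trimming a list.\<close>

definition shape_boxes :: "(nat \<Rightarrow> nat) \<Rightarrow> (nat \<times> nat) set" where
  "shape_boxes p = {(i, j). j < p i}"

definition tableaux :: "nat \<Rightarrow> (nat \<Rightarrow> nat) \<Rightarrow> (nat \<times> nat \<Rightarrow> nat) set" where
  "tableaux n p = {T \<in> shape_boxes p \<rightarrow>\<^sub>E {..<n}.
     (\<forall>i j j'. j < j' \<and> j' < p i \<longrightarrow> T (i, j) \<le> T (i, j')) \<and>
     (\<forall>i i' j. i < i' \<and> j < p i' \<longrightarrow> T (i, j) < T (i', j))}"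

definition shape :: "nat \<Rightarrow> (nat \<Rightarrow> nat) \<Rightarrow> bool" where
  "shape n p \<longleftrightarrow> (\<forall>i. p (Suc i) \<le> p i) \<and> (\<forall>i\<ge>n. p i = 0)"

definition interlacing :: "nat \<Rightarrow> (nat \<Rightarrow> nat) \<Rightarrow> (nat \<Rightarrow> nat) set" where
  "interlacing n p = {q. (\<forall>i<n. p (Suc i) \<le> q i \<and> q i \<le> p i) \<and> (\<forall>i\<ge>n. q i = 0)}"

lemma shape_antimono: "shape n p \<Longrightarrow> i \<le> j \<Longrightarrow> p j \<le> p i"
  unfolding shape_def by (rule lift_Suc_antimono_le[of p]) auto

lemma finite_shape_boxes: "shape n p \<Longrightarrow> finite (shape_boxes p)"
proof -
  assume s: "shape n p"
  have "j < p i \<Longrightarrow> i < n \<and> j < p 0" for i j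
    using shape_antimono[OF s, of 0 i] s by (cases "i < n") (auto simp: shape_def)
  hence "shape_boxes p \<subseteq> {..<n} \<times> {..<p 0}" by (auto simp: shape_boxes_def)
  thus ?thesis by (rule finite_subset) simp
qed

lemma finite_tableaux: "shape n p \<Longrightarrow> finite (tableaux n p)"
  unfolding tableaux_def
  by (rule finite_subset[OF _ finite_PiE[of "shape_boxes p" "\<lambda>_. {..<n}"]]) (auto simp: finite_shape_boxes)

lemma interlacing_shape: "shape (Suc n) p \<Longrightarrow> q \<in> interlacing n p \<Longrightarrow> shape n q"
proof -
  assume s: "shape (Suc n) p" and q: "q \<in> interlacing n p"
  have "q (Suc i) \<le> q i" for i
  proof (cases "Suc i < n")
    case True
    hence "q (Suc i) \<le> p (Suc i)" "p (Suc i) \<le> q i" using q by (auto simp: interlacing_def)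
    thus ?thesis by simp
  qed (use q in \<open>simp add: interlacing_def\<close>)
  thus ?thesis using q by (simp add: shape_def interlacing_def)
qed

lemma tableau_row_le: "T \<in> tableaux n p \<Longrightarrow> j \<le> j' \<Longrightarrow> j' < p i \<Longrightarrow> T (i, j) \<le> T (i, j')"
  by (cases "j = j'") (auto simp: tableaux_def)

lemma tableau_col_less: "T \<in> tableaux n p \<Longrightarrow> i < i' \<Longrightarrow> j < p i' \<Longrightarrow> T (i, j) < T (i', j)"
  by (auto simp: tableaux_def)

lemma tableau_entry_less: "T \<in> tableaux n p \<Longrightarrow> j < p i \<Longrightarrow> T (i, j) < n"
  by (auto simp: tableaux_def shape_boxes_def PiE_def Pi_def)

text \<open>Strictly increasing columns push the entries of row i up to at least i. Removing the
  largest entry n therefore empties all rows from n on.\<close>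

lemma tableau_entry_ge: "T \<in> tableaux n p \<Longrightarrow> shape m p \<Longrightarrow> j < p i \<Longrightarrow> i \<le> T (i, j)"
proof (induction i)
  case (Suc i)
  have "j < p i" using Suc.prems shape_antimono[of m p i "Suc i"] by simp
  thus ?case using Suc tableau_col_less[of T n p i "Suc i" j] by simp
qed simp

text \<open>The boxes of a tableau with entries in \<open>{..n}\<close> that do not contain \<open>n\<close> form a shape which
  interlaces with the given one.\<close>

lemma card_tableaux_Suc:
  assumes p: "shape (Suc n) p"
  shows "card (tableaux (Suc n) p) = (\<Sum>q\<in>interlacing n p. card (tableaux n q))"
proof -
  define sh where "sh = (\<lambda>(T :: nat \<times> nat \<Rightarrow> nat) i. card {j. j < p i \<and> T (i, j) < n})"
  \<comment> \<open>The inverse construction: the boxes outside the smaller shape, a horizontal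
    strip, are filled with the largest entry n.\<close>
  define ext where "ext = (\<lambda>q S. \<lambda>(i, j)\<in>shape_boxes p. if j < q i then S (i, j) else n)"
  have shI: "j < p i \<and> T (i, j) < n \<longleftrightarrow> j < sh T i" if T: "T \<in> tableaux (Suc n) p" for T i j
  proof -
    have "{j. j < p i \<and> T (i, j) < n} = {..<card {j. j < p i \<and> T (i, j) < n}}"
    proof (rule down_closed_eq_lessThan)
      fix a b assume "a \<in> {j. j < p i \<and> T (i, j) < n}" "b \<le> a"
      thus "b \<in> {j. j < p i \<and> T (i, j) < n}" using tableau_row_le[OF T, of b a i] by auto
    qed simp
    thus ?thesis unfolding sh_def by blast
  qed
  have shle: "sh T i \<le> p i" for T i
    unfolding sh_def using card_mono[of "{..<p i}" "{j. j < p i \<and> T (i, j) < n}"] by auto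
  have sh_inter: "sh T \<in> interlacing n p" if T: "T \<in> tableaux (Suc n) p" for T
    unfolding interlacing_def
  proof (intro CollectI conjI allI impI shle)
    fix i assume i: "i < n"
    show "p (Suc i) \<le> sh T i"
    proof (rule ccontr)
      assume "\<not> p (Suc i) \<le> sh T i"
      hence j: "sh T i < p (Suc i)" by simp
      have "T (i, sh T i) < T (Suc i, sh T i)" by (rule tableau_col_less[OF T _ j]) simp
      moreover have "T (Suc i, sh T i) < Suc n" by (rule tableau_entry_less[OF T j])
      moreover have "sh T i < p i" using j shape_antimono[OF p, of i "Suc i"] by simp
      ultimately have "sh T i < sh T i" using shI[OF T, of "sh T i" i] by simp
      thus False by simp
    qed
  next
    fix i assume i: "n \<le> i"
    have "\<not> (j < p i \<and> T (i, j) < n)" for j using tableau_entry_ge[OF T p, of j i] i by auto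
    thus "sh T i = 0" unfolding sh_def by simp
  qed
  have restr: "restrict T (shape_boxes (sh T)) \<in> tableaux n (sh T)" if T: "T \<in> tableaux (Suc n) p" for T
  proof -
    have s: "j < p i \<and> T (i, j) < n" if "j < sh T i" for i j using shI[OF T] that by simp
    have col: "j < sh T i" if "i < i'" "j < sh T i'" for i i' j
    proof -
      have "j < p i" using s[OF that(2)] shape_antimono[OF p, of i i'] that(1) by simp
      moreover have "T (i, j) < n" using tableau_col_less[OF T that(1), of j] s[OF that(2)] by simp
      ultimately show ?thesis using shI[OF T, of j i] by simp
    qed
    show ?thesis
      unfolding tableaux_def
    proof (intro CollectI conjI allI impI)
      show "restrict T (shape_boxes (sh T)) \<in> shape_boxes (sh T) \<rightarrow>\<^sub>E {..<n}"
        using s by (auto simp: shape_boxes_def)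
    next
      fix i j j' assume "j < j' \<and> j' < sh T i"
      thus "restrict T (shape_boxes (sh T)) (i, j) \<le> restrict T (shape_boxes (sh T)) (i, j')"
        using tableau_row_le[OF T, of j j' i] s[of j' i] by (simp add: shape_boxes_def)
    next
      fix i i' j assume "i < i' \<and> j < sh T i'"
      thus "restrict T (shape_boxes (sh T)) (i, j) < restrict T (shape_boxes (sh T)) (i', j)"
        using tableau_col_less[OF T, of i i' j] s[of j i'] col[of i i' j] by (simp add: shape_boxes_def)
    qed
  qed
  have qle: "q i \<le> p i" if "q \<in> interlacing n p" for q i
    using that by (cases "i < n") (auto simp: interlacing_def)
  have ext_val: "ext q S (i, j) = (if j < q i then S (i, j) else n)" if "j < p i" for q S i j
    using that by (simp add: ext_def shape_boxes_def)
  have ext_mem: "ext q S \<in> tableaux (Suc n) p" if q: "q \<in> interlacing n p" and S: "S \<in> tableaux n q" for q S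
    unfolding tableaux_def
  proof (intro CollectI conjI allI impI)
    show "ext q S \<in> shape_boxes p \<rightarrow>\<^sub>E {..<Suc n}"
    proof (rule PiE_I)
      fix b assume "b \<in> shape_boxes p"
      then obtain i j where "b = (i, j)" "j < p i" by (auto simp: shape_boxes_def)
      thus "ext q S b \<in> {..<Suc n}" using tableau_entry_less[OF S, of j i] by (auto simp: ext_val)
    qed (simp add: ext_def)
  next
    fix i j j' assume j: "j < j' \<and> j' < p i"
    hence jp: "j < p i" by simp
    have "S (i, j) < n" if "j < q i" using tableau_entry_less[OF S that] .
    moreover have "S (i, j) \<le> S (i, j')" if "j' < q i" using tableau_row_le[OF S _ that] j by simp
    ultimately show "ext q S (i, j) \<le> ext q S (i, j')" using j ext_val[OF jp] ext_val[of j' i] by auto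
  next
    fix i i' j assume *: "i < i' \<and> j < p i'"
    have "i < n"
    proof (rule ccontr)
      assume "\<not> i < n"
      hence "p i' = 0" using p * by (simp add: shape_def)
      thus False using * by simp
    qed
    hence "p (Suc i) \<le> q i" using q by (simp add: interlacing_def)
    hence jq: "j < q i" using * shape_antimono[OF p, of "Suc i" i'] by simp
    have jp: "j < p i" using * shape_antimono[OF p, of i i'] by simp
    have "S (i, j) < n" using tableau_entry_less[OF S jq] .
    moreover have "S (i, j) < S (i', j)" if "j < q i'" using tableau_col_less[OF S _ that] * by simp
    ultimately show "ext q S (i, j) < ext q S (i', j)" using * jq ext_val[OF jp] ext_val[of j i'] by auto
  qed
  have sh_ext: "sh (ext q S) = q" if q: "q \<in> interlacing n p" and S: "S \<in> tableaux n q" for q S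
  proof
    fix i
    have "{j. j < p i \<and> ext q S (i, j) < n} = {..<q i}"
      using qle[OF q, of i] tableau_entry_less[OF S, of _ i] ext_val by (auto split: if_splits)
    thus "sh (ext q S) i = q i" by (simp add: sh_def)
  qed
  have "bij_betw (\<lambda>T. (sh T, restrict T (shape_boxes (sh T)))) (tableaux (Suc n) p) (Sigma (interlacing n p) (tableaux n))"
  proof (rule bij_betw_byWitness[of _ "\<lambda>(q, S). ext q S"])
    show "\<forall>T\<in>tableaux (Suc n) p. (\<lambda>(q, S). ext q S) (sh T, restrict T (shape_boxes (sh T))) = T"
    proof
      fix T assume T: "T \<in> tableaux (Suc n) p"
      have "ext (sh T) (restrict T (shape_boxes (sh T))) = T"
      proof (rule extensionalityI[of _ "shape_boxes p"])
        show "T \<in> extensional (shape_boxes p)" using T by (auto simp: tableaux_def PiE_def)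
        fix b assume "b \<in> shape_boxes p"
        then obtain i j where b: "b = (i, j)" "j < p i" by (auto simp: shape_boxes_def)
        have "T (i, j) < Suc n" by (rule tableau_entry_less[OF T b(2)])
        thus "ext (sh T) (restrict T (shape_boxes (sh T))) b = T b"
          using shI[OF T, of j i] b by (auto simp: ext_val shape_boxes_def)
      qed (simp add: ext_def)
      thus "(\<lambda>(q, S). ext q S) (sh T, restrict T (shape_boxes (sh T))) = T" by simp
    qed
    show "\<forall>x\<in>Sigma (interlacing n p) (tableaux n). (\<lambda>T. (sh T, restrict T (shape_boxes (sh T)))) ((\<lambda>(q, S). ext q S) x) = x"
    proof
      fix x assume "x \<in> Sigma (interlacing n p) (tableaux n)"
      then obtain q S where x: "x = (q, S)" and q: "q \<in> interlacing n p" and S: "S \<in> tableaux n q" by auto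
      have "restrict (ext q S) (shape_boxes q) = S"
      proof (rule extensionalityI[of _ "shape_boxes q"])
        show "S \<in> extensional (shape_boxes q)" using S by (auto simp: tableaux_def PiE_def)
        fix b assume "b \<in> shape_boxes q"
        then obtain i j where b: "b = (i, j)" "j < q i" by (auto simp: shape_boxes_def)
        thus "restrict (ext q S) (shape_boxes q) b = S b" using qle[OF q, of i] by (simp add: ext_val shape_boxes_def)
      qed simp
      thus "(\<lambda>T. (sh T, restrict T (shape_boxes (sh T)))) ((\<lambda>(q, S). ext q S) x) = x"
        using sh_ext[OF q S] by (simp add: x)
    qed
    show "(\<lambda>T. (sh T, restrict T (shape_boxes (sh T)))) ` tableaux (Suc n) p \<subseteq> Sigma (interlacing n p) (tableaux n)"
      using sh_inter restr by auto
    show "(\<lambda>(q, S). ext q S) ` Sigma (interlacing n p) (tableaux n) \<subseteq> tableaux (Suc n) p"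
      using ext_mem by auto
  qed
  hence "card (tableaux (Suc n) p) = card (Sigma (interlacing n p) (tableaux n))" by (rule bij_betw_same_card)
  also have "\<dots> = (\<Sum>q\<in>interlacing n p. card (tableaux n q))"
  proof (rule card_SigmaI)
    have "q \<in> (\<lambda>f i. if i < n then f i else 0) ` ({..<n} \<rightarrow>\<^sub>E {..p 0})" if q: "q \<in> interlacing n p" for q
    proof (rule image_eqI[of _ _ "restrict q {..<n}"])
      show "q = (\<lambda>i. if i < n then restrict q {..<n} i else 0)" using q by (auto simp: interlacing_def fun_eq_iff)
      have "q i \<le> p 0" for i using qle[OF q, of i] shape_antimono[OF p, of 0 i] by simp
      thus "restrict q {..<n} \<in> {..<n} \<rightarrow>\<^sub>E {..p 0}" by auto
    qed
    hence "interlacing n p \<subseteq> (\<lambda>f i. if i < n then f i else 0) ` ({..<n} \<rightarrow>\<^sub>E {..p 0})" by blast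
    thus "finite (interlacing n p)" by (rule finite_subset) (auto intro!: finite_PiE)
    show "\<forall>q\<in>interlacing n p. finite (tableaux n q)" using finite_tableaux interlacing_shape[OF p] by blast
  qed
  finally show ?thesis .
qed

text \<open>Weyl's dimension formula. The recursion over interlacing shapes and
  \<open>sum_vdm_interlacing\<close> are the same recursion once the staircase is added.\<close>

lemma card_tableaux:
  "shape n p \<Longrightarrow> of_nat (card (tableaux n p)) * (\<Prod>a<n. fact a) =
     (vdm n (\<lambda>a. of_nat (p (n - Suc a) + a)) :: complex)"
proof (induction n arbitrary: p)
  case 0
  hence p0: "p i = 0" for i by (simp add: shape_def)
  have "tableaux 0 p = {\<lambda>_. undefined}" by (auto simp: tableaux_def shape_boxes_def p0)
  thus ?case by (simp add: vdm_def)
next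
  case (Suc n)
  define x where "x = (\<lambda>a. p (n - a) + a)"
  \<comment> \<open>Adding the staircase turns the closed conditions of interlacing into half-open
    intervals, because the upper endpoint \<open>x (Suc a)\<close> gains one more than
    \<open>F q a\<close>.\<close>
  define F where "F = (\<lambda>q. \<lambda>a\<in>{..<n}. q (n - Suc a) + a :: nat)"
  define G where "G = (\<lambda>(y :: nat \<Rightarrow> nat) i. if i < n then y (n - Suc i) - (n - Suc i) else 0)"
  let ?Y = "PiE {..<n} (\<lambda>a. {x a..<x (Suc a)})"
  have bij: "bij_betw F (interlacing n p) ?Y"
  proof (rule bij_betw_byWitness[of _ G])
    show "\<forall>q\<in>interlacing n p. G (F q) = q"
      by (auto simp: G_def F_def interlacing_def fun_eq_iff)
    show "\<forall>y\<in>?Y. F (G y) = y"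
    proof
      fix y assume y: "y \<in> ?Y"
      have "a \<le> y a" if "a < n" for a using PiE_mem[OF y, of a] that by (simp add: x_def)
      thus "F (G y) = y" by (intro extensionalityI[of _ "{..<n}"]) (use y in \<open>auto simp: G_def F_def PiE_def\<close>)
    qed
    show "F ` interlacing n p \<subseteq> ?Y"
    proof
      fix y assume "y \<in> F ` interlacing n p"
      then obtain q where q: "q \<in> interlacing n p" and y: "y = F q" by auto
      show "y \<in> ?Y"
      proof (rule PiE_I)
        fix a assume a: "a \<in> {..<n}"
        hence "p (Suc (n - Suc a)) \<le> q (n - Suc a)" "q (n - Suc a) \<le> p (n - Suc a)" using q by (auto simp: interlacing_def)
        moreover have "Suc (n - Suc a) = n - a" using a by auto
        ultimately show "y a \<in> {x a..<x (Suc a)}" using a by (simp add: y F_def x_def)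
      qed (simp add: y F_def)
    qed
    show "G ` ?Y \<subseteq> interlacing n p"
    proof
      fix q assume "q \<in> G ` ?Y"
      then obtain y where y: "y \<in> ?Y" and q: "q = G y" by auto
      have "p (Suc i) \<le> q i \<and> q i \<le> p i" if i: "i < n" for i
      proof -
        let ?a = "n - Suc i"
        have "x ?a \<le> y ?a" "y ?a < x (Suc ?a)" using PiE_mem[OF y, of ?a] i by auto
        moreover have "n - ?a = Suc i" "n - Suc ?a = i" using i by auto
        ultimately have "p (Suc i) + ?a \<le> y ?a" "y ?a < p i + Suc ?a" by (simp_all only: x_def)
        moreover have "q i = y ?a - ?a" using i by (simp add: q G_def)
        ultimately show ?thesis by linarith
      qed
      thus "q \<in> interlacing n p" by (simp add: interlacing_def q G_def)
    qed
  qed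
  have xs: "x a \<le> x (Suc a)" if "a < n" for a
  proof -
    have "p (n - a) \<le> p (n - Suc a)" by (rule shape_antimono[OF Suc.prems]) simp
    thus ?thesis by (simp add: x_def)
  qed
  have "of_nat (card (tableaux (Suc n) p)) * (\<Prod>a<Suc n. fact a) =
     fact n * (\<Sum>q\<in>interlacing n p. of_nat (card (tableaux n q)) * (\<Prod>a<n. fact a) :: complex)"
    unfolding card_tableaux_Suc[OF Suc.prems] sum_distrib_right[symmetric] prod.lessThan_Suc of_nat_sum
    by (simp only: mult_ac)
  also have "(\<Sum>q\<in>interlacing n p. of_nat (card (tableaux n q)) * (\<Prod>a<n. fact a)) =
     (\<Sum>q\<in>interlacing n p. vdm n (\<lambda>a. of_nat (F q a)) :: complex)"
  proof (rule sum.cong[OF refl])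
    fix q assume "q \<in> interlacing n p"
    hence "of_nat (card (tableaux n q)) * (\<Prod>a<n. fact a) = (vdm n (\<lambda>a. of_nat (q (n - Suc a) + a)) :: complex)"
      by (intro Suc.IH interlacing_shape[OF Suc.prems])
    also have "\<dots> = vdm n (\<lambda>a. of_nat (F q a))"
      unfolding vdm_def by (intro prod.cong refl) (simp add: F_def)
    finally show "of_nat (card (tableaux n q)) * (\<Prod>a<n. fact a) = (vdm n (\<lambda>a. of_nat (F q a)) :: complex)" .
  qed
  also have "\<dots> = (\<Sum>y\<in>?Y. vdm n (\<lambda>a. of_nat (y a)))"
    by (rule sum.reindex_bij_betw[OF bij])
  also have "fact n * \<dots> = vdm (Suc n) (\<lambda>a. of_nat (x a))" by (rule sum_vdm_interlacing) (rule xs)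
  finally show ?case by (simp add: x_def)
qed

lemma ssyt_eq_tableaux:
  assumes "\<mu> \<in> partitions_of r"
  shows "ssyt n \<mu> = tableaux n (part \<mu>)"
proof -
  have yd: "(i, j) \<in> young_diagram \<mu> \<longleftrightarrow> j < part \<mu> i" for i j
    by (auto simp: young_diagram_def part_def)
  have 1: "young_diagram \<mu> = shape_boxes (part \<mu>)" using yd by (auto simp: shape_boxes_def)
  have 2: "j < part \<mu> i" if "i < i'" "j < part \<mu> i'" for i i' j
    using part_antimono[OF assms, of i i'] that by simp
  have "(\<forall>i j j'. j < j' \<and> j < part \<mu> i \<and> j' < part \<mu> i \<longrightarrow> T (i, j) \<le> T (i, j')) \<longleftrightarrow>
        (\<forall>i j j'. j < j' \<and> j' < part \<mu> i \<longrightarrow> T (i, j) \<le> T (i, j'))"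
    "(\<forall>i i' j. i < i' \<and> j < part \<mu> i \<and> j < part \<mu> i' \<longrightarrow> T (i, j) < T (i', j)) \<longleftrightarrow>
        (\<forall>i i' j. i < i' \<and> j < part \<mu> i' \<longrightarrow> T (i, j) < T (i', j))" for T :: "nat \<times> nat \<Rightarrow> nat"
    using 2 by (meson less_trans)+
  thus ?thesis unfolding ssyt_def tableaux_def yd unfolding 1 by simp
qed

lemma card_ssyt:
  assumes "\<mu> \<in> partitions_of r" "length \<mu> \<le> n"
  shows "of_nat (card (ssyt n \<mu>)) * (\<Prod>a<n. fact a) = (vdm n (\<lambda>a. of_nat (part \<mu> (n - Suc a) + a)) :: complex)"
proof -
  have "shape n (part \<mu>)" using part_antimono[OF assms(1)] assms(2) by (auto simp: shape_def part_def)
  thus ?thesis unfolding ssyt_eq_tableaux[OF assms(1)] by (rule card_tableaux)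
qed

section \<open>Barnes function, conjugate partitions and limits\<close>

lemma barnes_G_Suc_add: "barnes_G (Suc (a + N)) = barnes_G (Suc a) * (\<Prod>i<N. fact (a + i))"
  by (induction N) (simp_all add: barnes_G_def)

lemma barnes_G_pos: "barnes_G (Suc a) > 0"
  by (simp add: barnes_G_def prod_pos)

lemma moment_constant_eq_barnes_G:
  "moment_constant k N = of_nat (barnes_G (N + 2 * k + 1)) * of_nat (barnes_G (N + 1)) /
          of_nat (barnes_G (N + k + 1)) ^ 2 *
        (of_nat (barnes_G (k + 1)) ^ 2 / of_nat (barnes_G (2 * k + 1)))"
proof -
  have G: "of_nat (barnes_G (N + a + 1)) = of_nat (barnes_G (a + 1)) * (\<Prod>i<N. fact (a + i) :: complex)" for a
    using barnes_G_Suc_add[of a N] by (simp add: add.commute)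
  have G0: "of_nat (barnes_G (N + 1)) = (\<Prod>i<N. fact i :: complex)"
    using G[of 0] by (simp add: barnes_G_def)
  have nz: "of_nat (barnes_G (a + 1)) \<noteq> (0 :: complex)" for a using barnes_G_pos[of a] by simp
  have p: "(\<Prod>i<N. fact (a + i)) \<noteq> (0 :: complex)" for a by simp
  show ?thesis
    unfolding G G0 moment_constant_def prod_dividef prod.distrib
    using nz[of k] nz[of "2 * k"] p[of k] p[of "2 * k"] by (simp add: power2_eq_square)
qed

section \<open>Tableaux of rectangular shape\<close>

lemma prod_lessThan_add: "(\<Prod>a<m + n. f a) = (\<Prod>a<m. f a) * (\<Prod>a<n::nat. f (m + a) :: 'a :: comm_monoid_mult)"
  by (induction n) (simp_all add: mult.assoc)

lemma replicate_partition: "N \<ge> 1 \<Longrightarrow> replicate k N \<in> partitions_of (k * N)"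
  by (auto simp: partitions_of_def sorted_wrt_iff_nth_less sum_list_replicate)

lemma prod_rect_pairs:
  fixes k N :: nat
  shows "(\<Prod>a<k. N + k + j - a) * fact (N + j) = (fact (N + k + j) :: nat)"
proof (induction k)
  case (Suc k)
  have "(\<Prod>a<Suc k. N + Suc k + j - a) = (N + Suc k + j) * (\<Prod>a<k. N + k + j - a)"
    unfolding prod.lessThan_Suc_shift by simp
  moreover have "fact (N + Suc k + j) = (N + Suc k + j) * (fact (N + k + j) :: nat)" by simp
  ultimately show ?case unfolding Suc[symmetric] by (simp only: mult.assoc)
qed simp

lemma prod_diff_eq_fact: "(\<Prod>a<b. b - a) = (fact b :: nat)"
  using prod_rect_pairs[where N = 0 and j = 0 and k = b] by simp

text \<open>The shifted parts form two runs of k consecutive numbers, starting at 0 and at N + k.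
  Pairs within a run give factorials, mixed pairs give the double product.\<close>

lemma vdm_rectangle:
  "vdm (2 * k) (\<lambda>a. of_nat (part (replicate k N) (2 * k - Suc a) + a)) =
    (of_nat ((\<Prod>b<k. fact b) * (\<Prod>j<k. (\<Prod>a<k. N + k + j - a) * fact j)) :: complex)"
proof -
  let ?x = "\<lambda>a. part (replicate k N) (2 * k - Suc a) + a"
  have x: "?x a = (if a < k then a else N + a)" if "a < 2 * k" for a
    using that by (auto simp: part_def)
  have "vdm (2 * k) (\<lambda>a. of_nat (?x a)) = (of_nat (\<Prod>b<2 * k. \<Prod>a<b. ?x b - ?x a) :: complex)"
    unfolding vdm_def of_nat_prod by (intro prod.cong refl) (subst of_nat_diff, auto simp: x)
  also have "(\<Prod>b<2 * k. \<Prod>a<b. ?x b - ?x a) = (\<Prod>b<2 * k. \<Prod>a<b. (if b < k then b else N + b) - (if a < k then a else N + a))"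
  proof (intro prod.cong refl)
    fix a b assume "b \<in> {..<2 * k}" "a \<in> {..<b}"
    thus "?x b - ?x a = (if b < k then b else N + b) - (if a < k then a else N + a)" using x[of a] x[of b] by simp
  qed
  also have "\<dots> = (\<Prod>b<k + k. \<Prod>a<b. (if b < k then b else N + b) - (if a < k then a else N + a))"
    by (simp only: mult_2)
  also have "\<dots> = (\<Prod>b<k. \<Prod>a<b. (if b < k then b else N + b) - (if a < k then a else N + a)) *
     (\<Prod>j<k. \<Prod>a<k + j. (if k + j < k then k + j else N + (k + j)) - (if a < k then a else N + a))"
    by (rule prod_lessThan_add)
  also have "(\<Prod>b<k. \<Prod>a<b. (if b < k then b else N + b) - (if a < k then a else N + a)) = (\<Prod>b<k. fact b)"
    unfolding prod_diff_eq_fact[symmetric] by (intro prod.cong refl) auto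
  also have "(\<Prod>j<k. \<Prod>a<k + j. (if k + j < k then k + j else N + (k + j)) - (if a < k then a else N + a)) =
     (\<Prod>j<k. (\<Prod>a<k. N + k + j - a) * fact j)"
  proof (rule prod.cong[OF refl])
    fix j
    have "(\<Prod>a<k + j. (if k + j < k then k + j else N + (k + j)) - (if a < k then a else N + a)) =
      (\<Prod>a<k. N + (k + j) - (if a < k then a else N + a)) * (\<Prod>a<j. N + (k + j) - (if k + a < k then k + a else N + (k + a)))"
      unfolding prod_lessThan_add by simp
    also have "(\<Prod>a<k. N + (k + j) - (if a < k then a else N + a)) = (\<Prod>a<k. N + k + j - a)"
      by (intro prod.cong refl) auto
    also have "(\<Prod>a<j. N + (k + j) - (if k + a < k then k + a else N + (k + a))) = fact j"
      unfolding prod_diff_eq_fact[symmetric] by (intro prod.cong refl) auto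
    finally show "(\<Prod>a<k + j. (if k + j < k then k + j else N + (k + j)) - (if a < k then a else N + a)) =
      (\<Prod>a<k. N + k + j - a) * fact j" .
  qed
  finally show ?thesis .
qed

lemma schur_poly_rectangle:
  assumes N: "N \<ge> 1"
  shows "schur_poly (2 * k) (replicate k N) (\<lambda>_. 1 :: complex) =
    of_nat (barnes_G (k + 1)) ^ 2 / of_nat (barnes_G (2 * k + 1)) * of_nat (\<Prod>j<k. \<Prod>a<k. N + k + j - a)"
proof -
  have G: "of_nat (barnes_G (k + 1)) = (\<Prod>b<k. fact b :: complex)" for k by (simp add: barnes_G_def)
  have "of_nat (card (ssyt (2 * k) (replicate k N))) * (\<Prod>a<2 * k. fact a) =
     (\<Prod>b<k. fact b) ^ 2 * (of_nat (\<Prod>j<k. \<Prod>a<k. N + k + j - a) :: complex)"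
    using card_ssyt[OF replicate_partition[OF N], of k "2 * k"]
    unfolding vdm_rectangle by (simp add: prod.distrib power2_eq_square)
  moreover have "(\<Prod>a<2 * k. fact a) \<noteq> (0 :: complex)" by simp
  ultimately show ?thesis unfolding G by (simp add: schur_poly_def field_simps)
qed

text \<open>\<open>moment_constant\<close> has a number of factors that grows with N; here the
  dependence on N sits in k^2 linear factors, from which the limit can be read off.\<close>

lemma rectangle_product_eq_moment_constant:
  "of_nat (barnes_G (k + 1)) ^ 2 / of_nat (barnes_G (2 * k + 1)) * of_nat (\<Prod>j<k. \<Prod>a<k. N + k + j - a) = moment_constant k N"
proof -
  have G: "of_nat (barnes_G (b + k + 1)) = of_nat (barnes_G (b + 1)) * (\<Prod>i<k. fact (b + i) :: complex)" for b
    using barnes_G_Suc_add[of b k] by simp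
  have "(\<Prod>j<k. \<Prod>a<k. N + k + j - a) * (\<Prod>j<k. fact (N + j)) = (\<Prod>j<k. fact (N + k + j) :: nat)"
    unfolding prod.distrib[symmetric] prod_rect_pairs by simp
  hence "of_nat ((\<Prod>j<k. \<Prod>a<k. N + k + j - a) * (\<Prod>j<k. fact (N + j))) = (of_nat (\<Prod>j<k. fact (N + k + j)) :: complex)"
    by (rule arg_cong)
  hence e: "of_nat (\<Prod>j<k. \<Prod>a<k. N + k + j - a) = (\<Prod>j<k. fact (N + k + j)) / (\<Prod>j<k. fact (N + j) :: complex)"
    by (simp add: field_simps)
  have nz: "of_nat (barnes_G (a + 1)) \<noteq> (0 :: complex)" for a using barnes_G_pos[of a] by simp
  have p: "(\<Prod>i<k. fact (a + i)) \<noteq> (0 :: complex)" for a by simp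
  have 2: "N + 2 * k + 1 = N + k + k + 1" by simp
  show ?thesis
    unfolding moment_constant_eq_barnes_G e 2 G[of "N + k"] G[of N]
    using nz[of N] p[of N] by (simp add: power2_eq_square mult_ac)
qed

section \<open>Asymptotics for large N\<close>

lemma of_nat_add_const_over_self: "(\<lambda>n. (of_nat n + c) / of_nat n :: complex) \<longlonglongrightarrow> 1"
proof -
  have "(\<lambda>n. 1 + c * (1 / of_nat n) :: complex) \<longlonglongrightarrow> 1 + c * 0"
    by (intro tendsto_intros lim_1_over_n)
  moreover have "eventually (\<lambda>n. 1 + c * (1 / of_nat n) = (of_nat n + c) / of_nat n) sequentially"
    using eventually_gt_at_top[of 0] by eventually_elim (simp add: field_simps)
  ultimately show ?thesis using Lim_transform_eventually by fastforce
qed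

lemma prod_of_nat_add_const_asymptotics:
  assumes "finite A"
  shows "(\<lambda>n. (\<Prod>b\<in>A. of_nat n + c b) / of_nat n ^ card A :: complex) \<longlonglongrightarrow> 1"
proof -
  have "(\<lambda>n. \<Prod>b\<in>A. (of_nat n + c b) / of_nat n :: complex) \<longlonglongrightarrow> (\<Prod>b\<in>A. 1)"
    by (intro tendsto_prod of_nat_add_const_over_self)
  thus ?thesis by (simp add: prod_dividef)
qed

lemma content_factorial_asymptotics:
  "\<mu> \<in> partitions_of r \<Longrightarrow> (\<lambda>n. (of_nat n \<up> \<mu>) / of_nat n ^ r :: complex) \<longlonglongrightarrow> 1"
  unfolding content_factorial_def
  using prod_of_nat_add_const_asymptotics[OF finite_young_diagram[of \<mu>], of "\<lambda>b. of_int (content b)"]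
  by (simp add: card_young_diagram)

lemma moment_constant_asymptotics:
  "(\<lambda>n. moment_constant k n / of_nat n ^ k\<^sup>2) \<longlonglongrightarrow> of_nat (barnes_G (k + 1)) ^ 2 / of_nat (barnes_G (2 * k + 1))"
proof -
  let ?A = "{..<k} \<times> {..<k}"
  have "(\<lambda>n. (\<Prod>(j, a)\<in>?A. of_nat n + (of_nat (k + j - a) :: complex)) / of_nat n ^ card ?A) \<longlonglongrightarrow> 1"
    unfolding case_prod_unfold by (rule prod_of_nat_add_const_asymptotics) simp
  moreover have "(\<Prod>(j, a)\<in>?A. of_nat n + (of_nat (k + j - a) :: complex)) = of_nat (\<Prod>j<k. \<Prod>a<k. n + k + j - a)" for n
    unfolding of_nat_prod prod.cartesian_product by (intro prod.cong refl) (auto simp: of_nat_add[symmetric] simp del: of_nat_add)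
  ultimately have "(\<lambda>n. of_nat (\<Prod>j<k. \<Prod>a<k. n + k + j - a) / of_nat n ^ k\<^sup>2 :: complex) \<longlonglongrightarrow> 1"
    by (simp add: power2_eq_square)
  from tendsto_mult[OF tendsto_const this, of "of_nat (barnes_G (k + 1)) ^ 2 / of_nat (barnes_G (2 * k + 1))"]
  show ?thesis unfolding rectangle_product_eq_moment_constant[symmetric] by (simp only: times_divide_eq_right mult_1_right)
qed

section \<open>Conjugate partitions\<close>

definition conjugate :: "nat list \<Rightarrow> nat list" where
  "conjugate \<mu> = map (col \<mu>) [0..<part \<mu> 0]"

lemma young_diagram_iff: "(i, j) \<in> young_diagram \<mu> \<longleftrightarrow> j < part \<mu> i"
  by (auto simp: young_diagram_def part_def)

lemma part_conjugate: "\<mu> \<in> partitions_of r \<Longrightarrow> i < part (conjugate \<mu>) j \<longleftrightarrow> j < part \<mu> i"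
proof -
  assume m: "\<mu> \<in> partitions_of r"
  have "part (conjugate \<mu>) j = (if j < part \<mu> 0 then col \<mu> j else 0)"
    unfolding part_def[of "conjugate \<mu>"] by (simp add: conjugate_def)
  thus ?thesis using less_part_iff[OF m, of j i] part_antimono[OF m, of 0 i] by auto
qed

lemma young_diagram_conjugate:
  "\<mu> \<in> partitions_of r \<Longrightarrow> young_diagram (conjugate \<mu>) = prod.swap ` young_diagram \<mu>"
  by (rule Set.set_eqI) (auto simp: young_diagram_iff part_conjugate pair_in_swap_image)

lemma conjugate_partition:
  assumes m: "\<mu> \<in> partitions_of r"
  shows "conjugate \<mu> \<in> partitions_of r"
proof -
  have "0 < col \<mu> j" if "j < part \<mu> 0" for j using less_part_iff[OF m] that by simp
  moreover have "sum_list (conjugate \<mu>) = card (young_diagram (conjugate \<mu>))"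
    by (simp add: young_diagram_eq_Sigma[OF order_refl] part_def sum_list_sum_nth lessThan_atLeast0)
  moreover have "card (young_diagram (conjugate \<mu>)) = r"
    unfolding young_diagram_conjugate[OF m] by (simp add: card_image card_young_diagram[OF m])
  ultimately show ?thesis
    using col_antimono[OF m] by (auto simp: partitions_of_def conjugate_def sorted_wrt_iff_nth_less)
qed

lemma conjugate_conjugate:
  assumes m: "\<mu> \<in> partitions_of r"
  shows "conjugate (conjugate \<mu>) = \<mu>"
proof (rule partition_eqI)
  show "conjugate (conjugate \<mu>) \<in> partitions_of r" by (intro conjugate_partition m)
  fix i
  have "j < part (conjugate (conjugate \<mu>)) i \<longleftrightarrow> j < part \<mu> i" for j
    using part_conjugate[OF conjugate_partition[OF m], of j i] part_conjugate[OF m, of i j] by simp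
  thus "part (conjugate (conjugate \<mu>)) i = part \<mu> i" by (metis less_irrefl linorder_neqE_nat)
qed (rule m)

lemma hook_product_conjugate:
  assumes m: "\<mu> \<in> partitions_of r"
  shows "hook_product (conjugate \<mu>) = hook_product \<mu>"
proof -
  have h: "hook (conjugate \<mu>) (prod.swap b) = prod.swap ` hook \<mu> b" for b
    unfolding hook_def young_diagram_conjugate[OF m]
    by (rule Set.set_eqI) (auto simp: pair_in_swap_image)
  have "hook_product (conjugate \<mu>) = (\<Prod>b\<in>young_diagram \<mu>. card (hook (conjugate \<mu>) (prod.swap b)))"
    unfolding hook_product_def young_diagram_conjugate[OF m] by (subst prod.reindex) (auto simp: o_def)
  thus ?thesis unfolding h hook_product_def by (simp add: card_image)
qed

lemma content_factorial_conjugate: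
  assumes m: "\<mu> \<in> partitions_of r"
  shows "(- x) \<up> conjugate \<mu> = (-1) ^ r * (x \<up> \<mu> :: complex)"
proof -
  have "(- x) \<up> conjugate \<mu> = (\<Prod>b\<in>young_diagram \<mu>. - x + of_int (content (prod.swap b)))"
    unfolding content_factorial_def young_diagram_conjugate[OF m] by (subst prod.reindex) (auto simp: o_def)
  also have "\<dots> = (\<Prod>b\<in>young_diagram \<mu>. (-1) * (x + of_int (content b)))"
    by (intro prod.cong refl) (simp add: content_def)
  also have "\<dots> = (-1) ^ r * (x \<up> \<mu>)"
    unfolding prod.distrib content_factorial_def by (simp add: card_young_diagram[OF m])
  finally show ?thesis .
qed

text \<open>Conjugation negates all contents and preserves the hook product; the signs (-1)^r of
  numerator and denominator cancel.\<close>

lemma sum_conjugate_partitions: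
  "(\<Sum>\<mu>\<in>partitions_of r. fact r / of_nat (hook_product \<mu>) ^ 2 * (((- x) \<up> \<mu>) / ((- y) \<up> \<mu>))) =
   (\<Sum>\<mu>\<in>partitions_of r. fact r / of_nat (hook_product \<mu>) ^ 2 * ((x \<up> \<mu>) / (y \<up> \<mu>) :: complex))"
proof (rule sum.reindex_bij_witness[of _ conjugate conjugate])
  fix \<mu> assume m: "\<mu> \<in> partitions_of r"
  have "((- x) \<up> \<mu>) / ((- y) \<up> \<mu>) = (x \<up> conjugate \<mu>) / (y \<up> conjugate \<mu>)"
    using content_factorial_conjugate[OF conjugate_partition[OF m]] by (simp add: conjugate_conjugate[OF m])
  thus "fact r / of_nat (hook_product (conjugate \<mu>)) ^ 2 * ((x \<up> conjugate \<mu>) / (y \<up> conjugate \<mu>)) =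
     fact r / of_nat (hook_product \<mu>) ^ 2 * (((- x) \<up> \<mu>) / ((- y) \<up> \<mu>))"
    by (simp add: hook_product_conjugate[OF m])
qed (auto simp: conjugate_partition conjugate_conjugate)

lemma partitions_of_0: "partitions_of 0 = {[]}"
  by (auto simp: partitions_of_def) (metis list.exhaust list.set_intros(1) not_gr_zero)

lemma moment_constant_neq_0: "moment_constant k N \<noteq> 0"
  by (simp add: moment_constant_def)

section \<open>Moments and limits for a family of Haar measures\<close>

context
  fixes H :: "nat \<Rightarrow> complex mat measure"
  assumes haar: "\<And>n. n \<ge> 1 \<Longrightarrow> haar_prob_measure n (H n)"
begin

lemma moment_eq:
  assumes "N \<ge> 1" "r \<le> 2 * k"
  shows "moment H N k r * \<i> ^ r = moment_constant k N *
    (\<Sum>\<mu>\<in>partitions_of r. fact r / of_nat (hook_product \<mu>) ^ 2 *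
       ((of_nat N \<up> \<mu>) * ((- of_nat k) \<up> \<mu>) / ((- of_nat (2 * k)) \<up> \<mu>)))"
  unfolding moment_def
  by (rule haar_unitary.haar_moment_eq[OF haar_unitaryI[OF haar[OF assms(1)]] assms])

lemma moment_0_eq: "N \<ge> 1 \<Longrightarrow> moment H N k 0 = moment_constant k N"
  using moment_eq[of N 0 k]
  by (simp add: partitions_of_0 content_factorial_def hook_product_def young_diagram_def)

lemma moment_asymptotics:
  assumes r: "r \<le> 2 * k"
  shows "(\<lambda>n. moment H n k r / of_nat n ^ (k\<^sup>2 + r)) \<longlonglongrightarrow>
    of_nat (barnes_G (k + 1)) ^ 2 / of_nat (barnes_G (2 * k + 1)) *
    (\<Sum>\<mu>\<in>partitions_of r. fact r / of_nat (hook_product \<mu>) ^ 2 * ((of_nat k \<up> \<mu>) / (of_nat (2 * k) \<up> \<mu>))) / \<i> ^ r"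
proof -
  \<comment> \<open>The part of a term that does not depend on n; the remaining content product
    divided by n^r tends to 1.\<close>
  define c where "c = (\<lambda>\<mu>. fact r / of_nat (hook_product \<mu>) ^ 2 * (((- of_nat k) \<up> \<mu>) / ((- of_nat (2 * k)) \<up> \<mu>)) :: complex)"
  have "(\<lambda>n. moment_constant k n / of_nat n ^ k\<^sup>2 * (\<Sum>\<mu>\<in>partitions_of r. c \<mu> * ((of_nat n \<up> \<mu>) / of_nat n ^ r)) / \<i> ^ r) \<longlonglongrightarrow>
     of_nat (barnes_G (k + 1)) ^ 2 / of_nat (barnes_G (2 * k + 1)) * (\<Sum>\<mu>\<in>partitions_of r. c \<mu> * 1) / \<i> ^ r"
    by (intro tendsto_intros moment_constant_asymptotics content_factorial_asymptotics) auto
  moreover have "eventually (\<lambda>n. moment_constant k n / of_nat n ^ k\<^sup>2 * (\<Sum>\<mu>\<in>partitions_of r. c \<mu> * ((of_nat n \<up> \<mu>) / of_nat n ^ r)) / \<i> ^ r =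
      moment H n k r / of_nat n ^ (k\<^sup>2 + r)) sequentially"
    using eventually_ge_at_top[of 1]
  proof eventually_elim
    case (elim n)
    have "(\<Sum>\<mu>\<in>partitions_of r. fact r / of_nat (hook_product \<mu>) ^ 2 *
       ((of_nat n \<up> \<mu>) * ((- of_nat k) \<up> \<mu>) / ((- of_nat (2 * k)) \<up> \<mu>))) = (\<Sum>\<mu>\<in>partitions_of r. c \<mu> * (of_nat n \<up> \<mu>))"
      unfolding c_def by (intro sum.cong refl) (simp add: mult_ac)
    hence "moment H n k r = moment_constant k n * (\<Sum>\<mu>\<in>partitions_of r. c \<mu> * (of_nat n \<up> \<mu>)) / \<i> ^ r"
      using moment_eq[OF elim r] by (simp add: field_simps)
    moreover have "(\<Sum>\<mu>\<in>partitions_of r. c \<mu> * ((of_nat n \<up> \<mu>) / of_nat n ^ r)) = (\<Sum>\<mu>\<in>partitions_of r. c \<mu> * (of_nat n \<up> \<mu>)) / of_nat n ^ r"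
      by (simp add: sum_divide_distrib)
    ultimately show ?case by (simp add: power_add mult_ac)
  qed
  ultimately have "(\<lambda>n. moment H n k r / of_nat n ^ (k\<^sup>2 + r)) \<longlonglongrightarrow>
     of_nat (barnes_G (k + 1)) ^ 2 / of_nat (barnes_G (2 * k + 1)) * (\<Sum>\<mu>\<in>partitions_of r. c \<mu> * 1) / \<i> ^ r"
    by (rule Lim_transform_eventually)
  moreover have "(\<Sum>\<mu>\<in>partitions_of r. c \<mu> * 1) =
    (\<Sum>\<mu>\<in>partitions_of r. fact r / of_nat (hook_product \<mu>) ^ 2 * ((of_nat k \<up> \<mu>) / (of_nat (2 * k) \<up> \<mu>)))"
    unfolding mult_1_right c_def by (rule sum_conjugate_partitions)
  ultimately show ?thesis by (simp only:)
qed

lemma limit_moment_0: "(\<lambda>n. moment H n k 0 / of_nat n ^ k\<^sup>2) \<longlonglongrightarrow> of_nat (barnes_G (k + 1)) ^ 2 / of_nat (barnes_G (2 * k + 1))"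
proof (rule Lim_transform_eventually[OF moment_constant_asymptotics])
  show "eventually (\<lambda>n. moment_constant k n / of_nat n ^ k\<^sup>2 = moment H n k 0 / of_nat n ^ k\<^sup>2) sequentially"
    using eventually_ge_at_top[of 1] by eventually_elim (simp add: moment_0_eq)
qed

end

theorem theorem2:
  fixes H :: "nat \<Rightarrow> complex mat measure" and k r N :: nat
  assumes haar: "\<And>n. n \<ge> 1 \<Longrightarrow> haar_prob_measure n (H n)"
    and r: "r \<le> 2 * k"
    and N: "N \<ge> 1"
  shows
    "(moment H N k r / moment H N k 0 * \<i> ^ r =
        (\<Sum>\<mu>\<in>partitions_of r. fact r / of_nat (hook_product \<mu>) ^ 2 *
           ((of_nat N \<up> \<mu>) * ((- of_nat k) \<up> \<mu>) / ((- of_nat (2 * k)) \<up> \<mu>)))) \<and>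
     (convergent (\<lambda>n. moment H n k r / of_nat n ^ (k\<^sup>2 + r))) \<and>
     (limit_moment H k r / limit_moment H k 0 * \<i> ^ r =
        (\<Sum>\<mu>\<in>partitions_of r. fact r / of_nat (hook_product \<mu>) ^ 2 *
           ((of_nat k \<up> \<mu>) / (of_nat (2 * k) \<up> \<mu>)))) \<and>
     (moment H N k 0 = schur_poly (2 * k) (replicate k N) (\<lambda>_. 1)) \<and>
     (schur_poly (2 * k) (replicate k N) (\<lambda>_. 1 :: complex) =
        of_nat (barnes_G (N + 2 * k + 1)) * of_nat (barnes_G (N + 1)) /
          of_nat (barnes_G (N + k + 1)) ^ 2 *
        (of_nat (barnes_G (k + 1)) ^ 2 / of_nat (barnes_G (2 * k + 1)))) \<and>
     (convergent (\<lambda>n. moment H n k 0 / of_nat n ^ k\<^sup>2)) \<and>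
     ((\<lambda>n. schur_poly (2 * k) (replicate k n) (\<lambda>_. 1) / of_nat n ^ k\<^sup>2)
        \<longlonglongrightarrow> limit_moment H k 0) \<and>
     (limit_moment H k 0 = of_nat (barnes_G (k + 1)) ^ 2 / of_nat (barnes_G (2 * k + 1)))"
proof -
  let ?g = "of_nat (barnes_G (k + 1)) ^ 2 / of_nat (barnes_G (2 * k + 1)) :: complex"
  have g: "?g \<noteq> 0" using barnes_G_pos[of k] barnes_G_pos[of "2 * k"] by simp
  have schur: "schur_poly (2 * k) (replicate k n) (\<lambda>_. 1) = moment_constant k n" if "n \<ge> 1" for n
    unfolding schur_poly_rectangle[OF that] by (rule rectangle_product_eq_moment_constant)
  have m0: "moment H N k 0 = moment_constant k N" by (rule moment_0_eq[OF _ N]) (rule haar)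
  note lim = moment_asymptotics[OF haar r]
  have lim0: "(\<lambda>n. moment H n k 0 / of_nat n ^ k\<^sup>2) \<longlonglongrightarrow> ?g" by (rule limit_moment_0) (rule haar)
  have L0: "limit_moment H k 0 = ?g" unfolding limit_moment_def using limI[OF lim0] by simp
  have L: "limit_moment H k r = ?g * (\<Sum>\<mu>\<in>partitions_of r. fact r / of_nat (hook_product \<mu>) ^ 2 * ((of_nat k \<up> \<mu>) / (of_nat (2 * k) \<up> \<mu>))) / \<i> ^ r"
    unfolding limit_moment_def by (rule limI[OF lim])
  have "moment H N k r / moment H N k 0 * \<i> ^ r =
      (\<Sum>\<mu>\<in>partitions_of r. fact r / of_nat (hook_product \<mu>) ^ 2 *
         ((of_nat N \<up> \<mu>) * ((- of_nat k) \<up> \<mu>) / ((- of_nat (2 * k)) \<up> \<mu>)))"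
  proof -
    have "moment H N k r / moment H N k 0 * \<i> ^ r = (moment H N k r * \<i> ^ r) / moment_constant k N"
      unfolding m0 by simp
    also have "moment H N k r * \<i> ^ r = moment_constant k N *
      (\<Sum>\<mu>\<in>partitions_of r. fact r / of_nat (hook_product \<mu>) ^ 2 *
         ((of_nat N \<up> \<mu>) * ((- of_nat k) \<up> \<mu>) / ((- of_nat (2 * k)) \<up> \<mu>)))"
      by (rule moment_eq[OF _ N r]) (rule haar)
    finally show ?thesis using moment_constant_neq_0[of k N] by (simp only: nonzero_mult_div_cancel_left not_False_eq_True)
  qed
  moreover have "limit_moment H k r / limit_moment H k 0 * \<i> ^ r =
      (\<Sum>\<mu>\<in>partitions_of r. fact r / of_nat (hook_product \<mu>) ^ 2 * ((of_nat k \<up> \<mu>) / (of_nat (2 * k) \<up> \<mu>)))"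
  proof -
    have "g * S / i / g * i = S" if "g \<noteq> 0" "i \<noteq> 0" for g S i :: complex using that by simp
    thus ?thesis unfolding L L0 using g by simp
  qed
  moreover have "moment H N k 0 = schur_poly (2 * k) (replicate k N) (\<lambda>_. 1)"
    unfolding schur[OF N] by (rule m0)
  moreover have "((\<lambda>n. schur_poly (2 * k) (replicate k n) (\<lambda>_. 1) / of_nat n ^ k\<^sup>2) \<longlonglongrightarrow> limit_moment H k 0)"
    unfolding L0
  proof (rule Lim_transform_eventually[OF moment_constant_asymptotics])
    show "eventually (\<lambda>n. moment_constant k n / of_nat n ^ k\<^sup>2 = schur_poly (2 * k) (replicate k n) (\<lambda>_. 1) / of_nat n ^ k\<^sup>2) sequentially"
      using eventually_ge_at_top[of 1] by eventually_elim (simp add: schur)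
  qed
  ultimately show ?thesis
    using lim lim0 L0 by (intro conjI) (auto simp: convergent_def schur[OF N] moment_constant_eq_barnes_G)
qed

end
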